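(* Let $\mathcal{T}$ be a random infinite standard Young tableau with the Plancherel distribution, and for $x,m\in\mathbb{N}_0$ let $Y^{[m]}_x$ be the index of the first row in which the bumping route $\mathcal{T}\leftsquigarrow m+\tfrac12$ reaches column $x$ or a column to its left. Then the random set \[ \left( \frac{2m}{Y^{[m]}_0}, \frac{2m}{Y^{[m]}_1}, \dots \right) \] converges in distribution, as $m\to\infty$, to the Poisson point process on $\mathbb{R}_+$ with unit intensity; that is, for each $l\in\mathbb{N}_0$ the joint distribution of $\left(\frac{2m}{Y^{[m]}_0},\dots,\frac{2m}{Y^{[m]}_l}\right)$ converges, as $m\to\infty$, to the joint distribution of $(\psi_0,\ \psi_0+\psi_1,\ \dots,\ \psi_0+\cdots+\psi_l)$, where $\psi_0,\psi_1,\dots$ are independent random variables with the exponential distribution $\mathrm{Exp}(1)$.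
   Context: Boxes of Young diagrams and tableaux are identified with the coordinates $(x,y)\in\mathbb{N}_0\times\mathbb{N}_0$ of their lower-left corners (French convention): $x$ is the column index, $y$ the row index, row $0$ is the bottom row. Schensted row insertion $\mathcal{T}\leftarrow a$ of a number $a$ into a tableau $\mathcal{T}$: $a$ is inserted into row $0$ into the leftmost box containing an entry strictly bigger than $a$; if there is no such entry, $a$ is put into the leftmost empty box of that row and the procedure stops; otherwise the previous content of that box is bumped and inserted into row $1$ by the same rule, and so on (for an infinite tableau the procedure may never stop). For a finite sequence $w=(w_1,\dots,w_\ell)$, $P(w)=(\cdots((\emptyset\leftarrow w_1)\leftarrow w_2)\cdots)\leftarrow w_\ell$ is the insertion tableau; for a (finite or infinite) sequence $w$ the recording tableau $Q(w)$ has in each box the index $i$ of the insertion step $\leftarrow w_i$ at which that box became nonempty. An infinite standard Young tableau is a filling of the boxes of a subset of the quarter-plane $\mathbb{N}_0^2$ with positive integers, increasing along rows and columns, using each positive integer exactly once. The Plancherel distribution on infinite standard Young tableaux is the law of $Q(\xi_1,\xi_2,\dots)$ where $\xi_1,\xi_2,\dots$ are i.i.d. uniform on $[0,1]$. The bumping route $\mathcal{T}\leftsquigarrow a$ consists of the boxes whose entries are changed by the insertion $\mathcal{T}\leftarrow a$, together with the last, newly created box (if any); it contains at most one box in each row $y$, and $\mathcal{T}_{\leftsquigarrow a}(y)$ denotes the $x$-coordinate of that box. For $x,m\in\mathbb{N}_0$, $Y^{[m]}_x=\min\{y\in\mathbb{N}_0:\ \mathcal{T}_{\leftsquigarrow m+1/2}(y)\le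 x\}$, with $Y^{[m]}_x=\infty$ if no such $y$ exists. *)

theory Defs
  imports "HOL-Probability.Probability" "HOL-Library.Extended_Nat"
begin

text \<open>Boxes are pairs \<open>(x, y)\<close> of a column \<open>x\<close> and a row \<open>y\<close>, row \<open>0\<close> being the bottom one
  (French convention); an empty box has content \<^const>\<open>None\<close>.\<close>

type_synonym 'a tableau = "nat \<times> nat \<Rightarrow> 'a option"

text \<open>Column of the box of row \<open>y\<close> into which \<open>a\<close> is put: the leftmost box with an entry strictly
  bigger than \<open>a\<close> or, failing this, the leftmost empty box. (It is unspecified only if the row has
  neither, which cannot happen for finite tableaux or for standard ones.)\<close>

definition insertion_column :: "'a::linorder tableau \<Rightarrow> nat \<Rightarrow> 'a \<Rightarrow> nat" where
  "insertion_column t y a =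
     (if \<exists>x c. t (x, y) = Some c \<and> a < c
      then LEAST x. \<exists>c. t (x, y) = Some c \<and> a < c
      else LEAST x. t (x, y) = None)"

text \<open>The number that arrives in row \<open>y\<close> during the insertion of \<open>a\<close>: in row \<open>Suc y\<close> it is the
  previous content of the box used in row \<open>y\<close>. It is \<^const>\<open>None\<close> once the procedure has stopped,
  i.e. above a row where an empty box was used.\<close>

primrec arriving :: "'a::linorder tableau \<Rightarrow> 'a \<Rightarrow> nat \<Rightarrow> 'a option" where
  "arriving t a 0 = Some a"
| "arriving t a (Suc y) =
     Option.bind (arriving t a y) (\<lambda>b. t (insertion_column t y b, y))"

definition row_insert :: "'a::linorder tableau \<Rightarrow> 'a \<Rightarrow> 'a tableau" where
  "row_insert t a = (\<lambda>(x, y).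
     case arriving t a y of
       None \<Rightarrow> t (x, y)
     | Some b \<Rightarrow> if x = insertion_column t y b then Some b else t (x, y))"

definition insertion_tableau :: "'a::linorder list \<Rightarrow> 'a tableau" where
  "insertion_tableau w = foldl row_insert (\<lambda>_. None) w"

text \<open>The \<open>i\<close>-th inserted number of the sequence \<open>w\<close> is \<open>w (i - 1)\<close>, so that \<open>n\<close> below is the
  1-based index of the insertion step at which the box \<open>b\<close> became nonempty.\<close>

definition recording_tableau :: "(nat \<Rightarrow> 'a::linorder) \<Rightarrow> nat tableau" where
  "recording_tableau w = (\<lambda>b.
     if \<exists>n. insertion_tableau (map w [0..<n]) b \<noteq> None
     then Some (LEAST n. insertion_tableau (map w [0..<n]) b \<noteq> None)
     else None)"

definition infinite_standard_tableau :: "nat tableau \<Rightarrow> bool" where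
  "infinite_standard_tableau t \<longleftrightarrow>
     (\<forall>x x' y i j. x < x' \<and> t (x, y) = Some i \<and> t (x', y) = Some j \<longrightarrow> i < j) \<and>
     (\<forall>x y y' i j. y < y' \<and> t (x, y) = Some i \<and> t (x, y') = Some j \<longrightarrow> i < j) \<and>
     (\<forall>b. t b \<noteq> Some 0) \<and>
     (\<forall>i\<ge>1. \<exists>!b. t b = Some i)"

text \<open>The measurable space of infinite standard Young tableaux, with the \<open>\<sigma>\<close>-algebra generated by
  the contents of the boxes.\<close>

definition tableau_space :: "nat tableau measure" where
  "tableau_space =
     restrict_space (PiM UNIV (\<lambda>_. count_space UNIV)) {t. infinite_standard_tableau t}"

definition plancherel :: "nat tableau measure" where
  "plancherel =
     distr (PiM UNIV (\<lambda>_::nat. uniform_measure lborel {0..1::real})) tableau_space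
       recording_tableau"

text \<open>Every box used by an insertion changes its content: either its entry is replaced by a strictly
  smaller one, or it is the newly created box.\<close>

definition bumping_route :: "'a::linorder tableau \<Rightarrow> 'a \<Rightarrow> (nat \<times> nat) set" where
  "bumping_route t a = {b. row_insert t a b \<noteq> t b}"

text \<open>\<open>Y\<^sub>x\<^sup>[\<^sup>m\<^sup>]\<close>; the infimum of the empty set is \<open>\<infinity>\<close>.\<close>

definition first_row :: "nat tableau \<Rightarrow> nat \<Rightarrow> nat \<Rightarrow> enat" where
  "first_row t m x =
     Inf {enat y | y. \<exists>x'\<le>x. (x', y) \<in> bumping_route (map_option real \<circ> t) (real m + 1 / 2)}"

text \<open>\<open>2m / Y\<^sub>x\<^sup>[\<^sup>m\<^sup>]\<close> with \<open>2m / \<infinity> = 0\<close>. In the degenerate case \<open>Y\<^sub>x\<^sup>[\<^sup>m\<^sup>] = 0\<close> the value is \<open>0\<close>; this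
  event means that at most \<open>x\<close> of the numbers \<open>1, \<dots>, m\<close> are in the bottom row, so for fixed \<open>x\<close> its
  probability tends to \<open>0\<close> and the chosen value does not influence the limit in distribution.\<close>

definition scaled_inverse_row :: "nat tableau \<Rightarrow> nat \<Rightarrow> nat \<Rightarrow> real" where
  "scaled_inverse_row t m x =
     (case first_row t m x of enat y \<Rightarrow> 2 * real m / real y | \<infinity> \<Rightarrow> 0)"

definition weakly_converges_in :: "'a topology \<Rightarrow> (nat \<Rightarrow> 'a measure) \<Rightarrow> 'a measure \<Rightarrow> bool" where
  "weakly_converges_in X \<mu> \<nu> \<longleftrightarrow>
     (\<forall>f. continuous_map X euclideanreal f \<and> bounded (f ` topspace X) \<longrightarrow>
        (\<lambda>n. \<integral>u. f u \<partial>\<mu> n) \<longlonglongrightarrow> (\<integral>u. f u \<partial>\<nu>))"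

text \<open>The joint law of \<open>Z\<^sub>0, \<dots>, Z\<^sub>l\<close>; the space \<open>\<real>\<^sup>l\<^sup>+\<^sup>1\<close> is rendered as the functions on \<open>{..l}\<close>
  (extensional, as in \<^const>\<open>PiM\<close> and \<^const>\<open>product_topology\<close>).\<close>

definition joint_law :: "'a measure \<Rightarrow> nat \<Rightarrow> (nat \<Rightarrow> 'a \<Rightarrow> real) \<Rightarrow> (nat \<Rightarrow> real) measure" where
  "joint_law M l Z = distr M (PiM {..l} (\<lambda>_. borel)) (\<lambda>\<omega>. \<lambda>i\<in>{..l}. Z i \<omega>)"

end

(* The boxes of the bumping route of m + 1/2 are the successive positions of a mark that is
   transported by the growth of the tableau: after m steps the mark is the first empty box of row 0,
   and when a new box is added at the mark, the mark moves to the end of the next row. Its column is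
   therefore nonincreasing in time, and Y_x is, up to the difference between the lengths of columns
   0 and x, the length of a column at the time when the mark reaches column x. A variance bound (the
   Poincare inequality of the Young graph) shows that each fixed column of a Plancherel diagram with
   n boxes has length close to 2 sqrt n.

   The law of the column of the mark is computed with weights of marked diagrams. Moving marks to
   the next row and to the next column gives two commuting operators R and C, and the number of
   growth paths that carry the mark to a given place is R^(n-m) C^m applied to the initial weight,
   which equals C^m R^(n-m). Since a new box falls into a fixed column with probability about
   1/sqrt n, each C shifts the mark independently of the diagram with about this probability, so
   that the column of the mark at time n is approximately Poisson with mean m/sqrt n. Going back to
   R, the passage to a later time thins this law binomially. With t = (m/s)^2, the columns at these
   times have in the limit the joint law of the numbers of points of a Poisson process below s,
   which is the law of the arrival process built from the exponential variables. *)
theory Submission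
  imports Defs "HOL-Real_Asymp.Real_Asymp" "HOL-Combinatorics.Multiset_Permutations"
begin

section \<open>Young diagrams\<close>

text \<open>The constant 2 is not imported. For the mean length of a column the upper bound is
  Cauchy-Schwarz; the lower bound comes from the content of the last box, whose moment generating
  function is explicit and tends to that of the semicircle law on [-2, 2]. So contents near 2 sqrt n
  keep positive probability, and such a box forces every column to its left to be long; as column
  lengths concentrate, their means must be that large.

  The obstacle in the law of the mark is its dependence on the diagram. With the row steps performed
  first the mark stays in column 0, which is independent of the diagram, and only about c sqrt n
  column steps remain, each with error o(1 / sqrt n). For joint laws the mark has to be restarted in
  a prescribed column a. Such a start is not produced by the operators; it is extracted from a
  Poisson mixture of starts with small mean c, where the columns beyond a have only O(c) of the mass
  of column a.

  Robinson-Schensted enters only as a count: insertion is injective for a fixed recording path, and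
  the identity that the squared path numbers add up to n! excludes any loss.\<close>

definition diagram :: "(nat \<times> nat) set \<Rightarrow> bool" where
  "diagram D \<longleftrightarrow> finite D \<and> (\<forall>x y x' y'. (x, y) \<in> D \<longrightarrow> x' \<le> x \<longrightarrow> y' \<le> y \<longrightarrow> (x', y') \<in> D)"

definition diagrams :: "nat \<Rightarrow> (nat \<times> nat) set set" where
  "diagrams n = {D. diagram D \<and> card D = n}"

definition addable :: "(nat \<times> nat) set \<Rightarrow> (nat \<times> nat) set" where
  "addable D = {a. a \<notin> D \<and> diagram (insert a D)}"

definition removable :: "(nat \<times> nat) set \<Rightarrow> (nat \<times> nat) set" where
  "removable D = {a \<in> D. diagram (D - {a})}"

definition rowlen :: "(nat \<times> nat) set \<Rightarrow> nat \<Rightarrow> nat" where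
  "rowlen D y = card {x. (x, y) \<in> D}"

definition collen :: "(nat \<times> nat) set \<Rightarrow> nat \<Rightarrow> nat" where
  "collen D x = card {y. (x, y) \<in> D}"

lemma diagramI:
  assumes "finite D" "\<And>x y x' y'. (x, y) \<in> D \<Longrightarrow> x' \<le> x \<Longrightarrow> y' \<le> y \<Longrightarrow> (x', y') \<in> D"
  shows "diagram D"
  using assms unfolding diagram_def by blast

lemma diagramD: "diagram D \<Longrightarrow> (x, y) \<in> D \<Longrightarrow> x' \<le> x \<Longrightarrow> y' \<le> y \<Longrightarrow> (x', y') \<in> D"
  unfolding diagram_def by blast

lemma diagram_finite: "diagram D \<Longrightarrow> finite D"
  unfolding diagram_def by blast

lemma diagram_empty [simp]: "diagram {}"
  unfolding diagram_def by simp

lemma diagram_Int: "diagram D \<Longrightarrow> diagram E \<Longrightarrow> diagram (D \<inter> E)"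
  unfolding diagram_def by blast

lemma diagram_Un: "diagram D \<Longrightarrow> diagram E \<Longrightarrow> diagram (D \<union> E)"
  unfolding diagram_def by blast

lemma down_closed_eq_lessThan:
  fixes S :: "nat set"
  assumes "finite S" and dc: "\<And>x x'. x \<in> S \<Longrightarrow> x' \<le> x \<Longrightarrow> x' \<in> S"
  shows "S = {..<card S}"
proof (cases "S = {}")
  case False
  have "S = {..Max S}"
    using assms(1) by (auto intro: dc[OF Max_in[OF assms(1) False]])
  then have "S = {..<Suc (Max S)}" by (simp add: lessThan_Suc_atMost)
  then show ?thesis by (metis card_lessThan)
qed simp

lemma rowlen_iff: assumes "diagram D" shows "x < rowlen D y \<longleftrightarrow> (x, y) \<in> D"
proof -
  have "{x. (x, y) \<in> D} \<subseteq> fst ` D" by force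
  then have "finite {x. (x, y) \<in> D}" using diagram_finite[OF assms] finite_surj by blast
  then have "{x. (x, y) \<in> D} = {..<rowlen D y}"
    unfolding rowlen_def by (rule down_closed_eq_lessThan) (auto intro: diagramD[OF assms])
  then show ?thesis by (simp add: set_eq_iff)
qed

lemma collen_iff: assumes "diagram D" shows "y < collen D x \<longleftrightarrow> (x, y) \<in> D"
proof -
  have "{y. (x, y) \<in> D} \<subseteq> snd ` D" by force
  then have "finite {y. (x, y) \<in> D}" using diagram_finite[OF assms] finite_surj by blast
  then have "{y. (x, y) \<in> D} = {..<collen D x}"
    unfolding collen_def by (rule down_closed_eq_lessThan) (auto intro: diagramD[OF assms])
  then show ?thesis by (simp add: set_eq_iff)
qed

lemma diagram_subset_square: assumes "diagram D" shows "D \<subseteq> {..<card D} \<times> {..<card D}"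
proof
  fix a assume a: "a \<in> D"
  obtain x y where xy: "a = (x, y)" by (cases a)
  have "{..x} \<times> {y} \<subseteq> D" "{x} \<times> {..y} \<subseteq> D" using diagramD[OF assms] a xy by blast+
  then have "card ({..x} \<times> {y}) \<le> card D" "card ({x} \<times> {..y}) \<le> card D"
    using card_mono diagram_finite[OF assms] by blast+
  then show "a \<in> {..<card D} \<times> {..<card D}" using xy by (simp add: card_cartesian_product)
qed

lemma finite_diagrams [simp]: "finite (diagrams n)"
proof -
  have "diagrams n \<subseteq> Pow ({..<n} \<times> {..<n})"
    using diagram_subset_square unfolding diagrams_def by blast
  then show ?thesis using finite_subset by fastforce
qed

lemma addable_subset: assumes "diagram D" shows "addable D \<subseteq> {..card D} \<times> {..card D}"
proof
  fix a assume "a \<in> addable D"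
  then have "diagram (insert a D)" "a \<notin> D" unfolding addable_def by auto
  then show "a \<in> {..card D} \<times> {..card D}"
    using diagram_subset_square[of "insert a D"] diagram_finite[OF assms] by (auto simp: less_Suc_eq_le)
qed

lemma finite_addable [simp]: "diagram D \<Longrightarrow> finite (addable D)"
  using addable_subset finite_subset by fastforce

lemma finite_removable [simp]: "diagram D \<Longrightarrow> finite (removable D)"
  unfolding removable_def by (simp add: diagram_finite)

lemma addable_diagram: "a \<in> addable D \<Longrightarrow> diagram (insert a D)"
  unfolding addable_def by blast

lemma removable_diagram: "a \<in> removable D \<Longrightarrow> diagram (D - {a})"
  unfolding removable_def by blast

lemma insert_in_diagrams: "D \<in> diagrams n \<Longrightarrow> a \<in> addable D \<Longrightarrow> insert a D \<in> diagrams (Suc n)"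
  unfolding diagrams_def addable_def by (auto simp: diagram_finite)

lemma remove_in_diagrams: "D \<in> diagrams (Suc n) \<Longrightarrow> a \<in> removable D \<Longrightarrow> D - {a} \<in> diagrams n"
  unfolding diagrams_def removable_def by (auto simp: diagram_finite)

lemma removable_insert: "diagram D \<Longrightarrow> a \<in> addable D \<Longrightarrow> a \<in> removable (insert a D)"
  unfolding removable_def addable_def by simp

lemma addable_remove: "diagram D \<Longrightarrow> a \<in> removable D \<Longrightarrow> a \<in> addable (D - {a})"
  unfolding removable_def addable_def by (simp add: insert_absorb)

lemma in_diagrams: "D \<in> diagrams n \<Longrightarrow> diagram D"
  unfolding diagrams_def by simp

lemma diagrams_0 [simp]: "diagrams 0 = {{}}"
  unfolding diagrams_def using diagram_finite by auto

lemma addable_iff: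
  assumes D: "diagram D"
  shows "(x, y) \<in> addable D \<longleftrightarrow> x = rowlen D y \<and> (y = 0 \<or> rowlen D y < rowlen D (y - 1))"
proof
  assume a: "(x, y) \<in> addable D"
  then have n: "(x, y) \<notin> D" and i: "diagram (insert (x, y) D)" unfolding addable_def by auto
  have "x = rowlen D y"
  proof (rule ccontr)
    assume "x \<noteq> rowlen D y"
    then have l: "rowlen D y < x" using n rowlen_iff[OF D, of x y] by linarith
    then have "(rowlen D y, y) \<in> D" using diagramD[OF i, of x y "rowlen D y" y] by auto
    then show False using rowlen_iff[OF D, of "rowlen D y" y] by simp
  qed
  moreover have "rowlen D y < rowlen D (y - 1)" if "y \<noteq> 0"
  proof -
    have "(x, y - 1) \<in> D" using diagramD[OF i, of x y x "y - 1"] that by auto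
    then show ?thesis using rowlen_iff[OF D] \<open>x = rowlen D y\<close> by blast
  qed
  ultimately show "x = rowlen D y \<and> (y = 0 \<or> rowlen D y < rowlen D (y - 1))" by blast
next
  assume r: "x = rowlen D y \<and> (y = 0 \<or> rowlen D y < rowlen D (y - 1))"
  have n: "(x, y) \<notin> D" using r rowlen_iff[OF D, of x y] by simp
  have below: "(x', y') \<in> insert (x, y) D" if le: "x' \<le> x" "y' \<le> y" for x' y'
  proof (cases "y' = y")
    case True
    then show ?thesis using r le rowlen_iff[OF D, of x' y] by (cases "x' = x") auto
  next
    case False
    then have "y \<noteq> 0" "y' \<le> y - 1" using le by auto
    then have "(x, y - 1) \<in> D" using r rowlen_iff[OF D] by blast
    then show ?thesis using diagramD[OF D] le \<open>y' \<le> y - 1\<close> by blast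
  qed
  have "diagram (insert (x, y) D)"
  proof (rule diagramI)
    fix x1 y1 x' y' assume *: "(x1, y1) \<in> insert (x, y) D" "x' \<le> x1" "y' \<le> y1"
    show "(x', y') \<in> insert (x, y) D"
    proof (cases "(x1, y1) = (x, y)")
      case True then show ?thesis using below * by blast
    next
      case False then show ?thesis using diagramD[OF D, of x1 y1 x' y'] * by blast
    qed
  qed (simp add: diagram_finite[OF D])
  then show "(x, y) \<in> addable D" using n unfolding addable_def by blast
qed

lemma removable_iff:
  assumes D: "diagram D"
  shows "(x, y) \<in> removable D \<longleftrightarrow> rowlen D y = Suc x \<and> rowlen D (Suc y) \<le> x"
proof
  assume "(x, y) \<in> removable D"
  then have i: "(x, y) \<in> D" and d: "diagram (D - {(x, y)})" unfolding removable_def by auto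
  have "(Suc x, y) \<notin> D" using diagramD[OF d, of "Suc x" y x y] by auto
  moreover have "(x, Suc y) \<notin> D" using diagramD[OF d, of x "Suc y" x y] by auto
  ultimately show "rowlen D y = Suc x \<and> rowlen D (Suc y) \<le> x"
    using i rowlen_iff[OF D, of x y] rowlen_iff[OF D, of "Suc x" y] rowlen_iff[OF D, of x "Suc y"]
    by auto
next
  assume r: "rowlen D y = Suc x \<and> rowlen D (Suc y) \<le> x"
  then have i: "(x, y) \<in> D" and n: "(Suc x, y) \<notin> D" "(x, Suc y) \<notin> D"
    using rowlen_iff[OF D, of x y] rowlen_iff[OF D, of "Suc x" y] rowlen_iff[OF D, of x "Suc y"]
    by auto
  have above: "x' = x \<and> y' = y" if "(x', y') \<in> D" "x \<le> x'" "y \<le> y'" for x' y'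
    using n diagramD[OF D that(1), of "Suc x" y] diagramD[OF D that(1), of x "Suc y"] that
    by (metis Suc_leI le_eq_less_or_eq)
  have "diagram (D - {(x, y)})"
  proof (rule diagramI)
    fix x1 y1 x' y' assume *: "(x1, y1) \<in> D - {(x, y)}" "x' \<le> x1" "y' \<le> y1"
    then have "(x', y') \<in> D" using diagramD[OF D, of x1 y1 x' y'] by blast
    moreover have "(x', y') \<noteq> (x, y)" using above[of x1 y1] * by blast
    ultimately show "(x', y') \<in> D - {(x, y)}" by blast
  qed (simp add: diagram_finite[OF D])
  then show "(x, y) \<in> removable D" using i unfolding removable_def by blast
qed

lemma addable_collen: assumes D: "diagram D" and a: "(x, y) \<in> addable D" shows "y = collen D x"
proof (rule ccontr)
  have n: "(x, y) \<notin> D" and i: "diagram (insert (x, y) D)" using a unfolding addable_def by auto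
  assume "y \<noteq> collen D x"
  then have "collen D x < y" using n collen_iff[OF D, of y x] by linarith
  then have "(x, collen D x) \<in> D" using diagramD[OF i, of x y x "collen D x"] by auto
  then show False using collen_iff[OF D, of "collen D x" x] by simp
qed

lemma addable_fst_inj: "diagram D \<Longrightarrow> a \<in> addable D \<Longrightarrow> b \<in> addable D \<Longrightarrow> fst a = fst b \<Longrightarrow> a = b"
  by (metis addable_collen prod.collapse)

text \<open>Of two boxes in one column the lower cannot be removed while the upper one
  stays.\<close>

lemma removable_fst_inj:
  assumes D: "diagram D" and a: "a \<in> removable D" "b \<in> removable D" "fst a = fst b" shows "a = b"
proof -
  have *: "snd b' \<le> snd a'" if "a' \<in> removable D" "b' \<in> removable D" "fst a' = fst b'" for a' b'
  proof (rule ccontr)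
    assume "\<not> snd b' \<le> snd a'"
    then have "snd a' \<le> snd b'" "a' \<noteq> b'" by auto
    then have "(fst a', snd a') \<in> D - {a'}"
      using that by (rule_tac diagramD[of "D - {a'}" "fst b'" "snd b'"]) (auto simp: removable_def prod_eq_iff)
    then show False by simp
  qed
  show ?thesis using *[OF a] *[OF a(2,1)] a(3) by (simp add: prod_eq_iff)
qed

text \<open>Both sides run over the edges of the Young graph between the levels \<open>n\<close> and
  \<open>Suc n\<close>, grouped by the upper end on the left and by the lower end on the
  right.\<close>

lemma sum_removable_eq_sum_addable:
  fixes F :: "(nat \<times> nat) set \<Rightarrow> nat \<times> nat \<Rightarrow> real"
  shows "(\<Sum>D\<in>diagrams (Suc n). \<Sum>a\<in>removable D. F D a)
       = (\<Sum>E\<in>diagrams n. \<Sum>a\<in>addable E. F (insert a E) a)"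
proof -
  have "(\<Sum>D\<in>diagrams (Suc n). \<Sum>a\<in>removable D. F D a)
      = (\<Sum>(D, a)\<in>Sigma (diagrams (Suc n)) removable. F D a)"
    by (rule sum.Sigma) (auto simp: in_diagrams)
  also have "\<dots> = (\<Sum>(E, a)\<in>Sigma (diagrams n) addable. F (insert a E) a)"
    by (rule sum.reindex_bij_witness[where i = "\<lambda>(E, a). (insert a E, a)" and j = "\<lambda>(D, a). (D - {a}, a)"])
      (auto simp: insert_in_diagrams remove_in_diagrams in_diagrams removable_insert addable_remove,
       auto simp: removable_def addable_def insert_absorb)
  also have "\<dots> = (\<Sum>E\<in>diagrams n. \<Sum>a\<in>addable E. F (insert a E) a)"
    by (rule sum.Sigma[symmetric]) (auto simp: in_diagrams)
  finally show ?thesis .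
qed

text \<open>Diagrams are closed under intersection and union: \<open>D - {c}\<close> is the meet of
  \<open>D\<close> and \<open>insert a D - {c}\<close>, and \<open>insert a D\<close> is the join of
  \<open>D\<close> and \<open>insert a (D - {c})\<close>. Hence the up-down walks from
  \<open>D\<close> that do not return match the down-up walks that do not return.\<close>

lemma addable_removable_swap:
  assumes "diagram D"
  shows "a \<in> addable D \<and> c \<in> removable (insert a D) - {a}
     \<longleftrightarrow> c \<in> removable D \<and> a \<in> addable (D - {c}) - {c}"
proof
  assume l: "a \<in> addable D \<and> c \<in> removable (insert a D) - {a}"
  then have e: "D - {c} = D \<inter> (insert a D - {c})" "insert a (D - {c}) = insert a D - {c}"
    unfolding addable_def by auto
  have "diagram (D - {c})" unfolding e(1) using l assms diagram_Int removable_diagram by blast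
  then show "c \<in> removable D \<and> a \<in> addable (D - {c}) - {c}"
    using l e(2) unfolding addable_def removable_def by auto
next
  assume r: "c \<in> removable D \<and> a \<in> addable (D - {c}) - {c}"
  then have e: "insert a D = D \<union> insert a (D - {c})" "insert a D - {c} = insert a (D - {c})"
    by auto
  have "diagram (insert a D)" unfolding e(1) using r assms diagram_Un addable_diagram by blast
  then show "a \<in> addable D \<and> c \<in> removable (insert a D) - {a}"
    using r e(2) unfolding addable_def removable_def by auto
qed

lemma sum_addable_removable_swap:
  fixes H :: "nat \<times> nat \<Rightarrow> nat \<times> nat \<Rightarrow> real"
  assumes D: "diagram D"
  shows "(\<Sum>a\<in>addable D. \<Sum>c\<in>removable (insert a D) - {a}. H a c)
       = (\<Sum>c\<in>removable D. \<Sum>a\<in>addable (D - {c}) - {c}. H a c)"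
proof -
  have "(\<Sum>a\<in>addable D. \<Sum>c\<in>removable (insert a D) - {a}. H a c)
      = (\<Sum>(a, c)\<in>Sigma (addable D) (\<lambda>a. removable (insert a D) - {a}). H a c)"
    using D by (intro sum.Sigma) (auto dest: addable_diagram)
  also have "\<dots> = (\<Sum>(c, a)\<in>Sigma (removable D) (\<lambda>c. addable (D - {c}) - {c}). H a c)"
    by (rule sum.reindex_bij_witness[where i = "\<lambda>(c, a). (a, c)" and j = "\<lambda>(a, c). (c, a)"])
      (use addable_removable_swap[OF D] in \<open>auto\<close>)
  also have "\<dots> = (\<Sum>c\<in>removable D. \<Sum>a\<in>addable (D - {c}) - {c}. H a c)"
    using D by (intro sum.Sigma[symmetric]) (auto dest: removable_diagram)
  finally show ?thesis .
qed

text \<open>The sign is opposite to the usual column minus row, so that a large content means a box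
  high up in the first columns, the region that matters for column lengths.\<close>

definition content :: "nat \<times> nat \<Rightarrow> int" where
  "content a = int (snd a) - int (fst a)"

lemma rowlen_antimono: "diagram D \<Longrightarrow> rowlen D (Suc y) \<le> rowlen D y"
  using rowlen_iff[of D "rowlen D y" "Suc y"] rowlen_iff[of D "rowlen D y" "y"]
    diagramD[of D "rowlen D y" "Suc y" "rowlen D y" y] by (metis le_Suc_eq not_less order_refl)

text \<open>Addable and removable boxes are the inner and outer corners of the boundary, and their
  contents interlace. Along one row the second difference of \<Phi> telescopes to the two ends of
  the row; summed over the rows, only the corners survive.\<close>

lemma sum_addable_content:
  fixes \<Phi> :: "int \<Rightarrow> real"
  assumes D: "diagram D"
  shows "(\<Sum>a\<in>addable D. \<Phi> (content a)) = (\<Sum>a\<in>removable D. \<Phi> (content a)) + \<Phi> 0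
    + (\<Sum>a\<in>D. \<Phi> (content a + 1) - 2 * \<Phi> (content a) + \<Phi> (content a - 1))"
proof -
  define r where "r = rowlen D"
  define L where "L = card D"
  have rL: "r y = 0" if "y \<ge> L" for y
    using that diagram_subset_square[OF D] rowlen_iff[OF D, of 0 y] unfolding L_def r_def by auto
  have mono: "r (Suc y) \<le> r y" for y unfolding r_def by (rule rowlen_antimono[OF D])
  have add: "addable D = (\<lambda>y. (r y, y)) ` insert 0 (Suc ` {y\<in>{..<L}. r (Suc y) < r y})" (is "_ = ?A")
  proof -
    have "(x, y) \<in> addable D \<longleftrightarrow> (x, y) \<in> ?A" for x y
    proof (cases y)
      case (Suc z)
      have "z < L" if "r (Suc z) < r z" using rL[of z] that by (cases "z < L") auto
      then show ?thesis using Suc by (auto simp: addable_iff[OF D] r_def[symmetric])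
    qed (auto simp: addable_iff[OF D] r_def[symmetric])
    then show ?thesis by auto
  qed
  have rem: "removable D = (\<lambda>y. (r y - 1, y)) ` {y\<in>{..<L}. r (Suc y) < r y}" (is "_ = ?B")
  proof -
    have "(x, y) \<in> removable D \<longleftrightarrow> (x, y) \<in> ?B" for x y
    proof -
      have "y < L" if "r (Suc y) < r y" using rL[of y] that by (cases "y < L") auto
      then show ?thesis by (auto simp: removable_iff[OF D] r_def[symmetric] image_iff)
    qed
    then show ?thesis by auto
  qed
  have "(\<Sum>a\<in>addable D. \<Phi> (content a))
      = (\<Sum>y\<in>insert 0 (Suc ` {y\<in>{..<L}. r (Suc y) < r y}). \<Phi> (int y - int (r y)))"
    unfolding add by (subst sum.reindex) (auto simp: inj_on_def content_def)
  also have "\<dots> = \<Phi> (- int (r 0)) + (\<Sum>y\<in>{y\<in>{..<L}. r (Suc y) < r y}. \<Phi> (int (Suc y) - int (r (Suc y))))"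
    by (subst sum.insert) (auto simp: sum.reindex)
  finally have 1: "(\<Sum>a\<in>addable D. \<Phi> (content a)) = \<Phi> (- int (r 0))
     + (\<Sum>y\<in>{y\<in>{..<L}. r (Suc y) < r y}. \<Phi> (int (Suc y) - int (r (Suc y))))" .
  have 2: "(\<Sum>a\<in>removable D. \<Phi> (content a))
     = (\<Sum>y\<in>{y\<in>{..<L}. r (Suc y) < r y}. \<Phi> (int (Suc y) - int (r y)))"
    unfolding rem by (subst sum.reindex)
      (auto simp: inj_on_def content_def of_nat_diff intro!: sum.cong arg_cong[where f = \<Phi>])
  have "(\<Sum>a\<in>addable D. \<Phi> (content a)) - (\<Sum>a\<in>removable D. \<Phi> (content a)) - \<Phi> (- int (r 0))
     = (\<Sum>y\<in>{y\<in>{..<L}. r (Suc y) < r y}. \<Phi> (int (Suc y) - int (r (Suc y))) - \<Phi> (int (Suc y) - int (r y)))"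
    unfolding 1 2 by (simp add: sum_subtractf)
  \<comment> \<open>A row that is as long as the row above it contributes 0, so the sum may run over
    all rows; only then does it telescope.\<close>
  also have "\<dots> = (\<Sum>y<L. \<Phi> (int (Suc y) - int (r (Suc y))) - \<Phi> (int (Suc y) - int (r y)))"
  proof (rule sum.mono_neutral_left)
    show "\<forall>y\<in>{..<L} - {y \<in> {..<L}. r (Suc y) < r y}.
        \<Phi> (int (Suc y) - int (r (Suc y))) - \<Phi> (int (Suc y) - int (r y)) = 0"
    proof
      fix y assume "y \<in> {..<L} - {y \<in> {..<L}. r (Suc y) < r y}"
      then have "r (Suc y) = r y" using mono[of y] by auto
      then show "\<Phi> (int (Suc y) - int (r (Suc y))) - \<Phi> (int (Suc y) - int (r y)) = 0" by simp
    qed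
  qed auto
  also have "\<dots> = (\<Sum>y<L. \<Phi> (int (Suc y) - int (r (Suc y))) - \<Phi> (int y - int (r y)))
     + (\<Sum>y<L. \<Phi> (int y - int (r y)) - \<Phi> (int (Suc y) - int (r y)))"
    by (simp add: sum.distrib[symmetric])
  also have "(\<Sum>y<L. \<Phi> (int (Suc y) - int (r (Suc y))) - \<Phi> (int y - int (r y))) = \<Phi> (int L) - \<Phi> (- int (r 0))"
    using sum_lessThan_telescope[of "\<lambda>y. \<Phi> (int y - int (r y))" L] rL[of L] by simp
  also have "(\<Sum>y<L. \<Phi> (int y - int (r y)) - \<Phi> (int (Suc y) - int (r y)))
     = (\<Sum>y<L. \<Phi> (int y) - \<Phi> (int (Suc y))
         + (\<Sum>x<r y. \<Phi> (int y - int x + 1) - 2 * \<Phi> (int y - int x) + \<Phi> (int y - int x - 1)))"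
  proof (rule sum.cong[OF refl])
    fix y
    have "\<Phi> (int y - int k) - \<Phi> (int (Suc y) - int k) = \<Phi> (int y) - \<Phi> (int (Suc y))
         + (\<Sum>x<k. \<Phi> (int y - int x + 1) - 2 * \<Phi> (int y - int x) + \<Phi> (int y - int x - 1))" for k
    proof (induction k)
      case (Suc k)
      have e: "int y - int (Suc k) = int y - int k - 1" "int (Suc y) - int (Suc k) = int y - int k"
        "int (Suc y) - int k = int y - int k + 1" by simp_all
      show ?case using Suc unfolding e sum.lessThan_Suc by simp
    qed simp
    then show "\<Phi> (int y - int (r y)) - \<Phi> (int (Suc y) - int (r y)) = \<Phi> (int y) - \<Phi> (int (Suc y))
         + (\<Sum>x<r y. \<Phi> (int y - int x + 1) - 2 * \<Phi> (int y - int x) + \<Phi> (int y - int x - 1))" .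
  qed
  also have "\<dots> = \<Phi> 0 - \<Phi> (int L)
     + (\<Sum>y<L. \<Sum>x<r y. \<Phi> (int y - int x + 1) - 2 * \<Phi> (int y - int x) + \<Phi> (int y - int x - 1))"
    using sum_lessThan_telescope'[of "\<lambda>y. \<Phi> (int y)" L] by (simp add: sum.distrib)
  also have "(\<Sum>y<L. \<Sum>x<r y. \<Phi> (int y - int x + 1) - 2 * \<Phi> (int y - int x) + \<Phi> (int y - int x - 1))
     = (\<Sum>(y, x)\<in>Sigma {..<L} (\<lambda>y. {..<r y}). \<Phi> (int y - int x + 1) - 2 * \<Phi> (int y - int x) + \<Phi> (int y - int x - 1))"
    by (rule sum.Sigma) auto
  also have "\<dots> = (\<Sum>a\<in>D. \<Phi> (content a + 1) - 2 * \<Phi> (content a) + \<Phi> (content a - 1))"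
    by (rule sum.reindex_bij_witness[where i = prod.swap and j = prod.swap])
      (use rowlen_iff[OF D] diagram_subset_square[OF D] in \<open>auto simp: content_def r_def L_def\<close>)
  finally show ?thesis by simp
qed

text \<open>The case of constant \<Phi>, where the second differences vanish. The surplus of one is
  the source of the commutation relation \<open>down_up_commute\<close>.\<close>

lemma card_addable: assumes "diagram D" shows "card (addable D) = Suc (card (removable D))"
proof -
  have "real (card (addable D)) = real (Suc (card (removable D)))"
    using sum_addable_content[OF assms, of "\<lambda>_. 1"] by simp
  then show ?thesis by linarith
qed

section \<open>Dimensions and the differential poset structure\<close>

text \<open>A standard Young tableau, written as the list of its boxes by decreasing entries, so
  that one growth step is a \<open>Cons\<close>.\<close>

fun growth_path :: "(nat \<times> nat) list \<Rightarrow> bool" where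
  "growth_path [] \<longleftrightarrow> True"
| "growth_path (a # p) \<longleftrightarrow> growth_path p \<and> a \<in> addable (set p)"

definition paths_to :: "(nat \<times> nat) set \<Rightarrow> (nat \<times> nat) list set" where
  "paths_to D = {p. growth_path p \<and> set p = D}"

text \<open>The number of standard Young tableaux of shape \<open>D\<close>, real-valued because it
  serves as a weight.\<close>

definition num_paths :: "(nat \<times> nat) set \<Rightarrow> real" where
  "num_paths D = real (card (paths_to D))"

text \<open>\<open>up_op\<close> and \<open>down_op\<close> are Stanley's operators of the
  differential poset of Young diagrams, acting on functions; they are transposes of each other
  (\<open>sum_up_op_adjoint\<close>).\<close>

definition up_op :: "((nat \<times> nat) set \<Rightarrow> real) \<Rightarrow> (nat \<times> nat) set \<Rightarrow> real" where
  "up_op g D = (\<Sum>c\<in>removable D. g (D - {c}))"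

definition down_op :: "((nat \<times> nat) set \<Rightarrow> real) \<Rightarrow> (nat \<times> nat) set \<Rightarrow> real" where
  "down_op g E = (\<Sum>a\<in>addable E. g (insert a E))"

lemma growth_path_diagram: "growth_path p \<Longrightarrow> diagram (set p)"
  by (cases p) (auto dest: addable_diagram)

lemma growth_path_distinct: "growth_path p \<Longrightarrow> distinct p"
  by (induction p) (auto simp: addable_def)

lemma growth_path_length: "growth_path p \<Longrightarrow> length p = card (set p)"
  using distinct_card growth_path_distinct by metis

lemma finite_paths_to [simp]: assumes "diagram D" shows "finite (paths_to D)"
proof (rule finite_subset)
  show "paths_to D \<subseteq> {p. set p \<subseteq> D \<and> length p = card D}"
    by (auto simp: paths_to_def growth_path_length)
  show "finite {p. set p \<subseteq> D \<and> length p = card D}"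
    using diagram_finite[OF assms] by (rule finite_lists_length_eq)
qed

lemma paths_to_empty [simp]: "paths_to {} = {[]}"
  by (auto simp: paths_to_def)

lemma num_paths_empty [simp]: "num_paths {} = 1"
  by (simp add: num_paths_def)

lemma num_paths_nonneg [simp]: "0 \<le> num_paths D"
  by (simp add: num_paths_def)

lemma paths_to_rec:
  assumes "diagram D" "D \<noteq> {}"
  shows "paths_to D = (\<Union>c\<in>removable D. Cons c ` paths_to (D - {c}))"
proof (intro equalityI subsetI)
  fix p assume p: "p \<in> paths_to D"
  then obtain c r where r: "p = c # r" using assms(2) by (cases p) (auto simp: paths_to_def)
  then have "c \<in> D" "set r = D - {c}" "growth_path r" "diagram (set r)"
    using p growth_path_diagram[of r] by (auto simp: paths_to_def addable_def)
  then show "p \<in> (\<Union>c\<in>removable D. Cons c ` paths_to (D - {c}))"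
    using r by (intro UN_I[of c] imageI) (auto simp: paths_to_def removable_def)
next
  fix p assume "p \<in> (\<Union>c\<in>removable D. Cons c ` paths_to (D - {c}))"
  then obtain c r where "p = c # r" "c \<in> removable D" "growth_path r" "set r = D - {c}"
    by (auto simp: paths_to_def)
  then show "p \<in> paths_to D"
    using addable_remove[OF assms(1)] by (auto simp: paths_to_def removable_def)
qed

lemma num_paths_rec: assumes "diagram D" "D \<noteq> {}" shows "up_op num_paths D = num_paths D"
proof -
  have "card (paths_to D) = (\<Sum>c\<in>removable D. card (Cons c ` paths_to (D - {c})))"
    unfolding paths_to_rec[OF assms]
    by (rule card_UN_disjoint) (use assms in \<open>auto dest: removable_diagram\<close>)
  also have "\<dots> = (\<Sum>c\<in>removable D. card (paths_to (D - {c})))"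
    by (intro sum.cong refl card_image) (auto simp: inj_on_def)
  finally show ?thesis by (simp add: num_paths_def up_op_def)
qed

lemma num_paths_rec_diagrams: "D \<in> diagrams (Suc n) \<Longrightarrow> up_op num_paths D = num_paths D"
  by (rule num_paths_rec) (auto simp: diagrams_def)

lemma insert_minus_addable: "a \<in> addable E \<Longrightarrow> insert a E - {a} = E" "a \<in> addable E \<Longrightarrow> E - {a} = E"
  by (auto simp: addable_def)

lemma insert_minus_removable: "a \<in> removable E \<Longrightarrow> insert a (E - {a}) = E" "a \<in> removable E \<Longrightarrow> insert a E = E"
  by (auto simp: removable_def)

lemma sum_removable_insert:
  fixes g :: "nat \<times> nat \<Rightarrow> real"
  assumes "diagram D" "a \<in> addable D"
  shows "(\<Sum>c\<in>removable (insert a D). g c) = g a + (\<Sum>c\<in>removable (insert a D) - {a}. g c)"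
  using assms by (intro sum.remove) (auto simp: removable_insert dest: addable_diagram)

lemma sum_addable_remove:
  fixes g :: "nat \<times> nat \<Rightarrow> real"
  assumes "diagram D" "c \<in> removable D"
  shows "(\<Sum>a\<in>addable (D - {c}). g a) = g c + (\<Sum>a\<in>addable (D - {c}) - {c}. g a)"
  using assms by (intro sum.remove) (auto simp: addable_remove dest: removable_diagram)

text \<open>Two-step walks that do not return to \<open>D\<close> agree in both orders by
  \<open>addable_removable_swap\<close>. The returning ones number \<open>card (addable D)\<close>
  in one order and \<open>card (removable D)\<close> in the other, and the difference is 1.\<close>

lemma down_up_commute:
  assumes D: "diagram D"
  shows "down_op (up_op g) D = g D + up_op (down_op g) D"
proof -
  have "down_op (up_op g) D
      = (\<Sum>a\<in>addable D. g D + (\<Sum>c\<in>removable (insert a D) - {a}. g (insert a D - {c})))"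
    unfolding down_op_def up_op_def
    by (intro sum.cong refl) (subst sum_removable_insert[OF D], simp_all add: insert_minus_addable)
  also have "\<dots> = card (addable D) * g D
      + (\<Sum>c\<in>removable D. \<Sum>a\<in>addable (D - {c}) - {c}. g (insert a D - {c}))"
    by (simp add: sum.distrib sum_addable_removable_swap[OF D])
  also have "(\<Sum>c\<in>removable D. \<Sum>a\<in>addable (D - {c}) - {c}. g (insert a D - {c}))
      = (\<Sum>c\<in>removable D. \<Sum>a\<in>addable (D - {c}) - {c}. g (insert a (D - {c})))"
  proof (intro sum.cong refl)
    fix c a assume "a \<in> addable (D - {c}) - {c}"
    then have "insert a D - {c} = insert a (D - {c})" by auto
    then show "g (insert a D - {c}) = g (insert a (D - {c}))" by simp
  qed
  also have "card (addable D) * g D + \<dots>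
      = g D + (\<Sum>c\<in>removable D. g D + (\<Sum>a\<in>addable (D - {c}) - {c}. g (insert a (D - {c}))))"
    by (simp add: sum.distrib card_addable[OF D] algebra_simps)
  also have "\<dots> = g D + up_op (down_op g) D"
    unfolding down_op_def up_op_def
    by (intro arg_cong2[where f = "(+)"] sum.cong refl)
      (subst sum_addable_remove[OF D], simp_all add: insert_minus_removable)
  finally show ?thesis .
qed

lemma down_op_cong: "(\<And>a. a \<in> addable E \<Longrightarrow> g (insert a E) = h (insert a E)) \<Longrightarrow> down_op g E = down_op h E"
  unfolding down_op_def by simp

text \<open>Since \<open>up_op\<close> reproduces \<open>num_paths\<close>, each exchange of the two
  operators contributes one further copy of it. Probabilistically, the Plancherel measures of
  consecutive levels are coherent.\<close>

lemma down_op_num_paths: "D \<in> diagrams n \<Longrightarrow> down_op num_paths D = real (Suc n) * num_paths D"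
proof (induction n arbitrary: D)
  case (0 D)
  have "down_op num_paths {} = down_op (up_op num_paths) {}"
    by (rule down_op_cong) (use num_paths_rec addable_diagram in auto)
  also have "\<dots> = 1" by (subst down_up_commute) (auto simp: up_op_def removable_def)
  finally show ?case using 0 by simp
next
  case (Suc n D)
  have "down_op num_paths D = down_op (up_op num_paths) D"
    by (rule down_op_cong) (use num_paths_rec addable_diagram in auto)
  also have "\<dots> = num_paths D + up_op (down_op num_paths) D"
    by (rule down_up_commute[OF in_diagrams[OF Suc.prems]])
  also have "up_op (down_op num_paths) D = real (Suc n) * up_op num_paths D"
    unfolding up_op_def sum_distrib_left
    by (intro sum.cong refl Suc.IH remove_in_diagrams[OF Suc.prems])
  finally show ?case by (simp add: num_paths_rec_diagrams[OF Suc.prems] algebra_simps)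
qed

lemma sum_up_op_adjoint:
  "(\<Sum>D\<in>diagrams (Suc n). h D * up_op v D) = (\<Sum>E\<in>diagrams n. down_op h E * v E)"
proof -
  have "(\<Sum>D\<in>diagrams (Suc n). h D * up_op v D)
      = (\<Sum>D\<in>diagrams (Suc n). \<Sum>a\<in>removable D. h D * v (D - {a}))"
    by (simp add: up_op_def sum_distrib_left)
  also have "\<dots> = (\<Sum>E\<in>diagrams n. \<Sum>a\<in>addable E. h (insert a E) * v (insert a E - {a}))"
    by (rule sum_removable_eq_sum_addable)
  also have "\<dots> = (\<Sum>E\<in>diagrams n. down_op h E * v E)"
    by (simp add: down_op_def sum_distrib_right insert_minus_addable)
  finally show ?thesis .
qed

text \<open>Frobenius' identity, obtained from adjointness without any bijection. It makes
  \<open>(num_paths D)\<^sup>2 / fact n\<close> a probability, the Plancherel measure, and later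
  supplies the missing half of the Robinson-Schensted count.\<close>

lemma sum_num_paths_squared: "(\<Sum>D\<in>diagrams n. (num_paths D)\<^sup>2) = fact n"
proof (induction n)
  case (Suc n)
  have "(\<Sum>D\<in>diagrams (Suc n). (num_paths D)\<^sup>2) = (\<Sum>D\<in>diagrams (Suc n). num_paths D * up_op num_paths D)"
    by (intro sum.cong refl) (simp add: num_paths_rec_diagrams power2_eq_square)
  also have "\<dots> = (\<Sum>E\<in>diagrams n. down_op num_paths E * num_paths E)" by (rule sum_up_op_adjoint)
  also have "\<dots> = (\<Sum>E\<in>diagrams n. real (Suc n) * (num_paths E)\<^sup>2)"
    by (intro sum.cong refl) (simp add: down_op_num_paths power2_eq_square)
  finally show ?case using Suc by (simp add: sum_distrib_left[symmetric])
qed simp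

text \<open>A spectral gap: \<open>num_paths\<close> itself would need the factor
  \<open>Suc n\<close>, and orthogonality to it gains one. In the induction step let
  \<open>v = down_op h\<close>. The commutation relation and the hypothesis for \<open>v\<close>
  bound the square norm of \<open>up_op v\<close> by \<open>Suc n\<close> times that of
  \<open>v\<close>; adjointness and Cauchy-Schwarz turn this into the bound for
  \<open>h\<close>.\<close>

lemma poincare_inequality:
  assumes "(\<Sum>D\<in>diagrams (Suc n). h D * num_paths D) = 0"
  shows "(\<Sum>E\<in>diagrams n. (down_op h E)\<^sup>2) \<le> real n * (\<Sum>D\<in>diagrams (Suc n). (h D)\<^sup>2)"
  using assms
proof (induction n arbitrary: h)
  case (0 h)
  have "(\<Sum>E\<in>diagrams 0. down_op h E * num_paths E) = (\<Sum>D\<in>diagrams (Suc 0). h D * num_paths D)"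
    unfolding sum_up_op_adjoint[symmetric] by (intro sum.cong refl) (simp add: num_paths_rec_diagrams)
  then show ?case using 0 by simp
next
  case (Suc n h)
  define v where "v = down_op h"
  define A where "A = (\<Sum>E\<in>diagrams (Suc n). (v E)\<^sup>2)"
  define B where "B = (\<Sum>D\<in>diagrams (Suc (Suc n)). (up_op v D)\<^sup>2)"
  define H where "H = (\<Sum>D\<in>diagrams (Suc (Suc n)). (h D)\<^sup>2)"
  have "(\<Sum>E\<in>diagrams (Suc n). v E * num_paths E) = (\<Sum>D\<in>diagrams (Suc (Suc n)). h D * num_paths D)"
    unfolding v_def sum_up_op_adjoint[symmetric] by (intro sum.cong refl) (simp add: num_paths_rec_diagrams)
  then have IH: "(\<Sum>E\<in>diagrams n. (down_op v E)\<^sup>2) \<le> real n * A"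
    unfolding A_def using Suc.IH[of v] Suc.prems by simp
  have "B = (\<Sum>E\<in>diagrams (Suc n). down_op (up_op v) E * v E)"
    unfolding B_def power2_eq_square by (rule sum_up_op_adjoint)
  also have "\<dots> = A + (\<Sum>E\<in>diagrams (Suc n). v E * up_op (down_op v) E)"
    unfolding A_def sum.distrib[symmetric]
    by (intro sum.cong refl) (simp add: down_up_commute in_diagrams power2_eq_square algebra_simps)
  also have "(\<Sum>E\<in>diagrams (Suc n). v E * up_op (down_op v) E) = (\<Sum>E\<in>diagrams n. (down_op v E)\<^sup>2)"
    unfolding power2_eq_square by (rule sum_up_op_adjoint)
  finally have B: "B \<le> real (Suc n) * A" using IH by (simp add: algebra_simps)
  have "A = (\<Sum>D\<in>diagrams (Suc (Suc n)). h D * up_op v D)"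
    unfolding A_def v_def power2_eq_square by (rule sum_up_op_adjoint[symmetric])
  then have "A\<^sup>2 \<le> H * B"
    unfolding H_def B_def by (simp add: Cauchy_Schwarz_ineq_sum)
  also have "\<dots> \<le> H * (real (Suc n) * A)"
    using B by (intro mult_left_mono) (simp_all add: H_def sum_nonneg)
  finally have "A * A \<le> A * (real (Suc n) * H)" by (simp add: power2_eq_square ac_simps)
  moreover have "0 \<le> A" "0 \<le> H" by (simp_all add: A_def H_def sum_nonneg)
  ultimately have "A \<le> real (Suc n) * H"
    by (cases "A = 0") (auto simp: mult_le_cancel_left)
  then show ?case unfolding A_def H_def v_def .
qed

section \<open>The last box of a Plancherel growth process\<close>

text \<open>Divided by \<open>(n + 1)!\<close>, this is the expectation of \<open>\<phi>\<close> at the box added in step \<open>n + 1\<close>.\<close>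

definition edge_sum :: "(nat \<times> nat \<Rightarrow> real) \<Rightarrow> nat \<Rightarrow> real" where
  "edge_sum \<phi> n = (\<Sum>E\<in>diagrams n. \<Sum>a\<in>addable E. \<phi> a * (num_paths E * num_paths (insert a E)))"

definition box_sum :: "(nat \<times> nat \<Rightarrow> real) \<Rightarrow> nat \<Rightarrow> real" where
  "box_sum \<phi> n = (\<Sum>D\<in>diagrams n. (num_paths D)\<^sup>2 * (\<Sum>b\<in>D. \<phi> b))"

text \<open>One of the two factors \<open>num_paths D\<close> is expanded by the last step, which
  turns a Plancherel average into an average over the last edge of the growth.\<close>

lemma sum_edges:
  fixes F :: "(nat \<times> nat) set \<Rightarrow> nat \<times> nat \<Rightarrow> real"
  shows "(\<Sum>D\<in>diagrams (Suc n). (num_paths D)\<^sup>2 * G D)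
       = (\<Sum>E\<in>diagrams n. \<Sum>a\<in>addable E. G (insert a E) * (num_paths E * num_paths (insert a E)))"
proof -
  have "(\<Sum>D\<in>diagrams (Suc n). (num_paths D)\<^sup>2 * G D) = (\<Sum>D\<in>diagrams (Suc n). (num_paths D * G D) * up_op num_paths D)"
    by (intro sum.cong refl) (simp add: num_paths_rec_diagrams power2_eq_square)
  also have "\<dots> = (\<Sum>E\<in>diagrams n. down_op (\<lambda>D. num_paths D * G D) E * num_paths E)"
    by (rule sum_up_op_adjoint)
  finally show ?thesis by (simp add: down_op_def sum_distrib_left sum_distrib_right ac_simps)
qed

text \<open>The new box contributes \<open>edge_sum\<close>; the old boxes depend only on the
  diagram before the step, for which coherence (\<open>down_op_num_paths\<close>) gives the factor
  \<open>Suc n\<close>.\<close>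

lemma box_sum_Suc: "box_sum \<phi> (Suc n) = real (Suc n) * box_sum \<phi> n + edge_sum \<phi> n"
proof -
  have "box_sum \<phi> (Suc n)
      = (\<Sum>E\<in>diagrams n. \<Sum>a\<in>addable E. (\<Sum>b\<in>insert a E. \<phi> b) * (num_paths E * num_paths (insert a E)))"
    unfolding box_sum_def by (rule sum_edges)
  also have "\<dots> = (\<Sum>E\<in>diagrams n. (\<Sum>b\<in>E. \<phi> b) * num_paths E * down_op num_paths E
      + (\<Sum>a\<in>addable E. \<phi> a * (num_paths E * num_paths (insert a E))))"
  proof (intro sum.cong refl)
    fix E assume "E \<in> diagrams n"
    then have "(\<Sum>b\<in>insert a E. \<phi> b) = \<phi> a + (\<Sum>b\<in>E. \<phi> b)" if "a \<in> addable E" for a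
      using that by (intro sum.insert) (auto simp: addable_def diagrams_def diagram_finite)
    then show "(\<Sum>a\<in>addable E. (\<Sum>b\<in>insert a E. \<phi> b) * (num_paths E * num_paths (insert a E)))
      = (\<Sum>b\<in>E. \<phi> b) * num_paths E * down_op num_paths E + (\<Sum>a\<in>addable E. \<phi> a * (num_paths E * num_paths (insert a E)))"
      unfolding down_op_def sum_distrib_left sum.distrib[symmetric]
      by (intro sum.cong refl) (simp add: algebra_simps)
  qed
  also have "\<dots> = real (Suc n) * box_sum \<phi> n + edge_sum \<phi> n"
    by (simp add: sum.distrib box_sum_def edge_sum_def sum_distrib_left down_op_num_paths power2_eq_square ac_simps)
  finally show ?thesis .
qed

text \<open>A recursion for the law of the last box. The factor
  \<open>num_paths (insert a D)\<close> is expanded by the box \<open>c\<close> removed from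
  \<open>insert a D\<close>. The case \<open>c = a\<close> gives the squares; for
  \<open>c \<noteq> a\<close> the swap leads to pairs of addable boxes \<open>a\<close>,
  \<open>c\<close> of \<open>D - {c}\<close>. There the full double sum factorises, and the missing
  diagonal is a sum over removable boxes.\<close>

lemma edge_sum_Suc:
  "edge_sum \<phi> (Suc n) = real (Suc n) * edge_sum \<phi> n
     + (\<Sum>D\<in>diagrams (Suc n). (num_paths D)\<^sup>2 * ((\<Sum>a\<in>addable D. \<phi> a) - (\<Sum>a\<in>removable D. \<phi> a)))"
proof -
  have "edge_sum \<phi> (Suc n) = (\<Sum>D\<in>diagrams (Suc n). (num_paths D)\<^sup>2 * (\<Sum>a\<in>addable D. \<phi> a)
      + (\<Sum>c\<in>removable D. \<Sum>a\<in>addable (D - {c}) - {c}. \<phi> a * num_paths D * num_paths (insert a (D - {c}))))"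
    unfolding edge_sum_def
  proof (intro sum.cong refl)
    fix D assume "D \<in> diagrams (Suc n)"
    then have D: "diagram D" by (rule in_diagrams)
    have "(\<Sum>a\<in>addable D. \<phi> a * (num_paths D * num_paths (insert a D)))
        = (\<Sum>a\<in>addable D. (num_paths D)\<^sup>2 * \<phi> a
            + (\<Sum>c\<in>removable (insert a D) - {a}. \<phi> a * num_paths D * num_paths (insert a D - {c})))"
    proof (intro sum.cong refl)
      fix a assume a: "a \<in> addable D"
      have "num_paths (insert a D) = up_op num_paths (insert a D)"
        using num_paths_rec[OF addable_diagram[OF a]] by simp
      also have "\<dots> = num_paths D + (\<Sum>c\<in>removable (insert a D) - {a}. num_paths (insert a D - {c}))"
        unfolding up_op_def by (subst sum_removable_insert[OF D a]) (simp add: insert_minus_addable(2)[OF a])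
      finally have "\<phi> a * (num_paths D * num_paths (insert a D))
        = \<phi> a * (num_paths D * (num_paths D + (\<Sum>c\<in>removable (insert a D) - {a}. num_paths (insert a D - {c}))))" by simp
      then show "\<phi> a * (num_paths D * num_paths (insert a D)) = (num_paths D)\<^sup>2 * \<phi> a
            + (\<Sum>c\<in>removable (insert a D) - {a}. \<phi> a * num_paths D * num_paths (insert a D - {c}))"
        by (simp add: sum_distrib_left power2_eq_square algebra_simps)
    qed
    also have "\<dots> = (num_paths D)\<^sup>2 * (\<Sum>a\<in>addable D. \<phi> a)
        + (\<Sum>c\<in>removable D. \<Sum>a\<in>addable (D - {c}) - {c}. \<phi> a * num_paths D * num_paths (insert a D - {c}))"
      by (simp add: sum.distrib sum_addable_removable_swap[OF D] sum_distrib_left)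
    also have "(\<Sum>c\<in>removable D. \<Sum>a\<in>addable (D - {c}) - {c}. \<phi> a * num_paths D * num_paths (insert a D - {c}))
        = (\<Sum>c\<in>removable D. \<Sum>a\<in>addable (D - {c}) - {c}. \<phi> a * num_paths D * num_paths (insert a (D - {c})))"
    proof (intro sum.cong refl)
      fix c a assume "a \<in> addable (D - {c}) - {c}"
      then have "insert a D - {c} = insert a (D - {c})" by auto
      then show "\<phi> a * num_paths D * num_paths (insert a D - {c}) = \<phi> a * num_paths D * num_paths (insert a (D - {c}))" by simp
    qed
    finally show "(\<Sum>a\<in>addable D. \<phi> a * (num_paths D * num_paths (insert a D))) = (num_paths D)\<^sup>2 * (\<Sum>a\<in>addable D. \<phi> a)
      + (\<Sum>c\<in>removable D. \<Sum>a\<in>addable (D - {c}) - {c}. \<phi> a * num_paths D * num_paths (insert a (D - {c})))" .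
  qed
  also have "\<dots> = (\<Sum>D\<in>diagrams (Suc n). (num_paths D)\<^sup>2 * (\<Sum>a\<in>addable D. \<phi> a))
      + (\<Sum>E\<in>diagrams n. \<Sum>c\<in>addable E. \<Sum>a\<in>addable E - {c}. \<phi> a * num_paths (insert c E) * num_paths (insert a E))"
    unfolding sum.distrib
    by (subst sum_removable_eq_sum_addable[where F = "\<lambda>D c. \<Sum>a\<in>addable (D - {c}) - {c}. \<phi> a * num_paths D * num_paths (insert a (D - {c}))"])
      (simp add: insert_minus_addable)
  also have "(\<Sum>E\<in>diagrams n. \<Sum>c\<in>addable E. \<Sum>a\<in>addable E - {c}. \<phi> a * num_paths (insert c E) * num_paths (insert a E))
      = (\<Sum>E\<in>diagrams n. \<Sum>c\<in>addable E. num_paths (insert c E) * (\<Sum>a\<in>addable E. \<phi> a * num_paths (insert a E)) - \<phi> c * (num_paths (insert c E))\<^sup>2)"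
    by (intro sum.cong refl)
      (simp add: sum_diff1 in_diagrams sum_distrib_left right_diff_distrib power2_eq_square algebra_simps)
  also have "\<dots> = real (Suc n) * edge_sum \<phi> n - (\<Sum>E\<in>diagrams n. \<Sum>c\<in>addable E. \<phi> c * (num_paths (insert c E))\<^sup>2)"
  proof -
    have "(\<Sum>c\<in>addable E. num_paths (insert c E) * (\<Sum>a\<in>addable E. \<phi> a * num_paths (insert a E)))
        = real (Suc n) * (\<Sum>a\<in>addable E. \<phi> a * (num_paths E * num_paths (insert a E)))" if "E \<in> diagrams n" for E
      using down_op_num_paths[OF that] unfolding sum_distrib_right[symmetric] down_op_def
      by (simp add: sum_distrib_left ac_simps)
    then show ?thesis by (simp add: sum_subtractf edge_sum_def sum_distrib_left)
  qed
  also have "(\<Sum>E\<in>diagrams n. \<Sum>c\<in>addable E. \<phi> c * (num_paths (insert c E))\<^sup>2)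
      = (\<Sum>D\<in>diagrams (Suc n). \<Sum>c\<in>removable D. \<phi> c * (num_paths D)\<^sup>2)"
    by (rule sum_removable_eq_sum_addable[symmetric])
  finally show ?thesis
    by (simp add: sum_subtractf right_diff_distrib sum_distrib_left sum_distrib_right ac_simps)
qed

section \<open>Column lengths of a Plancherel diagram\<close>

text \<open>The probability that the box added in step \<open>n + 1\<close> of a Plancherel growth
  lies in column \<open>q\<close>.\<close>

definition col_prob :: "nat \<Rightarrow> nat \<Rightarrow> real" where
  "col_prob q n = edge_sum (\<lambda>a. of_bool (fst a = q)) n / fact (Suc n)"

definition mean_col :: "nat \<Rightarrow> nat \<Rightarrow> real" where
  "mean_col q n = box_sum (\<lambda>a. of_bool (fst a = q)) n / fact n"

text \<open>A column has at most one addable box, so this is \<open>num_paths\<close> of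
  \<open>E\<close> enlarged in column \<open>q\<close>, or 0 if that is impossible.\<close>

definition col_up :: "nat \<Rightarrow> (nat \<times> nat) set \<Rightarrow> real" where
  "col_up q E = (\<Sum>a\<in>addable E. of_bool (fst a = q) * num_paths (insert a E))"

lemma real_collen: assumes "diagram D" shows "real (collen D q) = (\<Sum>b\<in>D. of_bool (fst b = q))"
proof -
  have "collen D q = card (Pair q ` {y. (q, y) \<in> D})"
    unfolding collen_def by (rule card_image[symmetric]) (simp add: inj_on_def)
  also have "Pair q ` {y. (q, y) \<in> D} = {b \<in> D. fst b = q}" by force
  finally show ?thesis using diagram_finite[OF assms] by (simp add: of_bool_def sum.If_cases Int_def)
qed

lemma collen_insert:
  assumes "diagram D" "a \<in> addable D"
  shows "real (collen (insert a D) q) = real (collen D q) + of_bool (fst a = q)"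
  using assms real_collen[OF assms(1)] real_collen[OF addable_diagram[OF assms(2)]]
  by (auto simp: addable_def diagram_finite)

lemma mean_col_alt: "mean_col q n = (\<Sum>D\<in>diagrams n. (num_paths D)\<^sup>2 * real (collen D q)) / fact n"
  unfolding mean_col_def box_sum_def by (simp add: real_collen in_diagrams)

lemma mean_col_0 [simp]: "mean_col q 0 = 0"
  by (simp add: mean_col_def box_sum_def)

lemma mean_col_Suc: "mean_col q (Suc n) = mean_col q n + col_prob q n"
  unfolding mean_col_def col_prob_def box_sum_Suc add_divide_distrib by simp

lemma edge_sum_col_up: "edge_sum (\<lambda>a. of_bool (fst a = q)) n = (\<Sum>E\<in>diagrams n. num_paths E * col_up q E)"
  unfolding edge_sum_def col_up_def by (simp add: sum_distrib_left ac_simps)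

text \<open>A column selects at most one addable or removable box, so selection sums have at most
  one term. The function \<open>g\<close> is quantified inside each case, so that one case
  distinction rewrites several sums, for instance a sum and the sum of squares.\<close>

lemma sum_of_bool_unique:
  fixes S :: "'a set" and P :: "'a \<Rightarrow> bool"
  assumes "finite S" "\<And>a b. a \<in> S \<Longrightarrow> b \<in> S \<Longrightarrow> P a \<Longrightarrow> P b \<Longrightarrow> a = b"
  obtains a where "a \<in> S" "P a" "\<And>g :: 'a \<Rightarrow> real. (\<Sum>x\<in>S. of_bool (P x) * g x) = g a"
    | "\<And>a. a \<in> S \<Longrightarrow> \<not> P a" "\<And>g :: 'a \<Rightarrow> real. (\<Sum>x\<in>S. of_bool (P x) * g x) = 0"
proof (cases "\<exists>a\<in>S. P a")
  case True
  then obtain a where a: "a \<in> S" "P a" by blast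
  then have "of_bool (P x) * g x = (if x = a then g a else 0)" if "x \<in> S" for x and g :: "'a \<Rightarrow> real"
    using assms(2) that by auto
  then show ?thesis using a assms(1) by (intro that(1)) (auto cong: sum.cong)
next
  case False
  then show ?thesis by (intro that(2)) auto
qed

lemma col_up_squared:
  assumes "diagram E"
  shows "(col_up q E)\<^sup>2 = (\<Sum>a\<in>addable E. of_bool (fst a = q) * (num_paths (insert a E))\<^sup>2)"
  unfolding col_up_def
  by (rule sum_of_bool_unique[of "addable E" "\<lambda>a. fst a = q"])
    (use assms addable_fst_inj in \<open>auto intro: addable_fst_inj\<close>)

text \<open>Regrouped by the larger diagram, each square \<open>(num_paths D)\<^sup>2\<close> occurs
  at most once, as \<open>D\<close> has at most one removable box in column
  \<open>q\<close>.\<close>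

lemma sum_col_up_squared: "(\<Sum>E\<in>diagrams n. (col_up q E)\<^sup>2) \<le> fact (Suc n)"
proof -
  have "(\<Sum>E\<in>diagrams n. (col_up q E)\<^sup>2)
      = (\<Sum>E\<in>diagrams n. \<Sum>a\<in>addable E. of_bool (fst a = q) * (num_paths (insert a E))\<^sup>2)"
    by (intro sum.cong refl col_up_squared in_diagrams)
  also have "\<dots> = (\<Sum>D\<in>diagrams (Suc n). \<Sum>a\<in>removable D. of_bool (fst a = q) * (num_paths D)\<^sup>2)"
    by (rule sum_removable_eq_sum_addable[symmetric])
  also have "\<dots> \<le> (\<Sum>D\<in>diagrams (Suc n). (num_paths D)\<^sup>2)"
  proof (rule sum_mono)
    fix D assume "D \<in> diagrams (Suc n)"
    then have "diagram D" by (rule in_diagrams)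
    show "(\<Sum>a\<in>removable D. of_bool (fst a = q) * (num_paths D)\<^sup>2) \<le> (num_paths D)\<^sup>2" (is ?thesis)
    proof (rule_tac sum_of_bool_unique[of "removable D" "\<lambda>a. fst a = q"])
      fix a assume g: "\<And>g :: nat \<times> nat \<Rightarrow> real. (\<Sum>x\<in>removable D. of_bool (fst x = q) * g x) = g a"
      show ?thesis unfolding g[of "\<lambda>_. (num_paths D)\<^sup>2"] by simp
    next
      assume g: "\<And>g :: nat \<times> nat \<Rightarrow> real. (\<Sum>x\<in>removable D. of_bool (fst x = q) * g x) = 0"
      show ?thesis unfolding g[of "\<lambda>_. (num_paths D)\<^sup>2"] by simp
    qed (simp_all add: \<open>diagram D\<close> removable_fst_inj[OF \<open>diagram D\<close>])
  qed
  finally show ?thesis by (simp add: sum_num_paths_squared)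
qed

lemma col_up_nonneg [simp]: "0 \<le> col_up q E"
  by (simp add: col_up_def sum_nonneg)

lemma col_prob_nonneg [simp]: "0 \<le> col_prob q n"
  unfolding col_prob_def edge_sum_col_up by (simp add: sum_nonneg)

text \<open>Cauchy-Schwarz for \<open>num_paths\<close> against \<open>col_up\<close>, with square
  norms \<open>n!\<close> and at most \<open>(n + 1)!\<close>. The bound is asymptotically sharp,
  see \<open>tendsto_col_prob\<close>.\<close>

lemma col_prob_le: "col_prob q n \<le> 1 / sqrt (real (Suc n))"
proof -
  have "(edge_sum (\<lambda>a. of_bool (fst a = q)) n)\<^sup>2
      \<le> (\<Sum>E\<in>diagrams n. (num_paths E)\<^sup>2) * (\<Sum>E\<in>diagrams n. (col_up q E)\<^sup>2)"
    unfolding edge_sum_col_up by (rule Cauchy_Schwarz_ineq_sum)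
  also have "\<dots> \<le> fact n * fact (Suc n)"
    by (simp only: sum_num_paths_squared) (intro mult_left_mono sum_col_up_squared, simp)
  finally have "(col_prob q n)\<^sup>2 \<le> fact n * fact (Suc n) / (fact (Suc n))\<^sup>2"
    unfolding col_prob_def power_divide by (rule divide_right_mono) simp
  also have "\<dots> = 1 / real (Suc n)"
    by (simp add: power2_eq_square)
  finally have "sqrt ((col_prob q n)\<^sup>2) \<le> sqrt (1 / real (Suc n))" by (rule real_sqrt_le_mono)
  then show ?thesis by (simp add: real_sqrt_divide)
qed

text \<open>The Poincare inequality is applied to \<open>num_paths D\<close> times the centred
  column length, which is orthogonal to \<open>num_paths\<close>. A growth step changes a column
  length by at most one, so \<open>Suc n\<close> times the square norm of \<open>h\<close> exceeds
  that of \<open>down_op h\<close> only by a multiple of \<open>col_prob\<close>. The variance is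
  thus of order sqrt n, while the square of the mean is of order n.\<close>

lemma variance_collen:
  "(\<Sum>D\<in>diagrams (Suc n). (num_paths D)\<^sup>2 * (real (collen D q) - mean_col q (Suc n))\<^sup>2)
     \<le> fact (Suc n) * sqrt (real (Suc n))"
proof -
  define \<mu> where "\<mu> = mean_col q (Suc n)"
  define h where "h D = num_paths D * (real (collen D q) - \<mu>)" for D
  define V where "V = (\<Sum>D\<in>diagrams (Suc n). (h D)\<^sup>2)"
  define C where "C = edge_sum (\<lambda>a. of_bool (fst a = q)) n"
  have "(\<Sum>D\<in>diagrams (Suc n). h D * num_paths D)
      = (\<Sum>D\<in>diagrams (Suc n). (num_paths D)\<^sup>2 * real (collen D q)) - \<mu> * (\<Sum>D\<in>diagrams (Suc n). (num_paths D)\<^sup>2)"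
    by (simp add: h_def sum_subtractf[symmetric] sum_distrib_left power2_eq_square algebra_simps)
  also have "\<dots> = 0" by (simp add: \<mu>_def mean_col_alt sum_num_paths_squared del: fact_Suc)
  finally have P: "(\<Sum>E\<in>diagrams n. (down_op h E)\<^sup>2) \<le> real n * V"
    unfolding V_def by (rule poincare_inequality)
  have "V = (\<Sum>E\<in>diagrams n. \<Sum>a\<in>addable E. (real (collen (insert a E) q) - \<mu>)\<^sup>2 * (num_paths E * num_paths (insert a E)))"
    unfolding V_def h_def power_mult_distrib by (rule sum_edges)
  then have "real (Suc n) * V - (\<Sum>E\<in>diagrams n. (down_op h E)\<^sup>2)
     = (\<Sum>E\<in>diagrams n. real (Suc n) * (\<Sum>a\<in>addable E. (real (collen (insert a E) q) - \<mu>)\<^sup>2 * (num_paths E * num_paths (insert a E)))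
          - (down_op h E)\<^sup>2)"
    by (simp add: sum_distrib_left sum_subtractf)
  also have "\<dots> \<le> (\<Sum>E\<in>diagrams n. real (Suc n) * (num_paths E * col_up q E))"
  proof (rule sum_mono)
    fix E assume E: "E \<in> diagrams n"
    define x where "x = real (collen E q) - \<mu>"
    define f where "f = num_paths E"
    define u where "u = col_up q E"
    have D: "diagram E" using E by (rule in_diagrams)
    have F: "(\<Sum>a\<in>addable E. num_paths (insert a E)) = real (Suc n) * f"
      using down_op_num_paths[OF E] by (simp add: down_op_def f_def)
    have "(\<Sum>a\<in>addable E. (real (collen (insert a E) q) - \<mu>)\<^sup>2 * (num_paths E * num_paths (insert a E)))
        = (\<Sum>a\<in>addable E. f * x\<^sup>2 * num_paths (insert a E)
             + f * (2 * x + 1) * (of_bool (fst a = q) * num_paths (insert a E)))"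
      by (intro sum.cong refl) (simp add: collen_insert[OF D] x_def f_def power2_eq_square algebra_simps of_bool_def)
    also have "\<dots> = f * x\<^sup>2 * (real (Suc n) * f) + f * (2 * x + 1) * u"
      unfolding sum.distrib sum_distrib_left[symmetric] F u_def col_up_def by simp
    finally have 1: "(\<Sum>a\<in>addable E. (real (collen (insert a E) q) - \<mu>)\<^sup>2 * (num_paths E * num_paths (insert a E)))
        = f * x\<^sup>2 * (real (Suc n) * f) + f * (2 * x + 1) * u" .
    have "down_op h E = (\<Sum>a\<in>addable E. x * num_paths (insert a E) + of_bool (fst a = q) * num_paths (insert a E))"
      unfolding down_op_def h_def by (intro sum.cong refl) (simp add: collen_insert[OF D] x_def algebra_simps)
    also have "\<dots> = x * (real (Suc n) * f) + u"
      unfolding sum.distrib sum_distrib_left[symmetric] F u_def col_up_def by simp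
    finally have 2: "down_op h E = x * (real (Suc n) * f) + u" .
    \<comment> \<open>All terms with \<open>x\<close> cancel: the left side equals
      \<open>real (Suc n) * f * u - u\<^sup>2\<close>.\<close>
    show "real (Suc n) * (\<Sum>a\<in>addable E. (real (collen (insert a E) q) - \<mu>)\<^sup>2 * (num_paths E * num_paths (insert a E)))
          - (down_op h E)\<^sup>2 \<le> real (Suc n) * (num_paths E * col_up q E)"
      unfolding 1 2 unfolding f_def[symmetric] u_def[symmetric] by (simp add: power2_eq_square algebra_simps)
  qed
  also have "\<dots> = real (Suc n) * C" by (simp add: C_def edge_sum_col_up sum_distrib_left)
  finally have "V \<le> real (Suc n) * C" using P by (simp add: algebra_simps)
  also have "C = fact (Suc n) * col_prob q n" by (simp add: C_def col_prob_def)
  also have "real (Suc n) * (fact (Suc n) * col_prob q n) \<le> real (Suc n) * (fact (Suc n) * (1 / sqrt (real (Suc n))))"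
    by (intro mult_left_mono col_prob_le) simp_all
  also have "\<dots> = fact (Suc n) * sqrt (real (Suc n))"
    using real_div_sqrt[of "real (Suc n)"] by (simp del: fact_Suc add: field_simps)
  finally show ?thesis unfolding V_def h_def power_mult_distrib \<mu>_def .
qed

subsection \<open>The content of the last box\<close>

lemma addable_empty: "addable {} = {(0, 0)}"
proof -
  have "(x, y) \<in> addable {} \<longleftrightarrow> (x, y) = (0, 0)" for x y
    by (subst addable_iff) (auto simp: rowlen_def)
  then show ?thesis by auto
qed

lemma edge_sum_0: "edge_sum \<phi> 0 = \<phi> (0, 0)"
  using down_op_num_paths[of "{}" 0] by (simp add: edge_sum_def addable_empty down_op_def)

text \<open>The exponential is an eigenfunction of the second difference with eigenvalue
  \<open>z\<close>, so by \<open>sum_addable_content\<close> the recursions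
  \<open>edge_sum_Suc\<close> and \<open>box_sum_Suc\<close> close in these two quantities and are
  solved together. The binomials vanish beyond \<open>n\<close>; the fixed upper limit
  \<open>N\<close> keeps the index range constant in the induction.\<close>

lemma edge_sum_exp_content:
  fixes t :: real
  defines "z \<equiv> exp t + exp (- t) - 2"
  assumes "n \<le> N"
  shows "edge_sum (\<lambda>a. exp (t * content a)) n = fact (Suc n) * (\<Sum>j\<le>N. real (n choose j) * z ^ j / fact (Suc j)) \<and>
    box_sum (\<lambda>a. exp (t * content a)) n = fact n * (\<Sum>j\<le>N. real (n choose Suc j) * z ^ j / fact (Suc j))"
  using assms(2)
proof (induction n)
  case 0
  have "(\<Sum>j\<le>N. real (0 choose j) * z ^ j / fact (Suc j)) = (\<Sum>j\<le>N. if j = 0 then 1 else 0)"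
    by (intro sum.cong refl) auto
  then have "edge_sum (\<lambda>a. exp (t * content a)) 0 = fact (Suc 0) * (\<Sum>j\<le>N. real (0 choose j) * z ^ j / fact (Suc j))"
    by (simp add: edge_sum_0 content_def)
  moreover have "box_sum (\<lambda>a. exp (t * content a)) 0 = fact 0 * (\<Sum>j\<le>N. real (0 choose Suc j) * z ^ j / fact (Suc j))"
    by (simp add: box_sum_def)
  ultimately show ?case by blast
next
  case (Suc n)
  let ?\<alpha> = "\<lambda>n. \<Sum>j\<le>N. real (n choose j) * z ^ j / fact (Suc j)"
  let ?\<beta> = "\<lambda>n. \<Sum>j\<le>N. real (n choose Suc j) * z ^ j / fact (Suc j)"
  have "n \<le> N" using Suc.prems by simp
  note IH = Suc.IH[OF this, THEN conjunct1] Suc.IH[OF this, THEN conjunct2]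
  have "?\<beta> (Suc n) = ?\<beta> n + ?\<alpha> n"
    by (simp add: sum.distrib[symmetric] add_divide_distrib algebra_simps)
  then have b: "box_sum (\<lambda>a. exp (t * content a)) (Suc n) = fact (Suc n) * ?\<beta> (Suc n)"
    by (simp add: box_sum_Suc IH algebra_simps)
  have "edge_sum (\<lambda>a. exp (t * content a)) (Suc n) = real (Suc n) * edge_sum (\<lambda>a. exp (t * content a)) n
      + (\<Sum>D\<in>diagrams (Suc n). (num_paths D)\<^sup>2 * (1 + z * (\<Sum>b\<in>D. exp (t * content b))))"
  proof -
    have "(\<Sum>a\<in>addable D. exp (t * content a)) - (\<Sum>a\<in>removable D. exp (t * content a))
        = 1 + z * (\<Sum>b\<in>D. exp (t * content b))" if "D \<in> diagrams (Suc n)" for D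
    proof -
      have "(\<Sum>a\<in>D. exp (t * of_int (content a + 1)) - 2 * exp (t * of_int (content a)) + exp (t * of_int (content a - 1)))
          = z * (\<Sum>b\<in>D. exp (t * content b))"
        unfolding sum_distrib_left z_def
        by (intro sum.cong refl) (simp add: exp_add[symmetric] algebra_simps)
      then show ?thesis
        using sum_addable_content[OF in_diagrams[OF that], of "\<lambda>c. exp (t * of_int c)"] by simp
    qed
    then show ?thesis by (simp add: edge_sum_Suc)
  qed
  also have "(\<Sum>D\<in>diagrams (Suc n). (num_paths D)\<^sup>2 * (1 + z * (\<Sum>b\<in>D. exp (t * content b))))
      = fact (Suc n) + z * box_sum (\<lambda>a. exp (t * content a)) (Suc n)"
    by (simp add: sum.distrib sum_num_paths_squared[symmetric] box_sum_def sum_distrib_left algebra_simps del: fact_Suc)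
  also have "real (Suc n) * edge_sum (\<lambda>a. exp (t * content a)) n + \<dots>
      = fact (Suc n) * (real (Suc n) * ?\<alpha> n + (1 + z * ?\<beta> (Suc n)))"
    unfolding b IH by (simp add: algebra_simps del: fact_Suc)
  also have "1 + z * ?\<beta> (Suc n) = (\<Sum>j\<le>Suc N. real (Suc n choose j) * z ^ j / fact j)"
    by (subst sum.atMost_Suc_shift) (simp add: sum_distrib_left ac_simps del: fact_Suc binomial_Suc_Suc)
  also have "\<dots> = (\<Sum>j\<le>N. real (Suc n choose j) * z ^ j / fact j)"
    using Suc.prems by (simp add: binomial_eq_0 del: binomial_Suc_Suc)
  also have "real (Suc n) * ?\<alpha> n + \<dots> = real (Suc (Suc n)) * ?\<alpha> (Suc n)"
    unfolding sum_distrib_left sum.distrib[symmetric]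
  proof (intro sum.cong refl)
    fix j assume "j \<in> {..N}"
    \<comment> \<open>Follows from absorption,
      \<open>(n + 1 - j) * (n + 1 choose j) = (n + 1) * (n choose j)\<close>.\<close>
    have *: "real (Suc n) * real (n choose j) + real (Suc j) * real (Suc n choose j) = real (Suc (Suc n)) * real (Suc n choose j)"
    proof (cases "j \<le> Suc n")
      case True
      have "(Suc n - j) * (Suc n choose j) = Suc n * (n choose j)"
        using binomial_absorb_comp[of "Suc n" j] by simp
      then have "real (Suc n - j) * real (Suc n choose j) = real (Suc n) * real (n choose j)"
        by (metis of_nat_mult)
      then show ?thesis using True by (simp add: of_nat_diff algebra_simps del: binomial_Suc_Suc)
    qed (simp add: binomial_eq_0 del: binomial_Suc_Suc)
    have "real (Suc n) * (real (n choose j) * z ^ j / fact (Suc j)) + real (Suc n choose j) * z ^ j / fact j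
       = (real (Suc n) * real (n choose j) + real (Suc j) * real (Suc n choose j)) * z ^ j / fact (Suc j)"
    proof -
      have "real (Suc n choose j) * z ^ j / fact j
          = (real (Suc j) * real (Suc n choose j)) * z ^ j / fact (Suc j)"
        by (simp del: binomial_Suc_Suc of_nat_Suc)
      then show ?thesis
        by (simp only: distrib_right add_divide_distrib times_divide_eq_right mult.assoc)
    qed
    then show "real (Suc n) * (real (n choose j) * z ^ j / fact (Suc j)) + real (Suc n choose j) * z ^ j / fact j
       = real (Suc (Suc n)) * (real (Suc n choose j) * z ^ j / fact (Suc j))"
      unfolding * by simp
  qed
  finally have "edge_sum (\<lambda>a. exp (t * content a)) (Suc n) = fact (Suc (Suc n)) * ?\<alpha> (Suc n)"
    by simp
  then show ?case using b by blast
qed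

lemma edge_sum_Sigma:
  "edge_sum \<phi> n = (\<Sum>(E, a)\<in>Sigma (diagrams n) addable. \<phi> a * (num_paths E * num_paths (insert a E)))"
  unfolding edge_sum_def by (rule sum.Sigma) (auto simp: in_diagrams)

lemma edge_sum_mono: "(\<And>a. \<phi> a \<le> \<psi> a) \<Longrightarrow> edge_sum \<phi> n \<le> edge_sum \<psi> n"
  unfolding edge_sum_def by (intro sum_mono mult_right_mono) auto

lemma edge_sum_nonneg: "(\<And>a. 0 \<le> \<phi> a) \<Longrightarrow> 0 \<le> edge_sum \<phi> n"
  unfolding edge_sum_def by (intro sum_nonneg mult_nonneg_nonneg) auto

lemma edge_sum_one: "edge_sum (\<lambda>_. 1) n = fact (Suc n)"
proof -
  have "fact (Suc n) = (\<Sum>D\<in>diagrams (Suc n). (num_paths D)\<^sup>2 * 1)"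
    by (simp add: sum_num_paths_squared)
  also have "\<dots> = edge_sum (\<lambda>_. 1) n" unfolding edge_sum_def by (rule sum_edges)
  finally show ?thesis by simp
qed

lemma edge_sum_add: "edge_sum (\<lambda>a. \<phi> a + \<psi> a) n = edge_sum \<phi> n + edge_sum \<psi> n"
  unfolding edge_sum_def by (simp add: distrib_right sum.distrib)

lemma edge_sum_cmult: "edge_sum (\<lambda>a. c * \<phi> a) n = c * edge_sum \<phi> n"
  unfolding edge_sum_def by (simp add: sum_distrib_left ac_simps)

lemma edge_sum_sum: "edge_sum (\<lambda>a. \<Sum>i\<in>I. \<phi> i a) n = (\<Sum>i\<in>I. edge_sum (\<phi> i) n)"
proof -
  have "edge_sum (\<lambda>a. \<Sum>i\<in>I. \<phi> i a) n
      = (\<Sum>E\<in>diagrams n. \<Sum>i\<in>I. \<Sum>a\<in>addable E. \<phi> i a * (num_paths E * num_paths (insert a E)))"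
    unfolding edge_sum_def sum_distrib_right by (intro sum.cong refl sum.swap)
  also have "\<dots> = (\<Sum>i\<in>I. edge_sum (\<phi> i) n)"
    unfolding edge_sum_def by (rule sum.swap)
  finally show ?thesis .
qed

lemma edge_sum_Cauchy_Schwarz:
  "(edge_sum (\<lambda>a. \<phi> a * \<psi> a) n)\<^sup>2 \<le> edge_sum (\<lambda>a. (\<phi> a)\<^sup>2) n * edge_sum (\<lambda>a. (\<psi> a)\<^sup>2) n"
proof -
  define w where "w = (\<lambda>(E, a). sqrt (num_paths E * num_paths (insert a E)))"
  have w: "num_paths E * num_paths (insert a E) = w (E, a) * w (E, a)" for E a
    by (simp add: w_def)
  have e: "edge_sum \<phi> n = (\<Sum>p\<in>Sigma (diagrams n) addable. \<phi> (snd p) * (w p * w p))" for \<phi>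
    unfolding edge_sum_Sigma by (intro sum.cong refl) (auto simp: w)
  have "(\<Sum>p\<in>Sigma (diagrams n) addable. (\<phi> (snd p) * w p) * (\<psi> (snd p) * w p))\<^sup>2
      \<le> (\<Sum>p\<in>Sigma (diagrams n) addable. (\<phi> (snd p) * w p)\<^sup>2) * (\<Sum>p\<in>Sigma (diagrams n) addable. (\<psi> (snd p) * w p)\<^sup>2)"
    by (rule Cauchy_Schwarz_ineq_sum)
  then show ?thesis by (simp add: e power2_eq_square ac_simps)
qed

lemma tendsto_binomial_over_power:
  "(\<lambda>n. real (n choose j) / real n ^ j) \<longlonglongrightarrow> 1 / fact j"
proof -
  have "(\<lambda>n. (\<Prod>i<j. (real n - real i) / real n) / fact j) \<longlonglongrightarrow> (\<Prod>i<j. 1) / fact j"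
  proof (intro tendsto_intros)
    fix i show "(\<lambda>n. (real n - real i) / real n) \<longlonglongrightarrow> 1" by real_asymp
  qed simp
  moreover have "real (n choose j) / real n ^ j = (\<Prod>i<j. (real n - real i) / real n) / fact j" for n
    by (simp add: binomial_gbinomial gbinomial_prod_rev prod_dividef atLeast0LessThan)
  ultimately show ?thesis by simp
qed

text \<open>The limit of the moment generating function is that of the semicircle law, which grows like
  \<open>exp (2 s)\<close> up to a power of \<open>s\<close>.\<close>

lemma two_pow_le_fact_quotient: "2 * 4 ^ j * (fact j * fact (Suc j)) \<le> (fact (2 * j + 2) :: real)"
proof (induction j)
  case (Suc j)
  have "2 * 4 ^ Suc j * (fact (Suc j) * fact (Suc (Suc j)))
      = (2 * 4 ^ j * (fact j * fact (Suc j))) * (4 * (real (Suc j) * real (Suc (Suc j))))"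
    by (simp add: algebra_simps)
  also have "\<dots> \<le> fact (2 * j + 2) * (4 * (real (Suc j) * real (Suc (Suc j))))"
    by (intro mult_right_mono Suc.IH) simp
  also have "\<dots> \<le> fact (2 * j + 2) * (real (2 * j + 3) * real (2 * j + 4))"
    by (intro mult_left_mono) (simp_all add: algebra_simps)
  also have "\<dots> = fact (2 * Suc j + 2)"
    by (simp add: numeral_eq_Suc algebra_simps)
  finally show ?case .
qed simp

lemma sums_cosh_shifted:
  assumes "x > (0 :: real)"
  shows "(\<lambda>j. 2 * x ^ (2 * j) / fact (2 * j + 2)) sums (2 * (cosh x - 1) / x\<^sup>2)"
proof -
  let ?f = "\<lambda>n. if even n then x ^ n /\<^sub>R fact n else 0"
  have "?f sums cosh x" by (rule cosh_converges)
  then have "(\<lambda>n. ?f (2 * n)) sums cosh x"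
    by (subst sums_mono_reindex) (auto simp: strict_mono_def elim!: evenE)
  then have "(\<lambda>n. ?f (2 * Suc n)) sums (cosh x - ?f (2 * 0))"
    by (subst sums_Suc_iff) simp
  then have "(\<lambda>n. 2 / x\<^sup>2 * ?f (2 * Suc n)) sums (2 / x\<^sup>2 * (cosh x - 1))"
    by (intro sums_mult) simp
  moreover have "2 / x\<^sup>2 * ?f (2 * Suc n) = 2 * x ^ (2 * n) / fact (2 * n + 2)" for n
    using assms by (simp add: field_simps power2_eq_square)
  ultimately show ?thesis by simp
qed

text \<open>With \<open>x = 2 * s\<close> the terms dominate those of
  \<open>2 * (cosh x - 1) / x\<^sup>2\<close>, which outgrows \<open>exp (x * k)\<close> for
  \<open>k < 1\<close>. The summand 1 is room for the part of the expectation that has to survive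
  the truncation in \<open>edge_content_tail\<close>.\<close>

lemma semicircle_moments_exceed:
  assumes "k < (1 :: real)"
  obtains s J where "s > 0" "(\<Sum>j\<le>J. s ^ (2 * j) / (fact j * fact (Suc j))) > exp (2 * s * k) + 1"
proof -
  have "eventually (\<lambda>x. 2 * (cosh x - 1) / x\<^sup>2 > exp (x * k) + 1) at_top"
  proof -
    have "filterlim (\<lambda>x. exp x / x\<^sup>2 - 2 / x\<^sup>2 - exp (x * k) - 1) at_top at_top"
      using assms by real_asymp
    then have "eventually (\<lambda>x. exp x / x\<^sup>2 - 2 / x\<^sup>2 - exp (x * k) - 1 > 0) at_top"
      by (rule filterlim_at_top_dense[THEN iffD1, rule_format])
    then show ?thesis
    proof eventually_elim
      case (elim x)
      have "(exp x - 2) / x\<^sup>2 \<le> 2 * (cosh x - 1) / x\<^sup>2"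
        by (intro divide_right_mono) (simp_all add: cosh_def)
      then show ?case using elim by (simp add: diff_divide_distrib)
    qed
  qed
  then obtain x where x: "x > 0" "2 * (cosh x - 1) / x\<^sup>2 > exp (x * k) + 1"
    using eventually_conj[OF _ eventually_gt_at_top[of 0]]
    by (metis (mono_tags, lifting) eventually_happens trivial_limit_at_top_linorder)
  have "(\<lambda>J. \<Sum>j\<le>J. 2 * x ^ (2 * j) / fact (2 * j + 2)) \<longlonglongrightarrow> 2 * (cosh x - 1) / x\<^sup>2"
    using sums_cosh_shifted[OF x(1)] by (simp add: sums_def_le)
  from order_tendstoD(1)[OF this x(2)]
  obtain J where J: "(\<Sum>j\<le>J. 2 * x ^ (2 * j) / fact (2 * j + 2)) > exp (x * k) + 1"
    by (auto simp: eventually_sequentially)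
  have "2 * x ^ (2 * j) / fact (2 * j + 2) \<le> (x / 2) ^ (2 * j) / (fact j * fact (Suc j))" for j
  proof -
    have "2 * x ^ (2 * j) / fact (2 * j + 2) \<le> 2 * x ^ (2 * j) / (2 * 4 ^ j * (fact j * fact (Suc j)))"
      using x(1) two_pow_le_fact_quotient[of j] by (intro divide_left_mono) auto
    also have "\<dots> = (x / 2) ^ (2 * j) / (fact j * fact (Suc j))"
      by (simp add: power_divide power_mult)
    finally show ?thesis .
  qed
  then have "(\<Sum>j\<le>J. 2 * x ^ (2 * j) / fact (2 * j + 2)) \<le> (\<Sum>j\<le>J. (x / 2) ^ (2 * j) / (fact j * fact (Suc j)))"
    by (intro sum_mono)
  then show ?thesis using J x(1) by (intro that[of "x / 2" J]) auto
qed

text \<open>A second moment argument with exponential weights. At \<open>t = s / sqrt n\<close> the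
  expectation of \<open>exp (t * content)\<close> exceeds the largest value below the threshold by
  at least 1. By Cauchy-Schwarz the square of this excess is at most \<open>C\<close> times the tail
  probability, where \<open>C\<close> bounds the expectation at \<open>2 * t\<close>; so
  \<open>\<delta> = 1 / C\<close> does not depend on \<open>n\<close>.\<close>

lemma edge_content_tail:
  assumes "0 < e"
  obtains \<delta> where "\<delta> > 0"
    "eventually (\<lambda>n. edge_sum (\<lambda>a. of_bool (of_int (content a) \<ge> (2 - e) * sqrt (real n))) n / fact (Suc n) \<ge> \<delta>) sequentially"
proof -
  obtain s J where s: "s > 0" and J: "(\<Sum>j\<le>J. s ^ (2 * j) / (fact j * fact (Suc j))) > exp (2 * s * (1 - e / 2)) + 1"
    using semicircle_moments_exceed[of "1 - e / 2"] assms by auto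
  define z where "z t = exp t + exp (- t) - 2" for t :: real
  define \<alpha> where "\<alpha> t n = edge_sum (\<lambda>a. exp (t * content a)) n / fact (Suc n)" for t :: real and n
  have z0: "z t \<ge> 0" for t
    using cosh_real_ge_1[of t] by (simp add: z_def cosh_def)
  have \<alpha>: "\<alpha> t n = (\<Sum>j\<le>N. real (n choose j) * z t ^ j / fact (Suc j))" if "n \<le> N" for t n N
    using edge_sum_exp_content[OF that, of t] by (simp add: \<alpha>_def z_def)
  have lim: "(\<lambda>n. real n * z (c / sqrt (real n))) \<longlonglongrightarrow> c\<^sup>2" if "c > 0" for c
  proof -
    have "(\<lambda>n. real n * z (c / sqrt (real n))) \<longlonglongrightarrow> c * c"
      unfolding z_def using that by real_asymp
    then show ?thesis by (simp add: power2_eq_square)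
  qed
  have lower: "eventually (\<lambda>n. \<alpha> (s / sqrt (real n)) n > exp (2 * s * (1 - e / 2)) + 1) sequentially"
  proof -
    have "(\<lambda>n. \<Sum>j\<le>J. (real (n choose j) / real n ^ j) * (real n * z (s / sqrt (real n))) ^ j / fact (Suc j))
       \<longlonglongrightarrow> (\<Sum>j\<le>J. 1 / fact j * (s\<^sup>2) ^ j / fact (Suc j))"
      by (intro tendsto_intros tendsto_binomial_over_power lim s) simp
    then have "(\<lambda>n. \<Sum>j\<le>J. (real (n choose j) / real n ^ j) * (real n * z (s / sqrt (real n))) ^ j / fact (Suc j))
       \<longlonglongrightarrow> (\<Sum>j\<le>J. s ^ (2 * j) / (fact j * fact (Suc j)))"
      by (simp add: power_mult)
    from order_tendstoD(1)[OF this J] eventually_gt_at_top[of 0] show ?thesis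
    proof eventually_elim
      case (elim n)
      let ?z = "z (s / sqrt (real n))"
      have "(\<Sum>j\<le>J. (real (n choose j) / real n ^ j) * (real n * ?z) ^ j / fact (Suc j))
          = (\<Sum>j\<le>J. real (n choose j) * ?z ^ j / fact (Suc j))"
        using elim(2) by (simp add: power_mult_distrib)
      also have "\<dots> \<le> (\<Sum>j\<le>max J n. real (n choose j) * ?z ^ j / fact (Suc j))"
        by (intro sum_mono2) (auto simp: z0)
      also have "\<dots> = \<alpha> (s / sqrt (real n)) n" by (rule \<alpha>[symmetric]) simp
      finally show ?case using elim(1) by linarith
    qed
  qed
  \<comment> \<open>At the doubled parameter the expectation is at most
    \<open>(1 + z) ^ n \<le> exp (n * z)\<close>, and \<open>n * z\<close> tends to
    \<open>(2 * s)\<^sup>2\<close>.\<close>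
  define C where "C = exp ((2 * s)\<^sup>2 + 1)"
  have upper: "eventually (\<lambda>n. \<alpha> (2 * s / sqrt (real n)) n \<le> C) sequentially"
  proof -
    have "(2 * s)\<^sup>2 < (2 * s)\<^sup>2 + 1" by simp
    from order_tendstoD(2)[OF lim this] s
    have "eventually (\<lambda>n. real n * z (2 * s / sqrt (real n)) < (2 * s)\<^sup>2 + 1) sequentially" by simp
    then show ?thesis
    proof eventually_elim
      case (elim n)
      let ?z = "z (2 * s / sqrt (real n))"
      have "\<alpha> (2 * s / sqrt (real n)) n = (\<Sum>j\<le>n. real (n choose j) * ?z ^ j / fact (Suc j))"
        by (rule \<alpha>) simp
      also have "\<dots> \<le> (\<Sum>j\<le>n. real (n choose j) * ?z ^ j / 1)"
        by (intro sum_mono divide_left_mono) (auto simp: z0 fact_ge_1 simp del: fact_Suc)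
      also have "\<dots> = (?z + 1) ^ n" using binomial_ring[of ?z 1 n] by simp
      also have "\<dots> \<le> exp ?z ^ n"
        using z0[of "2 * s / sqrt (real n)"] exp_ge_add_one_self[of ?z] by (intro power_mono) (auto simp: ac_simps)
      also have "\<dots> = exp (real n * ?z)" by (simp add: exp_of_nat_mult)
      also have "\<dots> \<le> C" using elim by (simp add: C_def)
      finally show ?case .
    qed
  qed
  have "C > 0" by (simp add: C_def)
  have "eventually (\<lambda>n. edge_sum (\<lambda>a. of_bool (of_int (content a) \<ge> (2 - e) * sqrt (real n))) n / fact (Suc n) \<ge> 1 / C) sequentially"
    using lower upper eventually_gt_at_top[of 0]
  proof eventually_elim
    case (elim n)
    define t where "t = s / sqrt (real n)"
    define B :: "nat \<times> nat \<Rightarrow> real" where "B a = of_bool (of_int (content a) \<ge> (2 - e) * sqrt (real n))" for a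
    define P where "P = edge_sum B n / fact (Suc n)"
    define X where "X = edge_sum (\<lambda>a. exp (t * content a) * B a) n / fact (Suc n)"
    have "edge_sum (\<lambda>a. exp (t * content a)) n
        \<le> edge_sum (\<lambda>a. exp (2 * s * (1 - e / 2)) * 1 + exp (t * content a) * B a) n"
    proof (rule edge_sum_mono)
      fix a
      show "exp (t * content a) \<le> exp (2 * s * (1 - e / 2)) * 1 + exp (t * content a) * B a"
      proof (cases "of_int (content a) \<ge> (2 - e) * sqrt (real n)")
        case False
        then have "t * content a \<le> t * ((2 - e) * sqrt (real n))"
          using s by (intro mult_left_mono) (auto simp: t_def)
        also have "\<dots> = 2 * s * (1 - e / 2)" using elim(3) by (simp add: t_def algebra_simps)
        finally show ?thesis by (simp add: B_def)
      qed (simp add: B_def)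
    qed
    also have "\<dots> = exp (2 * s * (1 - e / 2)) * fact (Suc n) + edge_sum (\<lambda>a. exp (t * content a) * B a) n"
      by (simp only: edge_sum_add edge_sum_cmult edge_sum_one)
    finally have "\<alpha> t n \<le> (exp (2 * s * (1 - e / 2)) * fact (Suc n) + edge_sum (\<lambda>a. exp (t * content a) * B a) n) / fact (Suc n)"
      unfolding \<alpha>_def by (rule divide_right_mono) simp
    also have "\<dots> = exp (2 * s * (1 - e / 2)) + X"
      by (simp add: X_def add_divide_distrib del: fact_Suc)
    finally have "X \<ge> 1" using elim(1) unfolding t_def by linarith
    then have "1 \<le> X\<^sup>2" by simp
    also have "X\<^sup>2 \<le> (edge_sum (\<lambda>a. (exp (t * content a))\<^sup>2) n * edge_sum (\<lambda>a. (B a)\<^sup>2) n) / (fact (Suc n))\<^sup>2"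
      unfolding X_def power_divide by (intro divide_right_mono edge_sum_Cauchy_Schwarz) simp
    also have "(\<lambda>a. (B a)\<^sup>2) = B" by (auto simp: B_def)
    also have "(\<lambda>a. (exp (t * content a))\<^sup>2) = (\<lambda>a. exp ((2 * s / sqrt (real n)) * content a))"
      by (auto simp: t_def power2_eq_square exp_add[symmetric])
    also have "edge_sum (\<lambda>a. exp ((2 * s / sqrt (real n)) * content a)) n * edge_sum B n / (fact (Suc n))\<^sup>2
        = \<alpha> (2 * s / sqrt (real n)) n * P"
      by (simp add: \<alpha>_def P_def power2_eq_square del: fact_Suc)
    also have "\<dots> \<le> C * P"
      using elim(2) by (intro mult_right_mono) (auto simp: P_def B_def intro!: divide_nonneg_nonneg edge_sum_nonneg)
    finally have "1 / C \<le> P" using \<open>C > 0\<close> by (simp add: pos_divide_le_eq mult.commute)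
    then show ?case unfolding P_def B_def .
  qed
  then show ?thesis using \<open>C > 0\<close> by (intro that[of "1 / C"]) auto
qed

section \<open>The mean length of a fixed column\<close>

lemma sum_edges_diagram:
  fixes g :: "(nat \<times> nat) set \<Rightarrow> real"
  shows "(\<Sum>E\<in>diagrams n. \<Sum>a\<in>addable E. g E * (num_paths E * num_paths (insert a E)))
      = real (Suc n) * (\<Sum>E\<in>diagrams n. (num_paths E)\<^sup>2 * g E)"
proof -
  have "(\<Sum>a\<in>addable E. g E * (num_paths E * num_paths (insert a E))) = real (Suc n) * ((num_paths E)\<^sup>2 * g E)"
    if "E \<in> diagrams n" for E
    using down_op_num_paths[OF that] unfolding down_op_def sum_distrib_left[symmetric]
    by (simp add: power2_eq_square)
  then show ?thesis by (simp add: sum_distrib_left)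
qed

text \<open>A last box of content at least \<open>(2 - e / 2) * sqrt n\<close> either lies in one of
  the columns up to \<open>q\<close>, which has probability O(1 / sqrt n) by
  \<open>col_prob_le\<close>, or makes column \<open>q\<close> at least that long. If the mean were
  below \<open>(2 - e) * sqrt n\<close>, Chebyshev's inequality would make the second event unlikely
  too, against the positive bound of \<open>edge_content_tail\<close>.\<close>

lemma mean_col_lower:
  assumes e: "0 < e"
  shows "eventually (\<lambda>n. mean_col q n \<ge> (2 - e) * sqrt (real n)) sequentially"
proof -
  obtain \<delta> where \<delta>: "\<delta> > 0" and tail:
    "eventually (\<lambda>n. edge_sum (\<lambda>a. of_bool (of_int (content a) \<ge> (2 - e / 2) * sqrt (real n))) n / fact (Suc n) \<ge> \<delta>) sequentially"
    using edge_content_tail[of "e / 2"] e by auto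
  have "(\<lambda>n. real (Suc q) / sqrt (real (Suc n)) + 1 / ((e / 2)\<^sup>2 * sqrt (real n))) \<longlonglongrightarrow> 0"
    using e by real_asymp
  from order_tendstoD(2)[OF this \<delta>] tail eventually_gt_at_top[of 0]
  show ?thesis
  proof eventually_elim
    case (elim n)
    show ?case
    proof (rule ccontr)
      assume "\<not> ?case"
      then have lt: "mean_col q n < (2 - e) * sqrt (real n)" by simp
      define L where "L = (2 - e / 2) * sqrt (real n)"
      have Lm: "L - mean_col q n \<ge> e / 2 * sqrt (real n)" using lt by (simp add: L_def algebra_simps)
      have pos: "e / 2 * sqrt (real n) > 0" using e elim(3) by simp
      \<comment> \<open>Chebyshev's majorant: \<open>v E\<close> is at least 1 as soon as column
        \<open>q\<close> of \<open>E\<close> reaches the length \<open>L\<close>.\<close>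
      define v where "v E = (real (collen E q) - mean_col q n)\<^sup>2 / (e / 2 * sqrt (real n))\<^sup>2" for E
      have "edge_sum (\<lambda>a. of_bool (of_int (content a) \<ge> L)) n
          \<le> (\<Sum>E\<in>diagrams n. \<Sum>a\<in>addable E. ((\<Sum>j\<le>q. of_bool (fst a = j)) + v E) * (num_paths E * num_paths (insert a E)))"
        unfolding edge_sum_def
      proof (intro sum_mono mult_right_mono)
        fix E a assume E: "E \<in> diagrams n" and a: "a \<in> addable E"
        have v0: "v E \<ge> 0" by (simp add: v_def)
        consider "\<not> of_int (content a) \<ge> L" | "fst a \<le> q" | "of_int (content a) \<ge> L" "q < fst a" by linarith
        then show "of_bool (of_int (content a) \<ge> L) \<le> (\<Sum>j\<le>q. of_bool (fst a = j)) + v E"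
        proof cases
          case 1
          then show ?thesis using v0 by (simp add: sum_nonneg)
        next
          case 2
          then have "(\<Sum>j\<le>q. of_bool (fst a = j)) = (1 :: real)" by (simp add: of_bool_def)
          then show ?thesis using v0 by simp
        next
          case 3
          have "(q, snd a) \<in> insert a E"
            using diagramD[OF addable_diagram[OF a], of "fst a" "snd a" q "snd a"] 3 by simp
          then have "(q, snd a) \<in> E" using 3 by (cases a) auto
          then have "snd a < collen E q" using collen_iff in_diagrams[OF E] by blast
          then have "real (collen E q) \<ge> L" using 3(1) by (simp add: content_def)
          then have "real (collen E q) - mean_col q n \<ge> e / 2 * sqrt (real n)" using Lm by simp
          then have "(e / 2 * sqrt (real n))\<^sup>2 \<le> (real (collen E q) - mean_col q n)\<^sup>2"
            using pos by (intro power_mono) auto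
          then have "v E \<ge> 1" 
            unfolding v_def by (subst pos_le_divide_eq) (use pos elim(3) in \<open>auto simp del: power_mult_distrib\<close>)
          then show ?thesis by (simp add: sum_nonneg add_increasing)
        qed
      qed simp
      also have "\<dots> = (\<Sum>j\<le>q. edge_sum (\<lambda>a. of_bool (fst a = j)) n) + real (Suc n) * (\<Sum>E\<in>diagrams n. (num_paths E)\<^sup>2 * v E)"
        unfolding distrib_right sum.distrib sum_edges_diagram edge_sum_sum[symmetric] by (simp add: edge_sum_def)
      finally have "edge_sum (\<lambda>a. of_bool (of_int (content a) \<ge> L)) n / fact (Suc n)
          \<le> ((\<Sum>j\<le>q. edge_sum (\<lambda>a. of_bool (fst a = j)) n) + real (Suc n) * (\<Sum>E\<in>diagrams n. (num_paths E)\<^sup>2 * v E)) / fact (Suc n)"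
        by (rule divide_right_mono) simp
      also have "\<dots> = (\<Sum>j\<le>q. col_prob j n) + (\<Sum>E\<in>diagrams n. (num_paths E)\<^sup>2 * v E) / fact n"
        unfolding add_divide_distrib col_prob_def sum_divide_distrib[symmetric] by simp
      also have "(\<Sum>E\<in>diagrams n. (num_paths E)\<^sup>2 * v E) / fact n
          \<le> sqrt (real n) / (e / 2 * sqrt (real n))\<^sup>2"
      proof -
        obtain n' where n': "n = Suc n'" using elim(3) by (cases n) auto
        have "(\<Sum>E\<in>diagrams n. (num_paths E)\<^sup>2 * v E) / fact n
           = (\<Sum>E\<in>diagrams n. (num_paths E)\<^sup>2 * (real (collen E q) - mean_col q n)\<^sup>2) / fact n / (e / 2 * sqrt (real n))\<^sup>2"
          by (simp add: v_def sum_divide_distrib ac_simps)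
        also have "\<dots> \<le> fact n * sqrt (real n) / fact n / (e / 2 * sqrt (real n))\<^sup>2"
          using variance_collen[where n = n' and q = q] unfolding n' by (intro divide_right_mono) auto
        finally show ?thesis by simp
      qed
      also have "sqrt (real n) / (e / 2 * sqrt (real n))\<^sup>2 = 1 / ((e / 2)\<^sup>2 * sqrt (real n))"
      proof -
        have "x / (e / 2 * x)\<^sup>2 = 1 / ((e / 2)\<^sup>2 * x)" if "x > 0" for x
          using that e by (simp add: power2_eq_square)
        then show ?thesis using elim(3) by simp
      qed
      also have "(\<Sum>j\<le>q. col_prob j n) \<le> (\<Sum>j\<le>q. 1 / sqrt (real (Suc n)))"
        by (intro sum_mono col_prob_le)
      also have "\<dots> = real (Suc q) / sqrt (real (Suc n))" by simp
      finally have "edge_sum (\<lambda>a. of_bool (of_int (content a) \<ge> L)) n / fact (Suc n)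
          \<le> real (Suc q) / sqrt (real (Suc n)) + 1 / ((e / 2)\<^sup>2 * sqrt (real n))" by simp
      then show False using elim(1,2) unfolding L_def by linarith
    qed
  qed
qed

text \<open>The bounds \<open>1 / sqrt (n + 1)\<close> for the increments are summed by comparison
  with the increments of \<open>2 * sqrt n\<close>.\<close>

lemma mean_col_upper: "mean_col q n \<le> 2 * sqrt (real n)"
proof (induction n)
  case (Suc n)
  have "1 / sqrt (real (Suc n)) \<le> 2 * (sqrt (real (Suc n)) - sqrt (real n))"
  proof -
    have "sqrt (real n) * sqrt (real (Suc n)) \<le> (real n + real (Suc n)) / 2"
      using arith_geo_mean_sqrt[of "real n" "real (Suc n)"] by (simp add: real_sqrt_mult)
    then have "1 \<le> 2 * (sqrt (real (Suc n)) * sqrt (real (Suc n)) - sqrt (real n) * sqrt (real (Suc n)))"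
      by simp
    then have "1 \<le> 2 * (sqrt (real (Suc n)) - sqrt (real n)) * sqrt (real (Suc n))"
      by (simp only: algebra_simps)
    then show ?thesis by (subst pos_divide_le_eq) simp_all
  qed
  then show ?case using Suc col_prob_le[of q n] by (simp add: mean_col_Suc)
qed simp

lemma tendsto_mean_col: "(\<lambda>n. mean_col q n / sqrt (real n)) \<longlonglongrightarrow> 2"
proof (rule order_tendstoI)
  fix a :: real assume "a < 2"
  then have "eventually (\<lambda>n. mean_col q n \<ge> (2 - (2 - a) / 2) * sqrt (real n)) sequentially"
    by (intro mean_col_lower) simp
  with eventually_gt_at_top[of 0] show "eventually (\<lambda>n. mean_col q n / sqrt (real n) > a) sequentially"
  proof eventually_elim
    case (elim n)
    then have "2 - (2 - a) / 2 \<le> mean_col q n / sqrt (real n)" by (simp add: pos_le_divide_eq)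
    moreover have "a < 2 - (2 - a) / 2" using \<open>a < 2\<close> by (simp add: field_simps)
    ultimately show ?case by (rule less_le_trans[rotated])
  qed
next
  fix a :: real assume "2 < a"
  show "eventually (\<lambda>n. mean_col q n / sqrt (real n) < a) sequentially"
    using eventually_gt_at_top[of 0]
  proof eventually_elim
    case (elim n)
    then have "mean_col q n / sqrt (real n) \<le> 2"
      using mean_col_upper[of q n] by (simp add: pos_divide_le_eq)
    then show ?case using \<open>2 < a\<close> by simp
  qed
qed

text \<open>A removable box is mapped to the end of the row above it, which is addable and not
  further to the right. This argument needs an initial block of columns and fails for a single one,
  which is why the next lemmas deal with sums over \<open>q \<le> j\<close>.\<close>

lemma card_removable_le_card_addable:
  assumes D: "diagram D"
  shows "card {a \<in> removable D. fst a \<le> j} \<le> card {a \<in> addable D. fst a \<le> j}"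
proof (rule card_inj_on_le)
  let ?f = "\<lambda>a. (rowlen D (Suc (snd a)), Suc (snd a))"
  show "inj_on ?f {a \<in> removable D. fst a \<le> j}"
  proof (rule inj_onI)
    fix a b assume "a \<in> {a \<in> removable D. fst a \<le> j}" "b \<in> {a \<in> removable D. fst a \<le> j}" "?f a = ?f b"
    then show "a = b" by (cases a; cases b) (auto simp: removable_iff[OF D])
  qed
  show "?f ` {a \<in> removable D. fst a \<le> j} \<subseteq> {a \<in> addable D. fst a \<le> j}"
    using removable_iff[OF D] by (fastforce simp: addable_iff[OF D])
qed (use D in simp)

lemma sum_col_prob: "(\<Sum>q\<le>j. col_prob q n) = edge_sum (\<lambda>a. of_bool (fst a \<le> j)) n / fact (Suc n)"
proof -
  have "edge_sum (\<lambda>a. of_bool (fst a \<le> j)) n = edge_sum (\<lambda>a. \<Sum>q\<le>j. of_bool (fst a = q)) n"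
    by (intro arg_cong2[where f = edge_sum] ext refl) (simp add: of_bool_def)
  then show ?thesis unfolding edge_sum_sum col_prob_def sum_divide_distrib[symmetric] by (simp only:)
qed

text \<open>In \<open>edge_sum_Suc\<close>, for the indicator of the first columns, the last sum is
  nonnegative by \<open>card_removable_le_card_addable\<close>. The factors \<open>Suc n\<close> and
  \<open>Suc (Suc n)\<close> are left over from the factorials.\<close>

lemma sum_col_prob_almost_mono:
  "real (Suc n) * (\<Sum>q\<le>j. col_prob q n) \<le> real (Suc (Suc n)) * (\<Sum>q\<le>j. col_prob q (Suc n))"
proof -
  have "0 \<le> (\<Sum>D\<in>diagrams (Suc n). (num_paths D)\<^sup>2 *
      ((\<Sum>a\<in>addable D. of_bool (fst a \<le> j)) - (\<Sum>a\<in>removable D. of_bool (fst a \<le> j))))"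
  proof (intro sum_nonneg mult_nonneg_nonneg)
    fix D assume "D \<in> diagrams (Suc n)"
    then have D: "diagram D" by (rule in_diagrams)
    show "0 \<le> ((\<Sum>a\<in>addable D. of_bool (fst a \<le> j)) - (\<Sum>a\<in>removable D. of_bool (fst a \<le> j)) :: real)"
      using card_removable_le_card_addable[OF D, of j] D
      by (simp add: of_bool_def sum.If_cases Int_def)
  qed simp
  then have "real (Suc n) * edge_sum (\<lambda>a. of_bool (fst a \<le> j)) n \<le> edge_sum (\<lambda>a. of_bool (fst a \<le> j)) (Suc n)"
    by (simp add: edge_sum_Suc)
  then have "real (Suc n) * edge_sum (\<lambda>a. of_bool (fst a \<le> j)) n / fact (Suc n) \<le> edge_sum (\<lambda>a. of_bool (fst a \<le> j)) (Suc n) / fact (Suc n)"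
    by (rule divide_right_mono) simp
  also have "\<dots> = real (Suc (Suc n)) * edge_sum (\<lambda>a. of_bool (fst a \<le> j)) (Suc n) / fact (Suc (Suc n))"
    by (simp add: fact_Suc[of "Suc n"] del: fact_Suc of_nat_Suc)
  finally show ?thesis unfolding sum_col_prob by (simp del: fact_Suc of_nat_Suc)
qed

text \<open>A Tauberian argument: almost monotonicity upgrades the convergence of the means.\<close>

lemma tendsto_sum_col_prob:
  "(\<lambda>n. sqrt (real n) * (\<Sum>q\<le>j. col_prob q n)) \<longlonglongrightarrow> real (Suc j)"
proof (rule order_tendstoI)
  define A where "A n = (\<Sum>q\<le>j. col_prob q n)" for n
  define S where "S n = (\<Sum>q\<le>j. mean_col q n)" for n
  have S_Suc: "S (Suc n) = S n + A n" for n
    by (simp add: S_def A_def mean_col_Suc sum.distrib)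
  have S: "S n = S m + (\<Sum>k=m..<n. A k)" if "m \<le> n" for m n
    using that by (induction n rule: dec_induct) (simp_all add: S_Suc)
  have mono: "real (Suc k) * A k \<le> real (Suc n) * A n" if "k \<le> n" for k n
    using that
  proof (induction n rule: dec_induct)
    case (step n)
    then show ?case using sum_col_prob_almost_mono[of n j] unfolding A_def by linarith
  qed simp
  have A0: "0 \<le> A n" for n by (simp add: A_def sum_nonneg)
  have Slim: "(\<lambda>n. S n / sqrt (real n)) \<longlonglongrightarrow> 2 * real (Suc j)"
  proof -
    have "(\<lambda>n. \<Sum>q\<le>j. mean_col q n / sqrt (real n)) \<longlonglongrightarrow> (\<Sum>q\<le>j. 2)"
      by (intro tendsto_sum tendsto_mean_col)
    then show ?thesis by (simp add: S_def sum_divide_distrib ac_simps)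
  qed
  {
    fix a assume a: "a < real (Suc j)"
    \<comment> \<open>The mean of \<open>A\<close> over the window from \<open>\<theta> * n\<close>
      to \<open>n\<close> bounds \<open>A n\<close> from below: \<open>1 - \<theta>\<close> is the
      relative length of the window and the factor \<open>\<theta>\<close> the loss in almost
      monotonicity. As \<open>\<theta>\<close> tends to 1 the bound becomes sharp.\<close>
    have "((\<lambda>\<theta>. 2 * real (Suc j) * (1 - sqrt \<theta>) * (\<theta> / (1 - \<theta>))) \<longlongrightarrow> real (Suc j)) (at_left 1)"
      by real_asymp
    from order_tendstoD(1)[OF this a] eventually_at_left_real[OF zero_less_one]
    have "eventually (\<lambda>\<theta>. \<theta> \<in> {0<..<1} \<and> a < 2 * real (Suc j) * (1 - sqrt \<theta>) * (\<theta> / (1 - \<theta>))) (at_left (1::real))"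
      by eventually_elim blast
    then obtain \<theta> :: real where \<theta>: "0 < \<theta>" "\<theta> < 1" "a < 2 * real (Suc j) * (1 - sqrt \<theta>) * (\<theta> / (1 - \<theta>))"
      using eventually_happens'[of "at_left (1::real)"] by (metis (no_types, lifting) greaterThanLessThan_iff trivial_limit_at_left_real)
    define m where "m n = nat \<lfloor>\<theta> * real n\<rfloor>" for n
    have m_top: "filterlim m at_top sequentially" unfolding m_def using \<theta> by real_asymp
    have m_ratio: "(\<lambda>n. real (m n) / real n) \<longlonglongrightarrow> \<theta>" unfolding m_def using \<theta> by real_asymp
    have m_ratio': "(\<lambda>n. real (Suc (m n)) / real (Suc n)) \<longlonglongrightarrow> \<theta>" unfolding m_def using \<theta> by real_asymp
    have m_ratio'': "(\<lambda>n. real n / (real n - real (m n))) \<longlonglongrightarrow> inverse (1 - \<theta>)" unfolding m_def using \<theta> by real_asymp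
    have "(\<lambda>n. S (m n) / sqrt (real (m n)) * sqrt (real (m n) / real n)) \<longlonglongrightarrow> 2 * real (Suc j) * sqrt \<theta>"
      by (intro tendsto_mult filterlim_compose[OF Slim m_top] tendsto_real_sqrt m_ratio)
    then have "(\<lambda>n. S (m n) / sqrt (real n)) \<longlonglongrightarrow> 2 * real (Suc j) * sqrt \<theta>"
      by (rule Lim_transform_eventually)
        (use eventually_compose_filterlim[OF eventually_gt_at_top[of 0] m_top] in
          \<open>eventually_elim, simp add: real_sqrt_divide\<close>)
    then have "(\<lambda>n. (S n / sqrt (real n) - S (m n) / sqrt (real n)) * (real (Suc (m n)) / real (Suc n) * (real n / (real n - real (m n)))))
       \<longlonglongrightarrow> (2 * real (Suc j) - 2 * real (Suc j) * sqrt \<theta>) * (\<theta> * inverse (1 - \<theta>))"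
      by (intro tendsto_intros Slim m_ratio' m_ratio'')
    also have "(2 * real (Suc j) - 2 * real (Suc j) * sqrt \<theta>) * (\<theta> * inverse (1 - \<theta>))
       = 2 * real (Suc j) * (1 - sqrt \<theta>) * (\<theta> / (1 - \<theta>))"
      by (simp only: divide_inverse right_diff_distrib mult_1_right)
    finally have "eventually (\<lambda>n. a < (S n / sqrt (real n) - S (m n) / sqrt (real n)) * (real (Suc (m n)) / real (Suc n) * (real n / (real n - real (m n))))) sequentially"
      by (rule order_tendstoD(1)) (rule \<theta>(3))
    with eventually_gt_at_top[of 0]
    show "eventually (\<lambda>n. a < sqrt (real n) * (\<Sum>q\<le>j. col_prob q n)) sequentially"
    proof eventually_elim
      case (elim n)
      have mn: "m n < n"
      proof -
        have "real (m n) \<le> \<theta> * real n" unfolding m_def using \<theta> by simp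
        also have "\<dots> < 1 * real n" using \<theta> elim by (intro mult_strict_right_mono) auto
        finally show ?thesis by simp
      qed
      have "real (Suc (m n)) * (S n - S (m n)) = (\<Sum>k=m n..<n. real (Suc (m n)) * A k)"
        using S[of "m n" n] mn by (simp add: sum_distrib_left del: of_nat_Suc)
      also have "\<dots> \<le> (\<Sum>k=m n..<n. real (Suc n) * A n)"
      proof (rule sum_mono)
        fix k assume k: "k \<in> {m n..<n}"
        then have "real (Suc (m n)) * A k \<le> real (Suc k) * A k" using A0 by (intro mult_right_mono) auto
        then show "real (Suc (m n)) * A k \<le> real (Suc n) * A n" using mono[of k n] k by simp
      qed
      also have "\<dots> = (real n - real (m n)) * (real (Suc n) * A n)" using mn by (simp add: of_nat_diff)
      finally have *: "real (Suc (m n)) * (S n - S (m n)) \<le> (real n - real (m n)) * (real (Suc n) * A n)" .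
      have "(S n / sqrt (real n) - S (m n) / sqrt (real n)) * (real (Suc (m n)) / real (Suc n) * (real n / (real n - real (m n))))
          = sqrt (real n) * (real (Suc (m n)) * (S n - S (m n)) / ((real n - real (m n)) * real (Suc n)))"
      proof -
        have *: "(x / s - y / s) * (M / N * (r / d)) = r / s * (M * (x - y) / (d * N))" for x y s r M N d :: real
          by (simp add: diff_divide_distrib[symmetric] ac_simps)
        show ?thesis unfolding * by (subst real_div_sqrt) simp_all
      qed
      also have "\<dots> \<le> sqrt (real n) * A n"
        using * mn by (intro mult_left_mono) (simp_all add: pos_divide_le_eq ac_simps del: of_nat_Suc)
      finally show ?case using elim(2) unfolding A_def by linarith
    qed
  }
  fix a assume a: "real (Suc j) < a"
  \<comment> \<open>The upper half needs no averaging: it is \<open>col_prob_le\<close> summed over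
    the columns.\<close>
  have "sqrt (real n) * (\<Sum>q\<le>j. col_prob q n) \<le> real (Suc j)" for n
  proof -
    have "sqrt (real n) * (\<Sum>q\<le>j. col_prob q n) \<le> sqrt (real (Suc n)) * (\<Sum>q\<le>j. 1 / sqrt (real (Suc n)))"
      by (intro mult_mono sum_mono col_prob_le) (auto intro: sum_nonneg)
    also have "\<dots> = real (Suc j)" by simp
    finally show ?thesis .
  qed
  then show "eventually (\<lambda>n. sqrt (real n) * (\<Sum>q\<le>j. col_prob q n) < a) sequentially"
    using a by (auto intro!: always_eventually intro: le_less_trans)
qed

lemma tendsto_col_prob: "(\<lambda>n. sqrt (real n) * col_prob q n) \<longlonglongrightarrow> 1"
proof (cases q)
  case 0
  then show ?thesis using tendsto_sum_col_prob[of 0] by simp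
next
  case (Suc j)
  have "(\<lambda>n. sqrt (real n) * (\<Sum>i\<le>Suc j. col_prob i n) - sqrt (real n) * (\<Sum>i\<le>j. col_prob i n))
      \<longlonglongrightarrow> real (Suc (Suc j)) - real (Suc j)"
    by (intro tendsto_diff tendsto_sum_col_prob)
  then show ?thesis using Suc by (simp add: algebra_simps)
qed

section \<open>Marked diagrams\<close>

text \<open>A marked diagram is a diagram with one of its addable boxes, which is recorded by its column.
  When a box is added at the marked place, the mark moves to the next row (\<open>row_next\<close>), as the last
  box of a bumping route does, or to the next column (\<open>col_next\<close>). The operators below
  transport weights of marked diagrams along one growth step, and they commute
  (\<open>mark_op_commute\<close>).\<close>

definition row_next :: "(nat \<times> nat) set \<Rightarrow> nat \<times> nat \<Rightarrow> nat" where
  "row_next D a = rowlen D (Suc (snd a))"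

definition col_next :: "(nat \<times> nat) set \<Rightarrow> nat \<times> nat \<Rightarrow> nat" where
  "col_next D a = Suc (fst a)"

definition move_mark :: "((nat \<times> nat) set \<Rightarrow> nat \<times> nat \<Rightarrow> nat) \<Rightarrow> (nat \<times> nat) set \<Rightarrow> nat \<times> nat \<Rightarrow> nat \<Rightarrow> nat" where
  "move_mark \<nu> D a p = (if p = fst a then \<nu> D a else p)"

definition mark_op :: "((nat \<times> nat) set \<Rightarrow> nat \<times> nat \<Rightarrow> nat) \<Rightarrow> ((nat \<times> nat) set \<Rightarrow> nat \<Rightarrow> real) \<Rightarrow> (nat \<times> nat) set \<Rightarrow> nat \<Rightarrow> real" where
  "mark_op \<nu> g D q = (\<Sum>a\<in>removable D. of_bool (fst a \<noteq> q) * g (D - {a}) q + of_bool (\<nu> D a = q) * g (D - {a}) (fst a))"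

text \<open>Only columns with an addable box can carry a mark. The commutation relies on this: a
  mark in the column of a newly added box then is that box.\<close>

definition mark_supported :: "((nat \<times> nat) set \<Rightarrow> nat \<Rightarrow> real) \<Rightarrow> bool" where
  "mark_supported g \<longleftrightarrow> (\<forall>D q. diagram D \<longrightarrow> g D q \<noteq> 0 \<longrightarrow> q \<in> fst ` addable D)"

lemma mark_op_cong:
  "(\<And>a p. a \<in> removable D \<Longrightarrow> g (D - {a}) p = h (D - {a}) p) \<Longrightarrow> mark_op \<nu> g D q = mark_op \<nu> h D q"
  unfolding mark_op_def by simp

lemma rowlen_insert:
  assumes D: "diagram D" and a: "a \<in> addable D"
  shows "rowlen (insert a D) y = (if y = snd a then Suc (rowlen D y) else rowlen D y)"
proof -
  have e: "{x. (x, y) \<in> insert a D} = (if y = snd a then insert (fst a) {x. (x, y) \<in> D} else {x. (x, y) \<in> D})"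
    by (cases a) auto
  have "{x. (x, y) \<in> D} \<subseteq> fst ` D" by force
  then have "finite {x. (x, y) \<in> D}" using diagram_finite[OF D] finite_surj by blast
  moreover have "fst a \<notin> {x. (x, snd a) \<in> D}" using a by (simp add: addable_def)
  ultimately show ?thesis unfolding rowlen_def e by auto
qed

lemma addable_iff_collen:
  assumes D: "diagram D" and l: "collen D (Suc x) < collen D x"
  shows "(Suc x, collen D (Suc x)) \<in> addable D"
proof -
  define y where "y = collen D (Suc x)"
  have n: "(Suc x, y) \<notin> D" using collen_iff[OF D, of y "Suc x"] by (simp add: y_def)
  have i: "(x, y) \<in> D" using collen_iff[OF D, of y x] l by (simp add: y_def)
  have "rowlen D y = Suc x"
    using rowlen_iff[OF D, of x y] rowlen_iff[OF D, of "Suc x" y] n i by linarith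
  moreover have "Suc x < rowlen D (y - 1)" if "y \<noteq> 0"
  proof -
    have "(Suc x, y - 1) \<in> D" using collen_iff[OF D, of "y - 1" "Suc x"] that by (simp add: y_def)
    then show ?thesis using rowlen_iff[OF D] by blast
  qed
  ultimately show ?thesis unfolding y_def[symmetric]
    by (cases "y = 0") (simp_all add: addable_iff[OF D])
qed

lemma removable_collen:
  assumes D: "diagram D" and a: "(x, y) \<in> removable D"
  shows "collen D (Suc x) \<le> y" "y < collen D x"
proof -
  have i: "(x, y) \<in> D" and d: "diagram (D - {(x, y)})" using a by (auto simp: removable_def)
  have "(Suc x, y) \<notin> D" using diagramD[OF d, of "Suc x" y x y] by auto
  then show "collen D (Suc x) \<le> y" using collen_iff[OF D, of y "Suc x"] by simp
  show "y < collen D x" using i collen_iff[OF D] by blast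
qed

text \<open>A mark that does not move stays addable, because a box added elsewhere neither occupies
  nor blocks its place.\<close>

lemma mark_supported_mark_op:
  assumes g: "mark_supported g"
    and next_addable: "\<And>D a. diagram D \<Longrightarrow> a \<in> removable D \<Longrightarrow> \<nu> D a \<in> fst ` addable D"
  shows "mark_supported (mark_op \<nu> g)"
  unfolding mark_supported_def
proof (intro allI impI)
  fix D q assume D: "diagram D" and n: "mark_op \<nu> g D q \<noteq> 0"
  obtain a where a: "a \<in> removable D"
    and n': "of_bool (fst a \<noteq> q) * g (D - {a}) q + of_bool (\<nu> D a = q) * g (D - {a}) (fst a) \<noteq> 0"
    using n unfolding mark_op_def by (meson sum.not_neutral_contains_not_neutral)
  show "q \<in> fst ` addable D"
  proof (cases "\<nu> D a = q")
    case True
    then show ?thesis using next_addable[OF D a] by simp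
  next
    case False
    then have "fst a \<noteq> q" "g (D - {a}) q \<noteq> 0" using n' by auto
    then obtain b where b: "b \<in> addable (D - {a})" "fst b = q" "b \<noteq> a"
      using g removable_diagram[OF a] unfolding mark_supported_def by force
    then have "b \<in> addable D" using addable_removable_swap[OF D, of b a] a by blast
    then show ?thesis using b by blast
  qed
qed

lemma row_next_addable: assumes D: "diagram D" and a: "a \<in> removable D" shows "row_next D a \<in> fst ` addable D"
proof -
  have "(rowlen D (Suc (snd a)), Suc (snd a)) \<in> addable D"
    using removable_iff[OF D, of "fst a" "snd a"] a by (simp add: addable_iff[OF D])
  then show ?thesis unfolding row_next_def by force
qed

lemma col_next_addable: assumes D: "diagram D" and a: "a \<in> removable D" shows "col_next D a \<in> fst ` addable D"
proof -
  have "(Suc (fst a), collen D (Suc (fst a))) \<in> addable D"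
    using removable_collen[OF D, of "fst a" "snd a"] a by (intro addable_iff_collen[OF D]) simp
  then show ?thesis unfolding col_next_def by force
qed

lemma mark_op_move:
  assumes "\<And>a. a \<in> removable D \<Longrightarrow> fst a \<le> N" "q \<le> N"
  shows "mark_op \<nu> g D q = (\<Sum>a\<in>removable D. \<Sum>p\<le>N. of_bool (move_mark \<nu> D a p = q) * g (D - {a}) p)"
  unfolding mark_op_def
proof (intro sum.cong refl)
  fix a assume a: "a \<in> removable D"
  have "of_bool (move_mark \<nu> D a p = q) * g (D - {a}) p
      = (if p = q then of_bool (fst a \<noteq> q) * g (D - {a}) q else 0) + (if p = fst a then of_bool (\<nu> D a = q) * g (D - {a}) (fst a) else 0)" for p
    by (auto simp: move_mark_def)
  then show "of_bool (fst a \<noteq> q) * g (D - {a}) q + of_bool (\<nu> D a = q) * g (D - {a}) (fst a)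
      = (\<Sum>p\<le>N. of_bool (move_mark \<nu> D a p = q) * g (D - {a}) p)"
    using assms(1)[OF a] assms(2) by (simp add: sum.distrib)
qed

text \<open>After \<open>b\<close> the mark stands at the end of the row above \<open>b\<close>. A
  later box \<open>c\<close> hits it exactly when it lengthens that row, and then the column move
  carries the mark to the new end.\<close>

lemma move_row_col:
  assumes D: "diagram D" and b: "b \<in> addable D" and c: "c \<in> addable (insert b D)"
  shows "move_mark col_next (insert c (insert b D)) c (rowlen (insert b D) (Suc (snd b)))
      = rowlen (insert c (insert b D)) (Suc (snd b))"
proof -
  let ?E = "insert b D"
  have E: "diagram ?E" by (rule addable_diagram[OF b])
  have "(rowlen ?E (Suc (snd b)), Suc (snd b)) \<in> addable ?E"
    using removable_iff[OF E, of "fst b" "snd b"] removable_insert[OF D b] by (simp add: addable_iff[OF E])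
  then have *: "snd c = Suc (snd b)" if "fst c = rowlen ?E (Suc (snd b))"
    using addable_fst_inj[OF E c] that by fastforce
  have **: "fst c = rowlen ?E (Suc (snd b))" if "snd c = Suc (snd b)"
    using c that addable_iff[OF E, of "fst c" "snd c"] unfolding prod.collapse by simp
  show ?thesis
  proof (cases "fst c = rowlen ?E (Suc (snd b))")
    case True
    then show ?thesis using *[OF True] by (simp add: move_mark_def col_next_def rowlen_insert[OF E c])
  next
    case False
    then have "snd c \<noteq> Suc (snd b)" using ** by blast
    then show ?thesis using False by (simp add: move_mark_def rowlen_insert[OF E c])
  qed
qed

text \<open>If \<open>c\<close> lies in the column to the right of \<open>b\<close> and was addable
  before \<open>b\<close>, it lies strictly below \<open>b\<close>. The row above \<open>c\<close>
  then ends with the column of \<open>b\<close>, so the row move leaves the mark in its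
  column.\<close>

lemma move_col_row_addable:
  assumes D: "diagram D" and b: "b \<in> addable D" and c: "c \<in> addable (insert b D)" "c \<in> addable D"
  shows "move_mark row_next (insert c (insert b D)) c (Suc (fst b)) = Suc (fst b)"
proof (cases "fst c = Suc (fst b)")
  case True
  let ?E = "insert b D"
  let ?F = "insert c ?E"
  have E: "diagram ?E" by (rule addable_diagram[OF b])
  have F: "diagram ?F" by (rule addable_diagram[OF c(1)])
  obtain x y where xy: "b = (x, y)" by (cases b)
  obtain y' where y': "c = (Suc x, y')" using True xy by (cases c) auto
  have "y' \<le> y \<or> (x, y) \<in> insert c D"
    using diagramD[OF addable_diagram[OF c(2)], of "Suc x" y' x y] y' by (cases "y \<le> y'") auto
  moreover have "(x, y) \<notin> insert c D" using b xy y' by (simp add: addable_def)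
  moreover have "(x, y') \<in> D" using diagramD[OF addable_diagram[OF c(2)], of "Suc x" y' x y'] y' by auto
  then have "y' \<noteq> y" using b xy by (auto simp: addable_def)
  ultimately have "y' < y" by linarith
  have "(x, Suc y') \<in> ?F" using diagramD[OF F, of x y x "Suc y'"] xy \<open>y' < y\<close> by simp
  moreover have "(Suc x, Suc y') \<notin> ?F"
  proof
    assume "(Suc x, Suc y') \<in> ?F"
    then have "(Suc x, Suc y') \<in> D" using xy y' by auto
    then have "(Suc x, y') \<in> D" by (rule diagramD[OF D]) auto
    then show False using c(2) y' by (simp add: addable_def)
  qed
  ultimately have "rowlen ?F (Suc y') = Suc x"
    using rowlen_iff[OF F, of x "Suc y'"] rowlen_iff[OF F, of "Suc x" "Suc y'"] by linarith
  then show ?thesis using xy y' by (simp add: move_mark_def row_next_def)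
qed (simp add: move_mark_def)

lemma addable_insert_cases:
  assumes D: "diagram D" and b: "b \<in> addable D" and c: "c \<in> addable (insert b D)" "c \<notin> addable D"
  shows "c = (Suc (fst b), snd b) \<or> c = (fst b, Suc (snd b))"
proof -
  have E: "diagram (insert b D)" by (rule addable_diagram[OF b])
  have r: "fst c = rowlen (insert b D) (snd c)"
    and r': "snd c = 0 \<or> rowlen (insert b D) (snd c) < rowlen (insert b D) (snd c - 1)"
    using c(1) addable_iff[OF E, of "fst c" "snd c"] by auto
  have br: "fst b = rowlen D (snd b)" using b addable_iff[OF D, of "fst b" "snd b"] by simp
  show ?thesis
  proof (cases "snd c = snd b")
    case True
    then show ?thesis using r br rowlen_insert[OF D b] by (simp add: prod_eq_iff)
  next
    case False
    then have rc: "fst c = rowlen D (snd c)" using r rowlen_insert[OF D b] by simp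
    then have n: "snd c \<noteq> 0" "\<not> rowlen D (snd c) < rowlen D (snd c - 1)"
      using c(2) addable_iff[OF D, of "fst c" "snd c"] unfolding prod.collapse by auto
    then have "rowlen D (snd c - 1) \<noteq> rowlen (insert b D) (snd c - 1)"
      using r' rc r by auto
    then have s: "snd c - 1 = snd b" using rowlen_insert[OF D b] by (auto split: if_splits)
    then have "rowlen D (snd c) = fst b"
      using n r' rowlen_insert[OF D b] br rowlen_antimono[OF D, of "snd b"] False by (auto split: if_splits)
    then show ?thesis using rc s n by (simp add: prod_eq_iff)
  qed
qed

text \<open>Here \<open>c\<close> is the right or the upper neighbour of \<open>b\<close>. On the
  right it takes the place of the mark and sends it to the end of the row above \<open>b\<close>;
  above, it leaves the mark in its column, where that row now ends.\<close>

lemma move_col_row_not_addable: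
  assumes D: "diagram D" and b: "b \<in> addable D" and c: "c \<in> addable (insert b D)" "c \<notin> addable D"
  shows "move_mark row_next (insert c (insert b D)) c (Suc (fst b)) = rowlen (insert c (insert b D)) (Suc (snd b))"
proof -
  have E: "diagram (insert b D)" by (rule addable_diagram[OF b])
  have "fst c = rowlen (insert b D) (snd c)"
    using c(1) addable_iff[OF E, of "fst c" "snd c"] by auto
  then show ?thesis
    using addable_insert_cases[OF assms] rowlen_insert[OF E c(1)]
    by (auto simp: move_mark_def row_next_def)
qed

text \<open>Both sides are expanded over the boxes \<open>b\<close>, \<open>c\<close>, added in this
  order, and the column \<open>p\<close> of the initial mark. Marks away from both boxes do not
  move. A mark at \<open>c\<close> requires that \<open>c\<close> was addable before
  \<open>b\<close> (the set \<open>S'\<close>); then the two boxes may be added in either order, and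
  its contribution is booked as that of a mark at \<open>b\<close> in the other order. After this
  the targets of marks at \<open>b\<close> agree pair by pair, though possibly with exchanged
  roles.\<close>

lemma mark_op_commute:
  assumes g: "mark_supported g" and F: "diagram F"
  shows "mark_op row_next (mark_op col_next g) F q = mark_op col_next (mark_op row_next g) F q"
proof -
  \<comment> \<open>Large enough for every column that a mark can reach, so that sums over columns
    are finite; \<open>bd\<close> states this for one move.\<close>
  define N where "N = q + card F + 2"
  define S where "S = Sigma (removable F) (\<lambda>c. removable (F - {c}))"
  define S' where "S' = {(c, b) \<in> S. c \<in> addable (F - {c} - {b})}"
  define h where "h c b p = g (F - {c} - {b}) p" for c b p
  define bd where "bd \<mu> \<longleftrightarrow> (\<forall>D a p. diagram D \<longrightarrow> a \<in> removable D \<longrightarrow> p \<in> fst ` addable (D - {a})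
    \<longrightarrow> card D \<le> card F \<longrightarrow> move_mark \<mu> D a p \<le> N)" for \<mu>
  have finS: "finite S" unfolding S_def using F by (intro finite_SigmaI finite_removable) (auto dest: removable_diagram)
  have S: "diagram (F - {c})" "diagram (F - {c} - {b})" "b \<in> addable (F - {c} - {b})" "c \<in> addable (F - {c})"
    "insert b (F - {c} - {b}) = F - {c}" "insert c (F - {c}) = F" "b \<noteq> c" "fst b \<le> N" "fst c \<le> N"
    if "(c, b) \<in> S" for c b
  proof -
    have c: "c \<in> removable F" and b: "b \<in> removable (F - {c})" using that by (auto simp: S_def)
    show d: "diagram (F - {c})" by (rule removable_diagram[OF c])
    show "diagram (F - {c} - {b})" by (rule removable_diagram[OF b])
    show "b \<in> addable (F - {c} - {b})" by (rule addable_remove[OF d b])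
    show "c \<in> addable (F - {c})" by (rule addable_remove[OF F c])
    show "insert b (F - {c} - {b}) = F - {c}" "insert c (F - {c}) = F" "b \<noteq> c"
      using b c by (auto simp: removable_def)
    show "fst b \<le> N" "fst c \<le> N"
      using diagram_subset_square[OF F] b c by (auto simp: removable_def N_def)
  qed
  have expand: "mark_op \<nu> (mark_op \<mu> g) F q
      = (\<Sum>(c, b)\<in>S. \<Sum>p\<le>N. of_bool (move_mark \<nu> F c (move_mark \<mu> (F - {c}) b p) = q) * h c b p)"
    if \<mu>: "bd \<mu>" for \<nu> \<mu>
  proof -
    have le: "fst a \<le> N" if "diagram D" "card D \<le> card F" "a \<in> D" for a D
      using diagram_subset_square[OF that(1)] that by (auto simp: N_def)
    have "mark_op \<nu> (mark_op \<mu> g) F q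
      = (\<Sum>c\<in>removable F. \<Sum>r\<le>N. of_bool (move_mark \<nu> F c r = q) * mark_op \<mu> g (F - {c}) r)"
      by (rule mark_op_move) (use le[OF F] in \<open>auto simp: removable_def N_def\<close>)
    also have "\<dots> = (\<Sum>c\<in>removable F. \<Sum>b\<in>removable (F - {c}). \<Sum>p\<le>N. of_bool (move_mark \<nu> F c (move_mark \<mu> (F - {c}) b p) = q) * h c b p)"
    proof (rule sum.cong[OF refl])
      fix c assume c: "c \<in> removable F"
      have Fc: "diagram (F - {c})" by (rule removable_diagram[OF c])
      have cF: "card (F - {c}) \<le> card F" using diagram_finite[OF F] by (intro card_mono) auto
      have "(\<Sum>r\<le>N. of_bool (move_mark \<nu> F c r = q) * mark_op \<mu> g (F - {c}) r)
        = (\<Sum>r\<le>N. \<Sum>b\<in>removable (F - {c}). \<Sum>p\<le>N. of_bool (move_mark \<nu> F c r = q) * (of_bool (move_mark \<mu> (F - {c}) b p = r) * h c b p))"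
        unfolding sum_distrib_left[symmetric] h_def
        by (intro sum.cong refl arg_cong2[where f = "(*)"] mark_op_move) (use le[OF Fc cF] in \<open>auto simp: removable_def\<close>)
      also have "\<dots> = (\<Sum>b\<in>removable (F - {c}). \<Sum>p\<le>N. \<Sum>r\<le>N. of_bool (move_mark \<nu> F c r = q) * (of_bool (move_mark \<mu> (F - {c}) b p = r) * h c b p))"
        by (subst sum.swap, intro sum.cong refl sum.swap)
      also have "\<dots> = (\<Sum>b\<in>removable (F - {c}). \<Sum>p\<le>N. of_bool (move_mark \<nu> F c (move_mark \<mu> (F - {c}) b p) = q) * h c b p)"
      proof (intro sum.cong refl)
        fix b p assume b: "b \<in> removable (F - {c})"
        show "(\<Sum>r\<le>N. of_bool (move_mark \<nu> F c r = q) * (of_bool (move_mark \<mu> (F - {c}) b p = r) * h c b p))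
          = of_bool (move_mark \<nu> F c (move_mark \<mu> (F - {c}) b p) = q) * h c b p"
        proof (cases "h c b p = 0")
          case False
          then have "p \<in> fst ` addable (F - {c} - {b})"
            using g removable_diagram[OF b] unfolding h_def mark_supported_def by blast
          then have "move_mark \<mu> (F - {c}) b p \<le> N" using \<mu> Fc b cF unfolding bd_def by blast
          moreover have "of_bool (move_mark \<nu> F c r = q) * (of_bool (move_mark \<mu> (F - {c}) b p = r) * h c b p)
            = (if r = move_mark \<mu> (F - {c}) b p then of_bool (move_mark \<nu> F c (move_mark \<mu> (F - {c}) b p) = q) * h c b p else 0)" for r
            by auto
          ultimately show ?thesis by simp
        qed simp
      qed
      finally show "(\<Sum>r\<le>N. of_bool (move_mark \<nu> F c r = q) * mark_op \<mu> g (F - {c}) r)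
        = (\<Sum>b\<in>removable (F - {c}). \<Sum>p\<le>N. of_bool (move_mark \<nu> F c (move_mark \<mu> (F - {c}) b p) = q) * h c b p)" .
    qed
    also have "\<dots> = (\<Sum>(c, b)\<in>S. \<Sum>p\<le>N. of_bool (move_mark \<nu> F c (move_mark \<mu> (F - {c}) b p) = q) * h c b p)"
      unfolding S_def by (rule sum.Sigma) (use F in \<open>auto dest: removable_diagram\<close>)
    finally show ?thesis .
  qed
  text \<open>Only marks in the columns of the two added boxes \<open>b\<close>, \<open>c\<close> move, and a mark in the column of
    \<open>c\<close> is the box \<open>c\<close> itself, which then was addable before \<open>b\<close>.\<close>
  have split: "(\<Sum>p\<le>N. of_bool (move_mark \<nu> F c (move_mark \<mu> (F - {c}) b p) = q) * h c b p)
      = (\<Sum>p\<in>{..N} - {fst b, fst c}. of_bool (p = q) * h c b p)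
        + of_bool (move_mark \<nu> F c (\<mu> (F - {c}) b) = q) * h c b (fst b)
        + of_bool ((c, b) \<in> S') * (of_bool (\<nu> F c = q) * h c b (fst c))" if cb: "(c, b) \<in> S" for c b \<nu> \<mu>
  proof -
    note s = S[OF cb]
    let ?f = "\<lambda>p. of_bool (move_mark \<nu> F c (move_mark \<mu> (F - {c}) b p) = q) * h c b p"
    have "(\<Sum>p\<le>N. ?f p) = ?f (fst b) + (\<Sum>p\<in>{..N} - {fst b}. ?f p)"
      using s by (intro sum.remove) auto
    also have "(\<Sum>p\<in>{..N} - {fst b}. ?f p) = (\<Sum>p\<in>{..N} - {fst b, fst c}. of_bool (p = q) * h c b p)
        + of_bool ((c, b) \<in> S') * (of_bool (\<nu> F c = q) * h c b (fst c))"
    proof (cases "fst c = fst b")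
      case True
      then have "c \<notin> addable (F - {c} - {b})" using addable_fst_inj[OF s(2)] s(3,7) by metis
      then have "(c, b) \<notin> S'" by (simp add: S'_def)
      then show ?thesis using True by (auto simp: move_mark_def intro!: sum.cong)
    next
      case False
      have "(\<Sum>p\<in>{..N} - {fst b}. ?f p) = ?f (fst c) + (\<Sum>p\<in>{..N} - {fst b} - {fst c}. ?f p)"
        using s False by (intro sum.remove) auto
      also have "(\<Sum>p\<in>{..N} - {fst b} - {fst c}. ?f p) = (\<Sum>p\<in>{..N} - {fst b, fst c}. of_bool (p = q) * h c b p)"
        by (intro sum.cong) (auto simp: move_mark_def)
      also have "?f (fst c) = of_bool ((c, b) \<in> S') * (of_bool (\<nu> F c = q) * h c b (fst c))"
      proof (cases "h c b (fst c) = 0")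
        case False': False
        then obtain c' where c': "c' \<in> addable (F - {c} - {b})" "fst c' = fst c"
          using g s(2) unfolding h_def mark_supported_def by force
        then have "c' \<noteq> b" using False by auto
        have "c' \<in> addable (F - {c})"
          using addable_removable_swap[OF s(1), of c' b] c' \<open>c' \<noteq> b\<close> cb by (auto simp: S_def)
        then have "c' = c" using addable_fst_inj[OF s(1) _ s(4)] c' by blast
        then have "(c, b) \<in> S'" using c' cb by (simp add: S'_def)
        then show ?thesis using False by (simp add: move_mark_def)
      qed simp
      finally show ?thesis by simp
    qed
    finally show ?thesis by (simp add: move_mark_def)
  qed
  have swap: "(\<Sum>(c, b)\<in>S. of_bool ((c, b) \<in> S') * (of_bool (\<nu> F c = q) * h c b (fst c)))
      = (\<Sum>(c, b)\<in>S. of_bool ((c, b) \<in> S') * (of_bool (\<nu> F b = q) * h c b (fst b)))" for \<nu>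
  proof -
    have S's: "(b, c) \<in> S'" if "(c, b) \<in> S'" for b c
    proof -
      have cb: "(c, b) \<in> S" "c \<in> addable (F - {c} - {b})" using that by (auto simp: S'_def)
      note s = S[OF cb(1)]
      have "c \<in> addable (F - {c} - {b}) \<and> b \<in> addable (F - {c} - {b})" using cb s by blast
      then have *: "b \<in> removable F" "c \<in> removable (F - {b})"
      proof -
        have e: "F - {b} = insert c (F - {c} - {b})" "F - {b} - {c} = F - {c} - {b}" using s by auto
        show "b \<in> removable F" unfolding removable_def
          using s e(1) addable_diagram[OF cb(2)] by auto
        show "c \<in> removable (F - {b})" unfolding removable_def e(2) using s(2) e(1) by auto
      qed
      have "b \<in> addable (F - {b} - {c})" using s(3) by (simp add: Diff_insert[symmetric] insert_commute)
      then show ?thesis using * by (simp add: S'_def S_def)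
    qed
    have subs: "S' \<subseteq> S" by (auto simp: S'_def)
    have r: "(\<Sum>(c, b)\<in>S. of_bool ((c, b) \<in> S') * f c b) = (\<Sum>(c, b)\<in>S'. f c b)" for f :: "nat \<times> nat \<Rightarrow> nat \<times> nat \<Rightarrow> real"
      by (rule sum.mono_neutral_cong_right[OF finS subs]) auto
    have "(\<Sum>(c, b)\<in>S'. of_bool (\<nu> F c = q) * h c b (fst c)) = (\<Sum>(c, b)\<in>S'. of_bool (\<nu> F b = q) * h c b (fst b))"
      by (rule sum.reindex_bij_witness[where i = prod.swap and j = prod.swap])
        (auto simp: S's h_def Diff_insert[symmetric] insert_commute)
    then show ?thesis unfolding r .
  qed
  have total: "mark_op \<nu> (mark_op \<mu> g) F q
      = (\<Sum>(c, b)\<in>S. (\<Sum>p\<in>{..N} - {fst b, fst c}. of_bool (p = q) * h c b p))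
        + (\<Sum>(c, b)\<in>S. (of_bool (move_mark \<nu> F c (\<mu> (F - {c}) b) = q) + of_bool ((c, b) \<in> S') * of_bool (\<nu> F b = q)) * h c b (fst b))"
    if \<mu>: "bd \<mu>" for \<nu> \<mu>
  proof -
    have "mark_op \<nu> (mark_op \<mu> g) F q = (\<Sum>(c, b)\<in>S. ((\<Sum>p\<in>{..N} - {fst b, fst c}. of_bool (p = q) * h c b p)
        + of_bool (move_mark \<nu> F c (\<mu> (F - {c}) b) = q) * h c b (fst b))
        + of_bool ((c, b) \<in> S') * (of_bool (\<nu> F c = q) * h c b (fst c)))"
      unfolding expand[OF \<mu>] using split by (intro sum.cong refl) auto
    also have "\<dots> = (\<Sum>(c, b)\<in>S. (\<Sum>p\<in>{..N} - {fst b, fst c}. of_bool (p = q) * h c b p))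
        + (\<Sum>(c, b)\<in>S. of_bool (move_mark \<nu> F c (\<mu> (F - {c}) b) = q) * h c b (fst b))
        + (\<Sum>(c, b)\<in>S. of_bool ((c, b) \<in> S') * (of_bool (\<nu> F b = q) * h c b (fst b)))"
      unfolding swap[of \<nu>, symmetric] by (simp add: sum.distrib case_prod_unfold)
    finally show ?thesis by (simp add: sum.distrib case_prod_unfold algebra_simps)
  qed
  have "move_mark row_next D a p \<le> N" "move_mark col_next D a p \<le> N"
    if "diagram D" "a \<in> removable D" "p \<in> fst ` addable (D - {a})" "card D \<le> card F" for D a p
  proof -
    have "fst a \<le> card F" using diagram_subset_square[OF that(1)] that by (auto simp: removable_def)
    moreover have "p \<le> card F"
    proof -
      have "card (D - {a}) \<le> card D" using diagram_finite[OF that(1)] by (intro card_mono) auto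
      then show ?thesis using addable_subset[OF removable_diagram[OF that(2)]] that(3,4) by force
    qed
    moreover have "row_next D a \<le> fst a"
      using removable_iff[OF that(1), of "fst a" "snd a"] that(2) by (simp add: row_next_def)
    ultimately show "move_mark row_next D a p \<le> N" "move_mark col_next D a p \<le> N"
      by (auto simp: move_mark_def col_next_def N_def)
  qed
  then have bounds: "bd row_next" "bd col_next" unfolding bd_def by blast+
  \<comment> \<open>On \<open>S'\<close> both sides sum over the two targets
    \<open>col_next F b\<close> and \<open>row_next F b\<close>; off \<open>S'\<close> both sides
    have the single target \<open>row_next F b\<close>.\<close>
  have "(of_bool (move_mark row_next F c (col_next (F - {c}) b) = q) + of_bool ((c, b) \<in> S') * of_bool (row_next F b = q)) * h c b (fst b)
      = (of_bool (move_mark col_next F c (row_next (F - {c}) b) = q) + of_bool ((c, b) \<in> S') * of_bool (col_next F b = q)) * h c b (fst b)"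
    if "(c, b) \<in> S" for c b
  proof -
    note s = S[OF that]
    let ?D = "F - {c} - {b}"
    have c: "c \<in> addable (insert b ?D)" using s by simp
    have F': "insert c (insert b ?D) = F" using s by simp
    have 1: "move_mark col_next F c (row_next (F - {c}) b) = row_next F b"
      using move_row_col[OF s(2,3) c] unfolding s(5) s(6) by (simp add: row_next_def)
    show ?thesis
    proof (cases "(c, b) \<in> S'")
      case True
      then have "c \<in> addable ?D" by (simp add: S'_def)
      from move_col_row_addable[OF s(2,3) c this] show ?thesis
        unfolding F' 1 using True by (simp add: col_next_def)
    next
      case False
      then have "c \<notin> addable ?D" using that by (simp add: S'_def)
      from move_col_row_not_addable[OF s(2,3) c this] show ?thesis
        unfolding F' 1 using False by (simp add: col_next_def row_next_def)
    qed
  qed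
  then have "(\<Sum>(c, b)\<in>S. (of_bool (move_mark row_next F c (col_next (F - {c}) b) = q) + of_bool ((c, b) \<in> S') * of_bool (row_next F b = q)) * h c b (fst b))
    = (\<Sum>(c, b)\<in>S. (of_bool (move_mark col_next F c (row_next (F - {c}) b) = q) + of_bool ((c, b) \<in> S') * of_bool (col_next F b = q)) * h c b (fst b))"
    by (intro sum.cong refl) auto
  then show ?thesis using total[OF bounds(2)] total[OF bounds(1)] by simp
qed

subsection \<open>Iterating the operators\<close>

text \<open>The empty diagram with the mark at its only addable box.\<close>

definition unmarked :: "(nat \<times> nat) set \<Rightarrow> nat \<Rightarrow> real" where
  "unmarked D q = of_bool (D = {} \<and> q = 0)"

text \<open>\<open>marked_weight m n D q\<close> is the number of growth paths to \<open>D\<close>, of size \<open>n\<close>, for which a mark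
  that starts at the end of row \<open>0\<close> at time \<open>m\<close> ends up in column \<open>q\<close>.\<close>

definition marked_weight :: "nat \<Rightarrow> nat \<Rightarrow> (nat \<times> nat) set \<Rightarrow> nat \<Rightarrow> real" where
  "marked_weight m n = (mark_op row_next ^^ (n - m)) ((mark_op col_next ^^ m) unmarked)"

lemma mark_supported_unmarked: "mark_supported unmarked"
  unfolding mark_supported_def unmarked_def by (auto simp: addable_empty)

lemma mark_supported_row: "mark_supported g \<Longrightarrow> mark_supported (mark_op row_next g)"
  by (rule mark_supported_mark_op) (auto intro: row_next_addable)

lemma mark_supported_col: "mark_supported g \<Longrightarrow> mark_supported (mark_op col_next g)"
  by (rule mark_supported_mark_op) (auto intro: col_next_addable)

lemma mark_op_cong_diagram:
  assumes "\<And>D q. diagram D \<Longrightarrow> g D q = h D q" "diagram D"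
  shows "mark_op \<nu> g D q = mark_op \<nu> h D q"
  using assms by (intro mark_op_cong) (auto dest: removable_diagram)

lemma funpow_mark_op_cong_diagram:
  assumes "\<And>D q. diagram D \<Longrightarrow> g D q = h D q" "diagram D"
  shows "(mark_op \<nu> ^^ k) g D q = (mark_op \<nu> ^^ k) h D q"
  using assms(2)
proof (induction k arbitrary: D q)
  case (Suc k)
  then show ?case by (auto intro: mark_op_cong_diagram)
qed (simp add: assms)

lemma mark_op_row_funpow_col:
  assumes "mark_supported g" "diagram D"
  shows "mark_op row_next ((mark_op col_next ^^ m) g) D q = (mark_op col_next ^^ m) (mark_op row_next g) D q"
  using assms(2)
proof (induction m arbitrary: D q)
  case (Suc m)
  have "mark_supported ((mark_op col_next ^^ m) g)"
    by (induction m) (auto intro: assms mark_supported_col)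
  then have "mark_op row_next (mark_op col_next ((mark_op col_next ^^ m) g)) D q
      = mark_op col_next (mark_op row_next ((mark_op col_next ^^ m) g)) D q"
    using Suc.prems by (rule mark_op_commute)
  also have "\<dots> = mark_op col_next ((mark_op col_next ^^ m) (mark_op row_next g)) D q"
    by (rule mark_op_cong_diagram) (use Suc in auto)
  finally show ?case by simp
qed simp

lemma funpow_row_col_commute:
  assumes "mark_supported g" "diagram D"
  shows "(mark_op row_next ^^ k) ((mark_op col_next ^^ m) g) D q = (mark_op col_next ^^ m) ((mark_op row_next ^^ k) g) D q"
  using assms
proof (induction k arbitrary: g D q)
  case (Suc k)
  have "(mark_op row_next ^^ Suc k) ((mark_op col_next ^^ m) g) D q
      = (mark_op row_next ^^ k) (mark_op row_next ((mark_op col_next ^^ m) g)) D q"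
    by (simp add: funpow_swap1)
  also have "\<dots> = (mark_op row_next ^^ k) ((mark_op col_next ^^ m) (mark_op row_next g)) D q"
    by (rule funpow_mark_op_cong_diagram) (use Suc mark_op_row_funpow_col in auto)
  also have "\<dots> = (mark_op col_next ^^ m) ((mark_op row_next ^^ k) (mark_op row_next g)) D q"
    by (rule Suc.IH) (use Suc.prems mark_supported_row in auto)
  finally show ?case by (simp add: funpow_swap1)
qed simp

text \<open>A mark that starts at the origin and moves to the next column stays at the end of row 0.
  So the first \<open>m\<close> steps, before the route of \<open>m + 1 / 2\<close> can start to
  climb, are also expressed by one of the two operators.\<close>

lemma funpow_col_unmarked:
  assumes "D \<in> diagrams m"
  shows "(mark_op col_next ^^ m) unmarked D q = num_paths D * of_bool (q = rowlen D 0)"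
  using assms
proof (induction m arbitrary: D q)
  case 0
  then show ?case by (auto simp: unmarked_def rowlen_def)
next
  case (Suc m)
  have D: "diagram D" using Suc.prems by (rule in_diagrams)
  have "(mark_op col_next ^^ Suc m) unmarked D q = mark_op col_next ((mark_op col_next ^^ m) unmarked) D q" by simp
  also have "\<dots> = (\<Sum>a\<in>removable D. num_paths (D - {a}) * of_bool (q = rowlen D 0))"
  proof (subst mark_op_def, intro sum.cong refl)
    fix a assume a: "a \<in> removable D"
    note IH = Suc.IH[OF remove_in_diagrams[OF Suc.prems a]]
    have r: "rowlen D y = (if y = snd a then Suc (rowlen (D - {a}) y) else rowlen (D - {a}) y)" for y
      using rowlen_insert[OF removable_diagram[OF a] addable_remove[OF D a]] insert_minus_removable(1)[OF a] by metis
    have "rowlen D (snd a) = Suc (fst a)" using removable_iff[OF D, of "fst a" "snd a"] a by simp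
    moreover have "rowlen D (snd a) \<le> rowlen D 0"
      by (rule lift_Suc_antimono_le[of "rowlen D"]) (use rowlen_antimono[OF D] in auto)
    ultimately have "fst a < rowlen D 0" "snd a = 0 \<Longrightarrow> fst a = rowlen (D - {a}) 0" using r[of 0] by auto
    then show "of_bool (fst a \<noteq> q) * (mark_op col_next ^^ m) unmarked (D - {a}) q
        + of_bool (col_next D a = q) * (mark_op col_next ^^ m) unmarked (D - {a}) (fst a)
        = num_paths (D - {a}) * of_bool (q = rowlen D 0)"
      unfolding IH using r[of 0] by (cases "snd a = 0") (auto simp: col_next_def)
  qed
  also have "\<dots> = num_paths D * of_bool (q = rowlen D 0)"
    using num_paths_rec_diagrams[OF Suc.prems] by (simp add: up_op_def sum_distrib_right[symmetric])
  finally show ?case .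
qed

text \<open>A mark that starts at the origin and moves to the next row stays on top of column 0,
  whatever the diagram, so the weight is a product. This is the independence from which the Poisson
  law is built up.\<close>

lemma funpow_row_unmarked:
  assumes "D \<in> diagrams k"
  shows "(mark_op row_next ^^ k) unmarked D q = num_paths D * of_bool (q = 0)"
  using assms
proof (induction k arbitrary: D q)
  case 0
  then show ?case by (auto simp: unmarked_def)
next
  case (Suc k)
  have D: "diagram D" using Suc.prems by (rule in_diagrams)
  have "(mark_op row_next ^^ Suc k) unmarked D q = mark_op row_next ((mark_op row_next ^^ k) unmarked) D q" by simp
  also have "\<dots> = (\<Sum>a\<in>removable D. num_paths (D - {a}) * of_bool (q = 0))"
  proof (subst mark_op_def, intro sum.cong refl)
    fix a assume a: "a \<in> removable D"
    note IH = Suc.IH[OF remove_in_diagrams[OF Suc.prems a]]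
    have "row_next D a \<le> fst a" using removable_iff[OF D, of "fst a" "snd a"] a by (simp add: row_next_def)
    then show "of_bool (fst a \<noteq> q) * (mark_op row_next ^^ k) unmarked (D - {a}) q
        + of_bool (row_next D a = q) * (mark_op row_next ^^ k) unmarked (D - {a}) (fst a)
        = num_paths (D - {a}) * of_bool (q = 0)"
      unfolding IH by (cases "fst a = 0") auto
  qed
  also have "\<dots> = num_paths D * of_bool (q = 0)"
    using num_paths_rec_diagrams[OF Suc.prems] by (simp add: up_op_def sum_distrib_right[symmetric])
  finally show ?case .
qed

lemma mark_op_linear:
  "mark_op \<nu> (\<lambda>D q. \<alpha> * g D q + \<beta> * h D q) = (\<lambda>D q. \<alpha> * mark_op \<nu> g D q + \<beta> * mark_op \<nu> h D q)"
  unfolding mark_op_def sum_distrib_left sum.distrib[symmetric]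
  by (intro ext sum.cong refl) (simp add: algebra_simps)

lemma funpow_mark_op_linear:
  "(mark_op \<nu> ^^ k) (\<lambda>D q. \<alpha> * g D q + \<beta> * h D q)
     = (\<lambda>D q. \<alpha> * (mark_op \<nu> ^^ k) g D q + \<beta> * (mark_op \<nu> ^^ k) h D q)"
  by (induction k) (simp_all add: mark_op_linear)

lemma funpow_mark_op_diff:
  "(mark_op \<nu> ^^ k) (\<lambda>D q. g D q - h D q) = (\<lambda>D q. (mark_op \<nu> ^^ k) g D q - (mark_op \<nu> ^^ k) h D q)"
  using funpow_mark_op_linear[where \<alpha> = 1 and \<beta> = "- 1" and g = g and h = h] by simp

subsection \<open>A weighted norm\<close>

text \<open>An L1 norm of signed measures: a single growth path to \<open>D\<close> has Plancherel
  probability \<open>num_paths D / fact n\<close>, so a weight that counts marked paths becomes the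
  joint law of diagram and mark, restricted to columns up to \<open>N\<close>.\<close>

definition mnorm :: "nat \<Rightarrow> nat \<Rightarrow> ((nat \<times> nat) set \<Rightarrow> nat \<Rightarrow> real) \<Rightarrow> real" where
  "mnorm N n g = (\<Sum>D\<in>diagrams n. num_paths D * (\<Sum>q\<le>N. \<bar>g D q\<bar>)) / fact n"

lemma mnorm_nonneg [simp]: "0 \<le> mnorm N n g"
  unfolding mnorm_def by (intro divide_nonneg_nonneg sum_nonneg mult_nonneg_nonneg) auto

lemma mnorm_cong:
  "(\<And>D q. D \<in> diagrams n \<Longrightarrow> q \<le> N \<Longrightarrow> \<bar>g D q\<bar> = \<bar>h D q\<bar>) \<Longrightarrow> mnorm N n g = mnorm N n h"
  unfolding mnorm_def by simp

lemma mnorm_mono: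
  "(\<And>D q. D \<in> diagrams n \<Longrightarrow> q \<le> N \<Longrightarrow> \<bar>g D q\<bar> \<le> \<bar>h D q\<bar>) \<Longrightarrow> mnorm N n g \<le> mnorm N n h"
  unfolding mnorm_def by (intro divide_right_mono sum_mono mult_left_mono) auto

lemma mnorm_add_le: "mnorm N n (\<lambda>D q. g D q + h D q) \<le> mnorm N n g + mnorm N n h"
  unfolding mnorm_def add_divide_distrib[symmetric] sum.distrib[symmetric] distrib_left[symmetric]
  by (intro divide_right_mono sum_mono mult_left_mono) auto

lemma mnorm_diff_le: "mnorm N n (\<lambda>D q. g D q - h D q) \<le> mnorm N n g + mnorm N n h"
  unfolding mnorm_def add_divide_distrib[symmetric] sum.distrib[symmetric] distrib_left[symmetric]
  by (intro divide_right_mono sum_mono mult_left_mono) auto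

lemma mnorm_cmult: "mnorm N n (\<lambda>D q. c * g D q) = \<bar>c\<bar> * mnorm N n g"
  unfolding mnorm_def abs_mult by (simp add: sum_distrib_left ac_simps)

lemma mnorm_sum_le: "finite J \<Longrightarrow> mnorm N n (\<lambda>D q. \<Sum>j\<in>J. g j D q) \<le> (\<Sum>j\<in>J. mnorm N n (g j))"
proof (induction J rule: finite_induct)
  case (insert x J)
  then show ?case using mnorm_add_le[of N n "g x" "\<lambda>D q. \<Sum>j\<in>J. g j D q"] by simp
qed (simp add: mnorm_def)

text \<open>A product weight describes a diagram and an independent mark, so the total Plancherel
  mass 1 splits off.\<close>

lemma mnorm_product: "mnorm N n (\<lambda>D q. num_paths D * \<rho> q) = (\<Sum>q\<le>N. \<bar>\<rho> q\<bar>)"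
  unfolding mnorm_def abs_mult
  by (simp add: sum_distrib_left[symmetric] sum_distrib_right[symmetric] mult.assoc[symmetric]
      power2_eq_square[symmetric] sum_num_paths_squared)

text \<open>The operators transport mass, and coherence of the Plancherel weights preserves it. The
  norm can grow only if mass from columns beyond \<open>N\<close> enters the window, which the
  hypothesis excludes.\<close>

lemma mnorm_mark_op:
  assumes \<nu>: "\<And>D a. D \<in> diagrams (Suc n) \<Longrightarrow> a \<in> removable D \<Longrightarrow> \<nu> D a \<le> N \<Longrightarrow> fst a \<le> N \<or> g (D - {a}) (fst a) = 0"
  shows "mnorm N (Suc n) (mark_op \<nu> g) \<le> mnorm N n g"
proof -
  define H where "H E = (\<Sum>q\<le>N. \<bar>g E q\<bar>)" for E
  have "(\<Sum>q\<le>N. \<bar>mark_op \<nu> g D q\<bar>) \<le> up_op H D" if D: "D \<in> diagrams (Suc n)" for D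
  proof -
    have "(\<Sum>q\<le>N. \<bar>mark_op \<nu> g D q\<bar>)
        \<le> (\<Sum>q\<le>N. \<Sum>a\<in>removable D. of_bool (fst a \<noteq> q) * \<bar>g (D - {a}) q\<bar> + of_bool (\<nu> D a = q) * \<bar>g (D - {a}) (fst a)\<bar>)"
      unfolding mark_op_def
      by (intro sum_mono order.trans[OF sum_abs]) (auto simp: abs_mult intro: order.trans[OF abs_triangle_ineq])
    also have "\<dots> = (\<Sum>a\<in>removable D. \<Sum>q\<le>N. of_bool (fst a \<noteq> q) * \<bar>g (D - {a}) q\<bar> + of_bool (\<nu> D a = q) * \<bar>g (D - {a}) (fst a)\<bar>)"
      by (rule sum.swap)
    also have "\<dots> \<le> up_op H D"
      unfolding up_op_def H_def
    proof (rule sum_mono)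
      fix a assume a: "a \<in> removable D"
      have "(\<Sum>q\<le>N. of_bool (fst a \<noteq> q) * \<bar>g (D - {a}) q\<bar> + of_bool (\<nu> D a = q) * \<bar>g (D - {a}) (fst a)\<bar>)
        = (\<Sum>q\<le>N. of_bool (fst a \<noteq> q) * \<bar>g (D - {a}) q\<bar>) + of_bool (\<nu> D a \<le> N) * \<bar>g (D - {a}) (fst a)\<bar>"
        unfolding sum.distrib by (simp add: of_bool_def if_distrib[of "\<lambda>x. x * _"] cong: if_cong)
      also have "\<dots> \<le> (\<Sum>q\<le>N. \<bar>g (D - {a}) q\<bar>)"
      proof (cases "\<nu> D a \<le> N \<and> g (D - {a}) (fst a) \<noteq> 0")
        case True
        then have "fst a \<in> {..N}" using \<nu>[OF D a] by auto
        then have "(\<Sum>q\<le>N. \<bar>g (D - {a}) q\<bar>) = \<bar>g (D - {a}) (fst a)\<bar> + (\<Sum>q\<in>{..N} - {fst a}. \<bar>g (D - {a}) q\<bar>)"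
          by (intro sum.remove) auto
        moreover have "(\<Sum>q\<le>N. of_bool (fst a \<noteq> q) * \<bar>g (D - {a}) q\<bar>) = (\<Sum>q\<in>{..N} - {fst a}. \<bar>g (D - {a}) q\<bar>)"
          by (intro sum.mono_neutral_cong_right) auto
        ultimately show ?thesis using True by simp
      next
        case False
        have "(\<Sum>q\<le>N. of_bool (fst a \<noteq> q) * \<bar>g (D - {a}) q\<bar>) \<le> (\<Sum>q\<le>N. \<bar>g (D - {a}) q\<bar>)"
          by (intro sum_mono) auto
        then show ?thesis using False by auto
      qed
      finally show "(\<Sum>q\<le>N. of_bool (fst a \<noteq> q) * \<bar>g (D - {a}) q\<bar> + of_bool (\<nu> D a = q) * \<bar>g (D - {a}) (fst a)\<bar>)
        \<le> (\<Sum>q\<le>N. \<bar>g (D - {a}) q\<bar>)" .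
    qed
    finally show ?thesis .
  qed
  then have "mnorm N (Suc n) (mark_op \<nu> g) \<le> (\<Sum>D\<in>diagrams (Suc n). num_paths D * up_op H D) / fact (Suc n)"
    unfolding mnorm_def by (intro divide_right_mono sum_mono mult_left_mono) auto
  also have "(\<Sum>D\<in>diagrams (Suc n). num_paths D * up_op H D) = (\<Sum>E\<in>diagrams n. down_op num_paths E * H E)"
    by (rule sum_up_op_adjoint)
  also have "\<dots> = real (Suc n) * (\<Sum>E\<in>diagrams n. num_paths E * H E)"
    by (simp add: down_op_num_paths sum_distrib_left ac_simps)
  also have "\<dots> / fact (Suc n) = mnorm N n g" by (simp add: mnorm_def H_def)
  finally show ?thesis .
qed

lemma mnorm_col_op: "mnorm N (Suc n) (mark_op col_next g) \<le> mnorm N n g"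
  by (rule mnorm_mark_op) (simp add: col_next_def)

lemma row_op_support:
  assumes "\<And>D q. D \<in> diagrams n \<Longrightarrow> N < q \<Longrightarrow> g D q = 0" "D \<in> diagrams (Suc n)" "N < q"
  shows "mark_op row_next g D q = 0"
  unfolding mark_op_def
proof (intro sum.neutral ballI)
  fix a assume a: "a \<in> removable D"
  have "row_next D a \<le> fst a"
    using removable_iff[OF in_diagrams[OF assms(2)], of "fst a" "snd a"] a by (simp add: row_next_def)
  then show "of_bool (fst a \<noteq> q) * g (D - {a}) q + of_bool (row_next D a = q) * g (D - {a}) (fst a) = 0"
    using assms(1)[OF remove_in_diagrams[OF assms(2) a]] assms(3) by auto
qed

lemma funpow_row_op_support:
  assumes "\<And>D q. D \<in> diagrams n \<Longrightarrow> N < q \<Longrightarrow> g D q = 0" "D \<in> diagrams (n + k)" "N < q"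
  shows "(mark_op row_next ^^ k) g D q = 0"
  using assms(2,3)
proof (induction k arbitrary: D q)
  case (Suc k)
  then show ?case
    using row_op_support[of "n + k" N "(mark_op row_next ^^ k) g"] by simp
qed (use assms(1) in simp)

text \<open>Row moves go to the left, so the weight must be supported in the window to begin with,
  in contrast to \<open>mnorm_col_op\<close>.\<close>

lemma mnorm_funpow_row:
  assumes "\<And>D q. D \<in> diagrams n \<Longrightarrow> N < q \<Longrightarrow> g D q = 0"
  shows "mnorm N (n + k) ((mark_op row_next ^^ k) g) \<le> mnorm N n g"
proof (induction k)
  case (Suc k)
  have "mnorm N (Suc (n + k)) (mark_op row_next ((mark_op row_next ^^ k) g)) \<le> mnorm N (n + k) ((mark_op row_next ^^ k) g)"
  proof (rule mnorm_mark_op)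
    fix D a assume "D \<in> diagrams (Suc (n + k))" "a \<in> removable D"
    then show "fst a \<le> N \<or> (mark_op row_next ^^ k) g (D - {a}) (fst a) = 0"
      using funpow_row_op_support[where D = "D - {a}" and q = "fst a" and k = k, OF assms] remove_in_diagrams by (meson not_less)
  qed
  then show ?case using Suc by simp
qed simp

subsection \<open>The column operator thins a product weight\<close>

text \<open>The number of growth paths to \<open>D\<close> whose last box lies in column
  \<open>q\<close>.\<close>

definition removed_col :: "nat \<Rightarrow> (nat \<times> nat) set \<Rightarrow> real" where
  "removed_col q D = (\<Sum>a\<in>removable D. of_bool (fst a = q) * num_paths (D - {a}))"

text \<open>The law of the column of a mark after an independent jump to the right with probability
  \<theta>.\<close>

definition thin :: "real \<Rightarrow> (nat \<Rightarrow> real) \<Rightarrow> nat \<Rightarrow> real" where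
  "thin \<theta> \<rho> q = (1 - \<theta>) * \<rho> q + \<theta> * (if q = 0 then 0 else \<rho> (q - 1))"

text \<open>\<open>removed_col q D / num_paths D\<close> is the conditional probability, given
  \<open>D\<close>, that the last box lies in column \<open>q\<close>; this is its mean distance
  from the constant \<theta>.\<close>

definition col_deviation :: "real \<Rightarrow> nat \<Rightarrow> nat \<Rightarrow> real" where
  "col_deviation \<theta> q n = (\<Sum>D\<in>diagrams (Suc n). num_paths D * \<bar>removed_col q D - \<theta> * num_paths D\<bar>) / fact (Suc n)"

definition binomial_weight :: "nat \<Rightarrow> real \<Rightarrow> nat \<Rightarrow> real" where
  "binomial_weight m \<theta> q = real (m choose q) * \<theta> ^ q * (1 - \<theta>) ^ (m - q)"

definition poisson_weight :: "real \<Rightarrow> nat \<Rightarrow> real" where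
  "poisson_weight c q = exp (- c) * c ^ q / fact q"

lemma sum_removed_col_squared: "(\<Sum>D\<in>diagrams (Suc n). (removed_col q D)\<^sup>2) \<le> fact n"
proof -
  have "(removed_col q D)\<^sup>2 = (\<Sum>a\<in>removable D. of_bool (fst a = q) * (num_paths (D - {a}))\<^sup>2)" if "D \<in> diagrams (Suc n)" for D
    unfolding removed_col_def
    by (rule sum_of_bool_unique[of "removable D" "\<lambda>a. fst a = q"])
      (use in_diagrams[OF that] removable_fst_inj in \<open>auto intro: removable_fst_inj\<close>)
  then have "(\<Sum>D\<in>diagrams (Suc n). (removed_col q D)\<^sup>2)
      = (\<Sum>D\<in>diagrams (Suc n). \<Sum>a\<in>removable D. of_bool (fst a = q) * (num_paths (D - {a}))\<^sup>2)" by simp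
  also have "\<dots> = (\<Sum>E\<in>diagrams n. \<Sum>a\<in>addable E. of_bool (fst a = q) * (num_paths E)\<^sup>2)"
    by (subst sum_removable_eq_sum_addable) (simp add: insert_minus_addable)
  also have "\<dots> \<le> (\<Sum>E\<in>diagrams n. (num_paths E)\<^sup>2)"
  proof (rule sum_mono)
    fix E assume "E \<in> diagrams n"
    then have E: "diagram E" by (rule in_diagrams)
    show "(\<Sum>a\<in>addable E. of_bool (fst a = q) * (num_paths E)\<^sup>2) \<le> (num_paths E)\<^sup>2" (is ?thesis)
    proof (rule sum_of_bool_unique[of "addable E" "\<lambda>a. fst a = q"])
      fix a assume g: "\<And>g :: nat \<times> nat \<Rightarrow> real. (\<Sum>x\<in>addable E. of_bool (fst x = q) * g x) = g a"
      show ?thesis unfolding g[of "\<lambda>_. (num_paths E)\<^sup>2"] by simp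
    next
      assume g: "\<And>g :: nat \<times> nat \<Rightarrow> real. (\<Sum>x\<in>addable E. of_bool (fst x = q) * g x) = 0"
      show ?thesis unfolding g[of "\<lambda>_. (num_paths E)\<^sup>2"] by simp
    qed (simp_all add: E addable_fst_inj[OF E])
  qed
  finally show ?thesis by (simp add: sum_num_paths_squared)
qed

text \<open>Cauchy-Schwarz, then expansion of the square; the last term comes from
  \<open>sum_removed_col_squared\<close>. With \<theta> and \<open>col_prob q n\<close> both close
  to \<open>1 / sqrt n\<close> the leading terms cancel, so the deviation is o(1 / sqrt n), small
  enough to be added up over c sqrt n steps.\<close>

lemma col_deviation_squared:
  "(col_deviation \<theta> q n)\<^sup>2 \<le> \<theta>\<^sup>2 - 2 * \<theta> * col_prob q n + 1 / real (Suc n)"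
proof -
  let ?X = "\<lambda>D. removed_col q D - \<theta> * num_paths D"
  have cross: "(\<Sum>D\<in>diagrams (Suc n). num_paths D * removed_col q D) = edge_sum (\<lambda>a. of_bool (fst a = q)) n"
  proof -
    have "(\<Sum>D\<in>diagrams (Suc n). num_paths D * removed_col q D)
       = (\<Sum>D\<in>diagrams (Suc n). \<Sum>a\<in>removable D. of_bool (fst a = q) * (num_paths (D - {a}) * num_paths D))"
      by (simp add: removed_col_def sum_distrib_left ac_simps)
    also have "\<dots> = edge_sum (\<lambda>a. of_bool (fst a = q)) n"
      unfolding edge_sum_def by (subst sum_removable_eq_sum_addable) (simp add: insert_minus_addable)
    finally show ?thesis .
  qed
  have "(\<Sum>D\<in>diagrams (Suc n). num_paths D * \<bar>?X D\<bar>)\<^sup>2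
      \<le> (\<Sum>D\<in>diagrams (Suc n). (num_paths D)\<^sup>2) * (\<Sum>D\<in>diagrams (Suc n). \<bar>?X D\<bar>\<^sup>2)"
    by (rule Cauchy_Schwarz_ineq_sum)
  also have "(\<Sum>D\<in>diagrams (Suc n). \<bar>?X D\<bar>\<^sup>2) = (\<Sum>D\<in>diagrams (Suc n). (removed_col q D)\<^sup>2)
      - 2 * \<theta> * (\<Sum>D\<in>diagrams (Suc n). num_paths D * removed_col q D) + \<theta>\<^sup>2 * (\<Sum>D\<in>diagrams (Suc n). (num_paths D)\<^sup>2)"
    unfolding sum_distrib_left sum_subtractf[symmetric] sum.distrib[symmetric]
    by (intro sum.cong refl) (simp add: power2_eq_square algebra_simps)
  also have "\<dots> \<le> fact n - 2 * \<theta> * (fact (Suc n) * col_prob q n) + \<theta>\<^sup>2 * fact (Suc n)"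
    using sum_removed_col_squared[where n = n and q = q]
    by (simp add: cross sum_num_paths_squared col_prob_def del: fact_Suc)
  finally have "(\<Sum>D\<in>diagrams (Suc n). num_paths D * \<bar>?X D\<bar>)\<^sup>2
      \<le> fact (Suc n) * (fact n - 2 * \<theta> * (fact (Suc n) * col_prob q n) + \<theta>\<^sup>2 * fact (Suc n))"
    by (simp add: sum_num_paths_squared mult_left_mono del: fact_Suc)
  then have "(col_deviation \<theta> q n)\<^sup>2 \<le> fact (Suc n) * (fact n - 2 * \<theta> * (fact (Suc n) * col_prob q n) + \<theta>\<^sup>2 * fact (Suc n)) / (fact (Suc n))\<^sup>2"
    unfolding col_deviation_def power_divide by (rule divide_right_mono) simp
  also have "\<dots> = fact n / fact (Suc n) - 2 * \<theta> * col_prob q n + \<theta>\<^sup>2"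
    by (simp add: power2_eq_square add_divide_distrib diff_divide_distrib del: fact_Suc)
  finally show ?thesis by simp
qed

lemma col_deviation_nonneg [simp]: "0 \<le> col_deviation \<theta> q n"
  unfolding col_deviation_def by (intro divide_nonneg_nonneg sum_nonneg mult_nonneg_nonneg) auto

text \<open>On a product weight the only error is that the conditional probability of a jump depends
  on the diagram. It enters once for the marks that leave a column and once for those that arrive,
  hence the factor 2.\<close>

lemma mnorm_thin_step:
  assumes \<rho>: "\<And>q. \<bar>\<rho> q\<bar> \<le> 1"
  shows "mnorm N (Suc n) (\<lambda>D q. mark_op col_next (\<lambda>D q. num_paths D * \<rho> q) D q - num_paths D * thin \<theta> \<rho> q)
     \<le> 2 * (\<Sum>q\<le>N. col_deviation \<theta> q n)"
proof -
  let ?d = "\<lambda>D q. \<bar>removed_col q D - \<theta> * num_paths D\<bar>"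
  have pw: "\<bar>mark_op col_next (\<lambda>D q. num_paths D * \<rho> q) D q - num_paths D * thin \<theta> \<rho> q\<bar>
      \<le> ?d D q + (if q = 0 then 0 else ?d D (q - 1))" if D: "D \<in> diagrams (Suc n)" for D q
  proof -
    have up: "(\<Sum>a\<in>removable D. num_paths (D - {a})) = num_paths D"
      using num_paths_rec_diagrams[OF D] by (simp add: up_op_def)
    have "mark_op col_next (\<lambda>D q. num_paths D * \<rho> q) D q
       = (\<Sum>a\<in>removable D. \<rho> q * (num_paths (D - {a}) - of_bool (fst a = q) * num_paths (D - {a}))
           + (if q = 0 then 0 else \<rho> (q - 1)) * (of_bool (fst a = q - 1) * num_paths (D - {a})))"
      unfolding mark_op_def col_next_def by (intro sum.cong refl) (auto simp: algebra_simps)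
    also have "\<dots> = \<rho> q * (num_paths D - removed_col q D) + (if q = 0 then 0 else \<rho> (q - 1)) * removed_col (q - 1) D"
      unfolding sum.distrib sum_distrib_left[symmetric] sum_subtractf up removed_col_def by simp
    finally have "mark_op col_next (\<lambda>D q. num_paths D * \<rho> q) D q - num_paths D * thin \<theta> \<rho> q
       = \<rho> q * (\<theta> * num_paths D - removed_col q D) + (if q = 0 then 0 else \<rho> (q - 1) * (removed_col (q - 1) D - \<theta> * num_paths D))"
      by (simp add: thin_def algebra_simps)
    also have "\<bar>\<dots>\<bar> \<le> \<bar>\<rho> q\<bar> * \<bar>\<theta> * num_paths D - removed_col q D\<bar> + (if q = 0 then 0 else \<bar>\<rho> (q - 1)\<bar> * ?d D (q - 1))"
      by (auto simp: abs_mult intro: order.trans[OF abs_triangle_ineq])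
    also have "\<dots> \<le> 1 * \<bar>\<theta> * num_paths D - removed_col q D\<bar> + (if q = 0 then 0 else 1 * ?d D (q - 1))"
      by (intro add_mono) (auto intro: mult_left_le_one_le \<rho> simp: mult_le_cancel_right1)
    finally show ?thesis
      by (simp only: mult_1_left abs_minus_commute[of "\<theta> * num_paths D" "removed_col q D"])
  qed
  have "(\<Sum>q\<le>N. \<bar>mark_op col_next (\<lambda>D q. num_paths D * \<rho> q) D q - num_paths D * thin \<theta> \<rho> q\<bar>) \<le> 2 * (\<Sum>q\<le>N. ?d D q)"
    if D: "D \<in> diagrams (Suc n)" for D
  proof -
    have "(\<Sum>q\<le>N. \<bar>mark_op col_next (\<lambda>D q. num_paths D * \<rho> q) D q - num_paths D * thin \<theta> \<rho> q\<bar>)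
        \<le> (\<Sum>q\<le>N. ?d D q + (if q = 0 then 0 else ?d D (q - 1)))" by (intro sum_mono pw D)
    also have "(\<Sum>q\<le>N. if q = 0 then 0 else ?d D (q - 1)) \<le> (\<Sum>q\<le>N. ?d D q)"
    proof (cases N)
      case (Suc N')
      have "(\<Sum>q\<le>N. if q = 0 then 0 else ?d D (q - 1)) = (\<Sum>q\<le>N'. ?d D q)"
        unfolding Suc by (subst sum.atMost_Suc_shift) simp
      also have "\<dots> \<le> (\<Sum>q\<le>N. ?d D q)" unfolding Suc by simp
      finally show ?thesis .
    qed simp
    then have "(\<Sum>q\<le>N. ?d D q + (if q = 0 then 0 else ?d D (q - 1))) \<le> 2 * (\<Sum>q\<le>N. ?d D q)"
      by (simp add: sum.distrib)
    finally show ?thesis by simp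
  qed
  then have "mnorm N (Suc n) (\<lambda>D q. mark_op col_next (\<lambda>D q. num_paths D * \<rho> q) D q - num_paths D * thin \<theta> \<rho> q)
     \<le> (\<Sum>D\<in>diagrams (Suc n). num_paths D * (2 * (\<Sum>q\<le>N. ?d D q))) / fact (Suc n)"
    unfolding mnorm_def by (intro divide_right_mono sum_mono mult_left_mono) auto
  also have "(\<Sum>D\<in>diagrams (Suc n). num_paths D * (2 * (\<Sum>q\<le>N. ?d D q)))
     = 2 * (\<Sum>q\<le>N. \<Sum>D\<in>diagrams (Suc n). num_paths D * ?d D q)"
    unfolding sum_distrib_left by (subst sum.swap) (simp add: ac_simps)
  also have "\<dots> / fact (Suc n) = 2 * (\<Sum>q\<le>N. col_deviation \<theta> q n)"
    unfolding col_deviation_def sum_divide_distrib[symmetric] by simp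
  finally show ?thesis .
qed

lemma funpow_thin: "(thin \<theta> ^^ m) (\<lambda>q. of_bool (q = 0)) = binomial_weight m \<theta>"
proof (induction m)
  case 0
  then show ?case by (auto simp: binomial_weight_def)
next
  case (Suc m)
  have "thin \<theta> (binomial_weight m \<theta>) q = binomial_weight (Suc m) \<theta> q" for q
  proof (cases q)
    case 0
    then show ?thesis by (simp add: thin_def binomial_weight_def)
  next
    case (Suc k)
    show ?thesis
    proof (cases "Suc k \<le> m")
      case True
      then have e: "(1 - \<theta>) ^ (m - k) = (1 - \<theta>) * (1 - \<theta>) ^ (m - Suc k)"
        by (metis Suc_diff_Suc Suc_le_lessD power_Suc)
      show ?thesis using Suc by (simp add: thin_def binomial_weight_def e) (simp add: algebra_simps)
    next
      case False
      then show ?thesis using Suc by (simp add: thin_def binomial_weight_def binomial_eq_0)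
    qed
  qed
  then show ?case using Suc by auto
qed

lemma binomial_weight_nonneg: "0 \<le> \<theta> \<Longrightarrow> \<theta> \<le> 1 \<Longrightarrow> 0 \<le> binomial_weight m \<theta> q"
  by (simp add: binomial_weight_def)

lemma sum_binomial_weight: "m \<le> N \<Longrightarrow> (\<Sum>q\<le>N. binomial_weight m \<theta> q) = 1"
proof -
  assume "m \<le> N"
  then have "(\<Sum>q\<le>N. binomial_weight m \<theta> q) = (\<Sum>q\<le>m. binomial_weight m \<theta> q)"
    by (intro sum.mono_neutral_right) (auto simp: binomial_weight_def binomial_eq_0)
  also have "\<dots> = (\<theta> + (1 - \<theta>)) ^ m" unfolding binomial_weight_def by (rule binomial_ring[symmetric])
  finally show ?thesis by simp
qed

lemma binomial_weight_le_1: assumes "0 \<le> \<theta>" "\<theta> \<le> 1" shows "binomial_weight m \<theta> q \<le> 1"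
proof -
  have "binomial_weight m \<theta> q \<le> (\<Sum>q\<le>m + q. binomial_weight m \<theta> q)"
    using assms binomial_weight_nonneg by (intro member_le_sum) auto
  then show ?thesis by (simp add: sum_binomial_weight)
qed

text \<open>The error of each step is passed on by a contraction (\<open>mnorm_col_op\<close>), so
  the errors just add up.\<close>

lemma mnorm_funpow_col_binomial:
  assumes \<theta>: "0 \<le> \<theta>" "\<theta> \<le> 1"
  shows "mnorm N (n + m) (\<lambda>D q. (mark_op col_next ^^ m) (\<lambda>D q. num_paths D * of_bool (q = 0)) D q - num_paths D * binomial_weight m \<theta> q)
    \<le> 2 * (\<Sum>k<m. \<Sum>q\<le>N. col_deviation \<theta> q (n + k))"
proof (induction m)
  case 0
  then show ?case unfolding funpow_thin[symmetric] by (simp add: mnorm_def)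
next
  case (Suc m)
  let ?g = "(mark_op col_next ^^ m) (\<lambda>D q. num_paths D * of_bool (q = 0))"
  let ?b = "\<lambda>D q. num_paths D * binomial_weight m \<theta> q"
  have bs: "binomial_weight (Suc m) \<theta> = thin \<theta> (binomial_weight m \<theta>)"
    using funpow_thin[of "Suc m" \<theta>] funpow_thin[of m \<theta>] by simp
  have lin: "mark_op col_next (\<lambda>D q. ?g D q - ?b D q) = (\<lambda>D q. mark_op col_next ?g D q - mark_op col_next ?b D q)"
    using funpow_mark_op_diff[where k = 1] by simp
  have "mnorm N (n + Suc m) (\<lambda>D q. (mark_op col_next ^^ Suc m) (\<lambda>D q. num_paths D * of_bool (q = 0)) D q - num_paths D * binomial_weight (Suc m) \<theta> q)
    = mnorm N (Suc (n + m)) (\<lambda>D q. mark_op col_next (\<lambda>D q. ?g D q - ?b D q) D q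
        + (mark_op col_next ?b D q - num_paths D * thin \<theta> (binomial_weight m \<theta>) q))"
    unfolding bs lin by simp
  also have "\<dots> \<le> mnorm N (Suc (n + m)) (mark_op col_next (\<lambda>D q. ?g D q - ?b D q))
      + mnorm N (Suc (n + m)) (\<lambda>D q. mark_op col_next ?b D q - num_paths D * thin \<theta> (binomial_weight m \<theta>) q)"
    by (rule mnorm_add_le)
  also have "\<dots> \<le> mnorm N (n + m) (\<lambda>D q. ?g D q - ?b D q) + 2 * (\<Sum>q\<le>N. col_deviation \<theta> q (n + m))"
    using binomial_weight_nonneg[OF \<theta>] binomial_weight_le_1[OF \<theta>]
    by (intro add_mono mnorm_col_op mnorm_thin_step) (simp add: abs_of_nonneg)
  finally show ?case using Suc by simp
qed

lemma funpow_mark_op_cong_diagrams: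
  assumes "\<And>D q. D \<in> diagrams n \<Longrightarrow> g D q = h D q" "D \<in> diagrams (n + m)"
  shows "(mark_op \<nu> ^^ m) g D q = (mark_op \<nu> ^^ m) h D q"
  using assms(2)
proof (induction m arbitrary: D q)
  case (Suc m)
  then have "mark_op \<nu> ((mark_op \<nu> ^^ m) g) D q = mark_op \<nu> ((mark_op \<nu> ^^ m) h) D q"
    by (intro mark_op_cong) (use remove_in_diagrams in auto)
  then show ?case by simp
qed (use assms(1) in simp)

text \<open>By commutation the row steps can be carried out first, where they grow the diagram and
  keep the mark in column 0 (\<open>funpow_row_unmarked\<close>).\<close>

lemma marked_weight_alt:
  assumes "m \<le> n" "D \<in> diagrams n"
  shows "marked_weight m n D q = (mark_op col_next ^^ m) (\<lambda>D q. num_paths D * of_bool (q = 0)) D q"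
proof -
  have "marked_weight m n D q = (mark_op col_next ^^ m) ((mark_op row_next ^^ (n - m)) unmarked) D q"
    unfolding marked_weight_def
    by (rule funpow_row_col_commute[OF mark_supported_unmarked in_diagrams[OF assms(2)]])
  also have "\<dots> = (mark_op col_next ^^ m) (\<lambda>D q. num_paths D * of_bool (q = 0)) D q"
    by (rule funpow_mark_op_cong_diagrams[where n = "n - m"]) (use assms funpow_row_unmarked in auto)
  finally show ?thesis .
qed

lemma mnorm_marked_weight_binomial:
  assumes "0 \<le> \<theta>" "\<theta> \<le> 1" "m \<le> n"
  shows "mnorm N n (\<lambda>D q. marked_weight m n D q - num_paths D * binomial_weight m \<theta> q)
    \<le> 2 * (\<Sum>k<m. \<Sum>q\<le>N. col_deviation \<theta> q (n - m + k))"
  using mnorm_funpow_col_binomial[OF assms(1,2), of N "n - m" m]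
  unfolding le_add_diff_inverse2[OF assms(3)]
  by (simp add: marked_weight_alt[OF assms(3)] cong: mnorm_cong)

text \<open>About \<open>c * sqrt n\<close> terms, each of order o(1 / sqrt n), uniformly over the
  sizes between \<open>n - m\<close> and \<open>n\<close>, which are all asymptotically
  \<open>n\<close>.\<close>

lemma sum_col_deviation_tendsto_0:
  fixes m n :: "nat \<Rightarrow> nat"
  assumes n: "filterlim n at_top sequentially" and mn: "(\<lambda>i. real (m i) / sqrt (real (n i))) \<longlonglongrightarrow> c"
  shows "(\<lambda>i. \<Sum>k<m i. \<Sum>q\<le>N. col_deviation (1 / sqrt (real (n i))) q (n i - m i + k)) \<longlonglongrightarrow> 0"
proof (rule tendstoI)
  fix \<eta> :: real assume \<eta>: "\<eta> > 0"
  have c0: "0 \<le> c" by (rule tendsto_lowerbound[OF mn]) auto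
  \<comment> \<open>Each deviation will be at most \<open>r / sqrt n\<close>, and \<open>r\<close>
    keeps the sum over fewer than \<open>(c + 1) * sqrt n\<close> steps and \<open>Suc N\<close>
    columns below \<eta>. The square of a deviation comes out as at most
    \<open>3 * \<epsilon> / n\<close>, hence the choice of \<epsilon>.\<close>
  define r where "r = \<eta> / ((c + 1) * real (Suc N) + 1)"
  define \<epsilon> where "\<epsilon> = r\<^sup>2 / 3"
  have r: "r > 0" using \<eta> c0 by (auto simp: r_def intro!: divide_pos_pos add_nonneg_pos)
  have \<epsilon>: "\<epsilon> > 0" using r by (simp add: \<epsilon>_def)
  have "\<forall>\<^sub>F k in sequentially. \<forall>q\<in>{..N}. 1 - \<epsilon> < sqrt (real k) * col_prob q k"
    using \<epsilon> by (intro eventually_ball_finite ballI order_tendstoD(1)[OF tendsto_col_prob]) auto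
  then obtain K0 where K0: "\<And>k q. k \<ge> K0 \<Longrightarrow> q \<le> N \<Longrightarrow> 1 - \<epsilon> < sqrt (real k) * col_prob q k"
    by (auto simp: eventually_sequentially)
  have sq: "filterlim (\<lambda>i. sqrt (real (n i))) at_top sequentially"
    by (rule filterlim_compose[OF sqrt_at_top filterlim_compose[OF filterlim_real_sequentially n]])
  have "(\<lambda>i. (real (m i) / sqrt (real (n i))) * inverse (sqrt (real (n i)))) \<longlonglongrightarrow> c * 0"
    by (intro tendsto_mult mn tendsto_inverse_0_at_top sq)
  then have mn0: "(\<lambda>i. real (m i) / real (n i)) \<longlonglongrightarrow> 0"
    by (simp add: divide_inverse mult.assoc inverse_mult_distrib[symmetric])
  \<comment> \<open>With \<open>m / n\<close> below this threshold, all sizes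
    \<open>j \<ge> n - m\<close> satisfy
    \<open>1 / (j + 1) \<le> (1 + \<epsilon>) / n\<close>.\<close>
  have "1 - 1 / (1 + \<epsilon>) > 0" using \<epsilon> by simp
  from order_tendstoD(2)[OF mn0 this]
  have e1: "eventually (\<lambda>i. real (m i) / real (n i) < 1 - 1 / (1 + \<epsilon>)) sequentially" .
  have e2: "eventually (\<lambda>i. real (m i) / real (n i) < 1 / 2) sequentially"
    by (rule order_tendstoD(2)[OF mn0]) simp
  have e3: "eventually (\<lambda>i. 2 * K0 + 1 \<le> n i) sequentially"
    using n by (simp add: filterlim_at_top)
  have e4: "eventually (\<lambda>i. real (m i) / sqrt (real (n i)) < c + 1) sequentially"
    by (rule order_tendstoD(2)[OF mn]) simp
  show "eventually (\<lambda>i. dist (\<Sum>k<m i. \<Sum>q\<le>N. col_deviation (1 / sqrt (real (n i))) q (n i - m i + k)) 0 < \<eta>) sequentially"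
    using e1 e2 e3 e4
  proof eventually_elim
    case (elim i)
    define s where "s = sqrt (real (n i))"
    have n0: "n i > 0" using elim(3) by simp
    have s: "s > 0" "s * s = real (n i)" using n0 by (simp_all add: s_def)
    have mh: "2 * m i < n i"
    proof -
      have "2 * real (m i) < real (n i)" using elim(2) n0 by (simp add: pos_divide_less_eq)
      then show ?thesis by linarith
    qed
    have dev: "col_deviation (1 / s) q (n i - m i + k) \<le> r / s" if k: "k < m i" and q: "q \<le> N" for k q
    proof -
      define j where "j = n i - m i + k"
      have j: "j \<ge> K0" "j < n i" "n i - m i \<le> j" "j > 0" using elim(3) mh k by (auto simp: j_def)
      have "1 - \<epsilon> < sqrt (real j) * col_prob q j" by (rule K0) (use j q in auto)
      also have "\<dots> \<le> s * col_prob q j" using j by (intro mult_right_mono) (auto simp: s_def)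
      finally have cp: "(1 - \<epsilon>) / s \<le> col_prob q j" using s by (simp add: pos_divide_le_eq mult.commute)
      have "1 / real (Suc j) \<le> (1 + \<epsilon>) / real (n i)"
      proof -
        have "real (m i) < (1 - 1 / (1 + \<epsilon>)) * real (n i)" using elim(1) n0 by (simp add: pos_divide_less_eq)
        then have "real (n i) / (1 + \<epsilon>) < real (n i) - real (m i)" by (simp add: algebra_simps)
        also have "\<dots> \<le> real (Suc j)" using j mh by linarith
        finally have "real (n i) \<le> (1 + \<epsilon>) * real (Suc j)" using \<epsilon> by (simp add: pos_divide_less_eq mult.commute)
        then show ?thesis using n0 by (simp add: pos_le_divide_eq pos_divide_le_eq del: of_nat_Suc)
      qed
      then have b: "1 / real (Suc j) \<le> (1 + \<epsilon>) / (s * s)" using s by simp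
      have "(col_deviation (1 / s) q j)\<^sup>2 \<le> (1 / s)\<^sup>2 - 2 * (1 / s) * col_prob q j + 1 / real (Suc j)"
        by (rule col_deviation_squared)
      also have "\<dots> \<le> (1 / s)\<^sup>2 - 2 * (1 / s) * ((1 - \<epsilon>) / s) + (1 + \<epsilon>) / (s * s)"
        using cp b s by (intro add_mono diff_left_mono mult_left_mono) auto
      also have "\<dots> = 3 * \<epsilon> / (s * s)"
        by (simp add: power2_eq_square add_divide_distrib diff_divide_distrib algebra_simps)
      also have "\<dots> = (r / s)\<^sup>2" unfolding \<epsilon>_def power_divide power2_eq_square by simp
      finally have sq_le: "(col_deviation (1 / s) q j)\<^sup>2 \<le> (r / s)\<^sup>2" .
      have "0 \<le> r / s" using r s by simp
      with sq_le show ?thesis unfolding j_def by (rule power2_le_imp_le)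
    qed
    have "(\<Sum>k<m i. \<Sum>q\<le>N. col_deviation (1 / s) q (n i - m i + k)) \<le> (\<Sum>k<m i. \<Sum>q\<le>N. r / s)"
      by (intro sum_mono dev) auto
    also have "\<dots> = (real (m i) / s) * (real (Suc N) * r)" by simp
    also have "\<dots> \<le> (c + 1) * (real (Suc N) * r)"
      using elim(4) r by (intro mult_right_mono) (auto simp: s_def)
    also have "\<dots> < ((c + 1) * real (Suc N) + 1) * r" using r by (simp add: algebra_simps)
    also have "\<dots> = \<eta>"
    proof -
      have "(c + 1) * real (Suc N) + 1 > 0" using c0 by (intro add_nonneg_pos mult_nonneg_nonneg) auto
      then show ?thesis unfolding r_def by simp
    qed
    finally show ?case by (simp add: s_def sum_nonneg)
  qed
qed

text \<open>The Poisson limit theorem for \<open>m\<close> trials with success probability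
  \<open>1 / sqrt n\<close>; positivity of \<open>c\<close> makes \<open>m\<close> tend to
  infinity.\<close>

lemma binomial_weight_tendsto:
  fixes m n :: "nat \<Rightarrow> nat"
  assumes n: "filterlim n at_top sequentially" and mn: "(\<lambda>i. real (m i) / sqrt (real (n i))) \<longlonglongrightarrow> c" and c: "c > 0"
  shows "(\<lambda>i. binomial_weight (m i) (1 / sqrt (real (n i))) q) \<longlonglongrightarrow> poisson_weight c q"
proof -
  define \<theta> where "\<theta> i = 1 / sqrt (real (n i))" for i
  have sq: "filterlim (\<lambda>i. sqrt (real (n i))) at_top sequentially"
    by (rule filterlim_compose[OF sqrt_at_top filterlim_compose[OF filterlim_real_sequentially n]])
  have "filterlim (\<lambda>i. (real (m i) / sqrt (real (n i))) * sqrt (real (n i))) at_top sequentially"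
    by (rule filterlim_tendsto_pos_mult_at_top[OF mn c sq])
  moreover have "eventually (\<lambda>i. (real (m i) / sqrt (real (n i))) * sqrt (real (n i)) = real (m i)) sequentially"
    using eventually_compose_filterlim[OF eventually_gt_at_top[of 0] n] by eventually_elim simp
  ultimately have "filterlim (\<lambda>i. real (m i)) at_top sequentially"
    by (simp cong: filterlim_cong)
  then have m: "filterlim m at_top sequentially"
    unfolding filterlim_at_top[of m] filterlim_at_top[of "\<lambda>i. real (m i)"] by (metis (mono_tags, lifting) eventually_mono of_nat_le_iff)
  have th0: "\<theta> \<longlonglongrightarrow> 0" unfolding \<theta>_def divide_inverse using tendsto_inverse_0_at_top[OF sq] by simp
  have "((\<lambda>x :: real. ln (1 - 1 / x) * x) \<longlongrightarrow> - 1) at_top" by real_asymp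
  from filterlim_compose[OF this sq]
  have l: "(\<lambda>i. ln (1 - \<theta> i) * sqrt (real (n i))) \<longlonglongrightarrow> - 1" by (simp add: \<theta>_def)
  have "(\<lambda>i. exp ((real (m i) / sqrt (real (n i))) * (ln (1 - \<theta> i) * sqrt (real (n i))))) \<longlonglongrightarrow> exp (c * - 1)"
    by (intro tendsto_exp tendsto_mult mn l)
  moreover have th1: "eventually (\<lambda>i. 0 < \<theta> i \<and> \<theta> i < 1) sequentially"
    using eventually_compose_filterlim[OF eventually_gt_at_top[of 1] n]
    by eventually_elim (auto simp: \<theta>_def)
  then have "eventually (\<lambda>i. exp ((real (m i) / sqrt (real (n i))) * (ln (1 - \<theta> i) * sqrt (real (n i)))) = (1 - \<theta> i) ^ m i) sequentially"
    using eventually_compose_filterlim[OF eventually_gt_at_top[of 0] n]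
  proof eventually_elim
    case (elim i)
    have "exp ((real (m i) / sqrt (real (n i))) * (ln (1 - \<theta> i) * sqrt (real (n i)))) = exp (real (m i) * ln (1 - \<theta> i))"
      using elim by simp
    also have "\<dots> = (1 - \<theta> i) ^ m i" using elim by (simp add: exp_of_nat_mult)
    finally show ?case .
  qed
  ultimately have "(\<lambda>i. (1 - \<theta> i) ^ m i) \<longlonglongrightarrow> exp (c * - 1)" by (rule Lim_transform_eventually)
  then have p: "(\<lambda>i. (1 - \<theta> i) ^ m i) \<longlonglongrightarrow> exp (- c)" by simp
  have "(\<lambda>i. (real (m i choose q) / real (m i) ^ q) * (real (m i) / sqrt (real (n i))) ^ q * ((1 - \<theta> i) ^ m i / (1 - \<theta> i) ^ q))
      \<longlonglongrightarrow> 1 / fact q * c ^ q * (exp (- c) / (1 - 0) ^ q)"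
    by (intro tendsto_intros filterlim_compose[OF tendsto_binomial_over_power m] mn p th0) simp
  moreover have "eventually (\<lambda>i. (real (m i choose q) / real (m i) ^ q) * (real (m i) / sqrt (real (n i))) ^ q * ((1 - \<theta> i) ^ m i / (1 - \<theta> i) ^ q)
      = binomial_weight (m i) (\<theta> i) q) sequentially"
    using th1 eventually_compose_filterlim[OF eventually_gt_at_top[of q] m]
  proof eventually_elim
    case (elim i)
    then show ?case
      by (simp add: binomial_weight_def \<theta>_def[symmetric] power_divide power_diff)
         (simp add: \<theta>_def power_divide)
  qed
  ultimately have "(\<lambda>i. binomial_weight (m i) (\<theta> i) q) \<longlonglongrightarrow> 1 / fact q * c ^ q * (exp (- c) / (1 - 0) ^ q)"
    by (rule Lim_transform_eventually)
  then show ?thesis by (simp add: poisson_weight_def \<theta>_def mult.commute)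
qed

lemma marked_weight_tendsto_poisson:
  fixes m n :: "nat \<Rightarrow> nat"
  assumes n: "filterlim n at_top sequentially" and mn: "(\<lambda>i. real (m i) / sqrt (real (n i))) \<longlonglongrightarrow> c" and c: "c > 0"
    and le: "eventually (\<lambda>i. m i \<le> n i) sequentially"
  shows "(\<lambda>i. mnorm N (n i) (\<lambda>D q. marked_weight (m i) (n i) D q - num_paths D * poisson_weight c q)) \<longlonglongrightarrow> 0"
proof (rule tendsto_sandwich[where f = "\<lambda>_. 0"])
  let ?\<theta> = "\<lambda>i. 1 / sqrt (real (n i))"
  show "eventually (\<lambda>i. mnorm N (n i) (\<lambda>D q. marked_weight (m i) (n i) D q - num_paths D * poisson_weight c q)
      \<le> 2 * (\<Sum>k<m i. \<Sum>q\<le>N. col_deviation (?\<theta> i) q (n i - m i + k)) + (\<Sum>q\<le>N. \<bar>binomial_weight (m i) (?\<theta> i) q - poisson_weight c q\<bar>)) sequentially"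
    using le eventually_compose_filterlim[OF eventually_gt_at_top[of 0] n]
  proof eventually_elim
    case (elim i)
    have "mnorm N (n i) (\<lambda>D q. marked_weight (m i) (n i) D q - num_paths D * poisson_weight c q)
      = mnorm N (n i) (\<lambda>D q. (marked_weight (m i) (n i) D q - num_paths D * binomial_weight (m i) (?\<theta> i) q)
          + num_paths D * (binomial_weight (m i) (?\<theta> i) q - poisson_weight c q))"
      by (simp add: algebra_simps)
    also have "\<dots> \<le> mnorm N (n i) (\<lambda>D q. marked_weight (m i) (n i) D q - num_paths D * binomial_weight (m i) (?\<theta> i) q)
        + mnorm N (n i) (\<lambda>D q. num_paths D * (binomial_weight (m i) (?\<theta> i) q - poisson_weight c q))"
      by (rule mnorm_add_le)
    finally show ?case
      using mnorm_marked_weight_binomial[of "?\<theta> i" "m i" "n i" N] elim unfolding mnorm_product by simp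
  qed
  have "(\<lambda>i. 2 * (\<Sum>k<m i. \<Sum>q\<le>N. col_deviation (?\<theta> i) q (n i - m i + k)) + (\<Sum>q\<le>N. \<bar>binomial_weight (m i) (?\<theta> i) q - poisson_weight c q\<bar>))
      \<longlonglongrightarrow> 2 * 0 + (\<Sum>q\<le>N. \<bar>poisson_weight c q - poisson_weight c q\<bar>)"
    by (intro tendsto_intros sum_col_deviation_tendsto_0[OF n mn] binomial_weight_tendsto[OF n mn c])
  then show "(\<lambda>i. 2 * (\<Sum>k<m i. \<Sum>q\<le>N. col_deviation (?\<theta> i) q (n i - m i + k)) + (\<Sum>q\<le>N. \<bar>binomial_weight (m i) (?\<theta> i) q - poisson_weight c q\<bar>)) \<longlonglongrightarrow> 0"
    by simp
qed auto

subsection \<open>The row operator thins a Poisson weight\<close>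

text \<open>The weight of a mark that starts in column \<open>a\<close> independently of the
  diagram, after \<open>k\<close> row steps.\<close>

definition row_column_weight :: "nat \<Rightarrow> nat \<Rightarrow> (nat \<times> nat) set \<Rightarrow> nat \<Rightarrow> real" where
  "row_column_weight a k = (mark_op row_next ^^ k) (\<lambda>D q. num_paths D * of_bool (q = a))"

lemma mnorm_support:
  assumes "\<And>D q. D \<in> diagrams n \<Longrightarrow> M < q \<Longrightarrow> g D q = 0"
  shows "mnorm N n g \<le> mnorm M n g"
  unfolding mnorm_def
proof (intro divide_right_mono sum_mono mult_left_mono)
  fix D assume D: "D \<in> diagrams n"
  have "(\<Sum>q\<le>N. \<bar>g D q\<bar>) \<le> (\<Sum>q\<le>max M N. \<bar>g D q\<bar>)" by (intro sum_mono2) auto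
  also have "\<dots> = (\<Sum>q\<le>M. \<bar>g D q\<bar>)"
    by (intro sum.mono_neutral_right) (auto simp: assms[OF D])
  finally show "(\<Sum>q\<le>N. \<bar>g D q\<bar>) \<le> (\<Sum>q\<le>M. \<bar>g D q\<bar>)" .
qed auto

lemma mnorm_mono_index: "M \<le> N \<Longrightarrow> mnorm M n g \<le> mnorm N n g"
  unfolding mnorm_def by (intro divide_right_mono sum_mono mult_left_mono sum_mono2) auto

lemma mnorm_split:
  assumes "a \<le> N"
  shows "mnorm N n g = mnorm a n g + mnorm N n (\<lambda>D q. of_bool (a < q) * g D q)"
proof -
  have "(\<Sum>q\<le>N. \<bar>g D q\<bar>) = (\<Sum>q\<le>a. \<bar>g D q\<bar>) + (\<Sum>q\<le>N. \<bar>of_bool (a < q) * g D q\<bar>)" for D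
  proof -
    have "(\<Sum>q\<le>N. \<bar>of_bool (a < q) * g D q\<bar>) = (\<Sum>q\<in>{..N} - {..a}. \<bar>g D q\<bar>)"
      by (intro sum.mono_neutral_cong_right) auto
    then show ?thesis using assms by (simp add: sum.subset_diff[of "{..a}" "{..N}"])
  qed
  then show ?thesis unfolding mnorm_def by (simp add: distrib_left sum.distrib add_divide_distrib)
qed

lemma marked_weight_support:
  assumes "D \<in> diagrams n" "m \<le> n" "n < q"
  shows "marked_weight m n D q = 0"
proof -
  have "(mark_op row_next ^^ (n - m)) ((mark_op col_next ^^ m) unmarked) D q = 0"
  proof (rule funpow_row_op_support[where n = m and N = n])
    fix D' q' assume D': "D' \<in> diagrams m" and q': "n < q'"
    have "{x. (x, 0) \<in> D'} \<subseteq> {..<m}"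
      using diagram_subset_square[OF in_diagrams[OF D']] D' by (auto simp: diagrams_def)
    then have "rowlen D' 0 \<le> m"
      unfolding rowlen_def using card_mono[of "{..<m}"] by fastforce
    then show "(mark_op col_next ^^ m) unmarked D' q' = 0"
      using q' assms(2) by (simp add: funpow_col_unmarked[OF D'])
  qed (use assms in auto)
  then show ?thesis by (simp add: marked_weight_def)
qed

lemma mnorm_marked_weight_le_1: assumes "m \<le> n" "n \<le> N" shows "mnorm N n (marked_weight m n) \<le> 1"
proof -
  have "mnorm N (m + (n - m)) (marked_weight m n) \<le> mnorm N m ((mark_op col_next ^^ m) unmarked)"
    unfolding marked_weight_def
  proof (rule mnorm_funpow_row)
    fix D q assume D: "D \<in> diagrams m" and q: "N < q"
    have "{x. (x, 0) \<in> D} \<subseteq> {..<m}"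
      using diagram_subset_square[OF in_diagrams[OF D]] D by (auto simp: diagrams_def)
    then have "rowlen D 0 \<le> m"
      unfolding rowlen_def using card_mono[of "{..<m}"] by fastforce
    then show "(mark_op col_next ^^ m) unmarked D q = 0"
      using q assms by (simp add: funpow_col_unmarked[OF D])
  qed
  also have "mnorm N k ((mark_op col_next ^^ k) unmarked) \<le> mnorm N 0 unmarked" for k
    by (induction k) (auto intro: order.trans[OF mnorm_col_op])
  also have "mnorm N 0 unmarked = (\<Sum>q\<le>N. if q = 0 then 1 else 0)"
    unfolding mnorm_def unmarked_def by (simp add: of_bool_def cong: if_cong)
  also have "\<dots> = 1" by simp
  finally show ?thesis using assms by simp
qed

lemma row_column_weight_support:
  assumes "D \<in> diagrams (n + k)" "a < q"
  shows "row_column_weight a k D q = 0"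
  unfolding row_column_weight_def by (rule funpow_row_op_support[OF _ assms]) auto

lemma binomial_weight_support: "a < q \<Longrightarrow> binomial_weight a r q = 0"
  by (simp add: binomial_weight_def binomial_eq_0)

lemma poisson_weight_nonneg: "0 \<le> c \<Longrightarrow> 0 \<le> poisson_weight c q"
  by (simp add: poisson_weight_def)

lemma poisson_weight_pos: "0 < c \<Longrightarrow> 0 < poisson_weight c q"
  by (simp add: poisson_weight_def)

lemma sum_power_div_fact_le_exp: "0 \<le> x \<Longrightarrow> (\<Sum>k\<le>n. x ^ k / fact k) \<le> exp (x :: real)"
proof -
  assume x: "0 \<le> x"
  have "(\<lambda>k. x ^ k / fact k) sums exp x"
    using exp_converges[of x] by (simp add: divide_inverse mult.commute)
  then show ?thesis
    using x sum_le_suminf[of "\<lambda>k. x ^ k / fact k" "{..n}"] by (auto simp: sums_iff)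
qed

lemma sum_poisson_weight_le_1: assumes "0 \<le> c" shows "(\<Sum>q\<le>n. poisson_weight c q) \<le> 1"
proof -
  have "(\<Sum>q\<le>n. poisson_weight c q) = exp (- c) * (\<Sum>q\<le>n. c ^ q / fact q)"
    by (simp add: poisson_weight_def sum_distrib_left)
  also have "\<dots> \<le> exp (- c) * exp c" by (intro mult_left_mono sum_power_div_fact_le_exp assms) simp
  finally show ?thesis by (simp add: exp_add[symmetric])
qed

text \<open>The point of the bound is the factor \<open>c\<close>: for a small mean the mass beyond
  \<open>a\<close> is negligible compared with the mass at \<open>a\<close> itself.\<close>

lemma poisson_tail_le: "0 \<le> c \<Longrightarrow> 1 - (\<Sum>q\<le>a. poisson_weight c q) \<le> c * exp c * poisson_weight c a"
proof -
  assume c: "0 \<le> c"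
  obtain t where t: "\<bar>t\<bar> \<le> \<bar>c\<bar>" "exp c = (\<Sum>m<Suc a. c ^ m / fact m) + exp t / fact (Suc a) * c ^ Suc a"
    using Maclaurin_exp_le[of c "Suc a"] by blast
  have "1 - (\<Sum>q\<le>a. poisson_weight c q) = exp (- c) * (exp c - (\<Sum>q\<le>a. c ^ q / fact q))"
    by (simp add: poisson_weight_def right_diff_distrib sum_distrib_left exp_add[symmetric])
  also have "\<dots> = exp (- c) * (exp t / fact (Suc a) * c ^ Suc a)"
    using t(2) by (simp add: lessThan_Suc_atMost)
  also have "\<dots> \<le> exp (- c) * (exp c / fact a * c ^ Suc a)"
    using t(1) c by (intro mult_left_mono mult_right_mono frac_le) (auto intro: fact_mono)
  also have "\<dots> = c * exp c * poisson_weight c a" by (simp add: poisson_weight_def)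
  finally show ?thesis .
qed

text \<open>Thinning a Poisson law gives a Poisson law; only an inequality because the mixture is
  cut at \<open>a\<close>.\<close>

lemma poisson_binomial_weight:
  assumes c: "0 \<le> c" and r: "0 \<le> r" "r \<le> 1"
  shows "(\<Sum>j\<le>a. poisson_weight c j * binomial_weight j r q) \<le> poisson_weight (c * r) q"
proof (cases "q \<le> a")
  case False
  then have "(\<Sum>j\<le>a. poisson_weight c j * binomial_weight j r q) = 0"
    by (intro sum.neutral) (auto simp: binomial_weight_support)
  then show ?thesis using poisson_weight_nonneg c r by simp
next
  case True
  have "(\<Sum>j\<le>a. poisson_weight c j * binomial_weight j r q) = (\<Sum>j\<in>{q..a}. poisson_weight c j * binomial_weight j r q)"
    by (intro sum.mono_neutral_right) (auto simp: binomial_weight_support)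
  also have "\<dots> = (\<Sum>k\<le>a - q. poisson_weight c (k + q) * binomial_weight (k + q) r q)"
    using True by (intro sum.reindex_bij_witness[of _ "\<lambda>k. k + q" "\<lambda>j. j - q"]) auto
  also have "\<dots> = (\<Sum>k\<le>a - q. (exp (- c) * (c * r) ^ q / fact q) * ((c * (1 - r)) ^ k / fact k))"
  proof (intro sum.cong refl)
    fix k
    have "real ((k + q) choose q) = fact (k + q) / (fact q * fact k)"
      by (simp add: binomial_fact)
    then show "poisson_weight c (k + q) * binomial_weight (k + q) r q = (exp (- c) * (c * r) ^ q / fact q) * ((c * (1 - r)) ^ k / fact k)"
      by (simp add: poisson_weight_def binomial_weight_def power_add power_mult_distrib)
  qed
  also have "\<dots> = (exp (- c) * (c * r) ^ q / fact q) * (\<Sum>k\<le>a - q. (c * (1 - r)) ^ k / fact k)"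
    by (simp add: sum_distrib_left)
  also have "\<dots> \<le> (exp (- c) * (c * r) ^ q / fact q) * exp (c * (1 - r))"
    using c r by (intro mult_left_mono sum_power_div_fact_le_exp) auto
  also have "\<dots> = poisson_weight (c * r) q"
    by (simp add: poisson_weight_def exp_add[symmetric] algebra_simps)
  finally show ?thesis .
qed

lemma mark_op_sum:
  "mark_op \<nu> (\<lambda>D q. \<Sum>j\<in>J. c j * g j D q) = (\<lambda>D q. \<Sum>j\<in>J. c j * mark_op \<nu> (g j) D q)"
proof (intro ext)
  fix D q
  have "mark_op \<nu> (\<lambda>D q. \<Sum>j\<in>J. c j * g j D q) D q
      = (\<Sum>a\<in>removable D. \<Sum>j\<in>J. c j * (of_bool (fst a \<noteq> q) * g j (D - {a}) q + of_bool (\<nu> D a = q) * g j (D - {a}) (fst a)))"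
    unfolding mark_op_def by (intro sum.cong refl) (simp add: sum_distrib_left sum.distrib distrib_left ac_simps)
  also have "\<dots> = (\<Sum>j\<in>J. c j * mark_op \<nu> (g j) D q)"
    unfolding mark_op_def sum_distrib_left by (rule sum.swap)
  finally show "mark_op \<nu> (\<lambda>D q. \<Sum>j\<in>J. c j * g j D q) D q = (\<Sum>j\<in>J. c j * mark_op \<nu> (g j) D q)" .
qed

lemma funpow_mark_op_sum:
  "(mark_op \<nu> ^^ k) (\<lambda>D q. \<Sum>j\<in>J. c j * g j D q) = (\<lambda>D q. \<Sum>j\<in>J. c j * (mark_op \<nu> ^^ k) (g j) D q)"
  by (induction k) (simp_all add: mark_op_sum)

text \<open>The Poisson law of the mark at time \<open>n\<close> is a mixture of starting columns.
  Applying the row steps to it gives the law at time \<open>n'\<close>, and the component of column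
  \<open>a\<close> is isolated: the errors of the columns below \<open>a\<close> appear on the
  right, the columns above have mass at most the Poisson tail, and the Poisson law with mean
  \<open>c * r\<close> is the thinned mixture up to the same tail.\<close>

lemma row_column_weight_bound:
  assumes c: "0 < c" and r: "0 \<le> r" "r \<le> 1" and le: "m \<le> n" "n \<le> n'"
  shows "poisson_weight c a * mnorm a n' (\<lambda>D q. row_column_weight a (n' - n) D q - num_paths D * binomial_weight a r q)
    \<le> mnorm a n' (\<lambda>D q. marked_weight m n' D q - num_paths D * poisson_weight (c * r) q)
      + (\<Sum>j<a. poisson_weight c j * mnorm a n' (\<lambda>D q. row_column_weight j (n' - n) D q - num_paths D * binomial_weight j r q))
      + 2 * mnorm a n (\<lambda>D q. marked_weight m n D q - num_paths D * poisson_weight c q)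
      + 2 * (1 - (\<Sum>j\<le>a. poisson_weight c j))"
proof -
  define k where "k = n' - n"
  have n': "n + k = n'" using le by (simp add: k_def)
  define G where "G = marked_weight m n"
  define R where "R = mark_op row_next ^^ k"
  define X where "X j D q = row_column_weight j k D q - num_paths D * binomial_weight j r q" for j D q
  define err where "err D q = of_bool (q \<le> a) * (G D q - num_paths D * poisson_weight c q)" for D q
  define top where "top D q = of_bool (a < q) * G D q" for D q
  \<comment> \<open>The tail \<tau> enters twice: as mass of the marks beyond \<open>a\<close>
    (\<open>top\<close>), and as the part of the thinned Poisson law that stems from columns beyond
    \<open>a\<close> (\<open>t\<close>).\<close>
  define t where "t q = poisson_weight (c * r) q - (\<Sum>j\<le>a. poisson_weight c j * binomial_weight j r q)" for q
  define \<tau> where "\<tau> = 1 - (\<Sum>j\<le>a. poisson_weight c j)"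
  have RG: "R G = marked_weight m n'"
  proof -
    have "n' - m = k + (n - m)" using le n' by simp
    then show ?thesis unfolding R_def G_def marked_weight_def by (simp add: funpow_add)
  qed
  \<comment> \<open>The indices \<open>a + 1\<close> and \<open>a + 2\<close> carry the two
    remainders, so that linearity is needed for one finite sum only.\<close>
  have decomp: "G = (\<lambda>D q. \<Sum>j\<in>{..a + 2}. (if j \<le> a then poisson_weight c j else 1) *
      (if j \<le> a then \<lambda>D q. num_paths D * of_bool (q = j) else if j = Suc a then err else top) D q)"
  proof (intro ext)
    fix D q
    have "(\<Sum>j\<in>{..a + 2}. (if j \<le> a then poisson_weight c j else 1) *
      (if j \<le> a then \<lambda>D q. num_paths D * of_bool (q = j) else if j = Suc a then err else top) D q)
      = (\<Sum>j\<le>a. poisson_weight c j * (num_paths D * of_bool (q = j))) + err D q + top D q"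
      by (simp add: numeral_2_eq_2)
    also have "(\<Sum>j\<le>a. poisson_weight c j * (num_paths D * of_bool (q = j))) = (\<Sum>j\<le>a. if j = q then poisson_weight c q * num_paths D else 0)"
      by (intro sum.cong refl) auto
    also have "\<dots> + err D q + top D q = G D q" by (simp add: err_def top_def)
    finally show "G D q = (\<Sum>j\<in>{..a + 2}. (if j \<le> a then poisson_weight c j else 1) *
      (if j \<le> a then \<lambda>D q. num_paths D * of_bool (q = j) else if j = Suc a then err else top) D q)" by simp
  qed
  have RG': "R G D q = (\<Sum>j\<le>a. poisson_weight c j * row_column_weight j k D q) + R err D q + R top D q" for D q
    by (subst decomp, subst R_def, subst funpow_mark_op_sum) (simp add: R_def numeral_2_eq_2 row_column_weight_def)
  have eq: "poisson_weight c a * X a D q = (((marked_weight m n' D q - num_paths D * poisson_weight (c * r) q)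
      - (\<Sum>j<a. poisson_weight c j * X j D q)) - R err D q - R top D q) + num_paths D * t q" for D q
  proof -
    have "(\<Sum>j<a. poisson_weight c j * X j D q) + poisson_weight c a * X a D q = (\<Sum>j\<le>a. poisson_weight c j * X j D q)"
      by (simp add: lessThan_Suc_atMost[symmetric])
    also have "\<dots> = (\<Sum>j\<le>a. poisson_weight c j * row_column_weight j k D q) - num_paths D * (\<Sum>j\<le>a. poisson_weight c j * binomial_weight j r q)"
      by (simp add: X_def right_diff_distrib sum_subtractf sum_distrib_left ac_simps)
    finally show ?thesis using RG'[of D q] unfolding RG by (simp add: t_def algebra_simps)
  qed
  have err_norm: "mnorm a n' (R err) \<le> mnorm a n (\<lambda>D q. G D q - num_paths D * poisson_weight c q)"
  proof -
    have "mnorm a (n + k) (R err) \<le> mnorm a n err"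
      unfolding R_def by (rule mnorm_funpow_row) (simp add: err_def)
    also have "\<dots> \<le> mnorm a n (\<lambda>D q. G D q - num_paths D * poisson_weight c q)"
      by (rule mnorm_mono) (simp add: err_def)
    finally show ?thesis by (simp add: n')
  qed
  have top_norm: "mnorm a n' (R top) \<le> \<tau> + mnorm a n (\<lambda>D q. G D q - num_paths D * poisson_weight c q)"
  proof -
    have "mnorm a (n + k) (R top) \<le> mnorm (n + a) (n + k) (R top)" by (rule mnorm_mono_index) simp
    also have "\<dots> \<le> mnorm (n + a) n top"
      unfolding R_def by (rule mnorm_funpow_row) (simp add: top_def G_def marked_weight_support le)
    also have "\<dots> = mnorm (n + a) n G - mnorm a n G"
      using mnorm_split[of a "n + a" n G] unfolding top_def by simp
    also have "\<dots> \<le> 1 - mnorm a n G"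
      using mnorm_marked_weight_le_1[of m n "n + a"] le by (simp add: G_def)
    also have "mnorm a n G \<ge> mnorm a n (\<lambda>D q. num_paths D * poisson_weight c q) - mnorm a n (\<lambda>D q. G D q - num_paths D * poisson_weight c q)"
      using mnorm_diff_le[of a n G "\<lambda>D q. G D q - num_paths D * poisson_weight c q"] by simp
    then have "1 - mnorm a n G \<le> \<tau> + mnorm a n (\<lambda>D q. G D q - num_paths D * poisson_weight c q)"
      using c unfolding mnorm_product \<tau>_def by (simp add: poisson_weight_nonneg)
    finally show ?thesis by (simp add: n')
  qed
  have t_norm: "mnorm a n' (\<lambda>D q. num_paths D * t q) \<le> \<tau>"
  proof -
    have "(\<Sum>q\<le>a. \<bar>t q\<bar>) = (\<Sum>q\<le>a. t q)"
      using poisson_binomial_weight[where a = a and c = c and r = r] c r by (intro sum.cong refl) (simp add: t_def)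
    also have "\<dots> = (\<Sum>q\<le>a. poisson_weight (c * r) q) - (\<Sum>q\<le>a. \<Sum>j\<le>a. poisson_weight c j * binomial_weight j r q)"
      by (simp add: t_def sum_subtractf)
    also have "(\<Sum>q\<le>a. \<Sum>j\<le>a. poisson_weight c j * binomial_weight j r q) = (\<Sum>j\<le>a. \<Sum>q\<le>a. poisson_weight c j * binomial_weight j r q)"
      by (rule sum.swap)
    also have "\<dots> = (\<Sum>j\<le>a. poisson_weight c j)"
      unfolding sum_distrib_left[symmetric] by (intro sum.cong refl) (simp add: sum_binomial_weight)
    also have "(\<Sum>q\<le>a. poisson_weight (c * r) q) \<le> 1" using c r by (intro sum_poisson_weight_le_1) auto
    finally show ?thesis unfolding mnorm_product \<tau>_def by simp
  qed
  have "poisson_weight c a * mnorm a n' (X a) = mnorm a n' (\<lambda>D q. poisson_weight c a * X a D q)"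
    using c by (simp add: mnorm_cmult poisson_weight_nonneg)
  also have "\<dots> \<le> mnorm a n' (\<lambda>D q. ((marked_weight m n' D q - num_paths D * poisson_weight (c * r) q)
      - (\<Sum>j<a. poisson_weight c j * X j D q)) - R err D q - R top D q) + mnorm a n' (\<lambda>D q. num_paths D * t q)"
    unfolding eq by (rule mnorm_add_le)
  also have "mnorm a n' (\<lambda>D q. ((marked_weight m n' D q - num_paths D * poisson_weight (c * r) q)
      - (\<Sum>j<a. poisson_weight c j * X j D q)) - R err D q - R top D q)
     \<le> ((mnorm a n' (\<lambda>D q. marked_weight m n' D q - num_paths D * poisson_weight (c * r) q)
      + mnorm a n' (\<lambda>D q. \<Sum>j<a. poisson_weight c j * X j D q)) + mnorm a n' (R err)) + mnorm a n' (R top)"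
    by (intro order.trans[OF mnorm_diff_le] add_mono order_refl)
  also have "mnorm a n' (\<lambda>D q. \<Sum>j<a. poisson_weight c j * X j D q) \<le> (\<Sum>j<a. poisson_weight c j * mnorm a n' (X j))"
    using c by (intro order.trans[OF mnorm_sum_le]) (auto simp: mnorm_cmult poisson_weight_nonneg)
  finally have "poisson_weight c a * mnorm a n' (X a) \<le> mnorm a n' (\<lambda>D q. marked_weight m n' D q - num_paths D * poisson_weight (c * r) q)
      + (\<Sum>j<a. poisson_weight c j * mnorm a n' (X j)) + mnorm a n' (R err) + mnorm a n' (R top) + mnorm a n' (\<lambda>D q. num_paths D * t q)" by simp
  then show ?thesis
    using err_norm top_norm t_norm unfolding X_def G_def k_def \<tau>_def by simp
qed

text \<open>The mean \<open>c\<close> is free here: an auxiliary time \<open>m\<close> of about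
  \<open>c * sqrt n\<close> is introduced only to produce a Poisson law with small mean. In
  \<open>row_column_weight_bound\<close> everything but the tail tends to 0, by induction over
  \<open>a\<close>, and by \<open>poisson_tail_le\<close> the tail divided by the weight at
  \<open>a\<close> is O(c).\<close>

lemma row_column_weight_tendsto:
  fixes n n' :: "nat \<Rightarrow> nat"
  assumes n: "filterlim n at_top sequentially" and le: "eventually (\<lambda>i. n i \<le> n' i) sequentially"
    and nn': "(\<lambda>i. sqrt (real (n i) / real (n' i))) \<longlonglongrightarrow> r" and r: "0 < r" "r \<le> 1"
  shows "(\<lambda>i. mnorm N (n' i) (\<lambda>D q. row_column_weight a (n' i - n i) D q - num_paths D * binomial_weight a r q)) \<longlonglongrightarrow> 0"
proof (induction a arbitrary: N rule: less_induct)
  case (less a)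
  define F where "F j i = mnorm a (n' i) (\<lambda>D q. row_column_weight j (n' i - n i) D q - num_paths D * binomial_weight j r q)" for j i
  have n': "filterlim n' at_top sequentially"
    by (rule filterlim_at_top_mono[OF n le])
  have main: "F a \<longlonglongrightarrow> 0"
  proof (rule tendstoI)
    fix \<epsilon> :: real assume \<epsilon>: "\<epsilon> > 0"
    \<comment> \<open>With this \<open>c\<close> twice the tail is at most
      \<open>2 * 3 * \<epsilon> / 8\<close> times the weight at \<open>a\<close>, as
      \<open>exp c \<le> 3\<close>.\<close>
    define c where "c = min 1 (\<epsilon> / 8)"
    have c: "c > 0" "c \<le> 1" "c \<le> \<epsilon> / 8" using \<epsilon> by (auto simp: c_def)
    define m where "m i = nat \<lfloor>c * sqrt (real (n i))\<rfloor>" for i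
    have rn: "filterlim (\<lambda>i. real (n i)) at_top sequentially"
      by (rule filterlim_compose[OF filterlim_real_sequentially n])
    have "((\<lambda>x. real (nat \<lfloor>c * sqrt x\<rfloor>) / sqrt x) \<longlongrightarrow> c) at_top" using c by real_asymp
    from filterlim_compose[OF this rn] have mn: "(\<lambda>i. real (m i) / sqrt (real (n i))) \<longlonglongrightarrow> c" by (simp add: m_def)
    have "eventually (\<lambda>x. nat \<lfloor>c * sqrt x\<rfloor> \<le> x) at_top" using c by real_asymp
    from eventually_compose_filterlim[OF this n] have mle: "eventually (\<lambda>i. m i \<le> n i) sequentially" by (simp add: m_def)
    have "(\<lambda>i. real (m i) / sqrt (real (n i)) * sqrt (real (n i) / real (n' i))) \<longlonglongrightarrow> c * r"
      by (intro tendsto_mult mn nn')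
    moreover have "eventually (\<lambda>i. real (m i) / sqrt (real (n i)) * sqrt (real (n i) / real (n' i)) = real (m i) / sqrt (real (n' i))) sequentially"
      using eventually_compose_filterlim[OF eventually_gt_at_top[of 0] n] by eventually_elim (simp add: real_sqrt_divide)
    ultimately have mn': "(\<lambda>i. real (m i) / sqrt (real (n' i))) \<longlonglongrightarrow> c * r"
      by (rule Lim_transform_eventually)
    have mle': "eventually (\<lambda>i. m i \<le> n' i) sequentially" using mle le by eventually_elim simp
    define \<tau> where "\<tau> = 1 - (\<Sum>j\<le>a. poisson_weight c j)"
    define B where "B i = mnorm a (n' i) (\<lambda>D q. marked_weight (m i) (n' i) D q - num_paths D * poisson_weight (c * r) q)
      + (\<Sum>j<a. poisson_weight c j * F j i)
      + 2 * mnorm a (n i) (\<lambda>D q. marked_weight (m i) (n i) D q - num_paths D * poisson_weight c q) + 2 * \<tau>" for i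
    have "B \<longlonglongrightarrow> 0 + (\<Sum>j<a. poisson_weight c j * 0) + 2 * 0 + 2 * \<tau>"
      unfolding B_def F_def
      by (intro tendsto_intros marked_weight_tendsto_poisson[OF n' mn' _ mle'] marked_weight_tendsto_poisson[OF n mn _ mle] less.IH)
        (use c r in auto)
    then have "B \<longlonglongrightarrow> 2 * \<tau>" by simp
    moreover have "2 * \<tau> < \<epsilon> * poisson_weight c a"
    proof -
      have "\<tau> \<le> c * exp c * poisson_weight c a" unfolding \<tau>_def by (rule poisson_tail_le) (use c in simp)
      also have "\<dots> \<le> (\<epsilon> / 8 * 3) * poisson_weight c a"
      proof (intro mult_right_mono mult_mono)
        have "exp c \<le> exp 1" using c by simp
        then show "exp c \<le> 3" using exp_le by linarith
      qed (use c poisson_weight_nonneg in auto)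
      finally have "\<tau> \<le> 3 / 8 * (\<epsilon> * poisson_weight c a)" by (simp add: ac_simps)
      moreover have "0 < \<epsilon> * poisson_weight c a" using \<epsilon> poisson_weight_pos[of c a] c by simp
      ultimately show ?thesis by linarith
    qed
    ultimately have "eventually (\<lambda>i. B i < \<epsilon> * poisson_weight c a) sequentially" by (rule order_tendstoD(2))
    then show "eventually (\<lambda>i. dist (F a i) 0 < \<epsilon>) sequentially"
      using mle le
    proof eventually_elim
      case (elim i)
      have "poisson_weight c a * F a i \<le> B i"
        unfolding F_def B_def \<tau>_def by (rule row_column_weight_bound) (use elim c r in auto)
      also have "\<dots> < \<epsilon> * poisson_weight c a" by (rule elim(1))
      finally have "F a i < \<epsilon>" using poisson_weight_pos[of c a] c by (simp add: mult.commute)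
      then show ?case by (simp add: F_def)
    qed
  qed
  show ?case
  proof (rule tendsto_sandwich[OF always_eventually _ tendsto_const main])
    \<comment> \<open>Neither weight reaches beyond column \<open>a\<close>, so the window
      \<open>a\<close> already carries the whole norm for every \<open>N\<close>.\<close>
    show "eventually (\<lambda>i. mnorm N (n' i) (\<lambda>D q. row_column_weight a (n' i - n i) D q - num_paths D * binomial_weight a r q) \<le> F a i) sequentially"
      using le
    proof eventually_elim
      case (elim i)
      show ?case unfolding F_def
        using row_column_weight_support[of _ "n i" "n' i - n i" a] elim
        by (intro mnorm_support) (simp add: binomial_weight_support)
    qed
  qed simp
qed

subsection \<open>Joint weights of the mark at several times\<close>

text \<open>At each time \<open>t j\<close> only the marks in column \<open>a j\<close> are kept, so
  this counts growth paths with prescribed mark columns; see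
  \<open>joint_weight_count\<close>.\<close>

primrec joint_weight :: "nat \<Rightarrow> (nat \<Rightarrow> nat) \<Rightarrow> (nat \<Rightarrow> nat) \<Rightarrow> nat \<Rightarrow> (nat \<times> nat) set \<Rightarrow> nat \<Rightarrow> real" where
  "joint_weight m t a 0 = (\<lambda>D q. of_bool (q = a 0) * marked_weight m (t 0) D q)"
| "joint_weight m t a (Suc j) =
     (\<lambda>D q. of_bool (q = a (Suc j)) * (mark_op row_next ^^ (t (Suc j) - t j)) (joint_weight m t a j) D q)"

text \<open>The counts of a Poisson process below decreasing levels, as a Markov chain: a Poisson
  number of points below \<open>s 0\<close>, and each point below \<open>s j\<close> is below the
  next level with probability \<open>s (Suc j) / s j\<close>.\<close>

primrec joint_limit :: "(nat \<Rightarrow> real) \<Rightarrow> (nat \<Rightarrow> nat) \<Rightarrow> nat \<Rightarrow> real" where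
  "joint_limit s a 0 = poisson_weight (s 0) (a 0)"
| "joint_limit s a (Suc j) = binomial_weight (a j) (s (Suc j) / s j) (a (Suc j)) * joint_limit s a j"

lemma joint_weight_support: "q \<noteq> a j \<Longrightarrow> joint_weight m t a j D q = 0"
  by (cases j) simp_all

text \<open>Keeping one column makes the weight close to a multiple of a product weight again, so
  the mark restarts in column \<open>a j\<close> independently of the diagram and
  \<open>row_column_weight_tendsto\<close> applies to the next stretch. Later times mean lower
  levels, since \<open>s j\<close> is the limit of \<open>m / sqrt (t j)\<close>.\<close>

lemma joint_weight_tendsto:
  fixes m :: "nat \<Rightarrow> nat" and t :: "nat \<Rightarrow> nat \<Rightarrow> nat"
  assumes t0: "filterlim (\<lambda>i. t i 0) at_top sequentially"
    and s: "\<And>j. j \<le> k \<Longrightarrow> 0 < s j" "\<And>j. j < k \<Longrightarrow> s (Suc j) \<le> s j"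
    and t: "\<And>j. j < k \<Longrightarrow> eventually (\<lambda>i. t i j \<le> t i (Suc j)) sequentially"
    and mt: "\<And>j. j \<le> k \<Longrightarrow> (\<lambda>i. real (m i) / sqrt (real (t i j))) \<longlonglongrightarrow> s j"
    and m: "eventually (\<lambda>i. m i \<le> t i 0) sequentially"
    and j: "j \<le> k"
  shows "filterlim (\<lambda>i. t i j) at_top sequentially \<and>
    (\<forall>N. (\<lambda>i. mnorm N (t i j) (\<lambda>D q. joint_weight (m i) (t i) a j D q - joint_limit s a j * (num_paths D * of_bool (q = a j)))) \<longlonglongrightarrow> 0)"
  using j
proof (induction j)
  case 0
  have "(\<lambda>i. mnorm N (t i 0) (\<lambda>D q. joint_weight (m i) (t i) a 0 D q - joint_limit s a 0 * (num_paths D * of_bool (q = a 0)))) \<longlonglongrightarrow> 0" for N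
  proof (rule tendsto_sandwich[where f = "\<lambda>_. 0"])
    show "(\<lambda>i. mnorm N (t i 0) (\<lambda>D q. marked_weight (m i) (t i 0) D q - num_paths D * poisson_weight (s 0) q)) \<longlonglongrightarrow> 0"
      using s(1)[of 0] mt[of 0] by (intro marked_weight_tendsto_poisson t0 m) auto
    show "eventually (\<lambda>i. mnorm N (t i 0) (\<lambda>D q. joint_weight (m i) (t i) a 0 D q - joint_limit s a 0 * (num_paths D * of_bool (q = a 0)))
      \<le> mnorm N (t i 0) (\<lambda>D q. marked_weight (m i) (t i 0) D q - num_paths D * poisson_weight (s 0) q)) sequentially"
      by (intro always_eventually allI mnorm_mono) (auto simp: mult.commute)
  qed auto
  then show ?case using t0 by blast
next
  case (Suc j)
  then have IH: "filterlim (\<lambda>i. t i j) at_top sequentially"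
    "\<And>N. (\<lambda>i. mnorm N (t i j) (\<lambda>D q. joint_weight (m i) (t i) a j D q - joint_limit s a j * (num_paths D * of_bool (q = a j)))) \<longlonglongrightarrow> 0"
    by auto
  have tj: "eventually (\<lambda>i. t i j \<le> t i (Suc j)) sequentially" using t[of j] Suc.prems by simp
  have top: "filterlim (\<lambda>i. t i (Suc j)) at_top sequentially" by (rule filterlim_at_top_mono[OF IH(1) tj])
  define r where "r = s (Suc j) / s j"
  have sj: "0 < s j" "0 < s (Suc j)" "s (Suc j) \<le> s j" using s Suc.prems by auto
  then have r: "0 < r" "r \<le> 1" by (auto simp: r_def)
  have "(\<lambda>i. (real (m i) / sqrt (real (t i (Suc j)))) / (real (m i) / sqrt (real (t i j)))) \<longlonglongrightarrow> r"
    unfolding r_def using mt[of j] mt[of "Suc j"] Suc.prems sj by (intro tendsto_divide) auto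
  moreover have "eventually (\<lambda>i. (real (m i) / sqrt (real (t i (Suc j)))) / (real (m i) / sqrt (real (t i j))) = sqrt (real (t i j) / real (t i (Suc j)))) sequentially"
  proof -
    have "eventually (\<lambda>i. real (m i) / sqrt (real (t i j)) > 0) sequentially"
      using order_tendstoD(1)[OF mt[of j], of 0] sj Suc.prems by auto
    then show ?thesis
    proof eventually_elim
      case (elim i)
      then have "m i \<noteq> 0" by (cases "m i = 0") auto
      then show ?case by (simp add: real_sqrt_divide)
    qed
  qed
  ultimately have ratio: "(\<lambda>i. sqrt (real (t i j) / real (t i (Suc j)))) \<longlonglongrightarrow> r" by (rule Lim_transform_eventually)
  define \<kappa> where "\<kappa> = joint_limit s a j"
  have "(\<lambda>i. mnorm N (t i (Suc j)) (\<lambda>D q. joint_weight (m i) (t i) a (Suc j) D q - joint_limit s a (Suc j) * (num_paths D * of_bool (q = a (Suc j))))) \<longlonglongrightarrow> 0" for N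
  proof (rule tendsto_sandwich[where f = "\<lambda>_. 0"])
    let ?A = "\<lambda>i. mnorm (a j) (t i j) (\<lambda>D q. joint_weight (m i) (t i) a j D q - \<kappa> * (num_paths D * of_bool (q = a j)))"
    let ?B = "\<lambda>i. mnorm N (t i (Suc j)) (\<lambda>D q. row_column_weight (a j) (t i (Suc j) - t i j) D q - num_paths D * binomial_weight (a j) r q)"
    have "(\<lambda>i. ?A i + \<bar>\<kappa>\<bar> * ?B i) \<longlonglongrightarrow> 0 + \<bar>\<kappa>\<bar> * 0"
      unfolding \<kappa>_def by (intro tendsto_intros IH row_column_weight_tendsto[OF IH(1) tj ratio r])
    then show "(\<lambda>i. ?A i + \<bar>\<kappa>\<bar> * ?B i) \<longlonglongrightarrow> 0" by simp
    show "eventually (\<lambda>i. mnorm N (t i (Suc j)) (\<lambda>D q. joint_weight (m i) (t i) a (Suc j) D q - joint_limit s a (Suc j) * (num_paths D * of_bool (q = a (Suc j))))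
        \<le> ?A i + \<bar>\<kappa>\<bar> * ?B i) sequentially"
      using tj
    proof eventually_elim
      case (elim i)
      define k where "k = t i (Suc j) - t i j"
      define g where "g = joint_weight (m i) (t i) a j"
      \<comment> \<open>The error before this stretch lives in column \<open>a j\<close> only, so
        the row steps do not increase its norm.\<close>
      define d where "d D q = g D q - \<kappa> * (num_paths D * of_bool (q = a j))" for D q
      have k: "t i j + k = t i (Suc j)" using elim by (simp add: k_def)
      have dk: "(mark_op row_next ^^ k) d = (\<lambda>D q. (mark_op row_next ^^ k) g D q - \<kappa> * row_column_weight (a j) k D q)"
        using funpow_mark_op_linear[where \<alpha> = 1 and \<beta> = "- \<kappa>" and g = g and h = "\<lambda>D q. num_paths D * of_bool (q = a j)" and k = k]
        by (simp add: d_def[abs_def] row_column_weight_def)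
      have "mnorm N (t i (Suc j)) (\<lambda>D q. joint_weight (m i) (t i) a (Suc j) D q - joint_limit s a (Suc j) * (num_paths D * of_bool (q = a (Suc j))))
        \<le> mnorm N (t i (Suc j)) (\<lambda>D q. (mark_op row_next ^^ k) d D q + \<kappa> * (row_column_weight (a j) k D q - num_paths D * binomial_weight (a j) r q))"
        unfolding dk by (intro mnorm_mono) (auto simp: g_def k_def \<kappa>_def r_def algebra_simps)
      also have "\<dots> \<le> mnorm N (t i (Suc j)) ((mark_op row_next ^^ k) d) + \<bar>\<kappa>\<bar> * ?B i"
        using mnorm_add_le[of N "t i (Suc j)" "(mark_op row_next ^^ k) d"
            "\<lambda>D q. \<kappa> * (row_column_weight (a j) k D q - num_paths D * binomial_weight (a j) r q)"]
        unfolding mnorm_cmult k_def by simp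
      also have "mnorm N (t i (Suc j)) ((mark_op row_next ^^ k) d) \<le> ?A i"
      proof -
        have supp: "d D q = 0" if "a j < q" for D q
          using that by (simp add: d_def g_def joint_weight_support)
        have "mnorm N (t i j + k) ((mark_op row_next ^^ k) d) \<le> mnorm (a j) (t i j + k) ((mark_op row_next ^^ k) d)"
          by (intro mnorm_support funpow_row_op_support[where n = "t i j" and N = "a j"]) (auto simp: supp)
        also have "\<dots> \<le> mnorm (a j) (t i j) d"
          by (rule mnorm_funpow_row) (simp add: supp)
        finally show ?thesis by (simp add: k d_def[abs_def] g_def)
      qed
      finally show ?case by simp
    qed
  qed auto
  then show ?case using top by blast
qed

lemma mnorm_member:
  assumes "q \<le> N"
  shows "(\<Sum>D\<in>diagrams n. num_paths D * \<bar>g D q\<bar>) / fact n \<le> mnorm N n g"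
proof -
  have "num_paths D * \<bar>g D q\<bar> \<le> num_paths D * (\<Sum>q\<le>N. \<bar>g D q\<bar>)" for D
    using assms by (intro mult_left_mono member_le_sum) auto
  then show ?thesis unfolding mnorm_def by (intro divide_right_mono sum_mono) auto
qed

theorem joint_weight_sum_tendsto:
  fixes m :: "nat \<Rightarrow> nat" and t :: "nat \<Rightarrow> nat \<Rightarrow> nat"
  assumes "filterlim (\<lambda>i. t i 0) at_top sequentially"
    and "\<And>j. j \<le> k \<Longrightarrow> 0 < s j" "\<And>j. j < k \<Longrightarrow> s (Suc j) \<le> s j"
    and "\<And>j. j < k \<Longrightarrow> eventually (\<lambda>i. t i j \<le> t i (Suc j)) sequentially"
    and "\<And>j. j \<le> k \<Longrightarrow> (\<lambda>i. real (m i) / sqrt (real (t i j))) \<longlonglongrightarrow> s j"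
    and "eventually (\<lambda>i. m i \<le> t i 0) sequentially"
  shows "(\<lambda>i. (\<Sum>D\<in>diagrams (t i k). num_paths D * joint_weight (m i) (t i) a k D (a k)) / fact (t i k)) \<longlonglongrightarrow> joint_limit s a k"
proof -
  define \<kappa> where "\<kappa> = joint_limit s a k"
  define d where "d i D q = joint_weight (m i) (t i) a k D q - \<kappa> * (num_paths D * of_bool (q = a k))" for i D q
  define S where "S i = (\<Sum>D\<in>diagrams (t i k). num_paths D * joint_weight (m i) (t i) a k D (a k)) / fact (t i k)" for i
  have lim: "(\<lambda>i. mnorm (a k) (t i k) (d i)) \<longlonglongrightarrow> 0"
    using joint_weight_tendsto[OF assms order_refl] by (simp add: d_def[abs_def] \<kappa>_def)
  have bound: "\<bar>S i - \<kappa>\<bar> \<le> mnorm (a k) (t i k) (d i)" for i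
  proof -
    have "(\<Sum>D\<in>diagrams (t i k). num_paths D * (\<kappa> * num_paths D)) = \<kappa> * (\<Sum>D\<in>diagrams (t i k). (num_paths D)\<^sup>2)"
      by (simp add: sum_distrib_left power2_eq_square ac_simps)
    then have "\<kappa> = (\<Sum>D\<in>diagrams (t i k). num_paths D * (\<kappa> * num_paths D)) / fact (t i k)"
      by (simp add: sum_num_paths_squared)
    moreover have "(\<Sum>D\<in>diagrams (t i k). num_paths D * d i D (a k)) / fact (t i k)
        = S i - (\<Sum>D\<in>diagrams (t i k). num_paths D * (\<kappa> * num_paths D)) / fact (t i k)"
      by (simp add: S_def d_def right_diff_distrib sum_subtractf diff_divide_distrib)
    ultimately have "S i - \<kappa> = (\<Sum>D\<in>diagrams (t i k). num_paths D * d i D (a k)) / fact (t i k)"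
      by presburger
    moreover have "\<bar>\<Sum>D\<in>diagrams (t i k). num_paths D * d i D (a k)\<bar> \<le> (\<Sum>D\<in>diagrams (t i k). num_paths D * \<bar>d i D (a k)\<bar>)"
      using sum_abs[of "\<lambda>D. num_paths D * d i D (a k)" "diagrams (t i k)"] by (simp add: abs_mult)
    ultimately have "\<bar>S i - \<kappa>\<bar> \<le> (\<Sum>D\<in>diagrams (t i k). num_paths D * \<bar>d i D (a k)\<bar>) / fact (t i k)"
      by (simp add: divide_right_mono)
    also have "\<dots> \<le> mnorm (a k) (t i k) (d i)"
      by (rule mnorm_member[where g = "d i" and q = "a k", OF order_refl])
    finally show ?thesis .
  qed
  have "S \<longlonglongrightarrow> \<kappa>"
    by (rule LIM_zero_cancel, rule Lim_null_comparison[OF always_eventually lim]) (simp add: bound)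
  then show ?thesis unfolding S_def \<kappa>_def .
qed

text \<open>Two descriptions of a Poisson process at the levels \<open>d\<close> and
  \<open>c\<close>: thinning on the left, independent increments on the right.\<close>

lemma poisson_times_binomial_weight:
  assumes "b \<le> a" "c > 0" "d > 0"
  shows "poisson_weight c a * binomial_weight a (d / c) b = poisson_weight d b * poisson_weight (c - d) (a - b)"
proof -
  have "c ^ a = c ^ b * c ^ (a - b)" using assms(1) by (simp add: power_add[symmetric])
  moreover have "(1 - d / c) ^ (a - b) = (c - d) ^ (a - b) / c ^ (a - b)"
    using assms by (simp add: power_divide[symmetric] diff_divide_distrib)
  moreover have "exp (- c) = exp (- d) * exp (- (c - d))" by (simp add: exp_add[symmetric])
  ultimately show ?thesis
    using assms by (simp add: poisson_weight_def binomial_weight_def binomial_fact power_divide)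
qed

lemma mult_if_zero:
  fixes b x y :: real
  assumes "b * x = y"
  shows "b * (if P then x else 0) = (if P then y else 0)"
  using assms by simp

text \<open>By \<open>poisson_times_binomial_weight\<close> the chain of thinnings has independent
  Poisson increments, which is the form that the exponential waiting times produce later.\<close>

lemma joint_limit_product:
  assumes "\<And>i. i \<le> j \<Longrightarrow> 0 < s i"
  shows "joint_limit s a j = (if \<forall>i<j. a (Suc i) \<le> a i
    then poisson_weight (s j) (a j) * (\<Prod>i<j. poisson_weight (s i - s (Suc i)) (a i - a (Suc i))) else 0)"
  using assms
proof (induction j)
  case (Suc j)
  show ?case
  proof (cases "a (Suc j) \<le> a j")
    case True
    have "poisson_weight (s j) (a j) * binomial_weight (a j) (s (Suc j) / s j) (a (Suc j))
        = poisson_weight (s (Suc j)) (a (Suc j)) * poisson_weight (s j - s (Suc j)) (a j - a (Suc j))"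
      using True Suc.prems by (intro poisson_times_binomial_weight) auto
    then have e: "binomial_weight (a j) (s (Suc j) / s j) (a (Suc j)) * (poisson_weight (s j) (a j) * p)
        = poisson_weight (s (Suc j)) (a (Suc j)) * (p * poisson_weight (s j - s (Suc j)) (a j - a (Suc j)))" for p
      by (metis mult.assoc mult.commute)
    have all: "(\<forall>i<Suc j. a (Suc i) \<le> a i) \<longleftrightarrow> (\<forall>i<j. a (Suc i) \<le> a i)" using True by (auto simp: less_Suc_eq)
    have IH: "joint_limit s a j = (if \<forall>i<j. a (Suc i) \<le> a i
      then poisson_weight (s j) (a j) * (\<Prod>i<j. poisson_weight (s i - s (Suc i)) (a i - a (Suc i))) else 0)"
      by (rule Suc.IH) (use Suc.prems in simp)
    show ?thesis
      unfolding joint_limit.simps IH all prod.lessThan_Suc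
      by (rule mult_if_zero, rule e)
  next
    case False
    then have "\<not> (\<forall>i<Suc j. a (Suc i) \<le> a i)" by blast
    then show ?thesis using False by (simp only: if_False joint_limit.simps binomial_weight_support not_le mult_zero_left)
  qed
qed simp

section \<open>Row insertion\<close>

definition semistandard :: "'a::linorder tableau \<Rightarrow> bool" where
  "semistandard t \<longleftrightarrow> diagram (dom t)
     \<and> (\<forall>x x' y a b. x \<le> x' \<and> t (x, y) = Some a \<and> t (x', y) = Some b \<longrightarrow> a \<le> b)
     \<and> (\<forall>x y a b. t (x, y) = Some a \<and> t (x, Suc y) = Some b \<longrightarrow> a < b)"

lemma semistandardD:
  assumes "semistandard t"
  shows "diagram (dom t)"
    and "x \<le> x' \<Longrightarrow> t (x, y) = Some a \<Longrightarrow> t (x', y) = Some b \<Longrightarrow> a \<le> b"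
    and "t (x, y) = Some a \<Longrightarrow> t (x, Suc y) = Some b \<Longrightarrow> a < b"
  using assms unfolding semistandard_def by blast+

lemma semistandard_empty: "semistandard (\<lambda>_. None)"
  by (simp add: semistandard_def dom_def)

lemma semistandard_mono:
  assumes t: "semistandard t" and "x' \<le> x" "y' \<le> y" "t (x', y') = Some a" "t (x, y) = Some b"
  shows "a \<le> b"
  using assms(3,5)
proof (induction y arbitrary: b rule: dec_induct)
  case base
  then show ?case using semistandardD(2)[OF t assms(2)] assms(4) by blast
next
  case (step y)
  have "(x, y) \<in> dom t" by (rule diagramD[OF semistandardD(1)[OF t], of x "Suc y"]) (use step in auto)
  then obtain c where "t (x, y) = Some c" by auto
  then show ?case using step.IH semistandardD(3)[OF t] step.prems by fastforce
qed

lemma insertion_column_prefix: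
  assumes t: "semistandard t" and x: "x < insertion_column t y a"
  obtains b where "t (x, y) = Some b" "b \<le> a"
proof (cases "\<exists>x c. t (x, y) = Some c \<and> a < c")
  case True
  then have c: "insertion_column t y a = (LEAST x. \<exists>c. t (x, y) = Some c \<and> a < c)"
    by (auto simp: insertion_column_def)
  obtain b where "t (insertion_column t y a, y) = Some b"
    using LeastI_ex[of "\<lambda>x. \<exists>c. t (x, y) = Some c \<and> a < c"] True unfolding c by blast
  then have "(x, y) \<in> dom t"
    using diagramD[OF semistandardD(1)[OF t], of "insertion_column t y a" y x y] x by auto
  moreover have "\<not> (\<exists>c. t (x, y) = Some c \<and> a < c)"
    using not_less_Least[of x "\<lambda>x. \<exists>c. t (x, y) = Some c \<and> a < c"] x unfolding c by blast
  ultimately show ?thesis using that by fastforce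
next
  case False
  then have c: "insertion_column t y a = (LEAST x. t (x, y) = None)"
    by (auto simp: insertion_column_def)
  have "t (x, y) \<noteq> None" using not_less_Least[of x "\<lambda>x. t (x, y) = None"] x unfolding c by blast
  then show ?thesis using that False by fastforce
qed

lemma insertion_column_box:
  assumes t: "semistandard t"
  shows "t (insertion_column t y a, y) = None \<or> (\<exists>b. t (insertion_column t y a, y) = Some b \<and> a < b)"
proof (cases "\<exists>x c. t (x, y) = Some c \<and> a < c")
  case True
  then have c: "insertion_column t y a = (LEAST x. \<exists>c. t (x, y) = Some c \<and> a < c)"
    by (auto simp: insertion_column_def)
  show ?thesis
    using LeastI_ex[of "\<lambda>x. \<exists>c. t (x, y) = Some c \<and> a < c"] True unfolding c by blast
next
  case False
  then have c: "insertion_column t y a = (LEAST x. t (x, y) = None)"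
    by (auto simp: insertion_column_def)
  have "t (rowlen (dom t) y, y) = None"
    using rowlen_iff[OF semistandardD(1)[OF t], of "rowlen (dom t) y" y] by auto
  then show ?thesis unfolding c by (metis (mono_tags, lifting) LeastI)
qed

text \<open>The recursion \<open>arriving\<close> unrolled: \<open>Y\<close> is the row of the new
  box, \<open>c y\<close> the column used and \<open>v y\<close> the number inserted in row
  \<open>y\<close>. The arguments on shapes below start from these properties.\<close>

lemma insertion_run:
  fixes t :: "'a::linorder tableau"
  assumes t: "semistandard t"
  obtains Y c v where "v 0 = a"
    "\<And>y x. y \<le> Y \<Longrightarrow> x < c y \<Longrightarrow> \<exists>b. t (x, y) = Some b \<and> b \<le> v y"
    "\<And>y. y < Y \<Longrightarrow> t (c y, y) = Some (v (Suc y))" "t (c Y, Y) = None"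
    "\<And>y. y < Y \<Longrightarrow> v y < v (Suc y)"
    "\<And>x y. row_insert t a (x, y) = (if y \<le> Y \<and> x = c y then Some (v y) else t (x, y))"
proof -
  have None_mono: "arriving t a y' = None" if "arriving t a y = None" "y \<le> y'" for y y'
    using that(2,1) by (induction y' rule: dec_induct) auto
  \<comment> \<open>The row whose index is the number of entries is empty, so the insertion stops
    there at the latest.\<close>
  have bound: "arriving t a (Suc (card (dom t))) = None"
  proof -
    have "(x, card (dom t)) \<notin> dom t" for x
      using diagram_subset_square[OF semistandardD(1)[OF t]] by auto
    then have "t (x, card (dom t)) = None" for x by auto
    then show ?thesis by (cases "arriving t a (card (dom t))") auto
  qed
  define Z where "Z = (LEAST y. arriving t a y = None)"
  have Z: "arriving t a Z = None" unfolding Z_def using bound by (rule LeastI)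
  have Zless: "arriving t a y \<noteq> None" if "y < Z" for y
    using not_less_Least[of y "\<lambda>y. arriving t a y = None"] that unfolding Z_def by blast
  have "Z \<noteq> 0" using Z by (cases Z) auto
  then obtain Y where Y: "Z = Suc Y" by (cases Z) auto
  define v where "v y = the (arriving t a y)" for y
  define c where "c y = insertion_column t y (v y)" for y
  have v: "arriving t a y = Some (v y)" if "y \<le> Y" for y
    using Zless[of y] that Y by (auto simp: v_def)
  have step: "t (c y, y) = Some (v (Suc y))" if "y < Y" for y
    using v[of "Suc y"] v[of y] that by (simp add: c_def)
  show ?thesis
  proof (rule that[of v Y c])
    show "v 0 = a" by (simp add: v_def)
    show "\<exists>b. t (x, y) = Some b \<and> b \<le> v y" if "x < c y" for x y
      using insertion_column_prefix[OF t that[unfolded c_def]] by blast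
    show "t (c y, y) = Some (v (Suc y))" if "y < Y" for y by (rule step[OF that])
    show "t (c Y, Y) = None" using Z v[of Y] unfolding Y by (simp add: c_def)
    show "v y < v (Suc y)" if "y < Y" for y
      using insertion_column_box[OF t, of y "v y"] step[OF that] by (auto simp: c_def)
    show "row_insert t a (x, y) = (if y \<le> Y \<and> x = c y then Some (v y) else t (x, y))" for x y
    proof (cases "y \<le> Y")
      case True
      then show ?thesis by (simp add: row_insert_def v c_def)
    next
      case False
      then have "arriving t a y = None" using None_mono[OF Z, of y] Y by simp
      then show ?thesis using False by (simp add: row_insert_def)
    qed
  qed
qed

lemma row_insert_semistandard:
  assumes t: "semistandard t"
  obtains b where "b \<in> addable (dom t)" "dom (row_insert t a) = insert b (dom t)" "semistandard (row_insert t a)"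
proof -
  obtain Y c v where run: "v 0 = a"
    "\<And>y x. y \<le> Y \<Longrightarrow> x < c y \<Longrightarrow> \<exists>b. t (x, y) = Some b \<and> b \<le> v y"
    "\<And>y. y < Y \<Longrightarrow> t (c y, y) = Some (v (Suc y))" "t (c Y, Y) = None"
    "\<And>y. y < Y \<Longrightarrow> v y < v (Suc y)"
    and R: "\<And>x y. row_insert t a (x, y) = (if y \<le> Y \<and> x = c y then Some (v y) else t (x, y))"
    by (rule insertion_run[OF t, of a]) (rule that)
  have D: "diagram (dom t)" by (rule semistandardD(1)[OF t])
  \<comment> \<open>Routes move weakly to the left: otherwise the box above the bumped number
    \<open>v (Suc y)\<close> would hold an entry of at most \<open>v (Suc y)\<close>, against
    strictness of columns.\<close>
  have left: "c (Suc y) \<le> c y" if y: "y < Y" for y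
  proof (rule ccontr)
    assume "\<not> c (Suc y) \<le> c y"
    then obtain b where "t (c y, Suc y) = Some b" "b \<le> v (Suc y)"
      using run(2)[of "Suc y" "c y"] y by auto
    then show False using semistandardD(3)[OF t run(3)[OF y]] by fastforce
  qed
  have cY: "c Y = rowlen (dom t) Y"
  proof -
    have "\<not> c Y < rowlen (dom t) Y" using run(4) rowlen_iff[OF D, of "c Y" Y] by auto
    moreover have "\<not> rowlen (dom t) Y < c Y"
      using run(2)[of Y "rowlen (dom t) Y"] rowlen_iff[OF D, of "rowlen (dom t) Y" Y] by auto
    ultimately show ?thesis by simp
  qed
  have add: "(c Y, Y) \<in> addable (dom t)"
    unfolding addable_iff[OF D]
  proof (intro conjI cY disjCI)
    assume "\<not> rowlen (dom t) Y < rowlen (dom t) (Y - 1)"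
    show "Y = 0"
    proof (rule ccontr)
      assume "Y \<noteq> 0"
      then obtain y where y: "Y = Suc y" by (cases Y) auto
      then have "(c y, y) \<in> dom t" using run(3)[of y] by auto
      then have "(c Y, y) \<in> dom t" by (rule diagramD[OF D]) (use left[of y] y in auto)
      then show False using \<open>\<not> rowlen (dom t) Y < _\<close> rowlen_iff[OF D, of "c Y" y] cY y by simp
    qed
  qed
  have dom: "dom (row_insert t a) = insert (c Y, Y) (dom t)"
  proof (rule set_eqI)
    fix b :: "nat \<times> nat"
    obtain x y where b: "b = (x, y)" by (cases b)
    show "b \<in> dom (row_insert t a) \<longleftrightarrow> b \<in> insert (c Y, Y) (dom t)"
    proof (cases "y \<le> Y \<and> x = c y")
      case True
      then show ?thesis using run(3)[of y] b by (cases "y = Y") (auto simp: R)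
    next
      case False
      then show ?thesis using b by (auto simp: R domIff)
    qed
  qed
  have "semistandard (row_insert t a)"
    unfolding semistandard_def
  proof (intro conjI allI impI)
    show "diagram (dom (row_insert t a))" unfolding dom by (rule addable_diagram[OF add])
    fix x x' y p q
    assume *: "x \<le> x' \<and> row_insert t a (x, y) = Some p \<and> row_insert t a (x', y) = Some q"
    show "p \<le> q"
    proof (cases "y \<le> Y \<and> (x = c y \<or> x' = c y)")
      case False
      then show ?thesis using * semistandardD(2)[OF t, of x x' y] R[of x y] R[of x' y] by (auto split: if_splits)
    next
      case True
      show ?thesis
      proof (cases "x = x'")
        case False
        consider "x' = c y" "x < c y" | "x = c y" "c y < x'" using True False * by (metis le_neq_implies_less)
        then show ?thesis
        proof cases
          case 1
          then show ?thesis using run(2)[of y x] True * 1 R[of x y] R[of x' y] by (auto split: if_splits)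
        next
          case 2
          then have q: "t (x', y) = Some q" "p = v y" using * True 2 R[of x y] R[of x' y] by (auto split: if_splits)
          then have "(c y, y) \<in> dom t" using 2 q by - (rule diagramD[OF D, of x' y], auto)
          then have "y < Y" using run(4) True by (cases "y = Y") auto
          then have "v (Suc y) \<le> q" using semistandardD(2)[OF t _ run(3) q(1)] 2 by simp
          then show ?thesis using q run(5)[OF \<open>y < Y\<close>] by simp
        qed
      qed (use * in auto)
    qed
  next
    fix x y p q
    assume *: "row_insert t a (x, y) = Some p \<and> row_insert t a (x, Suc y) = Some q"
    show "p < q"
    proof (cases "Suc y \<le> Y \<and> x = c (Suc y)")
      case True
      then have q: "q = v (Suc y)" and y: "y < Y" using * R[of x y] R[of x "Suc y"] by (auto split: if_splits)
      show ?thesis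
      proof (cases "x = c y")
        case True
        then show ?thesis using * y run(5)[OF y] q R[of x y] R[of x "Suc y"] by (simp split: if_splits)
      next
        case False
        then have "x < c y" using left[OF y] True by simp
        then obtain b where "t (x, y) = Some b" "b \<le> v y" using run(2)[of y x] y by auto
        then have "p \<le> v y" using * False R[of x y] R[of x "Suc y"] by (simp split: if_splits)
        then show ?thesis using q run(5)[OF y] by simp
      qed
    next
      case False
      then have q: "t (x, Suc y) = Some q" using * R[of x y] R[of x "Suc y"] by (auto split: if_splits)
      show ?thesis
      proof (cases "y \<le> Y \<and> x = c y")
        case True
        have "(c y, y) \<in> dom t" using q True by - (rule diagramD[OF D, of x "Suc y"], auto)
        then have "y < Y" using run(4) True by (cases "y = Y") auto
        then have "v (Suc y) < q" using semistandardD(3)[OF t run(3) ] q True by simp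
        then show ?thesis using run(5)[OF \<open>y < Y\<close>] * True R[of x y] R[of x "Suc y"] by (simp split: if_splits)
      next
        case False
        then show ?thesis using * q semistandardD(3)[OF t, of x y] R[of x y] R[of x "Suc y"] by (auto split: if_splits)
      qed
    qed
  qed
  then show ?thesis using that add dom by blast
qed

text \<open>Reverse bumping: in each row below the new box, the changed box is the last one with an entry
  smaller than the entry bumped out of that row.\<close>

lemma row_insert_inj:
  assumes t1: "semistandard t1" and t2: "semistandard t2" and d: "dom t1 = dom t2"
    and e: "row_insert t1 a1 = row_insert t2 a2"
  shows "t1 = t2 \<and> a1 = a2"
proof -
  define s where "s = row_insert t1 a1"
  obtain Y1 c1 v1 where r1: "v1 0 = a1"
    "\<And>y x. y \<le> Y1 \<Longrightarrow> x < c1 y \<Longrightarrow> \<exists>b. t1 (x, y) = Some b \<and> b \<le> v1 y"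
    "\<And>y. y < Y1 \<Longrightarrow> t1 (c1 y, y) = Some (v1 (Suc y))" "t1 (c1 Y1, Y1) = None"
    "\<And>y. y < Y1 \<Longrightarrow> v1 y < v1 (Suc y)"
    and R1': "\<And>x y. row_insert t1 a1 (x, y) = (if y \<le> Y1 \<and> x = c1 y then Some (v1 y) else t1 (x, y))"
    by (rule insertion_run[OF t1, of a1]) (rule that)
  note R1 = R1'[folded s_def]
  obtain Y2 c2 v2 where r2: "v2 0 = a2"
    "\<And>y x. y \<le> Y2 \<Longrightarrow> x < c2 y \<Longrightarrow> \<exists>b. t2 (x, y) = Some b \<and> b \<le> v2 y"
    "\<And>y. y < Y2 \<Longrightarrow> t2 (c2 y, y) = Some (v2 (Suc y))" "t2 (c2 Y2, Y2) = None"
    "\<And>y. y < Y2 \<Longrightarrow> v2 y < v2 (Suc y)"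
    and R2': "\<And>x y. row_insert t2 a2 (x, y) = (if y \<le> Y2 \<and> x = c2 y then Some (v2 y) else t2 (x, y))"
    by (rule insertion_run[OF t2, of a2]) (rule that)
  note R2 = R2'[folded e, folded s_def]
  \<comment> \<open>The domains tell where a run ended: its new box is the only one that is empty
    before and filled in the result.\<close>
  have new: "(c Y, Y) \<in> dom s - dom t \<and> (\<forall>b\<in>dom s - dom t. b = (c Y, Y))"
    if "\<And>y. y < Y \<Longrightarrow> t (c y, y) = Some (v (Suc y))" "t (c Y, Y) = None"
      "\<And>x y. s (x, y) = (if y \<le> Y \<and> x = c y then Some (v y) else t (x, y))"
    for t :: "'a tableau" and Y c and v :: "nat \<Rightarrow> 'a"
  proof (intro conjI ballI)
    show "(c Y, Y) \<in> dom s - dom t" using that by auto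
    fix b assume b: "b \<in> dom s - dom t"
    obtain x y where xy: "b = (x, y)" by (cases b)
    have "y \<le> Y \<and> x = c y" using b that(3)[of x y] unfolding xy by (auto split: if_splits)
    moreover from this have "\<not> y < Y" using b that(1)[of y] unfolding xy by auto
    ultimately show "b = (c Y, Y)" using xy by auto
  qed
  have "(c1 Y1, Y1) = (c2 Y2, Y2)"
    using new[OF r1(3,4) R1] new[OF r2(3,4) R2] unfolding d by blast
  then have Y: "Y2 = Y1" "c2 Y1 = c1 Y1" by auto
  have small: "{x. \<exists>w. s (x, y) = Some w \<and> w < v (Suc y)} = {..c y}"
    if t: "semistandard t" and y: "y < Y"
      and p2: "\<And>y x. y \<le> Y \<Longrightarrow> x < c y \<Longrightarrow> \<exists>b. t (x, y) = Some b \<and> b \<le> v y"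
      and p3: "\<And>y. y < Y \<Longrightarrow> t (c y, y) = Some (v (Suc y))" and p5: "\<And>y. y < Y \<Longrightarrow> v y < v (Suc y)"
      and pR: "\<And>x y. s (x, y) = (if y \<le> Y \<and> x = c y then Some (v y) else t (x, y))"
    for t :: "'a tableau" and Y c v y
  proof (rule set_eqI)
    fix x
    consider "x < c y" | "x = c y" | "c y < x" by linarith
    then show "x \<in> {x. \<exists>w. s (x, y) = Some w \<and> w < v (Suc y)} \<longleftrightarrow> x \<in> {..c y}"
    proof cases
      case 1
      then obtain b where "t (x, y) = Some b" "b \<le> v y" using p2[of y x] y by auto
      then show ?thesis using 1 p5[OF y] by (simp add: pR)
    next
      case 2
      then show ?thesis using y p5[OF y] by (simp add: pR)
    next
      case 3
      then have "\<not> w < v (Suc y)" if "t (x, y) = Some w" for w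
        using semistandardD(2)[OF t _ p3[OF y] \<open>t (x, y) = Some w\<close>] by auto
      then show ?thesis using 3 by (auto simp: pR)
    qed
  qed
  have cv: "c2 y = c1 y \<and> v2 y = v1 y" if "y \<le> Y1" for y
    using that
  proof (induction y rule: inc_induct)
    case base
    then show ?case using R1[of "c1 Y1" Y1] R2[of "c1 Y1" Y1] Y by simp
  next
    case (step y)
    have "{..c1 y} = {..c2 y}"
      using small[OF t1 _ r1(2,3,5) R1, of y] small[OF t2 _ r2(2,3,5) R2, of y] step Y by simp
    then have c: "c1 y = c2 y" by simp
    then show ?case using R1[of "c1 y" y] R2[of "c1 y" y] Y step by simp
  qed
  have "t1 (x, y) = t2 (x, y)" for x y
  proof (cases "y \<le> Y1 \<and> x = c1 y")
    case True
    then show ?thesis using r1(3)[of y] r1(4) r2(3)[of y] r2(4) cv[of y] cv[of "Suc y"] Y by (cases "y = Y1") auto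
  next
    case False
    then show ?thesis using R1[of x y] R2[of x y] cv[of y] Y by (auto split: if_splits)
  qed
  then show ?thesis using cv[of 0] r1(1) r2(1) by auto
qed

lemma insertion_tableau_Nil [simp]: "insertion_tableau [] = (\<lambda>_. None)"
  by (simp add: insertion_tableau_def)

lemma insertion_tableau_snoc [simp]: "insertion_tableau (w @ [a]) = row_insert (insertion_tableau w) a"
  by (simp add: insertion_tableau_def)

lemma semistandard_insertion_tableau: "semistandard (insertion_tableau w)"
proof (induction w rule: rev_induct)
  case (snoc a w)
  then show ?case using row_insert_semistandard[OF snoc, of a] by (metis insertion_tableau_snoc)
qed (simp add: semistandard_empty)

lemma ran_row_insert:
  assumes t: "semistandard t"
  shows "ran (row_insert t a) = insert a (ran t)"
proof -
  obtain Y c v where run: "v 0 = a"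
    "\<And>y x. y \<le> Y \<Longrightarrow> x < c y \<Longrightarrow> \<exists>b. t (x, y) = Some b \<and> b \<le> v y"
    "\<And>y. y < Y \<Longrightarrow> t (c y, y) = Some (v (Suc y))" "t (c Y, Y) = None"
    "\<And>y. y < Y \<Longrightarrow> v y < v (Suc y)"
    and R: "\<And>x y. row_insert t a (x, y) = (if y \<le> Y \<and> x = c y then Some (v y) else t (x, y))"
    by (rule insertion_run[OF t, of a]) (rule that)
  have new: "v y \<in> ran (row_insert t a)" if "y \<le> Y" for y
    using R[of "c y" y] that by (auto intro: ranI)
  show ?thesis
  proof (intro equalityI subsetI)
    fix i assume "i \<in> ran (row_insert t a)"
    then obtain x y where i: "row_insert t a (x, y) = Some i" unfolding ran_def by auto
    show "i \<in> insert a (ran t)"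
    proof (cases "y \<le> Y \<and> x = c y")
      case True
      then have "i = v y" using i R[of x y] by simp
      then show ?thesis using run(1) run(3)[of "y - 1"] True by (cases y) (auto intro: ranI)
    next
      case False
      then have "t (x, y) = Some i" using i R[of x y] by (simp split: if_splits)
      then show ?thesis by (auto intro: ranI)
    qed
  next
    fix i assume "i \<in> insert a (ran t)"
    then consider "i = a" | x y where "t (x, y) = Some i" unfolding ran_def by auto
    then show "i \<in> ran (row_insert t a)"
    proof cases
      case 1
      then show ?thesis using new[of 0] run(1) by simp
    next
      case (2 x y)
      show ?thesis
      proof (cases "y \<le> Y \<and> x = c y")
        case True
        then have "y < Y" using 2 run(4) by (cases "y = Y") auto
        then show ?thesis using run(3)[of y] 2 True new[of "Suc y"] by simp
      next
        case False
        then have "row_insert t a (x, y) = Some i" using 2 R[of x y] by auto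
        then show ?thesis by (rule ranI)
      qed
    qed
  qed
qed

lemma ran_insertion_tableau: "ran (insertion_tableau w) = set w"
  by (induction w rule: rev_induct) (simp_all add: ran_row_insert semistandard_insertion_tableau)

lemma insertion_column_map:
  assumes g: "strict_mono_on S g" and t: "ran t \<subseteq> S" and a: "a \<in> S"
  shows "insertion_column (map_option g \<circ> t) y (g a) = insertion_column t y a"
proof -
  have 1: "(\<exists>c. (map_option g \<circ> t) (x, y) = Some c \<and> g a < c) \<longleftrightarrow> (\<exists>c. t (x, y) = Some c \<and> a < c)" for x
  proof (cases "t (x, y)")
    case (Some c)
    then have "c \<in> S" using t by (auto intro: ranI)
    then show ?thesis using strict_mono_on_less[OF g a] Some by simp
  qed simp
  have 2: "(map_option g \<circ> t) (x, y) = None \<longleftrightarrow> t (x, y) = None" for x by simp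
  show ?thesis unfolding insertion_column_def 1 2 ..
qed

lemma arriving_map:
  assumes g: "strict_mono_on S g" and t: "ran t \<subseteq> S" and a: "a \<in> S"
  shows "arriving (map_option g \<circ> t) (g a) y = map_option g (arriving t a y) \<and> (\<forall>b. arriving t a y = Some b \<longrightarrow> b \<in> S)"
proof (induction y)
  case (Suc y)
  show ?case
  proof (cases "arriving t a y")
    case (Some b)
    then have "b \<in> S" using Suc by blast
    then have "insertion_column (map_option g \<circ> t) y (g b) = insertion_column t y b"
      by (rule insertion_column_map[OF g t])
    then show ?thesis using Suc Some t by (auto simp: comp_def intro: ranI)
  qed (use Suc in simp)
qed (use a in simp)

text \<open>Insertion only compares entries. This serves to replace real numbers by their ranks and
  the half-integer \<open>m + 1 / 2\<close> by an integer.\<close>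

lemma row_insert_map:
  assumes g: "strict_mono_on S g" and t: "ran t \<subseteq> S" and a: "a \<in> S"
  shows "row_insert (map_option g \<circ> t) (g a) = map_option g \<circ> row_insert t a"
proof (rule ext)
  fix b :: "nat \<times> nat"
  obtain x y where b: "b = (x, y)" by (cases b)
  show "row_insert (map_option g \<circ> t) (g a) b = (map_option g \<circ> row_insert t a) b"
  proof (cases "arriving t a y")
    case None
    then show ?thesis using arriving_map[OF g t a, of y] by (simp add: row_insert_def b comp_def)
  next
    case (Some c)
    then have "c \<in> S" "arriving (map_option g \<circ> t) (g a) y = Some (g c)"
      using arriving_map[OF g t a, of y] by auto
    then show ?thesis using Some insertion_column_map[OF g t, of c y] by (simp add: row_insert_def b comp_def)
  qed
qed

lemma insertion_tableau_map:
  assumes g: "strict_mono_on S g" and "set w \<subseteq> S"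
  shows "insertion_tableau (map g w) = map_option g \<circ> insertion_tableau w"
  using assms(2)
proof (induction w rule: rev_induct)
  case (snoc a w)
  then show ?case using row_insert_map[OF g, of "insertion_tableau w" a] by (simp add: ran_insertion_tableau comp_def)
qed (simp add: comp_def)

section \<open>Counting words by their growth paths\<close>

text \<open>The last letter is the head of the list: \<open>u\<close> stands for the word \<open>rev u\<close>.\<close>

primrec box_path :: "'a::linorder list \<Rightarrow> (nat \<times> nat) list" where
  "box_path [] = []"
| "box_path (a # u) =
     (THE b. b \<in> dom (insertion_tableau (rev (a # u))) - dom (insertion_tableau (rev u))) # box_path u"

lemma box_path:
  "growth_path (box_path u) \<and> set (box_path u) = dom (insertion_tableau (rev u)) \<and> length (box_path u) = length u"
proof (induction u)
  case (Cons a u)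
  obtain b where b: "b \<in> addable (dom (insertion_tableau (rev u)))"
    "dom (row_insert (insertion_tableau (rev u)) a) = insert b (dom (insertion_tableau (rev u)))"
    by (rule row_insert_semistandard[OF semistandard_insertion_tableau, of "rev u" a]) (rule that)
  then have "(THE b. b \<in> dom (insertion_tableau (rev (a # u))) - dom (insertion_tableau (rev u))) = b"
    by (intro the_equality) (auto simp: addable_def)
  then show ?case using Cons b by simp
qed simp

lemma box_path_map:
  assumes "strict_mono_on (set u) g"
  shows "box_path (map g u) = box_path u"
  using assms
proof (induction u)
  case (Cons a u)
  have d: "dom (insertion_tableau (rev (map g v))) = dom (insertion_tableau (rev v))" if "set v \<subseteq> set (a # u)" for v
    using insertion_tableau_map[OF Cons.prems, of "rev v"] that by (simp add: rev_map dom_def)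
  have "strict_mono_on (set u) g" using Cons.prems by (rule monotone_on_subset) auto
  moreover have "dom (insertion_tableau (rev (map g (a # u)))) = dom (insertion_tableau (rev (a # u)))"
    "dom (insertion_tableau (rev (map g u))) = dom (insertion_tableau (rev u))" by (rule d, force)+
  ultimately show ?case using Cons.IH by simp
qed simp

text \<open>The box path plays the role of the recording tableau: without its head it gives the
  shape before the last letter, so \<open>row_insert_inj\<close> undoes the last insertion and the
  rest follows by induction.\<close>

lemma word_determined:
  assumes "box_path u = box_path u'" "insertion_tableau (rev u) = insertion_tableau (rev u')"
  shows "u = u'"
  using assms
proof (induction u arbitrary: u')
  case Nil
  then have "length u' = 0" using box_path[of u'] by (metis box_path.simps(1) list.size(3))
  then show ?case by simp
next
  case (Cons a u)
  have "length u' = Suc (length u)"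
    using box_path[of u'] box_path[of "a # u"] Cons.prems(1) by (metis length_Cons)
  then obtain a' v where u': "u' = a' # v" by (cases u') auto
  have p: "box_path u = box_path v" using Cons.prems(1) u' by simp
  then have "dom (insertion_tableau (rev u)) = dom (insertion_tableau (rev v))"
    using box_path[of u] box_path[of v] by metis
  then have "insertion_tableau (rev u) = insertion_tableau (rev v) \<and> a = a'"
    using Cons.prems(2) u' by (intro row_insert_inj semistandard_insertion_tableau) auto
  then show ?case using Cons.IH[OF p] u' by simp
qed

definition entry_box :: "nat tableau \<Rightarrow> nat \<Rightarrow> nat \<times> nat" where
  "entry_box t i = (THE b. t b = Some i)"

text \<open>By monotonicity of the filling the boxes of the smallest \<open>k\<close> entries form a
  diagram, so listing the boxes by their entries gives a growth path.\<close>

lemma standard_filling_path: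
  assumes t: "semistandard t" and ran: "ran t = {..<n}" and inj: "\<And>b b' i. t b = Some i \<Longrightarrow> t b' = Some i \<Longrightarrow> b = b'"
  shows "map (entry_box t) (rev [0..<n]) \<in> paths_to (dom t)"
    and "t b = Some i \<longleftrightarrow> i < n \<and> b = entry_box t i"
proof -
  have eb: "t b = Some i \<longleftrightarrow> i < n \<and> b = entry_box t i" for b i
  proof -
    have *: "t (entry_box t i) = Some i" if i: "i < n"
    proof -
      have "i \<in> ran t" using i ran by simp
      then obtain b where b: "t b = Some i" unfolding ran_def by auto
      then have "entry_box t i = b" unfolding entry_box_def by (intro the_equality) (auto intro: inj)
      then show ?thesis using b by simp
    qed
    have "i < n" if "t b = Some i" using that ran by (auto intro: ranI)
    then show ?thesis using * inj by blast
  qed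
  then show "t b = Some i \<longleftrightarrow> i < n \<and> b = entry_box t i" .
  have "growth_path (map (entry_box t) (rev [0..<k])) \<and> set (map (entry_box t) (rev [0..<k])) = {b. \<exists>i<k. t b = Some i}"
    if "k \<le> n" for k
    using that
  proof (induction k)
    case (Suc k)
    let ?E = "{b. \<exists>i<k. t b = Some i}"
    have k: "t (entry_box t k) = Some k" using eb Suc.prems by auto
    have ins: "insert (entry_box t k) ?E = {b. \<exists>i<Suc k. t b = Some i}"
      using eb Suc.prems by (auto simp: less_Suc_eq)
    have "diagram {b. \<exists>i<Suc k. t b = Some i}"
    proof (rule diagramI)
      have "{b. \<exists>i<Suc k. t b = Some i} \<subseteq> dom t" by auto
      then show "finite {b. \<exists>i<Suc k. t b = Some i}"
        using diagram_finite[OF semistandardD(1)[OF t]] finite_subset by blast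
      fix x y x' y' assume *: "(x, y) \<in> {b. \<exists>i<Suc k. t b = Some i}" "x' \<le> x" "y' \<le> y"
      then obtain i where i: "i < Suc k" "t (x, y) = Some i" by blast
      then have "(x', y') \<in> dom t" using diagramD[OF semistandardD(1)[OF t], of x y x' y'] * by blast
      then obtain i' where i': "t (x', y') = Some i'" by auto
      then have "i' \<le> i" using semistandard_mono[OF t *(2,3)] i by blast
      then show "(x', y') \<in> {b. \<exists>i<Suc k. t b = Some i}" using i i' by auto
    qed
    then have "entry_box t k \<in> addable ?E" using k by (simp add: addable_def ins)
    then show ?case using Suc ins by simp
  qed simp
  from this[of n] show "map (entry_box t) (rev [0..<n]) \<in> paths_to (dom t)"
    using eb by (auto simp: paths_to_def)
qed

text \<open>With the recording path fixed, a permutation is determined by its insertion tableau,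
  which is a standard filling of the same shape and thus a second growth path.\<close>

lemma card_words_le:
  assumes "growth_path p" "length p = n"
  shows "card {u. set u = {..<n} \<and> distinct u \<and> box_path u = p} \<le> card (paths_to (set p))"
proof (rule card_inj_on_le)
  let ?W = "{u. set u = {..<n} \<and> distinct u \<and> box_path u = p}"
  let ?I = "\<lambda>u. insertion_tableau (rev u) :: nat tableau"
  have I: "semistandard (?I u)" "ran (?I u) = {..<n}" "dom (?I u) = set p"
    "\<And>b b' i. ?I u b = Some i \<Longrightarrow> ?I u b' = Some i \<Longrightarrow> b = b'" if "u \<in> ?W" for u
  proof -
    show "semistandard (?I u)" by (rule semistandard_insertion_tableau)
    show r: "ran (?I u) = {..<n}" using that by (simp add: ran_insertion_tableau)
    show d: "dom (?I u) = set p" using box_path[of u] that by simp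
    have "(the \<circ> ?I u) ` dom (?I u) = ran (?I u)" by (force simp: ran_def image_def dom_def)
    moreover have "card (dom (?I u)) = card (ran (?I u))"
      unfolding r d using assms growth_path_length by simp
    ultimately have "inj_on (the \<circ> ?I u) (dom (?I u))"
      using d by (intro eq_card_imp_inj_on) auto
    then show "b = b'" if "?I u b = Some i" "?I u b' = Some i" for b b' i
      using that inj_onD[of "the \<circ> ?I u" "dom (?I u)" b b'] by auto
  qed
  show "inj_on (\<lambda>u. map (entry_box (?I u)) (rev [0..<n])) ?W"
  proof (rule inj_onI)
    fix u u' assume u: "u \<in> ?W" and u': "u' \<in> ?W"
      and e: "map (entry_box (?I u)) (rev [0..<n]) = map (entry_box (?I u')) (rev [0..<n])"
    have "entry_box (?I u) i = entry_box (?I u') i" if "i < n" for i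
      using e[unfolded map_eq_conv] that by simp
    then have "?I u b = Some i \<longleftrightarrow> ?I u' b = Some i" for b i
      using standard_filling_path(2)[OF I(1,2,4)[OF u], where b = b and i = i] standard_filling_path(2)[OF I(1,2,4)[OF u'], where b = b and i = i] by auto
    then have "?I u = ?I u'" by (metis (no_types) ext not_Some_eq)
    then show "u = u'" using u u' by (intro word_determined) auto
  qed
  show "(\<lambda>u. map (entry_box (?I u)) (rev [0..<n])) ` ?W \<subseteq> paths_to (set p)"
    using standard_filling_path(1)[OF I(1,2,4)] I(3) by auto
  show "finite (paths_to (set p))" using growth_path_diagram[OF assms(1)] by simp
qed

lemma growth_paths_eq: "{p. growth_path p \<and> length p = n} = (\<Union>D\<in>diagrams n. paths_to D)"
  using growth_path_diagram growth_path_length by (auto simp: paths_to_def diagrams_def)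

lemma finite_growth_paths [simp]: "finite {p. growth_path p \<and> length p = n}"
  unfolding growth_paths_eq by (auto dest: in_diagrams)

lemma sum_growth_paths:
  fixes F :: "(nat \<times> nat) list \<Rightarrow> real"
  shows "(\<Sum>p | growth_path p \<and> length p = n. F p) = (\<Sum>D\<in>diagrams n. \<Sum>p\<in>paths_to D. F p)"
  unfolding growth_paths_eq
proof (rule sum.UNION_disjoint)
  show "\<forall>D\<in>diagrams n. finite (paths_to D)" using in_diagrams finite_paths_to by blast
qed (auto simp: paths_to_def)

text \<open>Surjectivity of the correspondence is obtained by counting: \<open>card_words_le\<close>
  holds for each path, and over all paths both sides add up to \<open>n!\<close>, so no inequality
  can be strict.\<close>

theorem card_words:
  assumes "growth_path p" "length p = n"
  shows "real (card {u. set u = {..<n} \<and> distinct u \<and> box_path u = p}) = num_paths (set p)"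
proof -
  let ?P = "{p. growth_path p \<and> length p = n}"
  define W where "W p = {u. set u = {..<n} \<and> distinct u \<and> box_path u = p}" for p
  have un: "permutations_of_set {..<n} = (\<Union>p\<in>?P. W p)"
  proof -
    have "growth_path (box_path u) \<and> length (box_path u) = n" if "set u = {..<n}" "distinct u" for u :: "nat list"
      using box_path[of u] distinct_card[OF that(2)] that(1) by simp
    then show ?thesis unfolding W_def permutations_of_set_def by auto
  qed
  have "W p \<subseteq> permutations_of_set {..<n}" for p
    by (auto simp: W_def permutations_of_set_def)
  then have finW: "finite (W p)" for p
    by (rule finite_subset) simp
  have "card (permutations_of_set {..<n}) = (\<Sum>p\<in>?P. card (W p))"
    unfolding un by (rule card_UN_disjoint) (use finW in \<open>auto simp: W_def\<close>)
  then have "fact n = (\<Sum>p\<in>?P. card (W p))" by simp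
  then have "real (fact n) = real (\<Sum>p\<in>?P. card (W p))" by (rule arg_cong)
  then have "(\<Sum>p\<in>?P. real (card (W p))) = fact n" by simp
  also have "\<dots> = (\<Sum>p\<in>?P. num_paths (set p))"
  proof -
    have "(\<Sum>p\<in>?P. num_paths (set p)) = (\<Sum>D\<in>diagrams n. \<Sum>p\<in>paths_to D. num_paths D)"
      unfolding sum_growth_paths by (intro sum.cong refl) (auto simp: paths_to_def)
    also have "\<dots> = (\<Sum>D\<in>diagrams n. (num_paths D)\<^sup>2)"
      by (simp add: num_paths_def power2_eq_square)
    finally show ?thesis by (simp add: sum_num_paths_squared)
  qed
  finally have eq: "(\<Sum>p\<in>?P. real (card (W p))) = (\<Sum>p\<in>?P. num_paths (set p))" .
  have "real (card (W p)) = num_paths (set p)"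
    by (rule sum_mono_inv[OF eq])
      (use assms card_words_le[of _ n] in \<open>auto simp: W_def num_paths_def\<close>)
  then show ?thesis by (simp add: W_def)
qed

section \<open>The shapes of a uniform random sequence\<close>

definition unif :: "real measure" where
  "unif = uniform_measure lborel {0..1}"

definition unif_seq :: "(nat \<Rightarrow> real) measure" where
  "unif_seq = PiM UNIV (\<lambda>_. unif)"

text \<open>The order pattern of the first \<open>n\<close> terms, with values from 0; a permutation
  if there are no ties.\<close>

definition ranks :: "(nat \<Rightarrow> real) \<Rightarrow> nat \<Rightarrow> nat list" where
  "ranks w n = map (\<lambda>i. card {j \<in> {..<n}. w j < w i}) [0..<n]"

lemma prob_space_unif: "prob_space unif"
  unfolding unif_def by (rule prob_space_uniform_measure) auto

lemma sets_unif [simp, measurable_cong]: "sets unif = sets borel"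
  by (simp add: unif_def)

lemma space_unif [simp]: "space unif = UNIV"
  by (simp add: unif_def)

lemma space_unif_seq [simp]: "space unif_seq = UNIV"
  by (simp add: unif_seq_def space_PiM)

interpretation unif_seq: prob_space unif_seq
  unfolding unif_seq_def by (intro prob_space_PiM prob_space_unif)

lemma measurable_unif_seq [measurable]: "(\<lambda>w. w i) \<in> borel_measurable unif_seq"
proof -
  have "(\<lambda>w. w i) \<in> unif_seq \<rightarrow>\<^sub>M unif"
    unfolding unif_seq_def by (rule measurable_component_singleton) simp
  then show ?thesis by (simp cong: measurable_cong_sets)
qed

lemma box_path_ranks: "box_path (rev (map w [0..<n])) = box_path (rev (ranks w n))"
proof -
  define g where "g x = card {j \<in> {..<n}. w j < x}" for x
  have "strict_mono_on (w ` {..<n}) g"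
  proof (rule strict_mono_onI)
    fix x y assume "x \<in> w ` {..<n}" "y \<in> w ` {..<n}" "x < y"
    then have "{j \<in> {..<n}. w j < x} \<subset> {j \<in> {..<n}. w j < y}" by auto
    then show "g x < g y" unfolding g_def by (intro psubset_card_mono) auto
  qed
  then have "box_path (map g (rev (map w [0..<n]))) = box_path (rev (map w [0..<n]))"
    by (intro box_path_map) (simp add: lessThan_atLeast0)
  moreover have "map g (rev (map w [0..<n])) = rev (ranks w n)"
    by (simp add: ranks_def g_def rev_map comp_def)
  ultimately show ?thesis by simp
qed

lemma ranks_permutation:
  assumes "inj_on w {..<n}"
  shows "set (ranks w n) = {..<n} \<and> distinct (ranks w n)"
proof -
  have lt: "card {j \<in> {..<n}. w j < w i} < card {j \<in> {..<n}. w j < w k}" if "i < n" "w i < w k" for i k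
    using that by (intro psubset_card_mono) auto
  have inj: "inj_on (\<lambda>i. card {j \<in> {..<n}. w j < w i}) {..<n}"
  proof (rule inj_onI)
    fix i k assume ik: "i \<in> {..<n}" "k \<in> {..<n}" "card {j \<in> {..<n}. w j < w i} = card {j \<in> {..<n}. w j < w k}"
    then have "w i = w k" using lt[of i k] lt[of k i] by fastforce
    then show "i = k" using assms ik by (auto dest: inj_onD)
  qed
  then have d: "distinct (ranks w n)" by (simp add: ranks_def distinct_map lessThan_atLeast0)
  have "set (ranks w n) \<subseteq> {..<n}"
  proof
    fix r assume "r \<in> set (ranks w n)"
    then obtain i where i: "i < n" "r = card {j \<in> {..<n}. w j < w i}" by (auto simp: ranks_def)
    then have "card {j \<in> {..<n}. w j < w i} < card {..<n}" by (intro psubset_card_mono) auto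
    then show "r \<in> {..<n}" using i by simp
  qed
  moreover have "card (set (ranks w n)) = n" using distinct_card[OF d] by (simp add: ranks_def)
  ultimately have "set (ranks w n) = {..<n}" by (intro card_subset_eq) auto
  then show ?thesis using d by blast
qed

lemma sets_ranks [measurable]: "{w. ranks w n = v} \<in> sets unif_seq"
proof -
  \<comment> \<open>The cardinality is rewritten as a finite sum of real indicators, for which
    measurability is automatic.\<close>
  have eq: "ranks w n = v \<longleftrightarrow> length v = n \<and> (\<forall>i\<in>{..<n}. (\<Sum>j<n. if w j < w i then 1 else 0) = real (v ! i))" for w
  proof -
    have "(\<Sum>j<n. if w j < w i then 1 else 0 :: real) = real (card {j \<in> {..<n}. w j < w i})" for i
      by (simp add: sum.If_cases Int_def)
    then show ?thesis by (auto simp: ranks_def list_eq_iff_nth_eq)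
  qed
  have "{w \<in> space unif_seq. length v = n \<and> (\<forall>i\<in>{..<n}. (\<Sum>j<n. if w j < w i then 1 else 0) = real (v ! i))} \<in> sets unif_seq"
    by measurable
  then show ?thesis unfolding eq by simp
qed

lemma unif_seq_permute:
  assumes "inj \<pi>"
  shows "distr unif_seq unif_seq (\<lambda>w i. w (\<pi> i)) = unif_seq"
  using distr_PiM_reindex[of UNIV "\<lambda>_. unif" \<pi> UNIV] assms prob_space_unif
  by (simp add: unif_seq_def restrict_def)

lemma measurable_permute: "(\<lambda>w i. w (\<pi> i)) \<in> unif_seq \<rightarrow>\<^sub>M unif_seq"
proof -
  have "(\<lambda>w i. w (\<pi> i)) \<in> unif_seq \<rightarrow>\<^sub>M PiM UNIV (\<lambda>_. unif)"
    by (rule measurable_PiM_single') (auto simp: measurable_unif_seq cong: measurable_cong_sets)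
  then show ?thesis by (simp add: unif_seq_def)
qed

lemma emeasure_unif_singleton: "emeasure unif {x} = 0"
proof -
  have "{0..1} \<inter> {x} \<subseteq> {x}" by auto
  then have "emeasure lborel ({0..1} \<inter> {x}) \<le> emeasure lborel {x}" by (intro emeasure_mono) auto
  then have "emeasure lborel ({0..1} \<inter> {x}) = 0" by simp
  then show ?thesis unfolding unif_def by (subst emeasure_uniform_measure) auto
qed

text \<open>Fubini: for fixed later terms the first term would have to hit one given point, which
  has measure 0 under \<open>unif\<close>.\<close>

lemma no_ties_0: "emeasure unif_seq {w. w 0 = w (Suc k)} = 0"
proof -
  interpret M: prob_space unif by (rule prob_space_unif)
  interpret S: sequence_space unif by unfold_locales
  interpret P: pair_sigma_finite unif unif_seq
    by unfold_locales
  have seq: "S.S = unif_seq" by (simp add: unif_seq_def)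
  have iter: "distr (unif \<Otimes>\<^sub>M unif_seq) unif_seq (\<lambda>(s, \<omega>). case_nat s \<omega>) = unif_seq"
    using S.PiM_iter unfolding seq .
  have m: "(\<lambda>(s, \<omega>). case_nat s \<omega>) \<in> unif \<Otimes>\<^sub>M unif_seq \<rightarrow>\<^sub>M unif_seq"
    unfolding unif_seq_def by measurable
  have s: "{w. w 0 = w (Suc k)} \<in> sets unif_seq"
  proof -
    have "{w \<in> space unif_seq. w 0 = w (Suc k)} \<in> sets unif_seq" by measurable
    then show ?thesis by simp
  qed
  let ?A = "{p \<in> space (unif \<Otimes>\<^sub>M unif_seq). fst p = snd p k}"
  have A: "?A \<in> sets (unif \<Otimes>\<^sub>M unif_seq)"
  proof (rule borel_measurable_eq)
    show "fst \<in> borel_measurable (unif \<Otimes>\<^sub>M unif_seq)"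
      using measurable_fst[of unif unif_seq] by (simp cong: measurable_cong_sets)
    show "(\<lambda>p. snd p k) \<in> borel_measurable (unif \<Otimes>\<^sub>M unif_seq)"
      by (rule measurable_compose[OF measurable_snd measurable_unif_seq])
  qed
  have "emeasure unif_seq {w. w 0 = w (Suc k)} = emeasure (unif \<Otimes>\<^sub>M unif_seq) ((\<lambda>(s, \<omega>). case_nat s \<omega>) -` {w. w 0 = w (Suc k)} \<inter> space (unif \<Otimes>\<^sub>M unif_seq))"
    using emeasure_distr[OF m s] unfolding iter .
  also have "(\<lambda>(s, \<omega>). case_nat s \<omega>) -` {w. w 0 = w (Suc k)} \<inter> space (unif \<Otimes>\<^sub>M unif_seq) = ?A" by auto
  also have "emeasure (unif \<Otimes>\<^sub>M unif_seq) ?A = (\<integral>\<^sup>+\<omega>. emeasure unif ((\<lambda>s. (s, \<omega>)) -` ?A) \<partial>unif_seq)"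
    by (rule P.emeasure_pair_measure_alt2[OF A])
  also have "\<dots> = (\<integral>\<^sup>+\<omega>. 0 \<partial>unif_seq)"
  proof (rule nn_integral_cong)
    fix \<omega>
    have "(\<lambda>s. (s, \<omega>)) -` ?A = {\<omega> k}" by (auto simp: space_pair_measure)
    then show "emeasure unif ((\<lambda>s. (s, \<omega>)) -` ?A) = 0" by (simp add: emeasure_unif_singleton)
  qed
  finally show ?thesis by simp
qed

lemma no_ties: assumes "i \<noteq> j" shows "AE w in unif_seq. w i \<noteq> w j"
proof -
  define \<pi> where "\<pi> = Transposition.transpose 0 i"
  have inj: "inj \<pi>" by (simp add: \<pi>_def)
  have "\<pi> j \<noteq> 0" using assms by (auto simp: \<pi>_def Transposition.transpose_def)
  then obtain k where k: "\<pi> j = Suc k" by (cases "\<pi> j") auto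
  have s: "{w. w i = w j} \<in> sets unif_seq"
  proof -
    have "{w \<in> space unif_seq. w i = w j} \<in> sets unif_seq" by measurable
    then show ?thesis by simp
  qed
  have "emeasure unif_seq {w. w i = w j} = emeasure unif_seq ((\<lambda>w i. w (\<pi> i)) -` {w. w i = w j} \<inter> space unif_seq)"
    using emeasure_distr[OF measurable_permute s, of \<pi>] unfolding unif_seq_permute[OF inj] .
  also have "(\<lambda>w i. w (\<pi> i)) -` {w. w i = w j} \<inter> space unif_seq = {w. w 0 = w (Suc k)}"
    using k by (auto simp: \<pi>_def)
  finally have "emeasure unif_seq {w. w i = w j} = 0" by (simp add: no_ties_0)
  then show ?thesis by (intro AE_I[of _ _ "{w. w i = w j}"]) (use s in auto)
qed

text \<open>Permuting the coordinates preserves the law, so all \<open>n!\<close> patterns are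
  equally likely, and almost surely one of them occurs since there are no ties.\<close>

lemma prob_ranks:
  assumes v: "set v = {..<n}" "distinct v"
  shows "measure unif_seq {w. ranks w n = v} = 1 / fact n"
proof -
  have eqp: "measure unif_seq {w. ranks w n = v} = measure unif_seq {w. ranks w n = [0..<n]}"
    if v: "set v = {..<n}" "distinct v" for v
  proof -
    have len: "length v = n" using distinct_card[OF v(2)] v(1) by simp
    \<comment> \<open>Reindexing by \<open>v\<close> itself turns the event
      \<open>ranks w n = v\<close> into that of the identity pattern.\<close>
    define \<pi> where "\<pi> i = (if i < n then v ! i else i)" for i
    have lt: "\<pi> i < n \<longleftrightarrow> i < n" for i
      using v(1) len nth_mem[of i v] by (auto simp: \<pi>_def)
    have inj: "inj \<pi>"
    proof (rule injI)
      fix i j assume "\<pi> i = \<pi> j"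
      then show "i = j" using lt[of i] lt[of j] v(2) len by (auto simp: \<pi>_def nth_eq_iff_index_eq split: if_splits)
    qed
    have img: "\<pi> ` {..<n} = {..<n}"
      using v(1) len by (auto simp: \<pi>_def set_conv_nth image_def)
    have card_eq: "card {j \<in> {..<n}. w (\<pi> j) < x} = card {j \<in> {..<n}. w j < x}" for w :: "nat \<Rightarrow> real" and x
    proof -
      have "{j \<in> {..<n}. w j < x} = \<pi> ` {j \<in> {..<n}. w (\<pi> j) < x}" using img by auto
      then show ?thesis using inj by (simp add: card_image inj_on_def)
    qed
    have *: "ranks (\<lambda>i. w (\<pi> i)) n = v \<longleftrightarrow> ranks w n = [0..<n]" for w
    proof -
      have "ranks (\<lambda>i. w (\<pi> i)) n = v \<longleftrightarrow> (\<forall>i<n. card {j \<in> {..<n}. w j < w (\<pi> i)} = \<pi> i)"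
      proof -
        have "ranks (\<lambda>i. w (\<pi> i)) n = v \<longleftrightarrow> (\<forall>i<n. card {j \<in> {..<n}. w (\<pi> j) < w (\<pi> i)} = v ! i)"
          using len by (auto simp: ranks_def list_eq_iff_nth_eq)
        also have "\<dots> \<longleftrightarrow> (\<forall>i<n. card {j \<in> {..<n}. w j < w (\<pi> i)} = \<pi> i)"
          unfolding card_eq by (simp add: \<pi>_def)
        finally show ?thesis .
      qed
      also have "\<dots> \<longleftrightarrow> (\<forall>k\<in>\<pi> ` {..<n}. card {j \<in> {..<n}. w j < w k} = k)" by auto
      also have "\<dots> \<longleftrightarrow> ranks w n = [0..<n]"
        unfolding img by (auto simp: ranks_def list_eq_iff_nth_eq)
      finally show ?thesis .
    qed
    have "measure unif_seq {w. ranks w n = v} = measure unif_seq ((\<lambda>w i. w (\<pi> i)) -` {w. ranks w n = v} \<inter> space unif_seq)"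
      using measure_distr[OF measurable_permute sets_ranks, of \<pi>] unfolding unif_seq_permute[OF inj] .
    also have "(\<lambda>w i. w (\<pi> i)) -` {w. ranks w n = v} \<inter> space unif_seq = {w. ranks w n = [0..<n]}"
      using * by auto
    finally show ?thesis .
  qed
  have "AE w in unif_seq. \<forall>i\<in>{..<n}. \<forall>j\<in>{..<n}. i \<noteq> j \<longrightarrow> w i \<noteq> w j"
    by (intro AE_finite_allI finite_lessThan) (auto intro: no_ties)
  then have "AE w in unif_seq. w \<in> (\<Union>v\<in>permutations_of_set {..<n}. {w. ranks w n = v})"
  proof eventually_elim
    case (elim w)
    then have "inj_on w {..<n}" by (auto simp: inj_on_def)
    then show ?case using ranks_permutation by (auto simp: permutations_of_set_def)
  qed
  then have "1 = measure unif_seq (\<Union>v\<in>permutations_of_set {..<n}. {w. ranks w n = v})"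
    by (subst unif_seq.prob_eq_1[THEN iffD2]) (auto intro!: sets.finite_UN)
  also have "\<dots> = (\<Sum>v\<in>permutations_of_set {..<n}. measure unif_seq {w. ranks w n = v})"
    by (rule unif_seq.finite_measure_finite_Union) (auto simp: disjoint_family_on_def)
  also have "\<dots> = (\<Sum>v\<in>permutations_of_set {..<n}. measure unif_seq {w. ranks w n = [0..<n]})"
    by (intro sum.cong refl eqp) (auto simp: permutations_of_set_def)
  finally have "1 = fact n * measure unif_seq {w. ranks w n = [0..<n]}" by simp
  then show ?thesis using eqp[OF v] by (simp add: field_simps)
qed

theorem prob_box_path:
  assumes p: "growth_path p" "length p = n"
  shows "measure unif_seq {w. box_path (rev (map w [0..<n])) = p} = num_paths (set p) / fact n"
proof -
  let ?V = "{v \<in> permutations_of_set {..<n}. box_path (rev v) = p}"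
  have m: "{w. box_path (rev (map w [0..<n])) = p} \<in> sets unif_seq"
  proof -
    have "{w. box_path (rev (map w [0..<n])) = p} = (\<Union>v\<in>{v. box_path (rev v) = p}. {w. ranks w n = v})"
      unfolding box_path_ranks by auto
    also have "\<dots> \<in> sets unif_seq" by (intro sets.countable_UN'') auto
    finally show ?thesis .
  qed
  have "AE w in unif_seq. \<forall>i\<in>{..<n}. \<forall>j\<in>{..<n}. i \<noteq> j \<longrightarrow> w i \<noteq> w j"
    by (intro AE_finite_allI finite_lessThan) (auto intro: no_ties)
  then have "AE w in unif_seq. w \<in> {w. box_path (rev (map w [0..<n])) = p} \<longleftrightarrow> w \<in> (\<Union>v\<in>?V. {w. ranks w n = v})"
  proof eventually_elim
    case (elim w)
    then have "inj_on w {..<n}" by (auto simp: inj_on_def)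
    then show ?case using ranks_permutation by (auto simp: permutations_of_set_def box_path_ranks)
  qed
  then have "measure unif_seq {w. box_path (rev (map w [0..<n])) = p} = measure unif_seq (\<Union>v\<in>?V. {w. ranks w n = v})"
    by (rule unif_seq.finite_measure_eq_AE) (auto intro!: m sets.finite_UN)
  also have "\<dots> = (\<Sum>v\<in>?V. measure unif_seq {w. ranks w n = v})"
    by (rule unif_seq.finite_measure_finite_Union) (auto simp: disjoint_family_on_def)
  also have "\<dots> = (\<Sum>v\<in>?V. 1 / fact n)"
    by (intro sum.cong refl prob_ranks) (auto simp: permutations_of_set_def)
  also have "\<dots> = real (card ?V) / fact n" by simp
  also have "card ?V = card {u. set u = {..<n} \<and> distinct u \<and> box_path u = p}"
  proof -
    have "{u. set u = {..<n} \<and> distinct u \<and> box_path u = p} = rev ` ?V"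
    proof (intro equalityI subsetI)
      fix u assume "u \<in> {u. set u = {..<n} \<and> distinct u \<and> box_path u = p}"
      then show "u \<in> rev ` ?V"
        by (intro image_eqI[of _ rev "rev u"]) (simp_all add: permutations_of_set_def)
    next
      fix u assume "u \<in> rev ` ?V"
      then obtain v where "u = rev v" "v \<in> ?V" by blast
      then show "u \<in> {u. set u = {..<n} \<and> distinct u \<and> box_path u = p}"
        by (simp add: permutations_of_set_def)
    qed
    then show ?thesis by (simp add: card_image)
  qed
  also have "real \<dots> = num_paths (set p)" by (rule card_words[OF p])
  finally show ?thesis .
qed

section \<open>Bumping routes and marks\<close>

text \<open>In a growth path the newest box comes first. The mark is the box that the insertion of
  \<open>m + 1 / 2\<close> would create if only the entries that belong to \<open>p\<close> were present; while there are at
  most \<open>m\<close> of them, it is the first empty box of row \<open>0\<close>.\<close>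

primrec mark_box :: "nat \<Rightarrow> (nat \<times> nat) list \<Rightarrow> nat \<times> nat" where
  "mark_box m [] = (0, 0)"
| "mark_box m (a # p) =
     (if length p < m then (rowlen (set (a # p)) 0, 0)
      else if a = mark_box m p then (rowlen (set (a # p)) (Suc (snd a)), Suc (snd a))
      else mark_box m p)"

lemma mark_box_start: "length p = m \<Longrightarrow> mark_box m p = (rowlen (set p) 0, 0)"
  by (cases p) (auto simp: rowlen_def)

lemma mark_box_addable:
  assumes "growth_path p" "m \<le> length p"
  shows "mark_box m p \<in> addable (set p)"
  using assms
proof (induction p)
  case Nil
  then show ?case by (simp add: addable_empty)
next
  case (Cons a p)
  let ?D = "set (a # p)"
  have D: "diagram ?D" and Dp: "diagram (set p)" and a: "a \<in> addable (set p)"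
    using growth_path_diagram[of "a # p"] growth_path_diagram[of p] Cons.prems by auto
  have rem: "a \<in> removable ?D" using removable_insert[OF Dp a] by simp
  consider "length p < m" | "m \<le> length p" "a = mark_box m p" | "m \<le> length p" "a \<noteq> mark_box m p" by linarith
  then show ?case
  proof cases
    case 1
    then show ?thesis by (auto simp: addable_iff[OF D[simplified]])
  next
    case 2
    have "rowlen ?D (Suc (snd a)) < rowlen ?D (snd a)"
      using removable_iff[OF D, of "fst a" "snd a"] rem by simp
    then have "(rowlen ?D (Suc (snd a)), Suc (snd a)) \<in> addable ?D" by (subst addable_iff[OF D]) simp
    then show ?thesis using 2 by simp
  next
    case 3
    then have "mark_box m p \<in> addable (?D - {a}) - {a}"
      using Cons insert_minus_addable[OF a] by auto
    then show ?thesis using addable_removable_swap[OF D, of "mark_box m p" a] rem 3 by simp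
  qed
qed

text \<open>An addable box is determined by its column, so the column alone carries the mark; this
  matches \<open>mark_box\<close> with \<open>mark_op row_next\<close>.\<close>

lemma fst_mark_box_Cons:
  assumes "growth_path (a # p)" "m \<le> length p"
  shows "fst (mark_box m (a # p)) = (if fst a = fst (mark_box m p) then row_next (set (a # p)) a else fst (mark_box m p))"
proof -
  have "a = mark_box m p \<longleftrightarrow> fst a = fst (mark_box m p)"
    using addable_fst_inj[OF growth_path_diagram[of p], of a "mark_box m p"] mark_box_addable[of p m] assms by auto
  then show ?thesis using assms(2) by (simp add: row_next_def)
qed

text \<open>The paths are sorted by their last box \<open>a\<close>: a mark off the column of
  \<open>a\<close> stays, a mark in it moves, which gives the two summands of
  \<open>mark_op\<close>. The condition \<open>Q\<close> concerns the path before the step and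
  carries earlier constraints along.\<close>

lemma mark_op_row_count:
  assumes g: "\<And>E q. E \<in> diagrams n \<Longrightarrow> g E q = real (card {p \<in> paths_to E. Q p \<and> fst (mark_box m p) = q})"
    and m: "m \<le> n" and D: "D \<in> diagrams (Suc n)"
  shows "mark_op row_next g D q = real (card {p \<in> paths_to D. Q (drop 1 p) \<and> fst (mark_box m p) = q})"
proof -
  have D': "diagram D" "D \<noteq> {}" using D by (auto simp: diagrams_def)
  define W where "W a = {p \<in> paths_to (D - {a}). Q p \<and> (if fst a = fst (mark_box m p) then row_next D a else fst (mark_box m p)) = q}" for a
  have "{p \<in> paths_to D. Q (drop 1 p) \<and> fst (mark_box m p) = q} = (\<Union>a\<in>removable D. Cons a ` W a)"
  proof -
    have key: "fst (mark_box m (a # p)) = (if fst a = fst (mark_box m p) then row_next D a else fst (mark_box m p))"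
      if a: "a \<in> removable D" and p: "p \<in> paths_to (D - {a})" for a p
    proof -
      have "a # p \<in> paths_to D" using a p paths_to_rec[OF D'] by blast
      then have gp: "growth_path (a # p)" "set (a # p) = D" by (auto simp: paths_to_def)
      have "length p = n" using growth_path_length[OF gp(1)] gp(2) D by (simp add: diagrams_def)
      then show ?thesis using fst_mark_box_Cons[OF gp(1), of m] m gp(2) by simp
    qed
    show ?thesis
    proof (intro equalityI subsetI)
      fix r assume r: "r \<in> {p \<in> paths_to D. Q (drop 1 p) \<and> fst (mark_box m p) = q}"
      then obtain a p where ap: "r = a # p" "a \<in> removable D" "p \<in> paths_to (D - {a})"
        using paths_to_rec[OF D'] by blast
      then have "p \<in> W a" using r key[OF ap(2,3)] by (simp add: W_def del: mark_box.simps)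
      then show "r \<in> (\<Union>a\<in>removable D. Cons a ` W a)" using ap by blast
    next
      fix r assume "r \<in> (\<Union>a\<in>removable D. Cons a ` W a)"
      then obtain a p where ap: "r = a # p" "a \<in> removable D" "p \<in> W a" by blast
      then have p: "p \<in> paths_to (D - {a})" by (simp add: W_def)
      have "r \<in> paths_to D" using ap p paths_to_rec[OF D'] by blast
      then show "r \<in> {p \<in> paths_to D. Q (drop 1 p) \<and> fst (mark_box m p) = q}"
        using ap key[OF ap(2) p] by (simp add: W_def del: mark_box.simps)
    qed
  qed
  then have "card {p \<in> paths_to D. Q (drop 1 p) \<and> fst (mark_box m p) = q} = (\<Sum>a\<in>removable D. card (Cons a ` W a))"
  proof -
    have "finite (W a)" if "a \<in> removable D" for a
      by (rule finite_subset[of _ "paths_to (D - {a})"]) (auto simp: W_def removable_diagram[OF that])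
    then show ?thesis unfolding \<open>_ = (\<Union>a\<in>removable D. Cons a ` W a)\<close>
      using D' by (intro card_UN_disjoint) auto
  qed
  also have "\<dots> = (\<Sum>a\<in>removable D. card (W a))"
    by (intro sum.cong refl card_image) (auto simp: inj_on_def)
  also have "real \<dots> = mark_op row_next g D q"
    unfolding mark_op_def of_nat_sum
  proof (intro sum.cong refl)
    fix a assume a: "a \<in> removable D"
    have E: "D - {a} \<in> diagrams n" by (rule remove_in_diagrams[OF D a])
    have fin: "finite (paths_to (D - {a}))" using removable_diagram[OF a] by simp
    let ?A = "{p \<in> paths_to (D - {a}). Q p \<and> fst (mark_box m p) = q}"
    let ?B = "{p \<in> paths_to (D - {a}). Q p \<and> fst (mark_box m p) = fst a}"
    have "W a = (if fst a \<noteq> q then ?A else {}) \<union> (if row_next D a = q then ?B else {})"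
      unfolding W_def by auto
    moreover have "(if fst a \<noteq> q then ?A else {}) \<inter> (if row_next D a = q then ?B else {}) = {}" by auto
    ultimately have "card (W a) = card (if fst a \<noteq> q then ?A else {}) + card (if row_next D a = q then ?B else {})"
      using fin by (simp add: card_Un_disjoint)
    then show "real (card (W a)) = of_bool (fst a \<noteq> q) * g (D - {a}) q + of_bool (row_next D a = q) * g (D - {a}) (fst a)"
      unfolding g[OF E] by simp
  qed
  finally show ?thesis by simp
qed

lemma funpow_row_count:
  assumes g: "\<And>E q. E \<in> diagrams n \<Longrightarrow> g E q = real (card {p \<in> paths_to E. Q p \<and> fst (mark_box m p) = q})"
    and m: "m \<le> n" and D: "D \<in> diagrams (n + k)"
  shows "(mark_op row_next ^^ k) g D q = real (card {p \<in> paths_to D. Q (drop k p) \<and> fst (mark_box m p) = q})"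
  using D
proof (induction k arbitrary: D q)
  case (Suc k)
  have "mark_op row_next ((mark_op row_next ^^ k) g) D q
      = real (card {p \<in> paths_to D. Q (drop k (drop 1 p)) \<and> fst (mark_box m p) = q})"
    by (rule mark_op_row_count[where Q = "\<lambda>p. Q (drop k p)" and n = "n + k"]) (use Suc m in auto)
  then show ?case by simp
qed (use g in simp)

lemma marked_weight_count:
  assumes "m \<le> n" "D \<in> diagrams n"
  shows "marked_weight m n D q = real (card {p \<in> paths_to D. fst (mark_box m p) = q})"
proof -
  have "(mark_op col_next ^^ m) unmarked E q = real (card {p \<in> paths_to E. True \<and> fst (mark_box m p) = q})"
    if E: "E \<in> diagrams m" for E q
  proof -
    have "fst (mark_box m p) = rowlen E 0" if "p \<in> paths_to E" for p
    proof -
      have "length p = m" using growth_path_length[of p] that E by (simp add: paths_to_def diagrams_def)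
      then show ?thesis using mark_box_start[of p m] that by (simp add: paths_to_def)
    qed
    then have "{p \<in> paths_to E. True \<and> fst (mark_box m p) = q} = (if q = rowlen E 0 then paths_to E else {})" by auto
    then show ?thesis by (simp add: funpow_col_unmarked[OF E] num_paths_def)
  qed
  from funpow_row_count[OF this order_refl, of D "n - m" q] show ?thesis
    using assms by (simp add: marked_weight_def)
qed

text \<open>As the newest box comes first, dropping \<open>length p - t i\<close> boxes leaves the
  path at time \<open>t i\<close>.\<close>

definition marks_at :: "nat \<Rightarrow> (nat \<Rightarrow> nat) \<Rightarrow> (nat \<Rightarrow> nat) \<Rightarrow> nat \<Rightarrow> (nat \<times> nat) list \<Rightarrow> bool" where
  "marks_at m t a j p \<longleftrightarrow> (\<forall>i\<le>j. fst (mark_box m (drop (length p - t i) p)) = a i)"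

lemma joint_weight_count:
  assumes "m \<le> t 0" "\<And>i. i < j \<Longrightarrow> t i \<le> t (Suc i)" "D \<in> diagrams (t j)"
  shows "joint_weight m t a j D q = real (card {p \<in> paths_to D. marks_at m t a j p \<and> fst (mark_box m p) = q})"
  using assms(2,3)
proof (induction j arbitrary: D q)
  case 0
  have "{p \<in> paths_to D. marks_at m t a 0 p \<and> fst (mark_box m p) = q}
      = (if q = a 0 then {p \<in> paths_to D. fst (mark_box m p) = q} else {})"
    using 0 growth_path_length by (auto simp: marks_at_def paths_to_def diagrams_def)
  then show ?case using marked_weight_count[OF assms(1) 0(2), of q] by simp
next
  case (Suc j)
  define k where "k = t (Suc j) - t j"
  have k: "t j + k = t (Suc j)" using Suc.prems(1)[of j] by (simp add: k_def)
  have mono: "t i \<le> t j" if "i \<le> j" for i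
    using that
  proof (induction rule: inc_induct)
    case (step i)
    then show ?case using Suc.prems(1)[of i] by simp
  qed simp
  have IH: "joint_weight m t a j E q = real (card {p \<in> paths_to E. marks_at m t a j p \<and> fst (mark_box m p) = q})"
    if "E \<in> diagrams (t j)" for E q
    using Suc.IH[OF _ that] Suc.prems(1) by simp
  have step: "(mark_op row_next ^^ k) (joint_weight m t a j) D q
      = real (card {p \<in> paths_to D. marks_at m t a j (drop k p) \<and> fst (mark_box m p) = q})"
    by (rule funpow_row_count[where n = "t j", OF IH]) (use mono[of 0] assms(1) Suc.prems(2) k in auto)
  have "marks_at m t a (Suc j) p \<longleftrightarrow> marks_at m t a j (drop k p) \<and> fst (mark_box m p) = a (Suc j)"
    if "p \<in> paths_to D" for p
  proof -
    have len: "length p = t (Suc j)" using that growth_path_length Suc.prems(2) by (auto simp: paths_to_def diagrams_def)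
    have "drop (length (drop k p) - t i) (drop k p) = drop (length p - t i) p" if "i \<le> j" for i
      using mono[OF that] k len by simp
    then show ?thesis using len by (auto simp: marks_at_def le_Suc_eq)
  qed
  then have "{p \<in> paths_to D. marks_at m t a (Suc j) p \<and> fst (mark_box m p) = q}
      = (if q = a (Suc j) then {p \<in> paths_to D. marks_at m t a j (drop k p) \<and> fst (mark_box m p) = q} else {})"
    by auto
  then show ?case using step by (simp add: k_def)
qed

section \<open>The mark of an infinite tableau and its bumping route\<close>

primrec tab_boxes :: "nat tableau \<Rightarrow> nat \<Rightarrow> (nat \<times> nat) list" where
  "tab_boxes T 0 = []"
| "tab_boxes T (Suc n) = entry_box T (Suc n) # tab_boxes T n"

text \<open>\<open>infinite_standard_tableau\<close> does not exclude gaps in the set of filled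
  boxes; the growth paths do. Almost every Plancherel tableau is of this kind
  (\<open>AE_growing\<close>).\<close>

definition growing :: "nat tableau \<Rightarrow> bool" where
  "growing T \<longleftrightarrow> infinite_standard_tableau T \<and> (\<forall>n. growth_path (tab_boxes T n))"

lemma length_tab_boxes [simp]: "length (tab_boxes T n) = n"
  by (induction n) auto

lemma drop_tab_boxes: "k \<le> n \<Longrightarrow> drop (n - k) (tab_boxes T n) = tab_boxes T k"
  by (induction n) (auto simp: le_Suc_eq Suc_diff_le)

definition real_tableau :: "nat tableau \<Rightarrow> real tableau" where
  "real_tableau T = map_option real \<circ> T"

lemma real_tableau_apply: "real_tableau T b = map_option real (T b)"
  by (simp add: real_tableau_def)

lemma real_tableau_pair [simp]: "real_tableau T (x, y) = map_option real (T (x, y))"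
  by (rule real_tableau_apply)

context
  fixes T :: "nat tableau" and m :: nat
  assumes T: "growing T"
begin

abbreviation "shape n \<equiv> set (tab_boxes T n)"
abbreviation "mark n \<equiv> mark_box m (tab_boxes T n)"
abbreviation "T' \<equiv> real_tableau T"
abbreviation "a' \<equiv> real m + 1 / 2"

lemma diagram_shape: "diagram (shape n)"
  using T growth_path_diagram by (simp add: growing_def)

lemma entry_iff: "1 \<le> i \<Longrightarrow> T b = Some i \<longleftrightarrow> b = entry_box T i"
  using T theI'[of "\<lambda>b. T b = Some i"] unfolding growing_def infinite_standard_tableau_def entry_box_def by metis

lemma entry_pos: "T b = Some i \<Longrightarrow> 1 \<le> i"
  using T unfolding growing_def infinite_standard_tableau_def by (cases i) auto

lemma shape_eq: "b \<in> shape n \<longleftrightarrow> (\<exists>i\<le>n. T b = Some i)"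
proof (induction n)
  case 0
  then show ?case using entry_pos[of b 0] by auto
next
  case (Suc n)
  have "b = entry_box T (Suc n) \<longleftrightarrow> T b = Some (Suc n)" using entry_iff[of "Suc n" b] by auto
  then show ?case using Suc by (auto simp: le_Suc_eq)
qed

lemma shape_mono: "k \<le> n \<Longrightarrow> shape k \<subseteq> shape n"
  using shape_eq le_trans by blast

lemma mark_addable: "m \<le> n \<Longrightarrow> mark n \<in> addable (shape n)"
  using T by (intro mark_box_addable) (auto simp: growing_def)

lemma mark_notin: "m \<le> n \<Longrightarrow> mark n \<notin> shape n"
  using mark_addable by (auto simp: addable_def)

lemma mark_Suc:
  assumes "m \<le> n"
  shows "mark (Suc n) = (if T (mark n) = Some (Suc n) then (rowlen (shape (Suc n)) (Suc (snd (mark n))), Suc (snd (mark n))) else mark n)"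
proof -
  have "entry_box T (Suc n) = mark n \<longleftrightarrow> T (mark n) = Some (Suc n)" using entry_iff[of "Suc n" "mark n"] by auto
  then show ?thesis using assms by auto
qed

declare mark_box.simps(2) [simp del] tab_boxes.simps(2) [simp del]

lemma mark_below: "m \<le> n \<Longrightarrow> x < fst (mark n) \<Longrightarrow> (x, snd (mark n)) \<in> shape n"
  using mark_addable[of n] addable_iff[OF diagram_shape, of "fst (mark n)" "snd (mark n)"]
    rowlen_iff[OF diagram_shape, of x n "snd (mark n)"] by simp

text \<open>While the mark waits in its row, the number that arrives in this row is smaller than
  every entry still to come, and all boxes to the left of the mark hold entries not exceeding it. So
  the insertion uses exactly the box of the mark, whether that box is filled later or never.\<close>

lemma mark_invariant:
  assumes "m \<le> n"
  shows "\<exists>e. arriving T' a' (snd (mark n)) = Some e \<and> e < real (Suc n)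
    \<and> (\<forall>x<fst (mark n). \<exists>i. T (x, snd (mark n)) = Some i \<and> real i \<le> e)"
  using assms
proof (induction n rule: dec_induct)
  case base
  have s: "mark m = (rowlen (shape m) 0, 0)" by (rule mark_box_start) simp
  have "\<exists>i. T (x, 0) = Some i \<and> real i \<le> a'" if "x < fst (mark m)" for x
    using mark_below[OF order_refl that] by (auto simp: shape_eq s)
  then show ?case by (auto simp: s)
next
  case (step n)
  then obtain e where e: "arriving T' a' (snd (mark n)) = Some e" "e < real (Suc n)"
    "\<And>x. x < fst (mark n) \<Longrightarrow> \<exists>i. T (x, snd (mark n)) = Some i \<and> real i \<le> e" by blast
  show ?case
  proof (cases "T (mark n) = Some (Suc n)")
    case False
    then have eq: "mark (Suc n) = mark n" using mark_Suc[of n] step(1) by (simp only: if_False)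
    show ?thesis unfolding eq using e by (intro exI[of _ e]) auto
  next
    case True
    have ms: "mark (Suc n) = (rowlen (shape (Suc n)) (Suc (snd (mark n))), Suc (snd (mark n)))"
      using mark_Suc[of n] step True by simp
    have col: "insertion_column T' (snd (mark n)) e = fst (mark n)"
    proof -
      have g: "T' (fst (mark n), snd (mark n)) = Some (real (Suc n))" using True by (simp add: real_tableau_apply[of T "mark n"])
      have "(LEAST x. \<exists>c. T' (x, snd (mark n)) = Some c \<and> e < c) = fst (mark n)"
      proof (rule Least_equality)
        show "\<exists>c. T' (fst (mark n), snd (mark n)) = Some c \<and> e < c" using g e(2) by auto
        fix x assume "\<exists>c. T' (x, snd (mark n)) = Some c \<and> e < c"
        then show "fst (mark n) \<le> x" using e(3)[of x] by (cases "x < fst (mark n)") auto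
      qed
      moreover have "\<exists>x c. T' (x, snd (mark n)) = Some c \<and> e < c" using g e(2) by blast
      ultimately show ?thesis by (simp add: insertion_column_def)
    qed
    have "arriving T' a' (snd (mark (Suc n))) = Some (real (Suc n))"
      using e(1) col True by (simp add: ms)
    moreover have "\<exists>i. T (x, snd (mark (Suc n))) = Some i \<and> real i \<le> real (Suc n)" if "x < fst (mark (Suc n))" for x
      using mark_below[OF _ that] step(1) by (auto simp: shape_eq)
    ultimately show ?thesis by (intro exI[of _ "real (Suc n)"]) simp
  qed
qed

lemma mark_column:
  assumes n: "m \<le> n" and e: "arriving T' a' (snd (mark n)) = Some e"
  shows "insertion_column T' (snd (mark n)) e = fst (mark n)" "e < real (Suc n)"
    "row_insert T' a' (mark n) = Some e"
proof -
  let ?y = "snd (mark n)"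
  show e2: "e < real (Suc n)" using mark_invariant[OF n] e by auto
  have e3: "\<And>x. x < fst (mark n) \<Longrightarrow> \<exists>i. T (x, ?y) = Some i \<and> real i \<le> e"
    using mark_invariant[OF n] e by auto
  show col: "insertion_column T' ?y e = fst (mark n)"
  proof (cases "T (mark n)")
    case (Some i)
    then have "n < i" using mark_notin[OF n] shape_eq[of "mark n" n] by (meson not_less)
    then have g: "\<exists>c. T' (fst (mark n), ?y) = Some c \<and> e < c" using Some e2 by (simp add: real_tableau_apply[of T "mark n"])
    have "(LEAST x. \<exists>c. T' (x, ?y) = Some c \<and> e < c) = fst (mark n)"
    proof (rule Least_equality)
      show "\<exists>c. T' (fst (mark n), ?y) = Some c \<and> e < c" by (rule g)
      fix x assume "\<exists>c. T' (x, ?y) = Some c \<and> e < c"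
      then show "fst (mark n) \<le> x" using e3[of x] by (cases "x < fst (mark n)") auto
    qed
    moreover have "\<exists>x c. T' (x, ?y) = Some c \<and> e < c" using g by blast
    ultimately show ?thesis by (simp only: insertion_column_def if_True)
  next
    case None
    \<comment> \<open>To the right of a box that is never filled the row is empty, so the rule falls
      back on the leftmost empty box.\<close>
    have "x < fst (mark n)" if "T (x, ?y) = Some i" for x i
    proof (rule ccontr)
      assume "\<not> x < fst (mark n)"
      moreover have "(x, ?y) \<in> shape i" using that by (auto simp: shape_eq)
      ultimately have "(fst (mark n), ?y) \<in> shape i" using diagramD[OF diagram_shape, of x ?y i "fst (mark n)" ?y] by simp
      then show False using None by (auto simp: shape_eq)
    qed
    then have "\<not> (\<exists>x c. T' (x, ?y) = Some c \<and> e < c)" using e3 by fastforce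
    moreover have "(LEAST x. T' (x, ?y) = None) = fst (mark n)"
    proof (rule Least_equality)
      show "T' (fst (mark n), ?y) = None" using None by (simp add: real_tableau_apply[of T "mark n"])
      fix x assume "T' (x, ?y) = None"
      then show "fst (mark n) \<le> x" using e3[of x] by (cases "x < fst (mark n)") auto
    qed
    ultimately show ?thesis unfolding insertion_column_def by auto
  qed
  show "row_insert T' a' (mark n) = Some e"
    using e col by (cases "mark n") (simp add: row_insert_def)
qed

lemma mark_in_route: "m \<le> n \<Longrightarrow> mark n \<in> bumping_route T' a'"
proof -
  assume n: "m \<le> n"
  obtain e where e: "arriving T' a' (snd (mark n)) = Some e" using mark_invariant[OF n] by blast
  have "T' (mark n) \<noteq> Some e"
  proof (cases "T (mark n)")
    case (Some i)
    then have "n < i" using mark_notin[OF n] shape_eq[of "mark n" n] by (meson not_less)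
    then show ?thesis using Some mark_column(2)[OF n e] by (simp add: real_tableau_apply[of T "mark n"])
  qed (simp add: real_tableau_apply[of T "mark n"])
  then show ?thesis using mark_column(3)[OF n e] by (simp add: bumping_route_def)
qed

text \<open>A number arrives in the next row only if the box of the mark has an entry
  \<open>i\<close>. The mark waits there until step \<open>i\<close>, which moves it to that
  row.\<close>

lemma arriving_imp_mark: "arriving T' a' y = Some e \<Longrightarrow> \<exists>n\<ge>m. snd (mark n) = y"
proof (induction y arbitrary: e)
  case 0
  have "mark m = (rowlen (shape m) 0, 0)" by (rule mark_box_start) simp
  then show ?case by (metis order_refl snd_conv)
next
  case (Suc y)
  then obtain e0 where e0: "arriving T' a' y = Some e0" by (cases "arriving T' a' y") auto
  then obtain n where n: "n \<ge> m" "snd (mark n) = y" using Suc.IH by blast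
  have "insertion_column T' y e0 = fst (mark n)" using mark_column(1)[OF n(1)] e0 n(2) by simp
  then have "T' (mark n) = Some e" using Suc.prems e0 n(2) by (cases "mark n") auto
  then obtain i where i: "T (mark n) = Some i" using real_tableau_apply[of T "mark n"] by auto
  have ni: "n < i" using i mark_notin[OF n(1)] shape_eq[of "mark n" n] by (meson not_less)
  obtain j where j: "i = Suc j" "n \<le> j" using ni by (cases i) auto
  have "mark k = mark n" if "n \<le> k" "k \<le> j" for k
    using that
  proof (induction k rule: dec_induct)
    case (step k)
    then have "mark k = mark n" by simp
    then have "T (mark k) \<noteq> Some (Suc k)" using i j step by simp
    then have "mark (Suc k) = mark k" using mark_Suc[of k] n(1) step(1) by (simp only: if_False order.trans)
    then show ?case using \<open>mark k = mark n\<close> by (rule trans)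
  qed (rule refl)
  then have mj: "mark j = mark n" using j by blast
  then have "T (mark j) = Some (Suc j)" using i j by simp
  then have "mark (Suc j) = (rowlen (shape (Suc j)) (Suc (snd (mark j))), Suc (snd (mark j)))"
    using mark_Suc[of j] n(1) j(2) by simp
  then have "snd (mark i) = Suc y" unfolding j(1) using mj n(2) by (simp only: snd_conv)
  then show ?case using n(1) ni by (metis less_or_eq_imp_le order.trans)
qed

lemma bumping_route_eq: "bumping_route T' a' = mark ` {m..}"
proof (intro equalityI subsetI)
  fix b assume b: "b \<in> bumping_route T' a'"
  obtain x y where xy: "b = (x, y)" by (cases b)
  obtain e where e: "arriving T' a' y = Some e" "x = insertion_column T' y e"
    using b unfolding xy bumping_route_def row_insert_def by (auto split: option.splits if_splits)
  then obtain n where n: "n \<ge> m" "snd (mark n) = y" using arriving_imp_mark by blast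
  then have "b = mark n" using mark_column(1)[OF n(1)] e xy by (simp add: prod_eq_iff)
  then show "b \<in> mark ` {m..}" using n(1) by simp
qed (auto intro: mark_in_route)

lemma first_row_eq: "first_row T m x = Inf {enat (snd (mark n)) | n. m \<le> n \<and> fst (mark n) \<le> x}"
proof -
  have "(\<exists>x'\<le>x. (x', y) \<in> bumping_route T' a') \<longleftrightarrow> (\<exists>n. y = snd (mark n) \<and> m \<le> n \<and> fst (mark n) \<le> x)" for y
  proof
    assume "\<exists>x'\<le>x. (x', y) \<in> bumping_route T' a'"
    then obtain x' n where "x' \<le> x" "(x', y) = mark n" "m \<le> n" unfolding bumping_route_eq by blast
    then show "\<exists>n. y = snd (mark n) \<and> m \<le> n \<and> fst (mark n) \<le> x" by (metis fst_conv snd_conv)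
  next
    assume "\<exists>n. y = snd (mark n) \<and> m \<le> n \<and> fst (mark n) \<le> x"
    then obtain n where "y = snd (mark n)" "m \<le> n" "fst (mark n) \<le> x" by blast
    then show "\<exists>x'\<le>x. (x', y) \<in> bumping_route T' a'"
      using mark_in_route[of n] by (metis prod.collapse)
  qed
  then have "{enat y | y. \<exists>x'\<le>x. (x', y) \<in> bumping_route T' a'} = {enat (snd (mark n)) | n. m \<le> n \<and> fst (mark n) \<le> x}"
    by blast
  then show ?thesis unfolding first_row_def real_tableau_def[symmetric] by (rule arg_cong)
qed

lemma fst_mark_antimono: assumes "m \<le> k" "k \<le> n" shows "fst (mark n) \<le> fst (mark k)"
  using assms(2)
proof (induction n rule: dec_induct)
  case (step n)
  have "fst (mark (Suc n)) \<le> fst (mark n)"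
  proof (cases "T (mark n) = Some (Suc n)")
    case True
    have mn: "mark n = entry_box T (Suc n)" using True entry_iff by simp
    have "mark n \<in> removable (shape (Suc n))"
      using removable_insert[OF diagram_shape mark_addable[of n]] assms step unfolding tab_boxes.simps mn by simp
    then have "rowlen (shape (Suc n)) (Suc (snd (mark n))) \<le> fst (mark n)"
      using removable_iff[OF diagram_shape, of "fst (mark n)" "snd (mark n)" "Suc n"] by simp
    then show ?thesis using mark_Suc[of n] True assms step by simp
  qed (use mark_Suc[of n] assms step in simp)
  then show ?case using step by simp
qed simp

text \<open>The mark is an addable box of the shape, hence not above the first empty box of column
  0.\<close>

lemma first_row_le: assumes "m \<le> n" "fst (mark n) \<le> x" shows "first_row T m x \<le> enat (collen (shape n) 0)"
proof -
  have "first_row T m x \<le> enat (snd (mark n))" unfolding first_row_eq by (rule Inf_lower) (use assms in auto)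
  also have "snd (mark n) \<le> collen (shape n) 0"
  proof (rule ccontr)
    assume "\<not> snd (mark n) \<le> collen (shape n) 0"
    then have "collen (shape n) 0 \<le> snd (mark n) - 1" "snd (mark n) \<noteq> 0" by auto
    moreover have "(0, snd (mark n) - 1) \<in> insert (mark n) (shape n)"
      by (rule diagramD[OF addable_diagram[OF mark_addable[OF assms(1)]], of "fst (mark n)" "snd (mark n)"]) auto
    ultimately have "(0, snd (mark n) - 1) \<in> shape n" by (cases "mark n") auto
    then show False using collen_iff[OF diagram_shape, of "snd (mark n) - 1" n 0] \<open>collen _ _ \<le> _\<close> by simp
  qed
  then have "enat (snd (mark n)) \<le> enat (collen (shape n) 0)" by simp
  finally show ?thesis .
qed

text \<open>Marks move to the left only, so column \<open>x\<close> is not reached before time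
  \<open>n\<close>; a place outside the shape in a column \<open>\<le> x\<close> is then at least as
  high as column \<open>x\<close> at time \<open>n\<close>.\<close>

lemma first_row_ge: assumes "m \<le> n" "x < fst (mark n)" shows "enat (collen (shape n) x) \<le> first_row T m x"
  unfolding first_row_eq
proof (rule Inf_greatest)
  fix z assume "z \<in> {enat (snd (mark k)) | k. m \<le> k \<and> fst (mark k) \<le> x}"
  then obtain k where k: "z = enat (snd (mark k))" "m \<le> k" "fst (mark k) \<le> x" by blast
  have "n \<le> k" using fst_mark_antimono[OF k(2), of n] k assms by (cases "n \<le> k") auto
  have "\<not> snd (mark k) < collen (shape n) x"
  proof
    assume "snd (mark k) < collen (shape n) x"
    then have "(x, snd (mark k)) \<in> shape n" using collen_iff[OF diagram_shape] by blast
    then have "(fst (mark k), snd (mark k)) \<in> shape n" by (rule diagramD[OF diagram_shape]) (use k in auto)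
    then show False using shape_mono[OF \<open>n \<le> k\<close>] mark_notin[OF k(2)] by auto
  qed
  then show "enat (collen (shape n) x) \<le> z" using k by simp
qed

end

subsection \<open>Measurability\<close>

lemma space_tableau_space: "space tableau_space = {t. infinite_standard_tableau t}"
  by (simp add: tableau_space_def space_restrict_space space_PiM)

lemma measurable_entry [measurable]: "(\<lambda>T. T b) \<in> tableau_space \<rightarrow>\<^sub>M count_space UNIV"
  unfolding tableau_space_def by (intro measurable_restrict_space1 measurable_component_singleton) simp

lemma measurable_entry_pred [measurable]: "Measurable.pred tableau_space (\<lambda>T. P (T b))"
  by (rule measurable_compose[OF measurable_entry]) simp

lemma pred_entry_box: "Measurable.pred tableau_space (\<lambda>T. entry_box T (Suc i) = b)"
proof -
  have "entry_box T (Suc i) = b \<longleftrightarrow> T b = Some (Suc i)" if "T \<in> space tableau_space" for T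
  proof -
    have "\<exists>!b. T b = Some (Suc i)" using that by (simp add: space_tableau_space infinite_standard_tableau_def)
    moreover from this have "T (entry_box T (Suc i)) = Some (Suc i)" unfolding entry_box_def by (rule theI')
    ultimately show ?thesis by blast
  qed
  then show ?thesis
    by (rule measurable_cong[THEN iffD2, rotated, OF measurable_entry_pred[of "\<lambda>v. v = Some (Suc i)" b]])
qed

lemma pred_tab_boxes: "Measurable.pred tableau_space (\<lambda>T. tab_boxes T n = p)"
proof (induction n arbitrary: p)
  case (Suc n)
  show ?case
  proof (cases p)
    case (Cons a q)
    then show ?thesis using pred_entry_box[of n a] Suc[of q] by (simp add: pred_intros_logic)
  qed simp
qed simp

lemma measurable_tab_boxes [measurable]: "(\<lambda>T. tab_boxes T n) \<in> tableau_space \<rightarrow>\<^sub>M count_space UNIV"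
  unfolding measurable_count_space_eq2_countable
  using pred_tab_boxes[of n] by (auto simp: pred_def vimage_def Int_def conj_commute)

text \<open>Doubling all numbers makes \<open>m + 1 / 2\<close> a natural number and keeps all values in a countable type.\<close>

definition doubled :: "nat tableau \<Rightarrow> nat tableau" where
  "doubled T b = map_option (\<lambda>i. 2 * i) (T b)"

lemma bumping_route_doubled:
  "bumping_route (map_option real \<circ> T) (real m + 1 / 2) = bumping_route (doubled T) (2 * m + 1)"
proof -
  define g where "g k = real k / 2" for k :: nat
  have g: "strict_mono_on UNIV g" by (auto simp: strict_mono_on_def g_def)
  have T: "map_option real \<circ> T = map_option g \<circ> doubled T"
    by (auto simp: doubled_def g_def option.map_comp comp_def)
  have a: "real m + 1 / 2 = g (2 * m + 1)" by (simp add: g_def add_divide_distrib)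
  have inj: "map_option g x = map_option g y \<longleftrightarrow> x = y" for x y
    by (cases x; cases y) (auto simp: g_def)
  have "row_insert (map_option g \<circ> doubled T) (g (2 * m + 1)) = map_option g \<circ> row_insert (doubled T) (2 * m + 1)"
    by (rule row_insert_map[OF g]) auto
  then show ?thesis unfolding bumping_route_def T a by (simp add: inj)
qed

lemma measurable_insertion_column:
  "(\<lambda>T. insertion_column (doubled T) y a) \<in> tableau_space \<rightarrow>\<^sub>M count_space UNIV"
proof -
  have 1 [measurable]: "Measurable.pred tableau_space (\<lambda>T. \<exists>c. doubled T (x, y) = Some c \<and> a < c)" for x
    unfolding doubled_def by (rule measurable_entry_pred)
  have 2 [measurable]: "Measurable.pred tableau_space (\<lambda>T. doubled T (x, y) = None)" for x
    unfolding doubled_def by (rule measurable_entry_pred)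
  show ?thesis unfolding insertion_column_def by measurable
qed

lemma measurable_doubled_at:
  assumes "f \<in> tableau_space \<rightarrow>\<^sub>M count_space UNIV"
  shows "(\<lambda>T. doubled T (f T, y :: nat)) \<in> tableau_space \<rightarrow>\<^sub>M count_space UNIV"
proof (rule measurable_compose_countable[OF _ assms])
  fix x
  show "(\<lambda>T. doubled T (x, y)) \<in> tableau_space \<rightarrow>\<^sub>M count_space UNIV"
    unfolding doubled_def by (rule measurable_compose[OF measurable_entry]) simp
qed

lemma measurable_arriving: "(\<lambda>T. arriving (doubled T) a y) \<in> tableau_space \<rightarrow>\<^sub>M count_space UNIV"
proof (induction y)
  case (Suc y)
  have "(\<lambda>T. (\<lambda>v T. Option.bind v (\<lambda>b. doubled T (insertion_column (doubled T) y b, y))) (arriving (doubled T) a y) T)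
      \<in> tableau_space \<rightarrow>\<^sub>M count_space UNIV"
  proof (rule measurable_compose_countable[OF _ Suc])
    fix v
    show "(\<lambda>T. Option.bind v (\<lambda>b. doubled T (insertion_column (doubled T) y b, y))) \<in> tableau_space \<rightarrow>\<^sub>M count_space UNIV"
      by (cases v) (auto intro: measurable_doubled_at measurable_insertion_column)
  qed
  then show ?case by simp
qed simp

lemma pred_bumping_route [measurable]: "Measurable.pred tableau_space (\<lambda>T. (x, y) \<in> bumping_route (doubled T) a)"
proof -
  have "Measurable.pred tableau_space (\<lambda>T. (\<lambda>v T. case v of None \<Rightarrow> False
      | Some b \<Rightarrow> x = insertion_column (doubled T) y b \<and> Some b \<noteq> doubled T (x, y)) (arriving (doubled T) a y) T)"
  proof (rule measurable_compose_countable[OF _ measurable_arriving])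
    fix v
    show "Measurable.pred tableau_space (\<lambda>T. case v of None \<Rightarrow> False
      | Some b \<Rightarrow> x = insertion_column (doubled T) y b \<and> Some b \<noteq> doubled T (x, y))"
    proof (cases v)
      case (Some b)
      have "Measurable.pred tableau_space (\<lambda>T. x = insertion_column (doubled T) y b)"
        by (rule measurable_compose[OF measurable_insertion_column]) simp
      moreover have "Measurable.pred tableau_space (\<lambda>T. Some b \<noteq> doubled T (x, y))"
        unfolding doubled_def by (rule measurable_entry_pred)
      ultimately show ?thesis using Some by (simp add: pred_intros_logic)
    qed simp
  qed
  moreover have "(x, y) \<in> bumping_route (doubled T) a \<longleftrightarrow> (case arriving (doubled T) a y of None \<Rightarrow> False
      | Some b \<Rightarrow> x = insertion_column (doubled T) y b \<and> Some b \<noteq> doubled T (x, y))" for T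
    by (auto simp: bumping_route_def row_insert_def split: option.splits)
  ultimately show ?thesis by simp
qed

text \<open>\<open>LEAST\<close> over the row numbers replaces the infimum in \<open>enat\<close>,
  which suits the measurability proof; the infinite case and the case without a row both give
  0.\<close>

lemma scaled_inverse_row_alt:
  "scaled_inverse_row T m x = (if \<exists>y. \<exists>x'\<le>x. (x', y) \<in> bumping_route (doubled T) (2 * m + 1)
     then 2 * real m / real (LEAST y. \<exists>x'\<le>x. (x', y) \<in> bumping_route (doubled T) (2 * m + 1)) else 0)"
proof -
  define R where "R y \<longleftrightarrow> (\<exists>x'\<le>x. (x', y) \<in> bumping_route (doubled T) (2 * m + 1))" for y
  have f: "first_row T m x = Inf {enat y | y. R y}"
    unfolding first_row_def bumping_route_doubled R_def by simp
  show ?thesis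
  proof (cases "\<exists>y. R y")
    case True
    have "Inf {enat y | y. R y} = enat (LEAST y. R y)"
    proof (rule antisym)
      show "Inf {enat y | y. R y} \<le> enat (LEAST y. R y)" using LeastI_ex[OF True] by (intro Inf_lower) auto
      show "enat (LEAST y. R y) \<le> Inf {enat y | y. R y}" by (intro Inf_greatest) (auto intro: Least_le)
    qed
    then show ?thesis using True f unfolding R_def[symmetric] by (simp add: scaled_inverse_row_def)
  next
    case False
    then have "Inf {enat y | y. R y} = \<infinity>" by (simp add: top_enat_def)
    then show ?thesis using False f unfolding R_def[symmetric] by (simp add: scaled_inverse_row_def)
  qed
qed

lemma measurable_scaled_inverse_row: "(\<lambda>T. scaled_inverse_row T m x) \<in> borel_measurable tableau_space"
proof -
  have [measurable]: "Measurable.pred tableau_space (\<lambda>T. \<exists>x'\<le>x. (x', y) \<in> bumping_route (doubled T) (2 * m + 1))" for y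
    by measurable
  have [measurable]: "(\<lambda>T. 2 * real m / real (LEAST y. \<exists>x'\<le>x. (x', y) \<in> bumping_route (doubled T) (2 * m + 1))) \<in> borel_measurable tableau_space"
    by (rule measurable_compose[where N = "count_space UNIV" and g = "\<lambda>y. 2 * real m / real y"]) (measurable, simp)
  show ?thesis unfolding scaled_inverse_row_alt by measurable
qed

subsection \<open>The law of the shapes of a Plancherel tableau\<close>

lemma sets_box_path: "{w. box_path (rev (map w [0..<n])) = p} \<in> sets unif_seq"
proof -
  have "{w. box_path (rev (map w [0..<n])) = p} = (\<Union>v\<in>{v. box_path (rev v) = p}. {w. ranks w n = v})"
    unfolding box_path_ranks by auto
  also have "\<dots> \<in> sets unif_seq" by (intro sets.countable_UN'') auto
  finally show ?thesis .
qed

definition nth_box :: "(nat \<Rightarrow> real) \<Rightarrow> nat \<Rightarrow> nat \<times> nat" where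
  "nth_box w n = hd (box_path (rev (map w [0..<Suc n])))"

lemma box_path_Suc: "box_path (rev (map w [0..<Suc n])) = nth_box w n # box_path (rev (map w [0..<n]))"
  by (simp add: nth_box_def)

lemma set_box_path: "set (box_path (rev (map w [0..<n]))) = nth_box w ` {..<n}"
  by (induction n) (simp_all only: box_path_Suc list.set lessThan_Suc image_insert, simp)

lemma nth_box_notin: "nth_box w n \<notin> nth_box w ` {..<n}"
  using box_path[of "rev (map w [0..<Suc n])"] unfolding box_path_Suc
  by (simp add: addable_def set_box_path)

lemma inj_nth_box: "inj (nth_box w)"
proof (rule linorder_injI)
  fix i j :: nat assume "i < j"
  then show "nth_box w i \<noteq> nth_box w j" using nth_box_notin[of w j] by (metis imageI lessThan_iff)
qed

lemma recording_tableau_iff: "recording_tableau w b = Some i \<longleftrightarrow> (\<exists>k. i = Suc k \<and> b = nth_box w k)"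
proof -
  have dom: "insertion_tableau (map w [0..<n]) b \<noteq> None \<longleftrightarrow> (\<exists>k<n. b = nth_box w k)" for n
  proof -
    have "dom (insertion_tableau (map w [0..<n])) = nth_box w ` {..<n}"
      using box_path[of "rev (map w [0..<n])"] by (simp add: set_box_path)
    then show ?thesis by (auto simp: domIff[symmetric])
  qed
  show ?thesis
  proof (cases "\<exists>k. b = nth_box w k")
    case True
    then obtain k where k: "b = nth_box w k" by blast
    then have uniq: "b = nth_box w k' \<longleftrightarrow> k' = k" for k' using inj_nth_box[of w] by (auto dest: injD)
    have "(LEAST n. insertion_tableau (map w [0..<n]) b \<noteq> None) = Suc k"
    proof (rule Least_equality)
      show "insertion_tableau (map w [0..<Suc k]) b \<noteq> None" using dom[of "Suc k"] k by blast
      fix n assume "insertion_tableau (map w [0..<n]) b \<noteq> None"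
      then obtain k' where "k' < n" "b = nth_box w k'" unfolding dom by blast
      then show "Suc k \<le> n" using uniq by simp
    qed
    moreover have "\<exists>n. insertion_tableau (map w [0..<n]) b \<noteq> None"
      by (rule exI[of _ "Suc k"]) (use dom[of "Suc k"] k in blast)
    ultimately have "recording_tableau w b = Some (Suc k)" unfolding recording_tableau_def by (simp only: if_True)
    then show ?thesis using uniq by auto
  next
    case False
    then have "recording_tableau w b = None" unfolding recording_tableau_def dom by auto
    then show ?thesis using False by auto
  qed
qed

lemma tab_boxes_recording:
  fixes w :: "nat \<Rightarrow> real"
  shows "tab_boxes (recording_tableau w) n = box_path (rev (map w [0..<n]))"
proof (induction n)
  case (Suc n)
  have "entry_box (recording_tableau w) (Suc n) = nth_box w n"
    unfolding entry_box_def by (rule the_equality) (auto simp: recording_tableau_iff)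
  then show ?case using Suc unfolding box_path_Suc tab_boxes.simps(2) by simp
qed simp

text \<open>Valid for every sequence, with or without ties, because the shapes of semistandard
  tableaux grow by one addable box at a time.\<close>

lemma growing_recording:
  fixes w :: "nat \<Rightarrow> real"
  shows "growing (recording_tableau w)"
proof -
  have diag: "diagram (nth_box w ` {..<n})" for n
    using box_path[of "rev (map w [0..<n])"] growth_path_diagram set_box_path[of w n] by metis
  have less: "k < k'" if "nth_box w k = (x, y)" "nth_box w k' = (x', y')" "x \<le> x'" "y \<le> y'" "(x, y) \<noteq> (x', y')" for k k' x x' y y'
  proof -
    have "(x', y') \<in> nth_box w ` {..<Suc k'}" using that(2) by (metis imageI lessThan_iff lessI)
    then have "(x, y) \<in> nth_box w ` {..<Suc k'}" by (rule diagramD[OF diag]) (use that in auto)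
    then obtain k'' where "(x, y) = nth_box w k''" "k'' \<in> {..<Suc k'}" by (rule imageE)
    then have "k'' < Suc k'" "nth_box w k'' = nth_box w k" using that(1) by simp_all
    then have "k \<le> k'" using inj_nth_box[of w] by (auto dest: injD)
    moreover have "k \<noteq> k'" using that by auto
    ultimately show ?thesis by simp
  qed
  have "infinite_standard_tableau (recording_tableau w)"
    unfolding infinite_standard_tableau_def
  proof (intro conjI allI impI)
    fix x x' y i j
    assume "x < x' \<and> recording_tableau w (x, y) = Some i \<and> recording_tableau w (x', y) = Some j"
    then show "i < j" by (auto simp: recording_tableau_iff intro!: less[of _ x y _ x' y])
  next
    fix x y y' i j
    assume "y < y' \<and> recording_tableau w (x, y) = Some i \<and> recording_tableau w (x, y') = Some j"
    then show "i < j" by (auto simp: recording_tableau_iff intro!: less[of _ x y _ x y'])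
  next
    fix b show "recording_tableau w b \<noteq> Some 0" by (auto simp: recording_tableau_iff)
  next
    fix i :: nat assume "1 \<le> i"
    then obtain k where "i = Suc k" by (cases i) auto
    then show "\<exists>!b. recording_tableau w b = Some i" by (auto simp: recording_tableau_iff)
  qed
  moreover have "growth_path (box_path (rev (map w [0..<n])))" for n
    using box_path[of "rev (map w [0..<n])"] by blast
  ultimately show ?thesis by (simp add: growing_def tab_boxes_recording)
qed

lemma measurable_recording: "recording_tableau \<in> unif_seq \<rightarrow>\<^sub>M tableau_space"
  unfolding tableau_space_def
proof (rule measurable_restrict_space2)
  show "(recording_tableau :: (nat \<Rightarrow> real) \<Rightarrow> _) \<in> space unif_seq \<rightarrow> {t. infinite_standard_tableau t}"
    using growing_recording by (auto simp: growing_def)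
  have nb: "{w. nth_box w k = b} \<in> sets unif_seq" for k b
  proof -
    have "{w. nth_box w k = b} = (\<Union>p\<in>{p. hd p = b}. {w. box_path (rev (map w [0..<Suc k])) = p})"
      unfolding nth_box_def by blast
    also have "\<dots> \<in> sets unif_seq" by (intro sets.countable_UN'' sets_box_path) auto
    finally show ?thesis .
  qed
  have some: "{w. recording_tableau w b = Some i} \<in> sets unif_seq" for b i
  proof -
    have "{w. recording_tableau w b = Some i} = (\<Union>k\<in>{k. i = Suc k}. {w. nth_box w k = b})"
      by (auto simp: recording_tableau_iff)
    also have "\<dots> \<in> sets unif_seq" by (intro sets.countable_UN'' nb) auto
    finally show ?thesis .
  qed
  have none: "{w. recording_tableau w b = None} \<in> sets unif_seq" for b
  proof -
    have "(\<Union>i. {w. recording_tableau w b = Some i}) \<in> sets unif_seq"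
      by (intro sets.countable_UN'') (auto simp only: some)
    from sets.compl_sets[OF this] have "space unif_seq - (\<Union>i. {w. recording_tableau w b = Some i}) \<in> sets unif_seq" .
    also have "space unif_seq - (\<Union>i. {w. recording_tableau w b = Some i}) = {w. recording_tableau w b = None}"
      by auto
    finally show ?thesis .
  qed
  have coord: "(\<lambda>w. recording_tableau w b) \<in> unif_seq \<rightarrow>\<^sub>M count_space UNIV" for b
    unfolding measurable_count_space_eq2_countable
  proof (intro conjI ballI)
    fix v :: "nat option"
    have "{w. recording_tableau w b = v} \<in> sets unif_seq" using none[of b] some[of b] by (cases v) simp_all
    also have "{w. recording_tableau w b = v} = (\<lambda>w. recording_tableau w b) -` {v} \<inter> space unif_seq" by auto
    finally show "(\<lambda>w. recording_tableau w b) -` {v} \<inter> space unif_seq \<in> sets unif_seq" .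
  qed simp
  have "(\<lambda>w b. recording_tableau w b) \<in> unif_seq \<rightarrow>\<^sub>M PiM UNIV (\<lambda>_. count_space UNIV)"
    by (rule measurable_PiM_single'[OF coord]) simp
  then show "recording_tableau \<in> unif_seq \<rightarrow>\<^sub>M PiM UNIV (\<lambda>_. count_space UNIV)" .
qed

lemma plancherel_eq: "plancherel = distr unif_seq tableau_space recording_tableau"
  by (simp add: plancherel_def unif_seq_def unif_def)

section \<open>The Poisson process\<close>

definition expo :: "real measure" where
  "expo = density lborel (exponential_density 1)"

definition expo_seq :: "(nat \<Rightarrow> real) measure" where
  "expo_seq = PiM UNIV (\<lambda>_. expo)"

definition arrival :: "(nat \<Rightarrow> real) \<Rightarrow> nat \<Rightarrow> real" where
  "arrival \<omega> i = (\<Sum>j\<le>i. \<omega> j)"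

text \<open>This counts the points \<open>arrival \<omega> i\<close> below \<open>u\<close> provided that all \<open>\<omega> i\<close> are nonnegative.\<close>

definition counts :: "(nat \<Rightarrow> real) \<Rightarrow> real \<Rightarrow> nat \<Rightarrow> bool" where
  "counts \<omega> u b \<longleftrightarrow> (b = 0 \<or> arrival \<omega> (b - 1) < u) \<and> u \<le> arrival \<omega> b"

definition all_counts :: "(nat \<Rightarrow> real) \<Rightarrow> (real \<times> nat) list \<Rightarrow> bool" where
  "all_counts \<omega> L \<longleftrightarrow> (\<forall>(u, b)\<in>set L. counts \<omega> u b)"

text \<open>Levels and counts are listed from below, starting after the level \<open>v\<close> with
  count \<open>c\<close>.\<close>

fun increasing_counts :: "real \<Rightarrow> nat \<Rightarrow> (real \<times> nat) list \<Rightarrow> bool" where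
  "increasing_counts v c [] \<longleftrightarrow> True"
| "increasing_counts v c ((u, b) # L) \<longleftrightarrow> v < u \<and> c \<le> b \<and> increasing_counts u b L"

text \<open>For the start \<open>v = 0\<close> this is the product of the Poisson probabilities of
  the increments; their exponentials telescope to the one at the highest level.\<close>

fun process_weight :: "real \<Rightarrow> nat \<Rightarrow> (real \<times> nat) list \<Rightarrow> real" where
  "process_weight v c [] = exp (- v)"
| "process_weight v c ((u, b) # L) = (u - v) ^ (b - c) / fact (b - c) * process_weight u b L"

lemma prob_space_expo: "prob_space expo"
  unfolding expo_def by (rule prob_space_exponential_density) simp

lemma sets_expo [simp, measurable_cong]: "sets expo = sets borel"
  by (simp add: expo_def)

lemma space_expo [simp]: "space expo = UNIV"
  by (simp add: expo_def)

lemma space_expo_seq [simp]: "space expo_seq = UNIV"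
  by (simp add: expo_seq_def space_PiM)

interpretation expo_seq: prob_space expo_seq
  unfolding expo_seq_def by (intro prob_space_PiM prob_space_expo)

lemma measurable_expo_seq [measurable]: "(\<lambda>w. w i) \<in> borel_measurable expo_seq"
proof -
  have "(\<lambda>w. w i) \<in> expo_seq \<rightarrow>\<^sub>M expo"
    unfolding expo_seq_def by (rule measurable_component_singleton) simp
  then show ?thesis by (simp cong: measurable_cong_sets)
qed

lemma measurable_arrival [measurable]: "(\<lambda>\<omega>. arrival \<omega> i) \<in> borel_measurable expo_seq"
  unfolding arrival_def by measurable

lemma pred_counts [measurable]: "Measurable.pred expo_seq (\<lambda>\<omega>. counts \<omega> u b)"
  unfolding counts_def by measurable

lemma pred_all_counts [measurable]: "Measurable.pred expo_seq (\<lambda>\<omega>. all_counts \<omega> L)"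
proof (induction L)
  case (Cons p L)
  obtain u b where "p = (u, b)" by (cases p)
  then have "all_counts \<omega> (p # L) \<longleftrightarrow> counts \<omega> u b \<and> all_counts \<omega> L" for \<omega> by (simp add: all_counts_def)
  then show ?case using Cons by simp
qed (simp add: all_counts_def)

lemma nn_integral_expo_seq:
  assumes "A \<in> sets expo_seq"
  shows "emeasure expo_seq A = (\<integral>\<^sup>+t. ennreal (exponential_density 1 t) * emeasure expo_seq {\<omega>. case_nat t \<omega> \<in> A} \<partial>lborel)"
proof -
  interpret E: prob_space expo by (rule prob_space_expo)
  interpret S: sequence_space expo by unfold_locales
  have seq: "S.S = expo_seq" by (simp add: expo_seq_def)
  have m: "(\<lambda>(s, \<omega>). case_nat s \<omega>) \<in> expo \<Otimes>\<^sub>M expo_seq \<rightarrow>\<^sub>M expo_seq"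
    unfolding expo_seq_def by measurable
  have "emeasure expo_seq A = emeasure (distr (expo \<Otimes>\<^sub>M expo_seq) expo_seq (\<lambda>(s, \<omega>). case_nat s \<omega>)) A"
    using S.PiM_iter unfolding seq by simp
  also have "\<dots> = emeasure (expo \<Otimes>\<^sub>M expo_seq) ((\<lambda>(s, \<omega>). case_nat s \<omega>) -` A \<inter> space (expo \<Otimes>\<^sub>M expo_seq))"
    by (rule emeasure_distr[OF m assms])
  also have "\<dots> = (\<integral>\<^sup>+t. emeasure expo_seq (Pair t -` ((\<lambda>(s, \<omega>). case_nat s \<omega>) -` A \<inter> space (expo \<Otimes>\<^sub>M expo_seq))) \<partial>expo)"
    by (rule expo_seq.emeasure_pair_measure_alt) (rule measurable_sets[OF m assms])
  also have "\<dots> = (\<integral>\<^sup>+t. emeasure expo_seq {\<omega>. case_nat t \<omega> \<in> A} \<partial>expo)"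
    by (intro nn_integral_cong arg_cong[where f = "emeasure expo_seq"]) (auto simp: space_pair_measure)
  also have "\<dots> = (\<integral>\<^sup>+t. ennreal (exponential_density 1 t) * emeasure expo_seq {\<omega>. case_nat t \<omega> \<in> A} \<partial>lborel)"
    unfolding expo_def
  proof (rule nn_integral_density)
    have "(\<lambda>t. emeasure expo_seq (Pair t -` ((\<lambda>(s, \<omega>). case_nat s \<omega>) -` A \<inter> space (expo \<Otimes>\<^sub>M expo_seq)))) \<in> borel_measurable expo"
      by (rule expo_seq.measurable_emeasure_Pair) (rule measurable_sets[OF m assms])
    also have "(\<lambda>t. emeasure expo_seq (Pair t -` ((\<lambda>(s, \<omega>). case_nat s \<omega>) -` A \<inter> space (expo \<Otimes>\<^sub>M expo_seq))))
        = (\<lambda>t. emeasure expo_seq {\<omega>. case_nat t \<omega> \<in> A})"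
      by (intro ext arg_cong[where f = "emeasure expo_seq"]) (auto simp: space_pair_measure)
    finally show "(\<lambda>t. emeasure expo_seq {\<omega>. case_nat t \<omega> \<in> A}) \<in> borel_measurable lborel"
      by (simp cong: measurable_cong_sets)
  qed simp
  finally show ?thesis .
qed

lemma AE_expo_seq_nonneg: "AE \<omega> in expo_seq. \<forall>i. 0 \<le> \<omega> i"
proof -
  have "AE \<omega> in expo_seq. 0 \<le> \<omega> i" for i
    unfolding expo_seq_def
  proof (rule AE_PiM_component)
    show "AE t in expo. 0 \<le> t"
      unfolding expo_def by (subst AE_density) (auto simp: exponential_density_def)
  qed (auto intro: prob_space_expo)
  then show ?thesis by (simp add: AE_all_countable)
qed

lemma arrival_case_nat: "arrival (case_nat t \<omega>) (Suc i) = t + arrival \<omega> i"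
  unfolding arrival_def by (subst sum.atMost_Suc_shift) simp

lemma arrival_0 [simp]: "arrival \<omega> 0 = \<omega> 0"
  by (simp add: arrival_def)

lemma arrival_nonneg: "(\<And>i. 0 \<le> \<omega> i) \<Longrightarrow> 0 \<le> arrival \<omega> i"
  unfolding arrival_def by (rule sum_nonneg) auto

lemma arrival_mono: "(\<And>i. 0 \<le> \<omega> i) \<Longrightarrow> i \<le> j \<Longrightarrow> arrival \<omega> i \<le> arrival \<omega> j"
  unfolding arrival_def by (rule sum_mono2) auto

lemma counts_case_nat:
  assumes "\<And>i. 0 \<le> \<omega> i"
  shows "counts (case_nat t \<omega>) u (Suc b) \<longleftrightarrow> t < u \<and> counts \<omega> (u - t) b"
proof (cases b)
  case 0
  then show ?thesis using arrival_case_nat[of t \<omega> 0] by (auto simp: counts_def)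
next
  case (Suc d)
  have "0 \<le> arrival \<omega> d" by (rule arrival_nonneg) (rule assms)
  then have "t < u" if "t + arrival \<omega> d < u" using that by linarith
  then show ?thesis using Suc arrival_case_nat[of t \<omega> d] arrival_case_nat[of t \<omega> "Suc d"] by (auto simp: counts_def)
qed

text \<open>Only differences of levels and counts enter, apart from the final exponential, which
  produces \<open>exp t\<close>. This cancels the density \<open>exp (- t)\<close> of the first
  arrival.\<close>

lemma process_weight_shift:
  "\<lbrakk>increasing_counts v c L; 1 \<le> c\<rbrakk> \<Longrightarrow>
    process_weight (v - t) (c - 1) (map (\<lambda>(u, b). (u - t, b - 1)) L) = exp t * process_weight v c L"
proof (induction L arbitrary: v c)
  case (Cons p L)
  obtain u b where p: "p = (u, b)" by (cases p)
  then have "process_weight (u - t) (b - 1) (map (\<lambda>(u, b). (u - t, b - 1)) L) = exp t * process_weight u b L"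
    using Cons by (intro Cons.IH) auto
  moreover have "b - 1 - (c - 1) = b - c" using Cons.prems p by simp
  ultimately show ?case using p by simp
qed (simp add: exp_diff exp_minus field_simps)

lemma increasing_counts_shift:
  "\<lbrakk>increasing_counts v c L; 1 \<le> c\<rbrakk> \<Longrightarrow> increasing_counts (v - t) (c - 1) (map (\<lambda>(u, b). (u - t, b - 1)) L)"
proof (induction L arbitrary: v c)
  case (Cons p L)
  obtain u b where p: "p = (u, b)" by (cases p)
  then show ?case using Cons.IH[of u b] Cons.prems by (simp add: diff_le_mono)
qed simp

lemma increasing_counts_in: "increasing_counts v c L \<Longrightarrow> (u, b) \<in> set L \<Longrightarrow> v < u \<and> c \<le> b"
proof (induction L arbitrary: v c)
  case (Cons p L)
  obtain ua ba where p: "p = (ua, ba)" by (cases p)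
  have *: "v < ua" "c \<le> ba" "increasing_counts ua ba L" using Cons.prems p by auto
  show ?case
  proof (cases "(u, b) = p")
    case True
    then show ?thesis using * p by simp
  next
    case False
    then have "ua < u \<and> ba \<le> b" using Cons.IH[OF *(3)] Cons.prems by simp
    then show ?thesis using * by auto
  qed
qed simp

lemma nn_integral_power_interval:
  assumes "v \<le> (u :: real)"
  shows "(\<integral>\<^sup>+t. ennreal ((u - t) ^ b / fact b) * indicator {v..u} t \<partial>lborel) = ennreal ((u - v) ^ Suc b / fact (Suc b))"
proof -
  define F where "F t = - ((u - t) ^ Suc b / fact (Suc b))" for t
  have "(\<integral>\<^sup>+t. ennreal ((u - t) ^ b / fact b) * indicator {v..u} t \<partial>lborel) = ennreal (F u - F v)"
  proof (rule nn_integral_FTC_Icc[where F = F])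
    show "(\<lambda>t. (u - t) ^ b / fact b) \<in> borel_measurable borel" by measurable
  next
    fix t assume "t \<in> {v..u}"
    have "((\<lambda>t. (u - t) ^ Suc b) has_real_derivative real (Suc b) * (u - t) ^ b * (- 1)) (at t)"
      by (rule derivative_eq_intros DERIV_power refl | simp)+
    from DERIV_cdivide[OF this, of "- fact (Suc b)"]
    have "(F has_real_derivative real (Suc b) * (u - t) ^ b * (- 1) / - fact (Suc b)) (at t)"
      unfolding F_def by simp
    also have "real (Suc b) * (u - t) ^ b * (- 1) / - fact (Suc b) = (u - t) ^ b / fact b"
      unfolding fact_Suc by (simp del: of_nat_Suc)
    finally show "(F has_real_derivative (u - t) ^ b / fact b) (at t)" .
  next
    fix t assume "t \<in> {v..u}"
    then show "0 \<le> (u - t) ^ b / fact b" by simp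
  qed (use assms in auto)
  then show ?thesis by (simp add: F_def del: fact_Suc)
qed

lemma process_weight_nonneg: "increasing_counts v c L \<Longrightarrow> 0 \<le> process_weight v c L"
  by (induction v c L rule: process_weight.induct) auto

text \<open>Conditioning on the first arrival \<open>t\<close> replaces all levels \<open>u\<close> by \<open>u - t\<close> and all counts \<open>b\<close> by
  \<open>b - 1\<close>; the lower bound \<open>v\<close> serves to pass over the levels with count \<open>0\<close>.\<close>

theorem emeasure_all_counts:
  assumes "0 \<le> v" "increasing_counts v 0 L"
  shows "emeasure expo_seq {\<omega>. v \<le> \<omega> 0 \<and> all_counts \<omega> L} = ennreal (process_weight v 0 L)"
  using assms
\<comment> \<open>The measure drops in both cases: either a level with count 0 is removed, or the
  counts are lowered.\<close>
proof (induction "sum_list (map snd L) + length L" arbitrary: v L rule: less_induct)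
  case (less L v)
  have meas: "{\<omega>. v \<le> \<omega> 0 \<and> all_counts \<omega> L} \<in> sets expo_seq" for v L
  proof -
    have "{\<omega> \<in> space expo_seq. v \<le> \<omega> 0 \<and> all_counts \<omega> L} \<in> sets expo_seq" by measurable
    then show ?thesis by simp
  qed
  show ?case
  proof (cases L)
    case Nil
    have "emeasure expo_seq {\<omega>. v \<le> \<omega> 0} = emeasure expo {v..}"
    proof -
      interpret E: prob_space expo by (rule prob_space_expo)
      interpret P: sequence_space expo by unfold_locales
      have "distr expo_seq expo (\<lambda>\<omega>. \<omega> 0) = expo" unfolding expo_seq_def by (rule P.PiM_component) simp
      then have "emeasure expo {v..} = emeasure (distr expo_seq expo (\<lambda>\<omega>. \<omega> 0)) {v..}" by simp
      also have "\<dots> = emeasure expo_seq ((\<lambda>\<omega>. \<omega> 0) -` {v..} \<inter> space expo_seq)"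
        by (rule emeasure_distr) (auto cong: measurable_cong_sets)
      also have "(\<lambda>\<omega>. \<omega> 0) -` {v..} \<inter> space expo_seq = {\<omega>. v \<le> \<omega> 0}" by auto
      finally show ?thesis by simp
    qed
    also have "\<dots> = ennreal (exp (- v))"
    proof -
      interpret E: prob_space expo by (rule prob_space_expo)
      have "distributed expo lborel (\<lambda>x. x) (exponential_density 1)"
        by (auto simp: distributed_def expo_def distr_id2)
      from E.exponential_distributedD_gt[OF this less.prems(1)]
      have gt: "measure expo {x. v < x} = exp (- v)" by simp
      have "emeasure expo {v} = 0"
        unfolding expo_def by (subst emeasure_density) (auto intro!: nn_integral_null_set simp: null_sets_def)
      then have "emeasure expo ({v<..} \<union> {v}) = emeasure expo {v<..}"
        by (intro emeasure_Un_null_set) (auto simp: null_sets_def)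
      moreover have "{v<..} \<union> {v} = {v..}" by auto
      moreover have "{x. v < x} = {v<..}" by auto
      ultimately show ?thesis using gt by (simp add: E.emeasure_eq_measure)
    qed
    finally show ?thesis using Nil by (simp add: all_counts_def)
  next
    case (Cons p L')
    obtain u b where p: "p = (u, b)" by (cases p)
    have vu: "v < u" and inc: "increasing_counts u b L'" using less.prems Cons p by auto
    show ?thesis
    proof (cases b)
      case 0
      \<comment> \<open>A level \<open>u\<close> with count 0 means
        \<open>u \<le> \<omega> 0\<close>, which absorbs the condition
        \<open>v \<le> \<omega> 0\<close>.\<close>
      have "{\<omega>. v \<le> \<omega> 0 \<and> all_counts \<omega> L} = {\<omega>. u \<le> \<omega> 0 \<and> all_counts \<omega> L'}"
        using vu Cons p 0 by (auto simp: all_counts_def counts_def)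
      also have "emeasure expo_seq \<dots> = ennreal (process_weight u 0 L')"
        using less.hyps[of L' u] less.prems vu inc Cons p 0 by auto
      finally show ?thesis using Cons p 0 by simp
    next
      case (Suc d)
      define M where "M t = map (\<lambda>(u, b). (u - t, b - 1)) L" for t
      have ge: "v < u' \<and> 1 \<le> b'" if "(u', b') \<in> set L" for u' b'
        using that increasing_counts_in[OF inc, of u' b'] vu Cons p Suc by auto
      have gu: "u \<le> u'" if "(u', b') \<in> set L" for u' b'
        using that increasing_counts_in[OF inc, of u' b'] Cons p by auto
      have slice: "emeasure expo_seq {\<omega>. case_nat t \<omega> \<in> {\<omega>. v \<le> \<omega> 0 \<and> all_counts \<omega> L}}
          = ennreal ((u - t) ^ d / fact d * (exp t * process_weight u b L')) * indicator {v..<u} t" for t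
      proof -
        have "emeasure expo_seq {\<omega>. case_nat t \<omega> \<in> {\<omega>. v \<le> \<omega> 0 \<and> all_counts \<omega> L}}
            = emeasure expo_seq {\<omega>. v \<le> t \<and> t < u \<and> 0 \<le> \<omega> 0 \<and> all_counts \<omega> (M t)}"
        proof (rule emeasure_eq_AE)
          show "AE \<omega> in expo_seq. (\<omega> \<in> {\<omega>. case_nat t \<omega> \<in> {\<omega>. v \<le> \<omega> 0 \<and> all_counts \<omega> L}})
              \<longleftrightarrow> (\<omega> \<in> {\<omega>. v \<le> t \<and> t < u \<and> 0 \<le> \<omega> 0 \<and> all_counts \<omega> (M t)})"
            using AE_expo_seq_nonneg
          proof eventually_elim
            case (elim \<omega>)
            have "counts (case_nat t \<omega>) u' b' \<longleftrightarrow> t < u' \<and> counts \<omega> (u' - t) (b' - 1)" if "(u', b') \<in> set L" for u' b'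
              using counts_case_nat[of \<omega> t u' "b' - 1"] elim ge[OF that] by simp
            then have "all_counts (case_nat t \<omega>) L \<longleftrightarrow> (\<forall>(u', b')\<in>set L. t < u' \<and> counts \<omega> (u' - t) (b' - 1))"
              unfolding all_counts_def by blast
            also have "\<dots> \<longleftrightarrow> t < u \<and> all_counts \<omega> (M t)"
            proof -
              have "(u, b) \<in> set L" using Cons p by simp
              then show ?thesis using gu unfolding all_counts_def M_def by fastforce
            qed
            finally show ?case using elim by auto
          qed
          have "(\<lambda>\<omega>. case_nat t \<omega>) \<in> expo_seq \<rightarrow>\<^sub>M expo_seq"
            unfolding expo_seq_def by measurable
          from measurable_sets[OF this meas]
          show "{\<omega>. case_nat t \<omega> \<in> {\<omega>. v \<le> \<omega> 0 \<and> all_counts \<omega> L}} \<in> sets expo_seq" by (simp add: vimage_def)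
          have "{\<omega> \<in> space expo_seq. v \<le> t \<and> t < u \<and> 0 \<le> \<omega> 0 \<and> all_counts \<omega> (M t)} \<in> sets expo_seq" by measurable
          then show "{\<omega>. v \<le> t \<and> t < u \<and> 0 \<le> \<omega> 0 \<and> all_counts \<omega> (M t)} \<in> sets expo_seq" by simp
        qed
        also have "\<dots> = ennreal ((u - t) ^ d / fact d * (exp t * process_weight u b L')) * indicator {v..<u} t"
        proof (cases "v \<le> t \<and> t < u")
          case True
          have Mt: "M t = (u - t, d) # map (\<lambda>(u, b). (u - t, b - 1)) L'" by (simp add: M_def Cons p Suc)
          have "sum_list (map snd (M t)) + length (M t) < sum_list (map snd L) + length L"
          proof -
            have "sum_list (map snd (map (\<lambda>(u, b). (u - t, b - 1)) L')) \<le> sum_list (map snd L')"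
              by (induction L') auto
            then show ?thesis unfolding Mt by (simp add: Cons p Suc)
          qed
          moreover have "increasing_counts 0 0 (M t)"
            using increasing_counts_shift[OF inc, of t] True Suc by (simp add: Mt)
          ultimately have "emeasure expo_seq {\<omega>. 0 \<le> \<omega> 0 \<and> all_counts \<omega> (M t)} = ennreal (process_weight 0 0 (M t))"
            by (intro less.hyps) auto
          also have "process_weight 0 0 (M t) = (u - t) ^ d / fact d * (exp t * process_weight u b L')"
            using process_weight_shift[OF inc, of t] Suc by (simp add: Mt)
          finally show ?thesis using True by simp
        qed auto
        finally show ?thesis .
      qed
      have "emeasure expo_seq {\<omega>. v \<le> \<omega> 0 \<and> all_counts \<omega> L}
          = (\<integral>\<^sup>+t. ennreal (exponential_density 1 t) * (ennreal ((u - t) ^ d / fact d * (exp t * process_weight u b L')) * indicator {v..<u} t) \<partial>lborel)"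
        unfolding nn_integral_expo_seq[OF meas] slice ..
      also have "\<dots> = (\<integral>\<^sup>+t. ennreal (process_weight u b L') * (ennreal ((u - t) ^ d / fact d) * indicator {v..u} t) \<partial>lborel)"
      proof (rule nn_integral_cong_AE)
        \<comment> \<open>The integrands can differ only at the endpoint \<open>t = u\<close>, where
          the half-open and the closed interval differ.\<close>
        have "AE t in lborel. t \<noteq> u" by (rule AE_lborel_singleton)
        then show "AE t in lborel. ennreal (exponential_density 1 t) * (ennreal ((u - t) ^ d / fact d * (exp t * process_weight u b L')) * indicator {v..<u} t)
          = ennreal (process_weight u b L') * (ennreal ((u - t) ^ d / fact d) * indicator {v..u} t)"
        proof eventually_elim
          case (elim t)
          show ?case
          proof (cases "v \<le> t \<and> t < u")
            case True
            have "exp (- t) * ((u - t) ^ d / fact d * (exp t * process_weight u b L')) = process_weight u b L' * ((u - t) ^ d / fact d)"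
              by (simp add: exp_minus field_simps)
            then show ?thesis
              using True less.prems(1) process_weight_nonneg[OF inc]
              by (simp add: exponential_density_def ennreal_mult[symmetric])
          next
            case False
            then show ?thesis using elim by (auto simp: indicator_def)
          qed
        qed
      qed
      also have "\<dots> = ennreal (process_weight u b L') * ennreal ((u - v) ^ Suc d / fact (Suc d))"
        using vu by (subst nn_integral_cmult) (auto simp: nn_integral_power_interval simp del: fact_Suc power_Suc)
      also have "\<dots> = ennreal (process_weight v 0 L)"
        using vu process_weight_nonneg[OF inc] Suc
        by (simp add: Cons p ennreal_mult[symmetric] mult.commute del: fact_Suc power_Suc)
      finally show ?thesis .
    qed
  qed
qed

section \<open>Plancherel probabilities of events at a fixed time\<close>

interpretation plancherel: prob_space plancherel
  unfolding plancherel_eq by (rule unif_seq.prob_space_distr[OF measurable_recording])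

lemma sets_plancherel [measurable_cong]: "sets plancherel = sets tableau_space"
  by (simp add: plancherel_def)

lemma space_plancherel: "space plancherel = space tableau_space"
  by (simp add: plancherel_def)

lemma sets_tab_boxes: "{T \<in> space tableau_space. P (tab_boxes T n)} \<in> sets plancherel"
proof -
  have "{T \<in> space tableau_space. P (tab_boxes T n)} = (\<lambda>T. tab_boxes T n) -` {p. P p} \<inter> space tableau_space"
    by auto
  also have "\<dots> \<in> sets tableau_space" by (rule measurable_sets[OF measurable_tab_boxes]) simp
  finally show ?thesis by (simp add: sets_plancherel)
qed

lemma growing_iff: "T \<in> space tableau_space \<Longrightarrow> growing T \<longleftrightarrow> (\<forall>n. growth_path (tab_boxes T n))"
  by (simp add: growing_def space_tableau_space)

lemma sets_growing: "{T \<in> space tableau_space. growing T} \<in> sets plancherel"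
proof -
  have "{T \<in> space tableau_space. growing T} = (\<Inter>n. {T \<in> space tableau_space. growth_path (tab_boxes T n)})"
    by (auto simp: growing_iff)
  also have "\<dots> \<in> sets plancherel" by (intro sets.countable_INT) (auto intro: sets_tab_boxes)
  finally show ?thesis .
qed

lemma AE_growing: "AE T in plancherel. growing T"
proof -
  have "AE T in distr unif_seq tableau_space recording_tableau. growing T"
    using sets_growing by (subst AE_distr_iff[OF measurable_recording]) (simp_all add: growing_recording sets_plancherel)
  then show ?thesis by (simp only: plancherel_eq)
qed

text \<open>Each growth path to \<open>D\<close> has probability \<open>num_paths D / fact n\<close>
  by \<open>prob_box_path\<close>; the sum is sorted by the final shape.\<close>

lemma prob_tab_boxes:
  "measure plancherel {T \<in> space tableau_space. P (tab_boxes T n)}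
     = (\<Sum>D\<in>diagrams n. num_paths D * real (card {p \<in> paths_to D. P p})) / fact n"
proof -
  define B where "B p = {w :: nat \<Rightarrow> real. box_path (rev (map w [0..<n])) = p}" for p
  define S where "S = {p. growth_path p \<and> length p = n \<and> P p}"
  have fin: "finite S"
    unfolding S_def by (rule finite_subset[OF _ finite_growth_paths[of n]]) auto
  have "measure plancherel {T \<in> space tableau_space. P (tab_boxes T n)}
      = measure unif_seq (recording_tableau -` {T \<in> space tableau_space. P (tab_boxes T n)} \<inter> space unif_seq)"
    unfolding plancherel_eq
    by (rule measure_distr[OF measurable_recording]) (use sets_tab_boxes[of P n] in \<open>simp add: sets_plancherel\<close>)
  also have "recording_tableau -` {T \<in> space tableau_space. P (tab_boxes T n)} \<inter> space unif_seq = (\<Union>p\<in>S. B p)"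
  proof -
    have "recording_tableau w \<in> space tableau_space" for w :: "nat \<Rightarrow> real"
      using growing_recording[of w] by (simp add: growing_def space_tableau_space)
    moreover have "box_path (rev (map w [0..<n])) \<in> S \<longleftrightarrow> P (box_path (rev (map w [0..<n])))" for w :: "nat \<Rightarrow> real"
      using box_path[of "rev (map w [0..<n])"] unfolding S_def by simp
    ultimately show ?thesis by (auto simp: B_def tab_boxes_recording)
  qed
  also have "measure unif_seq (\<Union>p\<in>S. B p) = (\<Sum>p\<in>S. measure unif_seq (B p))"
  proof (rule unif_seq.finite_measure_finite_Union[OF fin])
    show "B ` S \<subseteq> sets unif_seq" unfolding B_def using sets_box_path by blast
    show "disjoint_family_on B S" by (auto simp: disjoint_family_on_def B_def)
  qed
  also have "\<dots> = (\<Sum>p\<in>S. num_paths (set p) / fact n)"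
    by (rule sum.cong) (auto simp: S_def B_def prob_box_path)
  also have "\<dots> = (\<Sum>p | growth_path p \<and> length p = n. of_bool (P p) * num_paths (set p) / fact n)"
    by (rule sum.mono_neutral_cong_left) (auto simp: S_def)
  also have "\<dots> = (\<Sum>D\<in>diagrams n. \<Sum>p\<in>paths_to D. of_bool (P p) * num_paths (set p) / fact n)"
    by (rule sum_growth_paths)
  also have "\<dots> = (\<Sum>D\<in>diagrams n. num_paths D * real (card {p \<in> paths_to D. P p}) / fact n)"
  proof (rule sum.cong[OF refl])
    fix D assume D: "D \<in> diagrams n"
    then have fD: "finite (paths_to D)" by (intro finite_paths_to) (simp add: diagrams_def)
    have "(\<Sum>p\<in>paths_to D. of_bool (P p) * num_paths (set p) / fact n)
        = (\<Sum>p\<in>paths_to D. (if P p then num_paths D / fact n else 0))"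
      by (rule sum.cong) (auto simp: paths_to_def)
    also have "\<dots> = (\<Sum>p\<in>{p \<in> paths_to D. P p}. num_paths D / fact n)"
      by (rule sum.inter_filter[symmetric, OF fD])
    finally show "(\<Sum>p\<in>paths_to D. of_bool (P p) * num_paths (set p) / fact n)
        = num_paths D * real (card {p \<in> paths_to D. P p}) / fact n" by simp
  qed
  finally show ?thesis by (simp add: sum_divide_distrib)
qed

lemma prob_marks_at:
  assumes "m \<le> t 0" "\<And>i. i < j \<Longrightarrow> t i \<le> t (Suc i)"
  shows "measure plancherel {T \<in> space tableau_space. marks_at m t a j (tab_boxes T (t j))}
    = (\<Sum>D\<in>diagrams (t j). num_paths D * joint_weight m t a j D (a j)) / fact (t j)"
proof -
  have "real (card {p \<in> paths_to D. marks_at m t a j p}) = joint_weight m t a j D (a j)" if D: "D \<in> diagrams (t j)" for D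
  proof -
    have "fst (mark_box m p) = a j" if "p \<in> paths_to D" "marks_at m t a j p" for p
    proof -
      have "length p = t j" using that(1) D growth_path_length[of p] by (simp add: paths_to_def diagrams_def)
      moreover have "fst (mark_box m (drop (length p - t j) p)) = a j"
        using that(2) unfolding marks_at_def by blast
      ultimately show ?thesis by simp
    qed
    then have "{p \<in> paths_to D. marks_at m t a j p} = {p \<in> paths_to D. marks_at m t a j p \<and> fst (mark_box m p) = a j}"
      by blast
    then show ?thesis by (simp add: joint_weight_count[OF assms D])
  qed
  then show ?thesis unfolding prob_tab_boxes by simp
qed

text \<open>Chebyshev's inequality with \<open>variance_collen\<close>; the scaled mean is within
  \<open>\<epsilon> / 2\<close> of its limit 2, which costs the factor 4.\<close>

lemma collen_deviation:
  assumes \<epsilon>: "0 < \<epsilon>"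
  shows "(\<lambda>n. measure plancherel {T \<in> space tableau_space.
    \<epsilon> \<le> \<bar>real (collen (set (tab_boxes T n)) q) / sqrt (real n) - 2\<bar>}) \<longlonglongrightarrow> 0"
proof -
  define A where "A n = measure plancherel {T \<in> space tableau_space.
    \<epsilon> \<le> \<bar>real (collen (set (tab_boxes T n)) q) / sqrt (real n) - 2\<bar>}" for n
  define Q where "Q n D \<longleftrightarrow> \<epsilon> \<le> \<bar>real (collen D q) / sqrt (real n) - 2\<bar>" for n D
  have A: "A n = (\<Sum>D\<in>diagrams n. (num_paths D)\<^sup>2 * of_bool (Q n D)) / fact n" for n
  proof -
    have "A n = (\<Sum>D\<in>diagrams n. num_paths D * real (card {p \<in> paths_to D. Q n (set p)})) / fact n"
      unfolding A_def Q_def by (rule prob_tab_boxes)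
    also have "(\<Sum>D\<in>diagrams n. num_paths D * real (card {p \<in> paths_to D. Q n (set p)}))
        = (\<Sum>D\<in>diagrams n. (num_paths D)\<^sup>2 * of_bool (Q n D))"
    proof (rule sum.cong[OF refl])
      fix D
      have "{p \<in> paths_to D. Q n (set p)} = (if Q n D then paths_to D else {})" by (auto simp: paths_to_def)
      then show "num_paths D * real (card {p \<in> paths_to D. Q n (set p)}) = (num_paths D)\<^sup>2 * of_bool (Q n D)"
        by (simp add: num_paths_def power2_eq_square)
    qed
    finally show ?thesis .
  qed
  have "eventually (\<lambda>n. dist (mean_col q n / sqrt (real n)) 2 < \<epsilon> / 2) sequentially"
    using tendsto_mean_col \<epsilon> by (intro tendstoD) auto
  then have "eventually (\<lambda>n. A n \<le> 4 / \<epsilon>\<^sup>2 / sqrt (real n)) sequentially"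
    using eventually_gt_at_top[of 0]
  proof eventually_elim
    case (elim n)
    have n: "Suc (n - 1) = n" "0 < real n" using elim by auto
    have bound: "of_bool (Q n D) \<le> 4 / (\<epsilon>\<^sup>2 * real n) * (real (collen D q) - mean_col q n)\<^sup>2" for D
    proof (cases "Q n D")
      case True
      have "\<epsilon> / 2 \<le> \<bar>real (collen D q) / sqrt (real n) - mean_col q n / sqrt (real n)\<bar>"
        using True elim(1) unfolding Q_def dist_real_def by linarith
      also have "\<dots> = \<bar>real (collen D q) - mean_col q n\<bar> / sqrt (real n)"
        using n(2) by (simp add: diff_divide_distrib[symmetric])
      finally have "(\<epsilon> / 2)\<^sup>2 \<le> (\<bar>real (collen D q) - mean_col q n\<bar> / sqrt (real n))\<^sup>2"
        using \<epsilon> by (intro power_mono) auto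
      also have "\<dots> = (real (collen D q) - mean_col q n)\<^sup>2 / real n"
        using n(2) by (simp add: power_divide)
      finally have "\<epsilon>\<^sup>2 / 4 \<le> (real (collen D q) - mean_col q n)\<^sup>2 / real n" by (simp add: power_divide)
      then show ?thesis using True \<epsilon> n(2) by (simp add: field_simps)
    qed (use \<epsilon> in simp)
    have "A n \<le> (\<Sum>D\<in>diagrams n. (num_paths D)\<^sup>2 * (4 / (\<epsilon>\<^sup>2 * real n) * (real (collen D q) - mean_col q n)\<^sup>2)) / fact n"
      unfolding A by (intro divide_right_mono sum_mono mult_left_mono bound) auto
    also have "\<dots> = 4 / (\<epsilon>\<^sup>2 * real n) * (\<Sum>D\<in>diagrams n. (num_paths D)\<^sup>2 * (real (collen D q) - mean_col q n)\<^sup>2) / fact n"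
      by (simp add: sum_distrib_left mult_ac)
    also have "\<dots> \<le> 4 / (\<epsilon>\<^sup>2 * real n) * (fact n * sqrt (real n)) / fact n"
      using variance_collen[where n = "n - 1" and q = q] unfolding n(1) by (intro divide_right_mono mult_left_mono) auto
    also have "\<dots> = 4 / (\<epsilon>\<^sup>2 * real n) * sqrt (real n)" by simp
    also have "\<dots> = 4 / \<epsilon>\<^sup>2 / sqrt (real n)"
      using n(2) \<epsilon> real_sqrt_mult_self[of "real n"] by (simp add: field_simps)
    finally show ?case .
  qed
  moreover have "eventually (\<lambda>n. 0 \<le> A n) sequentially" by (simp add: A_def)
  moreover have "(\<lambda>n. 4 / \<epsilon>\<^sup>2 / sqrt (real n)) \<longlonglongrightarrow> 0" using \<epsilon> by real_asymp
  ultimately have "A \<longlonglongrightarrow> 0"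
    by (intro tendsto_sandwich[where f = "\<lambda>_. 0" and g = A and h = "\<lambda>n. 4 / \<epsilon>\<^sup>2 / sqrt (real n)"]) auto
  then show ?thesis unfolding A_def .
qed

text \<open>The levels will decrease with the index, so the list with the last index in front is
  increasing, as \<open>increasing_counts\<close> requires.\<close>

primrec grid :: "(nat \<Rightarrow> real) \<Rightarrow> (nat \<Rightarrow> nat) \<Rightarrow> nat \<Rightarrow> (real \<times> nat) list" where
  "grid s a 0 = [(s 0, a 0)]"
| "grid s a (Suc j) = (s (Suc j), a (Suc j)) # grid s a j"

lemma all_counts_grid: "all_counts \<omega> (grid s a j) \<longleftrightarrow> (\<forall>i\<le>j. counts \<omega> (s i) (a i))"
  by (induction j) (auto simp: all_counts_def le_Suc_eq)

lemma increasing_counts_grid: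
  "\<lbrakk>\<And>i. i < j \<Longrightarrow> s (Suc i) < s i; \<And>i. i < j \<Longrightarrow> a (Suc i) \<le> a i; v < s j; c \<le> a j\<rbrakk>
    \<Longrightarrow> increasing_counts v c (grid s a j)"
  by (induction j arbitrary: v c) auto

lemma process_weight_grid:
  "process_weight v c (grid s a j) = (s j - v) ^ (a j - c) / fact (a j - c) * exp (- s j) *
     (\<Prod>i<j. poisson_weight (s i - s (Suc i)) (a i - a (Suc i)))"
proof (induction j arbitrary: v c)
  case (Suc j)
  have "exp (- s j) = exp (- s (Suc j)) * exp (- (s j - s (Suc j)))"
    unfolding mult_exp_exp by simp
  then have "(s j - s (Suc j)) ^ (a j - a (Suc j)) / fact (a j - a (Suc j)) * exp (- s j)
      = exp (- s (Suc j)) * poisson_weight (s j - s (Suc j)) (a j - a (Suc j))"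
    by (simp add: poisson_weight_def)
  then show ?case by (simp add: Suc mult_ac)
qed simp

lemma pred_counts_upto [measurable]: "Measurable.pred expo_seq (\<lambda>\<omega>. \<forall>i\<le>(j::nat). counts \<omega> (s i) (a i))"
  by measurable

lemma sets_counts_upto: "{\<omega>. \<forall>i\<le>(j::nat). counts \<omega> (s i) (a i)} \<in> sets expo_seq"
  using pred_counts_upto[of j s a] by (simp add: pred_def)

text \<open>The meeting point of the two computations: the waiting times give the left side by
  \<open>emeasure_all_counts\<close>, the chain of thinnings the right side by
  \<open>joint_limit_product\<close>.\<close>

lemma prob_counts_upto:
  assumes s: "\<And>i. i < j \<Longrightarrow> s (Suc i) < s i" "\<And>i. i \<le> j \<Longrightarrow> 0 < s i"
    and a: "\<And>i. i < j \<Longrightarrow> a (Suc i) \<le> a i"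
  shows "measure expo_seq {\<omega>. \<forall>i\<le>j. counts \<omega> (s i) (a i)} = joint_limit s a j"
proof -
  have inc: "increasing_counts 0 0 (grid s a j)" using assms by (intro increasing_counts_grid) auto
  have "emeasure expo_seq {\<omega>. \<forall>i\<le>j. counts \<omega> (s i) (a i)} = emeasure expo_seq {\<omega>. 0 \<le> \<omega> 0 \<and> all_counts \<omega> (grid s a j)}"
  proof (rule emeasure_eq_AE)
    show "AE \<omega> in expo_seq. \<omega> \<in> {\<omega>. \<forall>i\<le>j. counts \<omega> (s i) (a i)} \<longleftrightarrow> \<omega> \<in> {\<omega>. 0 \<le> \<omega> 0 \<and> all_counts \<omega> (grid s a j)}"
      using AE_expo_seq_nonneg by eventually_elim (simp add: all_counts_grid)
    have "{\<omega> \<in> space expo_seq. 0 \<le> \<omega> 0 \<and> all_counts \<omega> (grid s a j)} \<in> sets expo_seq" by measurable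
    then show "{\<omega>. 0 \<le> \<omega> 0 \<and> all_counts \<omega> (grid s a j)} \<in> sets expo_seq" by simp
  qed (rule sets_counts_upto)
  also have "\<dots> = ennreal (process_weight 0 0 (grid s a j))"
    by (rule emeasure_all_counts[OF order_refl inc])
  also have "process_weight 0 0 (grid s a j) = joint_limit s a j"
    using a by (subst joint_limit_product[OF s(2)]) (simp_all add: process_weight_grid poisson_weight_def)
  finally show ?thesis
    using process_weight_nonneg[OF inc] \<open>process_weight 0 0 (grid s a j) = joint_limit s a j\<close>
    by (simp add: measure_def)
qed

lemma counts_unique:
  assumes \<omega>: "\<And>i. 0 \<le> \<omega> i" and "counts \<omega> u b" "counts \<omega> v c" "u \<le> v"
  shows "b \<le> c"
proof (rule ccontr)
  assume "\<not> b \<le> c"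
  then have "arrival \<omega> c \<le> arrival \<omega> (b - 1)" by (intro arrival_mono \<omega>) auto
  then show False using assms(2-4) \<open>\<not> b \<le> c\<close> by (auto simp: counts_def)
qed

lemma counts_exists:
  assumes "counts \<omega> v c" "u \<le> v"
  shows "\<exists>b. counts \<omega> u b"
proof -
  have ex: "\<exists>b. u \<le> arrival \<omega> b" using assms by (intro exI[of _ c]) (simp add: counts_def)
  define b where "b = (LEAST b. u \<le> arrival \<omega> b)"
  have "u \<le> arrival \<omega> b" unfolding b_def by (rule LeastI_ex[OF ex])
  moreover have "arrival \<omega> (b - 1) < u" if "b \<noteq> 0"
  proof -
    have "b - 1 < (LEAST b. u \<le> arrival \<omega> b)" unfolding b_def[symmetric] using that by simp
    then have "\<not> u \<le> arrival \<omega> (b - 1)" by (rule not_less_Least)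
    then show ?thesis by simp
  qed
  ultimately have "counts \<omega> u b" unfolding counts_def by blast
  then show ?thesis ..
qed

text \<open>Finitely many vectors of counts at the levels with index up to \<open>k\<close>. The
  condition \<open>l < a 0\<close> puts the points with index up to \<open>l\<close> below the
  highest level, and \<open>b\<close> cuts off large counts.\<close>

definition admissible :: "nat \<Rightarrow> nat \<Rightarrow> nat \<Rightarrow> (nat \<Rightarrow> nat) set" where
  "admissible l b k = {a \<in> {..k} \<rightarrow>\<^sub>E {..b}. (\<forall>i<k. a (Suc i) \<le> a i) \<and> l < a 0}"

lemma finite_admissible: "finite (admissible l b k)"
  unfolding admissible_def by (rule finite_subset[of _ "{..k} \<rightarrow>\<^sub>E {..b}"]) (auto intro: finite_PiE)

text \<open>Bounds the mass lost by the restriction to admissible vectors. The argument is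
  probabilistic instead of a summation: if the count at the highest level lies in
  \<open>{l<..b}\<close>, the counts at all levels exist and form an admissible vector.\<close>

lemma sum_joint_limit_ge:
  assumes s: "\<And>i. i < k \<Longrightarrow> s (Suc i) < s i" "\<And>i. i \<le> k \<Longrightarrow> 0 < s i"
  shows "(\<Sum>q\<in>{l<..b}. poisson_weight (s 0) q) \<le> (\<Sum>a\<in>admissible l b k. joint_limit s a k)"
proof -
  define E where "E a = {\<omega>. \<forall>i\<le>k. counts \<omega> (s i) (a i)}" for a
  have E: "E a \<in> sets expo_seq" for a unfolding E_def by (rule sets_counts_upto)
  define H where "H q = {\<omega>. (\<forall>i. 0 \<le> \<omega> i) \<and> counts \<omega> (s 0) q}" for q
  have nn: "{\<omega>. \<forall>i. 0 \<le> \<omega> i} \<in> sets expo_seq"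
  proof -
    have "{\<omega> \<in> space expo_seq. \<forall>i. 0 \<le> \<omega> i} \<in> sets expo_seq" by measurable
    then show ?thesis by simp
  qed
  have H: "H q \<in> sets expo_seq" for q
  proof -
    have "{\<omega> \<in> space expo_seq. (\<forall>i. 0 \<le> \<omega> i) \<and> counts \<omega> (s 0) q} \<in> sets expo_seq" by measurable
    then show ?thesis by (simp add: H_def)
  qed
  have prob_H: "measure expo_seq (H q) = poisson_weight (s 0) q" for q
  proof -
    have "measure expo_seq (H q) = measure expo_seq {\<omega>. \<forall>i\<le>(0::nat). counts \<omega> (s i) q}"
    proof (rule expo_seq.finite_measure_eq_AE)
      show "AE \<omega> in expo_seq. \<omega> \<in> H q \<longleftrightarrow> \<omega> \<in> {\<omega>. \<forall>i\<le>(0::nat). counts \<omega> (s i) q}"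
        using AE_expo_seq_nonneg by eventually_elim (simp add: H_def)
      show "{\<omega>. \<forall>i\<le>(0::nat). counts \<omega> (s i) q} \<in> sets expo_seq" by (rule sets_counts_upto)
    qed (rule H)
    also have "\<dots> = joint_limit s (\<lambda>_. q) 0" by (rule prob_counts_upto) (use s in auto)
    finally show ?thesis by simp
  qed
  have sub: "(\<Union>q\<in>{l<..b}. H q) \<subseteq> (\<Union>a\<in>admissible l b k. E a)"
  proof
    fix \<omega> assume "\<omega> \<in> (\<Union>q\<in>{l<..b}. H q)"
    then obtain q where q: "l < q" "q \<le> b" "\<And>i. 0 \<le> \<omega> i" "counts \<omega> (s 0) q" unfolding H_def by auto
    have le: "s i \<le> s 0" if "i \<le> k" for i
      using that
    proof (induction i)
      case (Suc i)
      then show ?case using s(1)[of i] by simp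
    qed simp
    have "\<exists>a. \<forall>i\<le>k. counts \<omega> (s i) (a i)"
      using counts_exists[OF q(4) le] by (intro choice) auto
    then obtain a0 where a0: "\<And>i. i \<le> k \<Longrightarrow> counts \<omega> (s i) (a0 i)" by blast
    define a where "a = restrict a0 {..k}"
    have a: "counts \<omega> (s i) (a i)" if "i \<le> k" for i using a0[OF that] that by (simp add: a_def)
    have "a i \<le> q" if "i \<le> k" for i by (rule counts_unique[OF q(3) a[OF that] q(4) le[OF that]])
    moreover have "q \<le> a 0" by (rule counts_unique[OF q(3) q(4) a]) auto
    moreover have "a (Suc i) \<le> a i" if "i < k" for i
      using that s(1)[OF that] by (intro counts_unique[OF q(3) a a]) auto
    moreover have "a \<in> extensional {..k}" by (simp add: a_def)
    ultimately have "a \<in> admissible l b k" using q(1,2) unfolding admissible_def by (force simp: PiE_def)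
    then show "\<omega> \<in> (\<Union>a\<in>admissible l b k. E a)" using a unfolding E_def by blast
  qed
  have "(\<Sum>q\<in>{l<..b}. poisson_weight (s 0) q) = measure expo_seq (\<Union>q\<in>{l<..b}. H q)"
  proof -
    have "disjoint_family_on H {l<..b}"
      unfolding disjoint_family_on_def
    proof (intro ballI impI equals0I)
      fix q q' \<omega> assume "q \<noteq> q'" "\<omega> \<in> H q \<inter> H q'"
      then have \<omega>: "\<And>i. 0 \<le> \<omega> i" "counts \<omega> (s 0) q" "counts \<omega> (s 0) q'" by (simp_all add: H_def)
      have "q \<le> q'" "q' \<le> q" using counts_unique[OF \<omega>(1,2,3)] counts_unique[OF \<omega>(1,3,2)] by simp_all
      then show False using \<open>q \<noteq> q'\<close> by simp
    qed
    then have "measure expo_seq (\<Union>q\<in>{l<..b}. H q) = (\<Sum>q\<in>{l<..b}. measure expo_seq (H q))"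
      using H by (intro expo_seq.finite_measure_finite_Union) auto
    then show ?thesis by (simp add: prob_H)
  qed
  also have "\<dots> \<le> measure expo_seq (\<Union>a\<in>admissible l b k. E a)"
    by (intro expo_seq.finite_measure_mono sub sets.finite_UN finite_admissible E)
  also have "\<dots> \<le> (\<Sum>a\<in>admissible l b k. measure expo_seq (E a))"
    by (intro expo_seq.finite_measure_subadditive_finite finite_admissible) (use E in auto)
  also have "\<dots> = (\<Sum>a\<in>admissible l b k. joint_limit s a k)"
    unfolding E_def by (intro sum.cong refl prob_counts_upto s) (auto simp: admissible_def)
  finally show ?thesis .
qed

lemma poisson_weight_sums: "(\<lambda>q. poisson_weight c q) sums 1"
proof -
  have "(\<lambda>q. exp (- c) * (c ^ q /\<^sub>R fact q)) sums (exp (- c) * exp c)"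
    by (intro sums_mult exp_converges)
  then show ?thesis by (simp add: poisson_weight_def exp_minus divide_inverse mult_ac)
qed

lemma poisson_weight_tendsto_0: "(\<lambda>n. \<Sum>q\<le>l. poisson_weight (real n) q) \<longlonglongrightarrow> 0"
proof (intro tendsto_null_sum)
  fix q
  have "(\<lambda>n. exp (- real n) * real n ^ q / fact q) \<longlonglongrightarrow> 0 / fact q"
    by (intro tendsto_divide) (real_asymp, auto)
  then show "(\<lambda>n. poisson_weight (real n) q) \<longlonglongrightarrow> 0" unfolding poisson_weight_def by simp
qed

lemma expo_seq_eq_distr:
  assumes N: "prob_space N" "prob_space.indep_vars N (\<lambda>_. borel) \<psi> UNIV"
    and d: "\<And>i. distributed N lborel (\<psi> i) (exponential_density 1)"
  shows "distr N (PiM UNIV (\<lambda>_. borel)) (\<lambda>\<omega> i. \<psi> i \<omega>) = expo_seq"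
proof -
  interpret prob_space N by fact
  have rv: "random_variable borel (\<psi> i)" for i
    using distributed_measurable[OF d[of i]] by (simp cong: measurable_cong_sets)
  have "distr N borel (\<psi> i) = expo" for i
  proof -
    have "distr N borel (\<psi> i) = distr N lborel (\<psi> i)" by (rule distr_cong) auto
    then show ?thesis using distributed_distr_eq_density[OF d[of i]] by (simp add: expo_def)
  qed
  moreover have "distr N (PiM UNIV (\<lambda>_. borel)) (\<lambda>\<omega>. \<lambda>i\<in>UNIV. \<psi> i \<omega>) = PiM UNIV (\<lambda>i. distr N borel (\<psi> i))"
    using N(2) rv by (subst indep_vars_iff_distr_eq_PiM'[symmetric]) auto
  ultimately show ?thesis by (simp add: expo_seq_def restrict_def)
qed

section \<open>Convergence in distribution\<close>

text \<open>Serves the Plancherel and the exponential side with the same values \<open>h\<close>.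
  Off \<open>G\<close> the integrand and its approximation differ by at most \<open>2 * B\<close>;
  off all \<open>E a\<close> the approximation is 0 and the error at most \<open>B\<close>.\<close>

lemma (in prob_space) integral_close:
  fixes X :: "'a \<Rightarrow> real" and h :: "'i \<Rightarrow> real"
  assumes fin: "finite F" and E: "\<And>a. a \<in> F \<Longrightarrow> E a \<in> sets M" and dis: "disjoint_family_on E F"
    and G: "G \<in> sets M" and X: "X \<in> borel_measurable M"
    and XB: "\<And>\<omega>. \<omega> \<in> space M \<Longrightarrow> \<bar>X \<omega>\<bar> \<le> B" and hB: "\<And>a. a \<in> F \<Longrightarrow> \<bar>h a\<bar> \<le> B"
    and close: "\<And>a \<omega>. a \<in> F \<Longrightarrow> \<omega> \<in> E a \<Longrightarrow> \<omega> \<in> G \<Longrightarrow> \<bar>X \<omega> - h a\<bar> \<le> \<epsilon>"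
    and \<epsilon>: "0 \<le> \<epsilon>"
  shows "\<bar>(\<integral>\<omega>. X \<omega> \<partial>M) - (\<Sum>a\<in>F. h a * prob (E a))\<bar>
    \<le> \<epsilon> + 2 * B * (1 - prob G) + B * (1 - (\<Sum>a\<in>F. prob (E a)))"
proof -
  define S where "S \<omega> = (\<Sum>a\<in>F. h a * indicator (E a) \<omega>)" for \<omega>
  define R where "R \<omega> = \<epsilon> + 2 * B * (1 - indicator G \<omega>) + B * (1 - (\<Sum>a\<in>F. indicator (E a) \<omega>))" for \<omega>
  have intE: "integrable M (\<lambda>\<omega>. indicator (E a) \<omega> :: real)" if "a \<in> F" for a
    using E[OF that] by (intro integrable_real_indicator) (auto simp: emeasure_eq_measure)
  have intG: "integrable M (\<lambda>\<omega>. indicator G \<omega> :: real)"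
    using G by (intro integrable_real_indicator) (auto simp: emeasure_eq_measure)
  have intX: "integrable M X"
    by (rule integrable_const_bound[OF _ X, where B = B]) (use XB in auto)
  have intS: "integrable M S" unfolding S_def using intE by auto
  have iS: "(\<integral>\<omega>. S \<omega> \<partial>M) = (\<Sum>a\<in>F. h a * prob (E a))"
  proof -
    have "(\<integral>\<omega>. S \<omega> \<partial>M) = (\<Sum>a\<in>F. \<integral>\<omega>. h a * indicator (E a) \<omega> \<partial>M)"
      unfolding S_def using intE by (intro Bochner_Integration.integral_sum) auto
    then show ?thesis using E by (simp add: sets.Int_space_eq2)
  qed
  have intR: "integrable M R" unfolding R_def using intE intG by auto
  have iR: "(\<integral>\<omega>. R \<omega> \<partial>M) = \<epsilon> + 2 * B * (1 - prob G) + B * (1 - (\<Sum>a\<in>F. prob (E a)))"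
  proof -
    have "(\<integral>\<omega>. (\<Sum>a\<in>F. indicator (E a) \<omega> :: real) \<partial>M) = (\<Sum>a\<in>F. prob (E a))"
      using intE E by (subst Bochner_Integration.integral_sum) (auto simp: sets.Int_space_eq2)
    moreover have "integrable M (\<lambda>\<omega>. (\<Sum>a\<in>F. indicator (E a) \<omega> :: real))" using intE by auto
    ultimately show ?thesis unfolding R_def using intG G by (simp add: prob_space sets.Int_space_eq2)
  qed
  have "\<bar>(\<integral>\<omega>. X \<omega> \<partial>M) - (\<integral>\<omega>. S \<omega> \<partial>M)\<bar> = \<bar>\<integral>\<omega>. (X \<omega> - S \<omega>) \<partial>M\<bar>"
    using intX intS by simp
  also have "\<dots> \<le> (\<integral>\<omega>. \<bar>X \<omega> - S \<omega>\<bar> \<partial>M)" by (rule integral_abs_bound)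
  also have "\<dots> \<le> (\<integral>\<omega>. R \<omega> \<partial>M)"
  proof (rule integral_mono)
    fix \<omega> assume \<omega>: "\<omega> \<in> space M"
    have B: "0 \<le> B" using XB[OF \<omega>] by linarith
    show "\<bar>X \<omega> - S \<omega>\<bar> \<le> R \<omega>"
    proof (cases "\<exists>a\<in>F. \<omega> \<in> E a")
      case True
      then obtain a where a: "a \<in> F" "\<omega> \<in> E a" by blast
      have other: "\<omega> \<in> E b \<longleftrightarrow> b = a" if "b \<in> F" for b
        using dis a that unfolding disjoint_family_on_def by blast
      have "S \<omega> = (\<Sum>b\<in>F. if b = a then h a else 0)"
        unfolding S_def by (rule sum.cong) (auto simp: other indicator_def)
      then have S: "S \<omega> = h a" using fin a by simp
      have "(\<Sum>b\<in>F. indicator (E b) \<omega> :: real) = (\<Sum>b\<in>F. if b = a then 1 else 0)"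
        by (rule sum.cong) (auto simp: other indicator_def)
      then have R: "R \<omega> = \<epsilon> + 2 * B * (1 - indicator G \<omega>)" using fin a by (simp add: R_def)
      show ?thesis
      proof (cases "\<omega> \<in> G")
        case True
        then show ?thesis using close[OF a] S R by simp
      next
        case False
        then show ?thesis using XB[OF \<omega>] hB[OF a(1)] S R \<epsilon> by simp
      qed
    next
      case False
      then have "S \<omega> = 0" "(\<Sum>b\<in>F. indicator (E b) \<omega> :: real) = 0"
        unfolding S_def by (auto intro!: sum.neutral)
      then have "\<bar>X \<omega> - S \<omega>\<bar> = \<bar>X \<omega>\<bar>" "R \<omega> = \<epsilon> + 2 * B * (1 - indicator G \<omega>) + B"
        unfolding R_def by simp_all
      moreover have "0 \<le> 2 * B * (1 - indicator G \<omega>)" using B by (simp add: indicator_def)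
      ultimately show ?thesis using XB[OF \<omega>] \<epsilon> by linarith
    qed
  qed (use intX intS intR in auto)
  finally show ?thesis unfolding iS iR .
qed

text \<open>Passes from the product topology on extensional functions to the topology of the type of
  all functions, where compactness and uniform continuity are at hand.\<close>

lemma continuous_on_restrict:
  fixes f :: "(nat \<Rightarrow> real) \<Rightarrow> real"
  assumes "continuous_map (product_topology (\<lambda>_. euclideanreal) {..l}) euclideanreal f"
  shows "continuous_on UNIV (\<lambda>u. f (restrict u {..l}))"
proof -
  have "continuous_map (product_topology (\<lambda>_. euclideanreal) UNIV) (product_topology (\<lambda>_. euclideanreal) {..l}) (\<lambda>u. restrict u {..l})"
    unfolding continuous_map_componentwise
    by (auto intro!: continuous_map_product_projection)
  from continuous_map_compose[OF this assms]
  show ?thesis by (simp add: o_def euclidean_product_topology continuous_map_iff_continuous2)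
qed

text \<open>Heine-Cantor on a compact cube of functions; the coordinates beyond \<open>l\<close> are
  set to 0.\<close>

lemma uniformly_close:
  fixes f :: "(nat \<Rightarrow> real) \<Rightarrow> real"
  assumes f: "continuous_map (product_topology (\<lambda>_. euclideanreal) {..l}) euclideanreal f" and \<epsilon>: "0 < \<epsilon>"
  obtains \<eta> where "0 < \<eta>"
    "\<And>u v. (\<And>i. i \<le> l \<Longrightarrow> \<bar>u i\<bar> \<le> A \<and> \<bar>v i\<bar> \<le> A \<and> \<bar>u i - v i\<bar> \<le> \<eta>) \<Longrightarrow> \<bar>f (restrict u {..l}) - f (restrict v {..l})\<bar> \<le> \<epsilon>"
proof -
  define g where "g u = f (restrict u {..l})" for u
  define C where "C = (UNIV \<rightarrow>\<^sub>E {- \<bar>A\<bar>..\<bar>A\<bar>} :: (nat \<Rightarrow> real) set)"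
  have "compactin (product_topology (\<lambda>_. euclideanreal) UNIV) C"
    unfolding C_def by (subst compactin_PiE) (auto simp: compactin_euclidean_iff)
  then have "compact C" by (simp add: euclidean_product_topology)
  moreover have "continuous_on C g"
    using continuous_on_restrict[OF f] continuous_on_subset unfolding g_def by blast
  ultimately have "uniformly_continuous_on C g" by (rule compact_uniformly_continuous[rotated])
  then obtain d where d: "0 < d" "\<And>u v. u \<in> C \<Longrightarrow> v \<in> C \<Longrightarrow> dist v u < d \<Longrightarrow> dist (g v) (g u) < \<epsilon>"
    using \<epsilon> unfolding uniformly_continuous_on_def by blast
  show ?thesis
  proof (rule that[of "d / 4"])
    show "0 < d / 4" using d by simp
    fix u v :: "nat \<Rightarrow> real"
    assume uv: "\<And>i. i \<le> l \<Longrightarrow> \<bar>u i\<bar> \<le> A \<and> \<bar>v i\<bar> \<le> A \<and> \<bar>u i - v i\<bar> \<le> d / 4"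
    define u' where "u' i = (if i \<le> l then u i else 0)" for i
    define v' where "v' i = (if i \<le> l then v i else 0)" for i
    have C: "u' \<in> C" "v' \<in> C" using uv unfolding C_def u'_def v'_def by (force simp: PiE_iff abs_le_iff)+
    have le: "dist (v' i) (u' i) \<le> d / 4" for i
      using uv[of i] d(1) by (auto simp: u'_def v'_def dist_real_def abs_minus_commute)
    \<comment> \<open>The metric on functions is at most twice the maximal distance of the
      coordinates up to \<open>n\<close> plus \<open>(1 / 2) ^ n\<close>, here less than
      \<open>3 * d / 4\<close>.\<close>
    obtain n where n: "(1 / 2) ^ n < d / 4" using real_arch_pow_inv[of "d / 4" "1 / 2"] d(1) by auto
    have "Max {dist (v' (from_nat i)) (u' (from_nat i)) | i. i \<le> n} \<le> d / 4"
      using le by (subst Max_le_iff) auto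
    then have "dist v' u' < d"
      using dist_fun_le_dist_first_terms[of v' u' n] n d(1) by linarith
    from d(2)[OF C this] have "\<bar>g v' - g u'\<bar> < \<epsilon>" by (simp add: dist_real_def)
    moreover have "restrict u' {..l} = restrict u {..l}" "restrict v' {..l} = restrict v {..l}"
      by (auto simp: u'_def v'_def restrict_def)
    ultimately show "\<bar>f (restrict u {..l}) - f (restrict v {..l})\<bar> \<le> \<epsilon>" by (simp add: g_def)
  qed
qed

lemma measurable_continuous_map_PiM:
  fixes f :: "(nat \<Rightarrow> real) \<Rightarrow> real"
  assumes "continuous_map (product_topology (\<lambda>_. euclideanreal) {..l}) euclideanreal f"
  shows "f \<in> borel_measurable (PiM {..l} (\<lambda>_. borel))"
proof -
  define g where "g u = f (restrict u {..l})" for u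
  have "g \<in> borel_measurable (borel :: (nat \<Rightarrow> real) measure)"
    unfolding g_def by (intro borel_measurable_continuous_onI continuous_on_restrict assms)
  then have g: "g \<in> borel_measurable (PiM UNIV (\<lambda>_::nat. borel :: real measure))"
    by (simp add: measurable_cong_sets[OF sets_PiM_equal_borel refl])
  have "(\<lambda>u i. if i \<le> l then u i else 0) \<in> PiM {..l} (\<lambda>_. borel :: real measure) \<rightarrow>\<^sub>M PiM UNIV (\<lambda>_::nat. borel)"
  proof (rule measurable_PiM_single')
    fix i :: nat
    show "(\<lambda>u. if i \<le> l then u i else 0) \<in> PiM {..l} (\<lambda>_. borel) \<rightarrow>\<^sub>M (borel :: real measure)"
      by (cases "i \<le> l") (auto intro: measurable_component_singleton)
  qed auto
  from measurable_compose[OF this g]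
  have "(\<lambda>u. g (\<lambda>i. if i \<le> l then u i else 0)) \<in> borel_measurable (PiM {..l} (\<lambda>_. borel))" .
  moreover have "g (\<lambda>i. if i \<le> l then u i else 0) = f u" if "u \<in> space (PiM {..l} (\<lambda>_. borel :: real measure))" for u
  proof -
    have "restrict (\<lambda>i. if i \<le> l then u i else 0) {..l} = u"
      using that by (auto simp: space_PiM PiE_def extensional_def restrict_def)
    then show ?thesis by (simp add: g_def)
  qed
  ultimately show ?thesis by (simp cong: measurable_cong)
qed

lemma measurable_joint:
  assumes "\<And>i. i \<le> l \<Longrightarrow> Z i \<in> borel_measurable M"
  shows "(\<lambda>\<omega>. \<lambda>i\<in>{..l}. Z i \<omega>) \<in> M \<rightarrow>\<^sub>M PiM {..l} (\<lambda>_. borel :: real measure)"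
  using assms by (intro measurable_restrict) auto

lemma integral_joint_law:
  fixes f :: "(nat \<Rightarrow> real) \<Rightarrow> real"
  assumes "continuous_map (product_topology (\<lambda>_. euclideanreal) {..l}) euclideanreal f"
    and "\<And>i. i \<le> l \<Longrightarrow> Z i \<in> borel_measurable M"
  shows "(\<integral>u. f u \<partial>joint_law M l Z) = (\<integral>\<omega>. f (\<lambda>i\<in>{..l}. Z i \<omega>) \<partial>M)"
  unfolding joint_law_def
  by (rule integral_distr[OF measurable_joint measurable_continuous_map_PiM]) (use assms in auto)

lemma joint_law_distr:
  assumes T: "T \<in> M \<rightarrow>\<^sub>M K" and Z: "\<And>i. i \<le> l \<Longrightarrow> Z i \<in> borel_measurable K"
  shows "joint_law M l (\<lambda>i \<omega>. Z i (T \<omega>)) = joint_law (distr M K T) l Z"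
proof -
  have "(\<lambda>\<omega>. \<lambda>i\<in>{..l}. Z i \<omega>) \<in> K \<rightarrow>\<^sub>M PiM {..l} (\<lambda>_. borel)" by (rule measurable_joint) (rule Z)
  from distr_distr[OF this T] show ?thesis unfolding joint_law_def by (simp add: o_def)
qed

subsection \<open>Discretisation of the levels\<close>

text \<open>If \<open>a j\<close> points lie below \<open>level k \<delta> j\<close>, which decreases in \<open>j\<close> in steps of \<open>\<delta>\<close>, then the
  point with index \<open>x\<close> lies between the level of index \<open>crossing k a x\<close> and the next higher one.\<close>

definition crossing :: "nat \<Rightarrow> (nat \<Rightarrow> nat) \<Rightarrow> nat \<Rightarrow> nat" where
  "crossing k a x = (LEAST r. a r \<le> x \<or> r = Suc k)"

lemma crossing:
  assumes "x < a 0"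
  shows "0 < crossing k a x" "crossing k a x \<le> Suc k" "x < a (crossing k a x - 1)"
    "crossing k a x \<le> k \<Longrightarrow> a (crossing k a x) \<le> x"
proof -
  define P where "P r \<longleftrightarrow> a r \<le> x \<or> r = Suc k" for r
  have r: "crossing k a x = (LEAST r. P r)" unfolding crossing_def P_def ..
  have P: "P (crossing k a x)" unfolding r by (rule LeastI[of P "Suc k"]) (simp add: P_def)
  show 1: "0 < crossing k a x" using P assms by (cases "crossing k a x") (auto simp: P_def)
  show "crossing k a x \<le> Suc k" unfolding r by (rule Least_le) (simp add: P_def)
  have "\<not> P (crossing k a x - 1)" unfolding r by (rule not_less_Least) (use 1 r in simp)
  then show "x < a (crossing k a x - 1)" by (simp add: P_def)
  show "crossing k a x \<le> k \<Longrightarrow> a (crossing k a x) \<le> x" using P by (auto simp: P_def)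
qed

text \<open>The positive levels are the multiples of \<delta> up to \<open>Suc k\<close>, highest
  first. Index \<open>Suc k\<close>, the default value of \<open>crossing\<close>, belongs to level
  0.\<close>

definition level :: "nat \<Rightarrow> real \<Rightarrow> nat \<Rightarrow> real" where
  "level k \<delta> j = real (Suc k - j) * \<delta>"

lemma level_pred: "0 < r \<Longrightarrow> r \<le> Suc k \<Longrightarrow> level k \<delta> (r - 1) = level k \<delta> r + \<delta>"
  by (cases r) (auto simp: level_def of_nat_diff algebra_simps)

text \<open>At the grid time before the crossing the mark is to the right of \<open>x\<close>, so
  \<open>first_row\<close> is at least the length of column \<open>x\<close> then; at the crossing
  time the mark has reached \<open>x\<close>, and \<open>first_row\<close> is at most the length of
  column 0. Both lengths are close to \<open>2 * m\<close> divided by the level, and the two levels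
  differ by \<delta>. If the mark never reaches \<open>x\<close> on the grid, 0 is the lower
  bound.\<close>

lemma scaled_inverse_row_close:
  assumes T: "growing T" and m: "0 < m" and \<delta>: "0 < \<delta>"
    and t: "\<And>j. j \<le> k \<Longrightarrow> m \<le> t j"
    and a: "\<And>j. j \<le> k \<Longrightarrow> fst (mark_box m (tab_boxes T (t j))) = a j" and x: "x < a 0"
    and C: "\<And>j q. j \<le> k \<Longrightarrow> q \<le> x \<Longrightarrow> 0 < collen (set (tab_boxes T (t j))) q \<and>
      \<bar>2 * real m / real (collen (set (tab_boxes T (t j))) q) - level k \<delta> j\<bar> \<le> \<delta>"
  shows "\<bar>scaled_inverse_row T m x - level k \<delta> (crossing k a x)\<bar> \<le> 2 * \<delta>"
proof -
  define r where "r = crossing k a x"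
  have r: "0 < r" "r \<le> Suc k" "x < a (r - 1)" "r \<le> k \<Longrightarrow> a r \<le> x"
    using crossing[of x a k] x unfolding r_def by auto
  have up: "enat (collen (set (tab_boxes T (t j))) x) \<le> first_row T m x" if "j \<le> k" "x < a j" for j
    by (rule first_row_ge[OF T t[OF that(1)]]) (use a that in simp)
  have "scaled_inverse_row T m x \<le> level k \<delta> r + 2 * \<delta>"
  proof (cases "first_row T m x")
    case (enat y)
    define c where "c = collen (set (tab_boxes T (t (r - 1)))) x"
    have c: "c \<le> y" using up[of "r - 1"] r enat by (simp add: c_def)
    have rk: "r - 1 \<le> k" using r by simp
    have c0: "0 < c" "\<bar>2 * real m / real c - level k \<delta> (r - 1)\<bar> \<le> \<delta>" using C[OF rk order_refl] by (auto simp: c_def)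
    have "2 * real m / real y \<le> 2 * real m / real c" using c c0 by (intro divide_left_mono) auto
    also have "\<dots> \<le> level k \<delta> (r - 1) + \<delta>" using c0(2) by linarith
    also have "\<dots> = level k \<delta> r + 2 * \<delta>" using level_pred[of r k \<delta>] r by simp
    finally show ?thesis using enat by (simp add: scaled_inverse_row_def)
  next
    case infinity
    then show ?thesis using \<delta> by (simp add: scaled_inverse_row_def level_def)
  qed
  moreover have "level k \<delta> r - \<delta> \<le> scaled_inverse_row T m x"
  proof (cases "r \<le> k")
    case True
    define c where "c = collen (set (tab_boxes T (t r))) 0"
    have "first_row T m x \<le> enat c"
      unfolding c_def by (rule first_row_le[OF T t[OF True]]) (use a[OF True] r(4)[OF True] in simp)
    then obtain y where y: "first_row T m x = enat y" "y \<le> c" by (cases "first_row T m x") auto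
    \<comment> \<open>Column \<open>x\<close> is nonempty at the first grid time, where the mark is
      to its right; so the row is not 0 and division by 0 does not occur.\<close>
    have "0 < y" using up[of 0] x y C[of 0 x] by auto
    have c0: "0 < c" "\<bar>2 * real m / real c - level k \<delta> r\<bar> \<le> \<delta>" using C[OF True, of 0] by (auto simp: c_def)
    have "level k \<delta> r - \<delta> \<le> 2 * real m / real c" using c0(2) by linarith
    also have "\<dots> \<le> 2 * real m / real y" using y \<open>0 < y\<close> by (intro divide_left_mono) auto
    finally show ?thesis using y by (simp add: scaled_inverse_row_def)
  next
    case False
    then have "level k \<delta> r = 0" using r by (simp add: level_def)
    moreover have "0 \<le> scaled_inverse_row T m x"
      by (cases "first_row T m x") (simp_all add: scaled_inverse_row_def)
    ultimately show ?thesis using \<delta> by simp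
  qed
  ultimately show ?thesis unfolding r_def[symmetric] using \<delta> by linarith
qed

text \<open>The same bracketing for the points of the Poisson process, by the same index
  \<open>crossing k a x\<close>. This is what makes the two sides comparable.\<close>

lemma arrival_close:
  assumes \<omega>: "\<And>i. 0 \<le> \<omega> i" and c: "\<And>j. j \<le> k \<Longrightarrow> counts \<omega> (level k \<delta> j) (a j)" and x: "x < a 0"
    and \<delta>: "0 < \<delta>"
  shows "\<bar>arrival \<omega> x - level k \<delta> (crossing k a x)\<bar> \<le> 2 * \<delta>"
proof -
  define r where "r = crossing k a x"
  have r: "0 < r" "r \<le> Suc k" "x < a (r - 1)" "r \<le> k \<Longrightarrow> a r \<le> x"
    using crossing[of x a k] x unfolding r_def by auto
  have "arrival \<omega> x \<le> arrival \<omega> (a (r - 1) - 1)" using r by (intro arrival_mono \<omega>) auto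
  also have "\<dots> < level k \<delta> (r - 1)" using c[of "r - 1"] r by (auto simp: counts_def)
  also have "\<dots> = level k \<delta> r + \<delta>" using level_pred[of r k \<delta>] r by simp
  finally have "arrival \<omega> x < level k \<delta> r + \<delta>" .
  moreover have "level k \<delta> r \<le> arrival \<omega> x"
  proof (cases "r \<le> k")
    case True
    then have "level k \<delta> r \<le> arrival \<omega> (a r)" using c[of r] by (auto simp: counts_def)
    also have "\<dots> \<le> arrival \<omega> x" by (intro arrival_mono \<omega> r(4) True)
    finally show ?thesis .
  next
    case False
    then have "level k \<delta> r = 0" using r by (simp add: level_def)
    then show ?thesis using arrival_nonneg[of \<omega> x] \<omega> by simp
  qed
  ultimately show ?thesis unfolding r_def[symmetric] using \<delta> by linarith
qed

lemma level_pos: "0 < \<delta> \<Longrightarrow> j \<le> k \<Longrightarrow> 0 < level k \<delta> j"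
  by (simp add: level_def)

lemma level_Suc_less: "0 < \<delta> \<Longrightarrow> j \<le> k \<Longrightarrow> level k \<delta> (Suc j) < level k \<delta> j"
  using level_pred[of "Suc j" k \<delta>] by simp

lemma level_antimono: "0 \<le> \<delta> \<Longrightarrow> i \<le> j \<Longrightarrow> level k \<delta> j \<le> level k \<delta> i"
  unfolding level_def by (intro mult_right_mono) auto

text \<open>The time at which the column of the mark is approximately Poisson with mean \<open>level k \<delta> j\<close>.\<close>

definition grid_time :: "nat \<Rightarrow> real \<Rightarrow> nat \<Rightarrow> nat \<Rightarrow> nat" where
  "grid_time k \<delta> m j = nat \<lceil>(real m / level k \<delta> j)\<^sup>2\<rceil>"

lemma grid_time_mono: "0 < \<delta> \<Longrightarrow> i \<le> j \<Longrightarrow> j \<le> k \<Longrightarrow> grid_time k \<delta> m i \<le> grid_time k \<delta> m j"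
  unfolding grid_time_def
  by (intro nat_mono ceiling_mono power_mono divide_left_mono level_antimono mult_pos_pos level_pos
      divide_nonneg_nonneg less_imp_le[OF level_pos]) auto

lemma grid_time_tendsto:
  assumes "0 < \<delta>" "j \<le> k"
  shows "(\<lambda>m. real m / sqrt (real (grid_time k \<delta> m j))) \<longlonglongrightarrow> level k \<delta> j"
proof -
  define s where "s = level k \<delta> j"
  have s: "0 < s" unfolding s_def using assms by (rule level_pos)
  have lower: "real m / (real m / s + 1) \<le> real m / sqrt (real (grid_time k \<delta> m j))"
    and upper: "real m / sqrt (real (grid_time k \<delta> m j)) \<le> s" for m
  proof -
    have 1: "(real m / s)\<^sup>2 \<le> real (grid_time k \<delta> m j)" unfolding grid_time_def s_def[symmetric] by linarith
    have "real (grid_time k \<delta> m j) = of_int \<lceil>(real m / s)\<^sup>2\<rceil>" unfolding grid_time_def s_def[symmetric] by simp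
    also have "\<dots> \<le> (real m / s)\<^sup>2 + 1" by linarith
    finally have "real (grid_time k \<delta> m j) \<le> (real m / s)\<^sup>2 + 1" .
    also have "\<dots> \<le> (real m / s + 1)\<^sup>2" using s by (simp add: power2_sum)
    finally have "sqrt (real (grid_time k \<delta> m j)) \<le> real m / s + 1" using s by (intro real_le_lsqrt) auto
    moreover have ge: "real m / s \<le> sqrt (real (grid_time k \<delta> m j))" using 1 by (rule real_le_rsqrt)
    ultimately show "real m / (real m / s + 1) \<le> real m / sqrt (real (grid_time k \<delta> m j))"
    proof (cases "m = 0")
      case False
      then have "0 < real m / s" using s by simp
      then have "0 < sqrt (real (grid_time k \<delta> m j))" "0 < real m / s + 1" using ge by linarith+
      then show ?thesis using \<open>sqrt (real (grid_time k \<delta> m j)) \<le> real m / s + 1\<close> by (intro divide_left_mono) auto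
    qed simp
    show "real m / sqrt (real (grid_time k \<delta> m j)) \<le> s"
    proof (cases "m = 0")
      case False
      then have "0 < real m / s" using s by simp
      then have "0 < sqrt (real (grid_time k \<delta> m j))" using ge by linarith
      then show ?thesis using ge s by (simp add: field_simps)
    qed (use s in simp)
  qed
  have "(\<lambda>m. real m / (real m / s + 1)) \<longlonglongrightarrow> s" using s by real_asymp
  then show ?thesis unfolding s_def[symmetric]
    by (rule tendsto_sandwich[OF always_eventually always_eventually _ tendsto_const, rotated 2])
      (use lower upper in auto)
qed

lemma eventually_le_grid_time:
  assumes "0 < \<delta>"
  shows "eventually (\<lambda>m. \<forall>j\<le>k. m \<le> grid_time k \<delta> m j) sequentially"
  using eventually_ge_at_top[of "nat \<lceil>(level k \<delta> 0)\<^sup>2\<rceil>"]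
proof eventually_elim
  case (elim m)
  have s: "0 < level k \<delta> 0" using assms by (rule level_pos) simp
  have "(level k \<delta> 0)\<^sup>2 \<le> real m" using elim by linarith
  then have "real m * (level k \<delta> 0)\<^sup>2 \<le> real m * real m" by (intro mult_left_mono) auto
  then have "real m \<le> (real m / level k \<delta> 0)\<^sup>2" using s by (simp add: field_simps power2_eq_square)
  then have "m \<le> grid_time k \<delta> m 0" unfolding grid_time_def by linarith
  then show ?case using grid_time_mono[OF assms, of 0 _ k m] by (auto intro: order_trans)
qed

lemma filterlim_grid_time:
  assumes "0 < \<delta>" "j \<le> k"
  shows "filterlim (\<lambda>m. grid_time k \<delta> m j) at_top sequentially"
proof (rule filterlim_at_top_mono)
  show "filterlim (\<lambda>m::nat. m) at_top sequentially" by (rule filterlim_ident)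
  show "eventually (\<lambda>m. m \<le> grid_time k \<delta> m j) sequentially"
    using eventually_le_grid_time[OF assms(1), of k] by eventually_elim (use assms in auto)
qed

definition marks_event :: "nat \<Rightarrow> real \<Rightarrow> nat \<Rightarrow> (nat \<Rightarrow> nat) \<Rightarrow> nat tableau set" where
  "marks_event k \<delta> m a = {T \<in> space tableau_space.
     marks_at m (grid_time k \<delta> m) a k (tab_boxes T (grid_time k \<delta> m k))}"

lemma prob_marks_event_tendsto:
  assumes \<delta>: "0 < \<delta>"
  shows "(\<lambda>m. measure plancherel (marks_event k \<delta> m a)) \<longlonglongrightarrow> joint_limit (level k \<delta>) a k"
proof -
  have "(\<lambda>m. (\<Sum>D\<in>diagrams (grid_time k \<delta> m k). num_paths D * joint_weight m (grid_time k \<delta> m) a k D (a k))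
      / fact (grid_time k \<delta> m k)) \<longlonglongrightarrow> joint_limit (level k \<delta>) a k"
  proof (rule joint_weight_sum_tendsto)
    show "filterlim (\<lambda>m. grid_time k \<delta> m 0) at_top sequentially" by (rule filterlim_grid_time[OF \<delta>]) simp
    show "0 < level k \<delta> j" if "j \<le> k" for j by (rule level_pos[OF \<delta> that])
    show "level k \<delta> (Suc j) \<le> level k \<delta> j" if "j < k" for j by (rule level_antimono) (use \<delta> in auto)
    show "eventually (\<lambda>m. grid_time k \<delta> m j \<le> grid_time k \<delta> m (Suc j)) sequentially" if "j < k" for j
      using that \<delta> by (intro always_eventually allI grid_time_mono) auto
    show "(\<lambda>m. real m / sqrt (real (grid_time k \<delta> m j))) \<longlonglongrightarrow> level k \<delta> j" if "j \<le> k" for j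
      by (rule grid_time_tendsto[OF \<delta> that])
    show "eventually (\<lambda>m. m \<le> grid_time k \<delta> m 0) sequentially"
      using eventually_le_grid_time[OF \<delta>, of k] by eventually_elim auto
  qed
  moreover have "eventually (\<lambda>m. (\<Sum>D\<in>diagrams (grid_time k \<delta> m k). num_paths D * joint_weight m (grid_time k \<delta> m) a k D (a k))
      / fact (grid_time k \<delta> m k) = measure plancherel (marks_event k \<delta> m a)) sequentially"
    using eventually_le_grid_time[OF \<delta>, of k]
  proof eventually_elim
    case (elim m)
    show ?case unfolding marks_event_def
      by (rule prob_marks_at[symmetric]) (use elim \<delta> in \<open>auto intro!: grid_time_mono\<close>)
  qed
  ultimately show ?thesis by (rule Lim_transform_eventually)
qed

lemma marks_eventD:
  assumes "T \<in> marks_event k \<delta> m a" "0 < \<delta>" "j \<le> k"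
  shows "fst (mark_box m (tab_boxes T (grid_time k \<delta> m j))) = a j"
proof -
  have "fst (mark_box m (drop (length (tab_boxes T (grid_time k \<delta> m k)) - grid_time k \<delta> m j) (tab_boxes T (grid_time k \<delta> m k)))) = a j"
    using assms unfolding marks_event_def marks_at_def by blast
  then show ?thesis using assms by (simp add: drop_tab_boxes grid_time_mono)
qed

text \<open>\<open>growing\<close> is included because the link between routes and marks is proved
  for such tableaux; it holds almost surely.\<close>

definition regular_event :: "nat \<Rightarrow> nat \<Rightarrow> real \<Rightarrow> real \<Rightarrow> nat \<Rightarrow> nat tableau set" where
  "regular_event l k \<delta> e m = {T \<in> space tableau_space. growing T \<and> (\<forall>j\<le>k. \<forall>q\<le>l.
     \<bar>real (collen (set (tab_boxes T (grid_time k \<delta> m j))) q) / sqrt (real (grid_time k \<delta> m j)) - 2\<bar> < e)}"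

lemma regular_event:
  assumes \<delta>: "0 < \<delta>" and e: "0 < e"
  shows "regular_event l k \<delta> e m \<in> sets plancherel"
    and "(\<lambda>m. measure plancherel (regular_event l k \<delta> e m)) \<longlonglongrightarrow> 1"
proof -
  define Bad where "Bad m p = {T \<in> space tableau_space.
    e \<le> \<bar>real (collen (set (tab_boxes T (grid_time k \<delta> m (fst p)))) (snd p)) / sqrt (real (grid_time k \<delta> m (fst p))) - 2\<bar>}"
    for m and p :: "nat \<times> nat"
  define I where "I = {..k} \<times> {..l}"
  have Bad: "Bad m p \<in> sets plancherel" for m p unfolding Bad_def by (rule sets_tab_boxes)
  have U: "(\<Union>p\<in>I. Bad m p) \<in> sets plancherel" for m
    by (intro sets.finite_UN Bad) (simp add: I_def)
  have eq: "regular_event l k \<delta> e m = {T \<in> space tableau_space. growing T} - (\<Union>p\<in>I. Bad m p)" for m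
  proof -
    have "T \<in> (\<Union>p\<in>I. Bad m p) \<longleftrightarrow> T \<in> space tableau_space \<and> (\<exists>j\<le>k. \<exists>q\<le>l.
        e \<le> \<bar>real (collen (set (tab_boxes T (grid_time k \<delta> m j))) q) / sqrt (real (grid_time k \<delta> m j)) - 2\<bar>)" for T
      unfolding Bad_def I_def by force
    then show ?thesis
      unfolding regular_event_def set_eq_iff Diff_iff mem_Collect_eq by (simp only: not_le[symmetric]) blast
  qed
  show R: "regular_event l k \<delta> e m \<in> sets plancherel" for m
    unfolding eq by (rule sets.Diff[OF sets_growing U])
  have lim0: "(\<lambda>m. \<Sum>p\<in>I. measure plancherel (Bad m p)) \<longlonglongrightarrow> 0"
  proof (rule tendsto_null_sum)
    fix p assume "p \<in> I"
    then have "fst p \<le> k" by (auto simp: I_def)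
    from filterlim_compose[OF collen_deviation[OF e, of "snd p"] filterlim_grid_time[OF \<delta> this]]
    show "(\<lambda>m. measure plancherel (Bad m p)) \<longlonglongrightarrow> 0" unfolding Bad_def .
  qed
  have ge: "1 - (\<Sum>p\<in>I. measure plancherel (Bad m p)) \<le> measure plancherel (regular_event l k \<delta> e m)" for m
  proof -
    have "measure plancherel (\<Union>p\<in>I. Bad m p) \<le> (\<Sum>p\<in>I. measure plancherel (Bad m p))"
      by (intro plancherel.finite_measure_subadditive_finite) (use Bad in \<open>auto simp: I_def\<close>)
    moreover have "measure plancherel (regular_event l k \<delta> e m) = measure plancherel (space plancherel - (\<Union>p\<in>I. Bad m p))"
    proof (rule plancherel.finite_measure_eq_AE)
      have sp: "AE T in plancherel. T \<in> space plancherel" by simp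
      show "AE T in plancherel. T \<in> regular_event l k \<delta> e m \<longleftrightarrow> T \<in> space plancherel - (\<Union>p\<in>I. Bad m p)"
        using AE_growing sp by eventually_elim (auto simp: eq space_plancherel)
    qed (use R U in auto)
    ultimately show ?thesis using plancherel.prob_compl[OF U[of m]] by simp
  qed
  have "(\<lambda>m. 1 - (\<Sum>p\<in>I. measure plancherel (Bad m p))) \<longlonglongrightarrow> 1 - 0" by (intro tendsto_diff tendsto_const lim0)
  then have lower: "(\<lambda>m. 1 - (\<Sum>p\<in>I. measure plancherel (Bad m p))) \<longlonglongrightarrow> 1" by simp
  show "(\<lambda>m. measure plancherel (regular_event l k \<delta> e m)) \<longlonglongrightarrow> 1"
    by (rule tendsto_sandwich[OF always_eventually always_eventually lower tendsto_const]) (use ge in auto)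
qed

text \<open>\<open>2 * m / c - s\<close> equals
  \<open>(2 * (m / q - s) + s * (2 - c / q)) / (c / q)\<close>, and the denominator exceeds 1. The
  two parts of the numerator are at most \<open>\<delta> / 2\<close> each.\<close>

lemma ratio_close:
  fixes c m q s :: real
  assumes "0 \<le> q" "\<bar>c / q - 2\<bar> < e" "e \<le> 1" "0 \<le> s" "s * e \<le> \<delta> / 2" "\<bar>m / q - s\<bar> \<le> \<delta> / 4"
  shows "0 < c" "\<bar>2 * m / c - s\<bar> \<le> \<delta>"
proof -
  have q: "0 < q" using assms(1-3) by (cases "q = 0") auto
  have y: "1 < c / q" using assms(2,3) by linarith
  then show c: "0 < c" using q by (simp add: field_simps)
  have "2 * m / c - s = (2 * (m / q - s) + s * (2 - c / q)) / (c / q)" using c q by (simp add: field_simps)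
  moreover have "\<bar>c / q\<bar> = c / q" using y by linarith
  ultimately have "\<bar>2 * m / c - s\<bar> = \<bar>2 * (m / q - s) + s * (2 - c / q)\<bar> / (c / q)"
    by (simp only: abs_divide[of _ "c / q"])
  also have "\<dots> \<le> \<bar>2 * (m / q - s) + s * (2 - c / q)\<bar> / 1" using y by (intro divide_left_mono) auto
  finally have le: "\<bar>2 * m / c - s\<bar> \<le> \<bar>2 * (m / q - s) + s * (2 - c / q)\<bar>" by simp
  have "\<bar>2 * (m / q - s)\<bar> = 2 * \<bar>m / q - s\<bar>" by (simp only: abs_mult abs_numeral)
  moreover have "\<bar>s * (2 - c / q)\<bar> = s * \<bar>c / q - 2\<bar>"
    using assms(4) by (simp add: abs_mult abs_minus_commute[of 2])
  moreover have "s * \<bar>c / q - 2\<bar> \<le> s * e" using assms by (intro mult_left_mono) auto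
  ultimately show "\<bar>2 * m / c - s\<bar> \<le> \<delta>"
    using le abs_triangle_ineq[of "2 * (m / q - s)" "s * (2 - c / q)"] assms(5,6) by linarith
qed

lemma regular_event_close:
  assumes \<delta>: "0 < \<delta>" and m: "0 < m" and le: "\<And>j. j \<le> k \<Longrightarrow> m \<le> grid_time k \<delta> m j"
    and lim: "\<And>j. j \<le> k \<Longrightarrow> \<bar>real m / sqrt (real (grid_time k \<delta> m j)) - level k \<delta> j\<bar> \<le> \<delta> / 4"
    and T: "T \<in> regular_event l k \<delta> (1 / (2 * real (Suc k))) m" "T \<in> marks_event k \<delta> m a"
    and a: "l < a 0" and i: "i \<le> l"
  shows "\<bar>scaled_inverse_row T m i - level k \<delta> (crossing k a i)\<bar> \<le> 2 * \<delta>"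
proof (rule scaled_inverse_row_close[OF _ m \<delta> le marks_eventD[OF T(2) \<delta>]])
  show "growing T" using T(1) by (simp add: regular_event_def)
  show "i < a 0" using a i by simp
  fix j q assume j: "j \<le> k" and q: "q \<le> i"
  define c where "c = collen (set (tab_boxes T (grid_time k \<delta> m j))) q"
  \<comment> \<open>The highest level is \<open>Suc k * \<delta>\<close>, so this tolerance keeps
    level times \<open>e\<close> below or at \<open>\<delta> / 2\<close>.\<close>
  define e where "e = 1 / (2 * real (Suc k))"
  have c: "\<bar>real c / sqrt (real (grid_time k \<delta> m j)) - 2\<bar> < e"
    using T(1) j q i unfolding regular_event_def c_def e_def by auto
  have e: "e \<le> 1" by (simp add: e_def)
  have "level k \<delta> j \<le> level k \<delta> 0" by (rule level_antimono) (use \<delta> in auto)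
  also have "\<dots> = real (Suc k) * \<delta>" by (simp add: level_def)
  finally have "level k \<delta> j * e \<le> real (Suc k) * \<delta> * e" by (intro mult_right_mono) (simp_all add: e_def)
  also have "\<dots> = \<delta> / 2" by (simp add: e_def del: of_nat_Suc)
  finally have "level k \<delta> j * e \<le> \<delta> / 2" .
  from ratio_close[OF _ c e _ this lim[OF j]] level_pos[OF \<delta> j]
  show "0 < collen (set (tab_boxes T (grid_time k \<delta> m j))) q \<and>
      \<bar>2 * real m / real (collen (set (tab_boxes T (grid_time k \<delta> m j))) q) - level k \<delta> j\<bar> \<le> \<delta>"
    unfolding c_def by simp
qed

lemma disjoint_admissible:
  assumes "\<And>a x j. x \<in> E a \<Longrightarrow> j \<le> k \<Longrightarrow> g x j = a j"
  shows "disjoint_family_on E (admissible l b k)"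
  unfolding disjoint_family_on_def
proof (intro ballI impI equals0I)
  fix a a' x assume a: "a \<in> admissible l b k" "a' \<in> admissible l b k" and "a \<noteq> a'" "x \<in> E a \<inter> E a'"
  then have "a j = a' j" if "j \<le> k" for j using assms[of x a j] assms[of x a' j] that by simp
  moreover have "a \<in> extensional {..k}" "a' \<in> extensional {..k}" using a by (simp_all add: admissible_def PiE_def)
  ultimately have "a = a'" by (intro extensionalityI) auto
  then show False using \<open>a \<noteq> a'\<close> by simp
qed

text \<open>Both integrals are compared with one finite sum \<open>S\<close> of values of
  \<open>f\<close> at vectors of levels, indexed by the admissible counts. The errors are the
  variation of \<open>f\<close> over distances \<open>2 * \<delta>\<close> and the mass outside the
  events considered.\<close>

lemma weakly_converges_scaled_inverse_row:
  "weakly_converges_in (product_topology (\<lambda>_. euclideanreal) {..l})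
     (\<lambda>m. joint_law plancherel l (\<lambda>i T. scaled_inverse_row T m i)) (joint_law expo_seq l (\<lambda>i \<omega>. arrival \<omega> i))"
  unfolding weakly_converges_in_def
proof (intro allI impI, elim conjE)
  fix f :: "(nat \<Rightarrow> real) \<Rightarrow> real"
  assume cont: "continuous_map (product_topology (\<lambda>_. euclideanreal) {..l}) euclideanreal f"
    and bdd: "bounded (f ` topspace (product_topology (\<lambda>_. euclideanreal) {..l}))"
  define X where "X m T = f (\<lambda>i\<in>{..l}. scaled_inverse_row T m i)" for m T
  define Y where "Y \<omega> = f (\<lambda>i\<in>{..l}. arrival \<omega> i)" for \<omega>
  have sir: "(\<lambda>T. scaled_inverse_row T m i) \<in> borel_measurable plancherel" for m i
    using measurable_scaled_inverse_row by (simp cong: measurable_cong_sets add: sets_plancherel)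
  have X: "X m \<in> borel_measurable plancherel" for m
    unfolding X_def by (rule measurable_compose[OF measurable_joint measurable_continuous_map_PiM[OF cont]]) (rule sir)
  have Y: "Y \<in> borel_measurable expo_seq"
    unfolding Y_def by (rule measurable_compose[OF measurable_joint measurable_continuous_map_PiM[OF cont]]) (rule measurable_arrival)
  obtain B where B: "0 < B" "\<And>u. \<bar>f (restrict u {..l})\<bar> \<le> B"
  proof -
    obtain B where "\<forall>u\<in>topspace (product_topology (\<lambda>_. euclideanreal) {..l}). \<bar>f u\<bar> \<le> B"
      using bdd unfolding bounded_iff by auto
    then have "\<bar>f (restrict u {..l})\<bar> \<le> B" for u by auto
    then have "\<bar>f (restrict u {..l})\<bar> \<le> max B 1" for u using le_max_iff_disj by blast
    then show ?thesis by (intro that[of "max B 1"]) auto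
  qed
  have "(\<lambda>m. \<integral>T. X m T \<partial>plancherel) \<longlonglongrightarrow> (\<integral>\<omega>. Y \<omega> \<partial>expo_seq)"
  proof (rule tendstoI)
    fix e :: real assume e: "0 < e"
    \<comment> \<open>Each side of the comparison may cost \<open>e / 4\<close>: \<epsilon> for the
      variation of \<open>f\<close> and \<open>B * (2 * \<gamma>) = e / 8\<close> for the lost
      mass.\<close>
    define \<epsilon> where "\<epsilon> = e / 8"
    define \<gamma> where "\<gamma> = e / (16 * B)"
    have pos: "0 < \<epsilon>" "0 < \<gamma>" using e B by (simp_all add: \<epsilon>_def \<gamma>_def)
    \<comment> \<open>\<open>n\<close> will be the highest level: more than \<open>l\<close> points
      lie below it up to probability \<gamma>. The bound \<open>b\<close> on their number costs
      another \<gamma>.\<close>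
    obtain n where n: "1 \<le> n" "(\<Sum>q\<le>l. poisson_weight (real n) q) < \<gamma>"
    proof -
      have "eventually (\<lambda>n. (\<Sum>q\<le>l. poisson_weight (real n) q) < \<gamma>) sequentially"
        by (rule order_tendstoD(2)[OF poisson_weight_tendsto_0 pos(2)])
      then have "eventually (\<lambda>n. 1 \<le> n \<and> (\<Sum>q\<le>l. poisson_weight (real n) q) < \<gamma>) sequentially"
        using eventually_ge_at_top[of 1] by eventually_elim simp
      then show ?thesis using that by (auto dest: eventually_happens)
    qed
    obtain b where b: "l \<le> b" "1 - \<gamma> < (\<Sum>q\<le>b. poisson_weight (real n) q)"
    proof -
      have "(\<lambda>b. \<Sum>q\<le>b. poisson_weight (real n) q) \<longlonglongrightarrow> 1"
        using poisson_weight_sums[of "real n"] unfolding sums_def_le .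
      then have "eventually (\<lambda>b. 1 - \<gamma> < (\<Sum>q\<le>b. poisson_weight (real n) q)) sequentially"
        using pos by (intro order_tendstoD(1)) auto
      then have "eventually (\<lambda>b. l \<le> b \<and> 1 - \<gamma> < (\<Sum>q\<le>b. poisson_weight (real n) q)) sequentially"
        using eventually_ge_at_top[of l] by eventually_elim simp
      then show ?thesis using that by (auto dest: eventually_happens)
    qed
    obtain \<eta> where \<eta>: "0 < \<eta>" "\<And>u v. (\<And>i. i \<le> l \<Longrightarrow> \<bar>u i\<bar> \<le> real n + 1 \<and> \<bar>v i\<bar> \<le> real n + 1 \<and> \<bar>u i - v i\<bar> \<le> \<eta>)
        \<Longrightarrow> \<bar>f (restrict u {..l}) - f (restrict v {..l})\<bar> \<le> \<epsilon>"
      by (rule uniformly_close[OF cont pos(1), where A = "real n + 1"]) (rule that, assumption, (blast | simp | meson))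
    \<comment> \<open>Twice the mesh \<open>n / Suc k\<close> is at most \<eta>, for uniform
      continuity, and at most 1, so that all points stay in the cube of size
      \<open>n + 1\<close>.\<close>
    obtain k where k: "2 * real n / min \<eta> 1 < real k" using reals_Archimedean2 by blast
    define \<delta> where "\<delta> = real n / real (Suc k)"
    have \<delta>: "0 < \<delta>" "2 * \<delta> \<le> min \<eta> 1"
    proof -
      show "0 < \<delta>" using n by (simp add: \<delta>_def)
      have mn: "0 < min \<eta> 1" using \<eta>(1) by simp
      have "2 * real n < real k * min \<eta> 1" using k mn by (simp add: pos_divide_less_eq)
      also have "\<dots> \<le> real (Suc k) * min \<eta> 1" using mn by (intro mult_right_mono) auto
      finally have "2 * real n < min \<eta> 1 * real (Suc k)" by (simp only: mult.commute)
      then have "2 * real n / real (Suc k) < min \<eta> 1"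
        by (subst pos_divide_less_eq) (simp_all only: of_nat_0_less_iff zero_less_Suc)
      then show "2 * \<delta> \<le> min \<eta> 1" unfolding \<delta>_def by (simp only: times_divide_eq_right less_imp_le)
    qed
    have level0: "level k \<delta> 0 = real n" by (simp add: level_def \<delta>_def del: of_nat_Suc)
    define F where "F = admissible l b k"
    define h where "h a = f (\<lambda>i\<in>{..l}. level k \<delta> (crossing k a i))" for a
    have fin: "finite F" unfolding F_def by (rule finite_admissible)
    have hB: "\<bar>h a\<bar> \<le> B" for a unfolding h_def by (rule B(2))
    have close: "\<bar>f (restrict u {..l}) - h a\<bar> \<le> \<epsilon>"
      if "\<And>i. i \<le> l \<Longrightarrow> \<bar>u i - level k \<delta> (crossing k a i)\<bar> \<le> 2 * \<delta>" for u a
      unfolding h_def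
    proof (rule \<eta>(2))
      fix i assume "i \<le> l"
      moreover have "0 \<le> level k \<delta> (crossing k a i)" using \<delta>(1) by (simp add: level_def)
      moreover have "level k \<delta> (crossing k a i) \<le> real n"
        unfolding level0[symmetric] by (rule level_antimono) (use \<delta> in auto)
      ultimately show "\<bar>u i\<bar> \<le> real n + 1 \<and> \<bar>level k \<delta> (crossing k a i)\<bar> \<le> real n + 1
          \<and> \<bar>u i - level k \<delta> (crossing k a i)\<bar> \<le> \<eta>"
        using that[of i] \<delta>(2) by (auto simp: abs_le_iff)
    qed
    define J where "J = (\<Sum>a\<in>F. joint_limit (level k \<delta>) a k)"
    define S where "S = (\<Sum>a\<in>F. h a * joint_limit (level k \<delta>) a k)"
    have J: "1 - 2 * \<gamma> < J"
    proof -
      have "(\<Sum>q\<in>{l<..b}. poisson_weight (level k \<delta> 0) q) \<le> J" unfolding J_def F_def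
        by (rule sum_joint_limit_ge) (use \<delta> in \<open>auto intro: level_pos level_Suc_less\<close>)
      moreover have "(\<Sum>q\<le>b. poisson_weight (real n) q)
          = (\<Sum>q\<le>l. poisson_weight (real n) q) + (\<Sum>q\<in>{l<..b}. poisson_weight (real n) q)"
      proof -
        have "{..b} = {..l} \<union> {l<..b}" using b(1) by auto
        then show ?thesis by (simp only:) (rule sum.union_disjoint, auto)
      qed
      ultimately show ?thesis using n(2) b(2) level0 by simp
    qed
    have limit: "\<bar>(\<integral>\<omega>. Y \<omega> \<partial>expo_seq) - S\<bar> \<le> \<epsilon> + B * (1 - J)"
    proof -
      define E where "E a = {\<omega>. \<forall>i\<le>k. counts \<omega> (level k \<delta> i) (a i)} \<inter> {\<omega>. \<forall>i. 0 \<le> \<omega> i}" for a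
      define G where "G = {\<omega> :: nat \<Rightarrow> real. \<forall>i. 0 \<le> \<omega> i}"
      have G: "G \<in> sets expo_seq"
      proof -
        have "{\<omega> \<in> space expo_seq. \<forall>i. 0 \<le> \<omega> i} \<in> sets expo_seq" by measurable
        then show ?thesis by (simp add: G_def)
      qed
      have E: "E a \<in> sets expo_seq" for a
        unfolding E_def G_def[symmetric] by (intro sets.Int sets_counts_upto G)
      have pE: "measure expo_seq (E a) = joint_limit (level k \<delta>) a k" if "a \<in> F" for a
      proof -
        have "measure expo_seq (E a) = measure expo_seq {\<omega>. \<forall>i\<le>k. counts \<omega> (level k \<delta> i) (a i)}"
        proof (rule expo_seq.finite_measure_eq_AE)
          show "AE \<omega> in expo_seq. \<omega> \<in> E a \<longleftrightarrow> \<omega> \<in> {\<omega>. \<forall>i\<le>k. counts \<omega> (level k \<delta> i) (a i)}"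
            using AE_expo_seq_nonneg by eventually_elim (simp add: E_def)
        qed (rule E sets_counts_upto)+
        also have "\<dots> = joint_limit (level k \<delta>) a k"
          by (rule prob_counts_upto) (use \<delta> that in \<open>auto simp: F_def admissible_def intro: level_pos level_Suc_less\<close>)
        finally show ?thesis .
      qed
      have "\<bar>(\<integral>\<omega>. Y \<omega> \<partial>expo_seq) - (\<Sum>a\<in>F. h a * measure expo_seq (E a))\<bar>
          \<le> \<epsilon> + 2 * B * (1 - measure expo_seq G) + B * (1 - (\<Sum>a\<in>F. measure expo_seq (E a)))"
      proof (rule expo_seq.integral_close[OF fin E _ G Y _ hB])
        show "disjoint_family_on E F" unfolding F_def
        proof (rule disjoint_admissible[where g = "\<lambda>\<omega> j. THE c. counts \<omega> (level k \<delta> j) c"])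
          fix a \<omega> j assume "\<omega> \<in> E a" "j \<le> k"
          then have \<omega>: "\<And>i. 0 \<le> \<omega> i" "counts \<omega> (level k \<delta> j) (a j)" by (auto simp: E_def)
          show "(THE c. counts \<omega> (level k \<delta> j) c) = a j"
          proof (rule the_equality)
            show "counts \<omega> (level k \<delta> j) (a j)" by (rule \<omega>(2))
          next
            fix c assume c: "counts \<omega> (level k \<delta> j) c"
            show "c = a j"
              using counts_unique[OF \<omega>(1) c \<omega>(2)] counts_unique[OF \<omega>(1) \<omega>(2) c] by simp
          qed
        qed
        show "\<bar>Y \<omega>\<bar> \<le> B" for \<omega> unfolding Y_def by (rule B(2))
        fix a \<omega> assume a: "a \<in> F" and \<omega>: "\<omega> \<in> E a" "\<omega> \<in> G"
        show "\<bar>Y \<omega> - h a\<bar> \<le> \<epsilon>" unfolding Y_def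
        proof (rule close)
          fix i assume "i \<le> l"
          then have "i < a 0" using a by (auto simp: F_def admissible_def)
          then show "\<bar>arrival \<omega> i - level k \<delta> (crossing k a i)\<bar> \<le> 2 * \<delta>"
            using \<omega> \<delta> by (intro arrival_close) (auto simp: E_def)
        qed
      qed (use pos in auto)
      moreover have "measure expo_seq G = 1"
        using AE_expo_seq_nonneg G by (subst expo_seq.prob_eq_1) (auto simp: G_def)
      moreover have "(\<Sum>a\<in>F. measure expo_seq (E a)) = J" unfolding J_def by (rule sum.cong) (auto simp: pE)
      moreover have "(\<Sum>a\<in>F. h a * measure expo_seq (E a)) = S" unfolding S_def by (rule sum.cong) (auto simp: pE)
      ultimately show ?thesis by simp
    qed
    define E where "E m a = marks_event k \<delta> m a" for m a
    define G where "G m = regular_event l k \<delta> (1 / (2 * real (Suc k))) m" for m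
    have Gm: "G m \<in> sets plancherel" for m unfolding G_def by (rule regular_event(1)[OF \<delta>(1)]) simp
    have Em: "E m a \<in> sets plancherel" for m a unfolding E_def marks_event_def by (rule sets_tab_boxes)
    have "eventually (\<lambda>m. \<forall>j\<in>{..k}. \<bar>real m / sqrt (real (grid_time k \<delta> m j)) - level k \<delta> j\<bar> < \<delta> / 4) sequentially"
    proof (rule eventually_ball_finite, simp, rule ballI)
      fix j assume "j \<in> {..k}"
      then have "(\<lambda>m. real m / sqrt (real (grid_time k \<delta> m j))) \<longlonglongrightarrow> level k \<delta> j"
        by (intro grid_time_tendsto \<delta>(1)) simp
      from tendstoD[OF this, of "\<delta> / 4"] \<delta>(1)
      show "eventually (\<lambda>m. \<bar>real m / sqrt (real (grid_time k \<delta> m j)) - level k \<delta> j\<bar> < \<delta> / 4) sequentially"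
        by (simp add: dist_real_def)
    qed
    then have bound: "eventually (\<lambda>m. \<bar>(\<integral>T. X m T \<partial>plancherel) - (\<Sum>a\<in>F. h a * measure plancherel (E m a))\<bar>
        \<le> \<epsilon> + 2 * B * (1 - measure plancherel (G m)) + B * (1 - (\<Sum>a\<in>F. measure plancherel (E m a)))) sequentially"
      using eventually_le_grid_time[OF \<delta>(1), of k] eventually_gt_at_top[of 0]
    proof eventually_elim
      case (elim m)
      show ?case
      proof (rule prob_space.integral_close[OF plancherel.prob_space_axioms fin Em _ Gm X _ hB])
        show "disjoint_family_on (E m) F" unfolding F_def E_def
          by (rule disjoint_admissible[where g = "\<lambda>T j. fst (mark_box m (tab_boxes T (grid_time k \<delta> m j)))"])
            (rule marks_eventD[OF _ \<delta>(1)])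
        show "\<bar>X m T\<bar> \<le> B" for T unfolding X_def by (rule B(2))
        fix a T assume a: "a \<in> F" and T: "T \<in> E m a" "T \<in> G m"
        show "\<bar>X m T - h a\<bar> \<le> \<epsilon>" unfolding X_def
        proof (rule close)
          fix i assume i: "i \<le> l"
          show "\<bar>scaled_inverse_row T m i - level k \<delta> (crossing k a i)\<bar> \<le> 2 * \<delta>"
          proof (rule regular_event_close[OF \<delta>(1) _ _ _ T(2)[unfolded G_def] T(1)[unfolded E_def] _ i])
            show "l < a 0" using a by (simp add: F_def admissible_def)
          qed (use elim in \<open>auto intro: less_imp_le\<close>)
        qed
      qed (use pos in auto)
    qed
    define D where "D m = \<epsilon> + 2 * B * (1 - measure plancherel (G m)) + B * (1 - (\<Sum>a\<in>F. measure plancherel (E m a)))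
      + \<bar>(\<Sum>a\<in>F. h a * measure plancherel (E m a)) - S\<bar>" for m
    have "D \<longlonglongrightarrow> \<epsilon> + 2 * B * (1 - 1) + B * (1 - J) + \<bar>S - S\<bar>"
    proof -
      have G1: "(\<lambda>m. measure plancherel (G m)) \<longlonglongrightarrow> 1" unfolding G_def by (rule regular_event(2)[OF \<delta>(1)]) simp
      have E1: "(\<lambda>m. measure plancherel (E m a)) \<longlonglongrightarrow> joint_limit (level k \<delta>) a k" for a
        unfolding E_def by (rule prob_marks_event_tendsto[OF \<delta>(1)])
      have E2: "(\<lambda>m. \<Sum>a\<in>F. measure plancherel (E m a)) \<longlonglongrightarrow> J" unfolding J_def by (intro tendsto_sum E1)
      have E3: "(\<lambda>m. \<Sum>a\<in>F. h a * measure plancherel (E m a)) \<longlonglongrightarrow> S" unfolding S_def by (intro tendsto_sum tendsto_mult E1 tendsto_const)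
      show ?thesis unfolding D_def by (intro tendsto_intros G1 E2 E3)
    qed
    moreover have BJ: "B * (1 - J) < e / 8"
    proof -
      have "B * (1 - J) < B * (2 * \<gamma>)" using J B(1) by (intro mult_strict_left_mono) auto
      also have "\<dots> = e / 8" using B(1) by (simp add: \<gamma>_def)
      finally show ?thesis .
    qed
    moreover have "\<epsilon> + 2 * B * (1 - 1) + B * (1 - J) + \<bar>S - S\<bar> < e / 4" using BJ by (simp add: \<epsilon>_def)
    ultimately have "eventually (\<lambda>m. D m < e / 4) sequentially" by (intro order_tendstoD(2)) auto
    then show "eventually (\<lambda>m. dist (\<integral>T. X m T \<partial>plancherel) (\<integral>\<omega>. Y \<omega> \<partial>expo_seq) < e) sequentially"
      using bound
    proof eventually_elim
      case (elim m)
      then show ?case using limit BJ e unfolding D_def \<epsilon>_def dist_real_def by linarith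
    qed
  qed
  moreover have "(\<integral>u. f u \<partial>joint_law plancherel l (\<lambda>i T. scaled_inverse_row T m i)) = (\<integral>T. X m T \<partial>plancherel)" for m
    unfolding X_def by (rule integral_joint_law[OF cont]) (rule sir)
  moreover have "(\<integral>u. f u \<partial>joint_law expo_seq l (\<lambda>i \<omega>. arrival \<omega> i)) = (\<integral>\<omega>. Y \<omega> \<partial>expo_seq)"
    unfolding Y_def by (rule integral_joint_law[OF cont]) (rule measurable_arrival)
  ultimately show "(\<lambda>m. \<integral>u. f u \<partial>joint_law plancherel l (\<lambda>i T. scaled_inverse_row T m i))
      \<longlonglongrightarrow> (\<integral>u. f u \<partial>joint_law expo_seq l (\<lambda>i \<omega>. arrival \<omega> i))" by simp
qed

text \<open>Weak convergence concerns the laws only, so the given realisations may be replaced by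
  \<open>plancherel\<close> and \<open>expo_seq\<close> (\<open>joint_law_distr\<close>).\<close>

theorem theorem1p2:
  fixes M :: "'a measure" and T :: "'a \<Rightarrow> nat tableau"
    and N :: "'b measure" and \<psi> :: "nat \<Rightarrow> 'b \<Rightarrow> real"
  assumes "prob_space M"
    and "T \<in> M \<rightarrow>\<^sub>M tableau_space"
    and "distr M tableau_space T = plancherel"
    and "prob_space N"
    and "prob_space.indep_vars N (\<lambda>_. borel) \<psi> UNIV"
    and "\<And>i. distributed N lborel (\<psi> i) (exponential_density 1)"
  shows "\<forall>l. weakly_converges_in (product_topology (\<lambda>_. euclideanreal) {..l})
           (\<lambda>m. joint_law M l (\<lambda>x \<omega>. scaled_inverse_row (T \<omega>) m x))
           (joint_law N l (\<lambda>x \<omega>. \<Sum>j\<le>x. \<psi> j \<omega>))"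
proof
  fix l
  have "joint_law M l (\<lambda>x \<omega>. scaled_inverse_row (T \<omega>) m x) = joint_law plancherel l (\<lambda>x T. scaled_inverse_row T m x)" for m
    using joint_law_distr[OF assms(2), of l "\<lambda>x T. scaled_inverse_row T m x"] measurable_scaled_inverse_row
    by (simp add: assms(3))
  moreover have "joint_law N l (\<lambda>x \<omega>. \<Sum>j\<le>x. \<psi> j \<omega>) = joint_law expo_seq l (\<lambda>x \<omega>. arrival \<omega> x)"
  proof -
    have psi: "(\<lambda>\<omega> i. \<psi> i \<omega>) \<in> N \<rightarrow>\<^sub>M PiM UNIV (\<lambda>_. borel)"
    proof (rule measurable_PiM_single')
      show "\<psi> i \<in> borel_measurable N" for i
        using distributed_measurable[OF assms(6)[of i]] by (simp cong: measurable_cong_sets)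
    qed simp
    have "(\<lambda>\<omega>. arrival \<omega> i) \<in> borel_measurable (PiM UNIV (\<lambda>_::nat. borel))" for i
      unfolding arrival_def by measurable
    from joint_law_distr[OF psi this]
    show ?thesis unfolding expo_seq_eq_distr[OF assms(4-6)] by (simp add: arrival_def)
  qed
  ultimately show "weakly_converges_in (product_topology (\<lambda>_. euclideanreal) {..l})
           (\<lambda>m. joint_law M l (\<lambda>x \<omega>. scaled_inverse_row (T \<omega>) m x))
           (joint_law N l (\<lambda>x \<omega>. \<Sum>j\<le>x. \<psi> j \<omega>))"
    using weakly_converges_scaled_inverse_row[of l] by simp
qed

end
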